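(* Let $V$ be a valuation ring with field of fractions $K$. Then the canonical map $\operatorname{Br}(V) \to \operatorname{Br}(K)$, $[A]\mapsto [A\otimes_V K]$, is injective.
   Context: A subring $V$ of a field $K$ is a valuation ring (of $K$) if for each nonzero $a\in K$, either $a\in V$ or $a^{-1}\in V$. Valuation rings are not assumed Noetherian or of finite rank, and $V=K$ is allowed (the trivial valuation ring). For a commutative ring $R$, the Brauer group $\operatorname{Br}(R)$ is the group of Morita equivalence classes $[A]$ of Azumaya algebras $A$ over $R$, with group operation induced by $\otimes_R$. *)

theory Defs
  imports "HOL-Algebra.QuotRing" "HOL-Algebra.Subrings" "HOL-Algebra.Free_Abelian_Groups"
begin

section \<open>Valuation rings\<close>

definition valuation_ring :: "'k set \<Rightarrow> ('k, 'm) ring_scheme \<Rightarrow> bool" where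
  "valuation_ring V K \<longleftrightarrow>
     subring V K \<and>
     (\<forall>a \<in> carrier K. a \<noteq> \<zero>\<^bsub>K\<^esub> \<longrightarrow> a \<in> V \<or> inv\<^bsub>K\<^esub> a \<in> V)"


section \<open>Modules over rings that need not be commutative\<close>

text \<open>
  The library locale \<^locale>\<open>module\<close> forces the scalars to be commutative; this is the same
  axiom list over an arbitrary ring. As there, modules live in the record
  type of the library, whose multiplicative fields are irrelevant for modules.
\<close>

locale left_module = A: ring A + M: abelian_group M
  for A :: "('a, 'm) ring_scheme" and M :: "('a, 'b, 'n) module_scheme" +
  assumes smult_closed:
      "\<lbrakk>a \<in> carrier A; x \<in> carrier M\<rbrakk> \<Longrightarrow> a \<odot>\<^bsub>M\<^esub> x \<in> carrier M"
    and smult_l_distr: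
      "\<lbrakk>a \<in> carrier A; b \<in> carrier A; x \<in> carrier M\<rbrakk> \<Longrightarrow>
       (a \<oplus>\<^bsub>A\<^esub> b) \<odot>\<^bsub>M\<^esub> x = a \<odot>\<^bsub>M\<^esub> x \<oplus>\<^bsub>M\<^esub> b \<odot>\<^bsub>M\<^esub> x"
    and smult_r_distr:
      "\<lbrakk>a \<in> carrier A; x \<in> carrier M; y \<in> carrier M\<rbrakk> \<Longrightarrow>
       a \<odot>\<^bsub>M\<^esub> (x \<oplus>\<^bsub>M\<^esub> y) = a \<odot>\<^bsub>M\<^esub> x \<oplus>\<^bsub>M\<^esub> a \<odot>\<^bsub>M\<^esub> y"
    and smult_assoc:
      "\<lbrakk>a \<in> carrier A; b \<in> carrier A; x \<in> carrier M\<rbrakk> \<Longrightarrow>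
       (a \<otimes>\<^bsub>A\<^esub> b) \<odot>\<^bsub>M\<^esub> x = a \<odot>\<^bsub>M\<^esub> (b \<odot>\<^bsub>M\<^esub> x)"
    and smult_one: "x \<in> carrier M \<Longrightarrow> \<one>\<^bsub>A\<^esub> \<odot>\<^bsub>M\<^esub> x = x"

text \<open>Homomorphisms are extensional, so that equality of functions is equality of morphisms.\<close>

definition module_hom ::
  "('a, 'm) ring_scheme \<Rightarrow> ('a, 'b, 'n) module_scheme \<Rightarrow> ('a, 'c, 'p) module_scheme \<Rightarrow> ('b \<Rightarrow> 'c) set"
where
  "module_hom A M N =
     {f \<in> carrier M \<rightarrow>\<^sub>E carrier N.
        (\<forall>x \<in> carrier M. \<forall>y \<in> carrier M. f (x \<oplus>\<^bsub>M\<^esub> y) = f x \<oplus>\<^bsub>N\<^esub> f y) \<and>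
        (\<forall>a \<in> carrier A. \<forall>x \<in> carrier M. f (a \<odot>\<^bsub>M\<^esub> x) = a \<odot>\<^bsub>N\<^esub> f x)}"

definition endomorphism_ring ::
  "('a, 'm) ring_scheme \<Rightarrow> ('a, 'b, 'n) module_scheme \<Rightarrow> ('b \<Rightarrow> 'b) ring"
where
  "endomorphism_ring A M =
     \<lparr>carrier = module_hom A M M,
      monoid.mult = compose (carrier M),
      monoid.one = (\<lambda>x \<in> carrier M. x),
      ring.zero = (\<lambda>x \<in> carrier M. \<zero>\<^bsub>M\<^esub>),
      ring.add = (\<lambda>f g. \<lambda>x \<in> carrier M. f x \<oplus>\<^bsub>M\<^esub> g x)\<rparr>"

definition finitely_generated ::
  "('a, 'm) ring_scheme \<Rightarrow> ('a, 'b, 'n) module_scheme \<Rightarrow> bool"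
where
  "finitely_generated A M \<longleftrightarrow>
     (\<exists>S. finite S \<and> S \<subseteq> carrier M \<and>
        (\<forall>x \<in> carrier M. \<exists>c \<in> S \<rightarrow> carrier A. x = (\<Oplus>\<^bsub>M\<^esub>s \<in> S. c s \<odot>\<^bsub>M\<^esub> s)))"

definition free_module :: "('a, 'm) ring_scheme \<Rightarrow> 'i set \<Rightarrow> ('a, 'i \<Rightarrow> 'a) module" where
  "free_module A I =
     \<lparr>carrier = {f. (\<forall>i. f i \<in> carrier A) \<and>
                    finite {i. f i \<noteq> \<zero>\<^bsub>A\<^esub>} \<and> {i. f i \<noteq> \<zero>\<^bsub>A\<^esub>} \<subseteq> I},
      monoid.mult = undefined,
      monoid.one = undefined,
      ring.zero = (\<lambda>i. \<zero>\<^bsub>A\<^esub>),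
      ring.add = (\<lambda>f g i. f i \<oplus>\<^bsub>A\<^esub> g i),
      smult = (\<lambda>a f i. a \<otimes>\<^bsub>A\<^esub> f i)\<rparr>"

text \<open>
  A module is projective if it is a direct summand of a free module. Index sets inside the type
  of the module suffice, since the basis may be taken to be a generating set of the module.
\<close>

definition projective_module ::
  "('a, 'm) ring_scheme \<Rightarrow> ('a, 'b, 'n) module_scheme \<Rightarrow> bool"
where
  "projective_module A M \<longleftrightarrow>
     (\<exists>(I :: 'b set) s p. s \<in> module_hom A M (free_module A I) \<and>
        p \<in> module_hom A (free_module A I) M \<and> (\<forall>x \<in> carrier M. p (s x) = x))"

definition faithful_module ::
  "('a, 'm) ring_scheme \<Rightarrow> ('a, 'b, 'n) module_scheme \<Rightarrow> bool"
where
  "faithful_module A M \<longleftrightarrow>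
     (\<forall>a \<in> carrier A. (\<forall>x \<in> carrier M. a \<odot>\<^bsub>M\<^esub> x = \<zero>\<^bsub>M\<^esub>) \<longrightarrow> a = \<zero>\<^bsub>A\<^esub>)"


section \<open>Associative algebras over a commutative ring\<close>

text \<open>The library locale \<^locale>\<open>algebra\<close> is restricted to commutative algebras.\<close>

locale assoc_algebra = module R A + A: ring A
  for R :: "('r, 'm) ring_scheme" and A :: "('r, 'a, 'n) module_scheme" +
  assumes smult_mult_left:
      "\<lbrakk>r \<in> carrier R; x \<in> carrier A; y \<in> carrier A\<rbrakk> \<Longrightarrow>
       (r \<odot>\<^bsub>A\<^esub> x) \<otimes>\<^bsub>A\<^esub> y = r \<odot>\<^bsub>A\<^esub> (x \<otimes>\<^bsub>A\<^esub> y)"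
    and smult_mult_right:
      "\<lbrakk>r \<in> carrier R; x \<in> carrier A; y \<in> carrier A\<rbrakk> \<Longrightarrow>
       x \<otimes>\<^bsub>A\<^esub> (r \<odot>\<^bsub>A\<^esub> y) = r \<odot>\<^bsub>A\<^esub> (x \<otimes>\<^bsub>A\<^esub> y)"

text \<open>A commutative ring as an algebra over itself, and over each of its subrings.\<close>

definition self_algebra :: "('r, 'm) ring_scheme \<Rightarrow> ('r, 'r) module" where
  "self_algebra R =
     \<lparr>carrier = carrier R, monoid.mult = monoid.mult R, monoid.one = \<one>\<^bsub>R\<^esub>,
      ring.zero = \<zero>\<^bsub>R\<^esub>, ring.add = ring.add R, smult = monoid.mult R\<rparr>"

definition opposite_algebra :: "('r, 'a) module \<Rightarrow> ('r, 'a) module" where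
  "opposite_algebra A = A\<lparr>monoid.mult := (\<lambda>x y. y \<otimes>\<^bsub>A\<^esub> x)\<rparr>"


section \<open>Tensor products of algebras\<close>

text \<open>
  The tensor product of \<open>M\<close> and \<open>N\<close> over \<open>R\<close> is the quotient of the free abelian group on
  \<open>M \<times> N\<close> by the subgroup generated by the bilinearity relations; its elements are cosets.
\<close>

abbreviation free_pairs ::
  "('r, 'a, 'm) module_scheme \<Rightarrow> ('r, 'b, 'n) module_scheme \<Rightarrow> ('a \<times> 'b \<Rightarrow>\<^sub>0 int) monoid"
where
  "free_pairs M N \<equiv> free_Abelian_group (carrier M \<times> carrier N)"

definition tensor_relations ::
  "('r, 'k) ring_scheme \<Rightarrow> ('r, 'a, 'm) module_scheme \<Rightarrow> ('r, 'b, 'n) module_scheme \<Rightarrow>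
   ('a \<times> 'b \<Rightarrow>\<^sub>0 int) set"
where
  "tensor_relations R M N =
     {frag_of (x \<oplus>\<^bsub>M\<^esub> x', y) - frag_of (x, y) - frag_of (x', y) | x x' y.
        x \<in> carrier M \<and> x' \<in> carrier M \<and> y \<in> carrier N} \<union>
     {frag_of (x, y \<oplus>\<^bsub>N\<^esub> y') - frag_of (x, y) - frag_of (x, y') | x y y'.
        x \<in> carrier M \<and> y \<in> carrier N \<and> y' \<in> carrier N} \<union>
     {frag_of (r \<odot>\<^bsub>M\<^esub> x, y) - frag_of (x, r \<odot>\<^bsub>N\<^esub> y) | r x y.
        r \<in> carrier R \<and> x \<in> carrier M \<and> y \<in> carrier N}"

definition tensor_null ::
  "('r, 'k) ring_scheme \<Rightarrow> ('r, 'a, 'm) module_scheme \<Rightarrow> ('r, 'b, 'n) module_scheme \<Rightarrow>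
   ('a \<times> 'b \<Rightarrow>\<^sub>0 int) set"
where
  "tensor_null R M N = generate (free_pairs M N) (tensor_relations R M N)"

definition tensor_class ::
  "('r, 'k) ring_scheme \<Rightarrow> ('r, 'a, 'm) module_scheme \<Rightarrow> ('r, 'b, 'n) module_scheme \<Rightarrow>
   ('a \<times> 'b \<Rightarrow>\<^sub>0 int) \<Rightarrow> ('a \<times> 'b \<Rightarrow>\<^sub>0 int) set"
where
  "tensor_class R M N p = tensor_null R M N #>\<^bsub>free_pairs M N\<^esub> p"

definition pure_tensor ::
  "('r, 'k) ring_scheme \<Rightarrow> ('r, 'a, 'm) module_scheme \<Rightarrow> ('r, 'b, 'n) module_scheme \<Rightarrow>
   'a \<Rightarrow> 'b \<Rightarrow> ('a \<times> 'b \<Rightarrow>\<^sub>0 int) set"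
where
  "pure_tensor R M N x y = tensor_class R M N (frag_of (x, y))"

text \<open>The biadditive extension of \<open>((a, b), (c, d)) \<mapsto> (a c, b d)\<close> to formal sums.\<close>

definition frag_mult ::
  "('r, 'a, 'm) module_scheme \<Rightarrow> ('r, 'b, 'n) module_scheme \<Rightarrow>
   ('a \<times> 'b \<Rightarrow>\<^sub>0 int) \<Rightarrow> ('a \<times> 'b \<Rightarrow>\<^sub>0 int) \<Rightarrow> ('a \<times> 'b \<Rightarrow>\<^sub>0 int)"
where
  "frag_mult A B p q =
     frag_extend (\<lambda>(a, b). frag_extend (\<lambda>(c, d). frag_of (a \<otimes>\<^bsub>A\<^esub> c, b \<otimes>\<^bsub>B\<^esub> d)) q) p"

text \<open>
  The class of a product does not depend on the representatives, so the union defining the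
  multiplication is a union of equal cosets. In \<open>(r a) \<otimes> b = (r 1 \<otimes> 1) (a \<otimes> b)\<close>, the right-hand
  side is taken as the scalar multiplication.
\<close>

definition tensor_mult ::
  "('r, 'k) ring_scheme \<Rightarrow> ('r, 'a, 'm) module_scheme \<Rightarrow> ('r, 'b, 'n) module_scheme \<Rightarrow>
   ('a \<times> 'b \<Rightarrow>\<^sub>0 int) set \<Rightarrow> ('a \<times> 'b \<Rightarrow>\<^sub>0 int) set \<Rightarrow> ('a \<times> 'b \<Rightarrow>\<^sub>0 int) set"
where
  "tensor_mult R A B X Y = (\<Union>p \<in> X. \<Union>q \<in> Y. tensor_class R A B (frag_mult A B p q))"

definition tensor_algebra ::
  "('r, 'k) ring_scheme \<Rightarrow> ('r, 'a, 'm) module_scheme \<Rightarrow> ('r, 'b, 'n) module_scheme \<Rightarrow>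
   ('r, ('a \<times> 'b \<Rightarrow>\<^sub>0 int) set) module"
where
  "tensor_algebra R A B =
     \<lparr>carrier = carrier (free_pairs A B Mod tensor_null R A B),
      monoid.mult = tensor_mult R A B,
      monoid.one = pure_tensor R A B \<one>\<^bsub>A\<^esub> \<one>\<^bsub>B\<^esub>,
      ring.zero = tensor_null R A B,
      ring.add = monoid.mult (free_pairs A B Mod tensor_null R A B),
      smult = (\<lambda>r X. tensor_mult R A B (pure_tensor R A B (r \<odot>\<^bsub>A\<^esub> \<one>\<^bsub>A\<^esub>) \<one>\<^bsub>B\<^esub>) X)\<rparr>"

text \<open>
  The \<open>S\<close>-algebra \<open>A \<otimes> S\<close> obtained from an \<open>R\<close>-algebra \<open>A\<close>, where \<open>R\<close> is a subring of the
  commutative ring \<open>S\<close>; the scalars from \<open>S\<close> act through the second factor.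
\<close>

definition base_change ::
  "('r, 'm) ring_scheme \<Rightarrow> ('r, 'n) ring_scheme \<Rightarrow> ('r, 'a) module \<Rightarrow>
   ('r, ('a \<times> 'r \<Rightarrow>\<^sub>0 int) set) module"
where
  "base_change R S A =
     (tensor_algebra R A (self_algebra S))
       \<lparr>smult := (\<lambda>c X. tensor_mult R A (self_algebra S)
                          (pure_tensor R A (self_algebra S) \<one>\<^bsub>A\<^esub> c) X)\<rparr>"


section \<open>Azumaya algebras\<close>

text \<open>
  The map \<open>a \<otimes> b \<mapsto> (x \<mapsto> a x b)\<close> is determined by its values on pure tensors.
\<close>

definition azumaya :: "('r, 'm) ring_scheme \<Rightarrow> ('r, 'a) module \<Rightarrow> bool" where
  "azumaya R A \<longleftrightarrow>
     assoc_algebra R A \<and> finitely_generated R A \<and> projective_module R A \<and>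
     faithful_module R A \<and>
     (\<exists>\<phi> \<in> ring_iso (tensor_algebra R A (opposite_algebra A)) (endomorphism_ring R A).
        \<forall>a \<in> carrier A. \<forall>b \<in> carrier A.
          \<phi> (pure_tensor R A (opposite_algebra A) a b) =
            (\<lambda>x \<in> carrier A. a \<otimes>\<^bsub>A\<^esub> x \<otimes>\<^bsub>A\<^esub> b))"


section \<open>Morita equivalence\<close>

text \<open>
  Two \<open>R\<close>-algebras are Morita equivalent if their categories of left modules are equivalent by
  \<open>R\<close>-linear functors. The modules range over all modules carried by subsets of a type \<open>'u\<close>, which
  plays the role of a universe. A functor is given by a map \<open>Fo\<close> on objects and
  a map \<open>Fm\<close> on morphisms, the latter with source and target as additional arguments.
\<close>

definition linear_functor ::
  "('r, 'm) ring_scheme \<Rightarrow> ('r, 'a) module \<Rightarrow> ('r, 'b) module \<Rightarrow>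
   (('a, 'u) module \<Rightarrow> ('b, 'u) module) \<Rightarrow>
   (('a, 'u) module \<Rightarrow> ('a, 'u) module \<Rightarrow> ('u \<Rightarrow> 'u) \<Rightarrow> ('u \<Rightarrow> 'u)) \<Rightarrow> bool"
where
  "linear_functor R A B Fo Fm \<longleftrightarrow>
     (\<forall>M. left_module A M \<longrightarrow>
        left_module B (Fo M) \<and>
        Fm M M (\<lambda>x \<in> carrier M. x) = (\<lambda>y \<in> carrier (Fo M). y)) \<and>
     (\<forall>M N. left_module A M \<and> left_module A N \<longrightarrow>
        (\<forall>f \<in> module_hom A M N. Fm M N f \<in> module_hom B (Fo M) (Fo N)) \<and>
        (\<forall>f \<in> module_hom A M N. \<forall>g \<in> module_hom A M N.
           Fm M N (\<lambda>x \<in> carrier M. f x \<oplus>\<^bsub>N\<^esub> g x) =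
             (\<lambda>y \<in> carrier (Fo M). Fm M N f y \<oplus>\<^bsub>Fo N\<^esub> Fm M N g y)) \<and>
        (\<forall>r \<in> carrier R. \<forall>f \<in> module_hom A M N.
           Fm M N (\<lambda>x \<in> carrier M. (r \<odot>\<^bsub>A\<^esub> \<one>\<^bsub>A\<^esub>) \<odot>\<^bsub>N\<^esub> f x) =
             (\<lambda>y \<in> carrier (Fo M). (r \<odot>\<^bsub>B\<^esub> \<one>\<^bsub>B\<^esub>) \<odot>\<^bsub>Fo N\<^esub> Fm M N f y))) \<and>
     (\<forall>L M N. left_module A L \<and> left_module A M \<and> left_module A N \<longrightarrow>
        (\<forall>f \<in> module_hom A L M. \<forall>g \<in> module_hom A M N.
           Fm L N (compose (carrier L) g f) =
             compose (carrier (Fo L)) (Fm M N g) (Fm L M f)))"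

definition natural_iso_id ::
  "('r, 'a) module \<Rightarrow>
   (('a, 'u) module \<Rightarrow> ('a, 'u) module) \<Rightarrow>
   (('a, 'u) module \<Rightarrow> ('a, 'u) module \<Rightarrow> ('u \<Rightarrow> 'u) \<Rightarrow> ('u \<Rightarrow> 'u)) \<Rightarrow>
   (('a, 'u) module \<Rightarrow> 'u \<Rightarrow> 'u) \<Rightarrow> bool"
where
  "natural_iso_id A Ho Hm \<eta> \<longleftrightarrow>
     (\<forall>M. left_module A M \<longrightarrow>
        \<eta> M \<in> module_hom A M (Ho M) \<and> bij_betw (\<eta> M) (carrier M) (carrier (Ho M))) \<and>
     (\<forall>M N. left_module A M \<and> left_module A N \<longrightarrow>
        (\<forall>f \<in> module_hom A M N.
           compose (carrier M) (\<eta> N) f = compose (carrier M) (Hm M N f) (\<eta> M)))"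

definition morita_equivalent ::
  "'u itself \<Rightarrow> ('r, 'm) ring_scheme \<Rightarrow> ('r, 'a) module \<Rightarrow> ('r, 'b) module \<Rightarrow> bool"
where
  "morita_equivalent (u :: 'u itself) R A B \<longleftrightarrow>
     (\<exists>(Fo :: ('a, 'u) module \<Rightarrow> ('b, 'u) module) Fm (Go :: ('b, 'u) module \<Rightarrow> ('a, 'u) module) Gm \<eta> \<epsilon>.
        linear_functor R A B Fo Fm \<and> linear_functor R B A Go Gm \<and>
        natural_iso_id A (Go \<circ> Fo) (\<lambda>M N f. Gm (Fo M) (Fo N) (Fm M N f)) \<eta> \<and>
        natural_iso_id B (Fo \<circ> Go) (\<lambda>M N f. Fm (Go M) (Go N) (Gm M N f)) \<epsilon>)"


section \<open>The Brauer group\<close>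

text \<open>
  An Azumaya algebra over \<open>R\<close> is a direct summand of some \<open>R\<close>-module \<open>R^n\<close>, hence
  isomorphic to an algebra carried by a set of sequences in \<open>R\<close>. The elements of the Brauer
  group are therefore formed from the Azumaya algebras carried by subsets of
  the type \<^typ>\<open>nat \<Rightarrow> 'r\<close>, while the representative \<open>A\<close> of a class
  \<^term>\<open>brauer_class u R A\<close> may have any carrier type.

  Modules range over the universe \<^typ>\<open>(nat \<Rightarrow> 'r) + 'u\<close>, where \<open>'u\<close> is arbitrary. The left
  summand makes every such universe contain copies of all finitely generated modules over
  Azumaya \<open>R\<close>-algebras.
\<close>

definition brauer_class ::
  "'u itself \<Rightarrow> ('r, 'm) ring_scheme \<Rightarrow> ('r, 'a) module \<Rightarrow> ('r, nat \<Rightarrow> 'r) module set"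
where
  "brauer_class (u :: 'u itself) R A =
     {B. azumaya R B \<and> morita_equivalent TYPE((nat \<Rightarrow> 'r) + 'u) R A B}"

text \<open>
  Multiplication and base change are defined on classes as the union over all representatives
  of the class of the result. These are unions of equal classes, because tensor products and
  base change respect Morita equivalence.
\<close>

definition brauer_group ::
  "'u itself \<Rightarrow> ('r, 'm) ring_scheme \<Rightarrow> ('r, nat \<Rightarrow> 'r) module set monoid"
where
  "brauer_group u R =
     \<lparr>carrier = {brauer_class u R A | A :: ('r, nat \<Rightarrow> 'r) module. azumaya R A},
      monoid.mult = (\<lambda>X Y. \<Union>A \<in> X. \<Union>B \<in> Y. brauer_class u R (tensor_algebra R A B)),
      monoid.one = brauer_class u R (self_algebra R)\<rparr>"

definition brauer_base_change ::
  "'u itself \<Rightarrow> ('r, 'm) ring_scheme \<Rightarrow> ('r, 'n) ring_scheme \<Rightarrow>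
   ('r, nat \<Rightarrow> 'r) module set \<Rightarrow> ('r, nat \<Rightarrow> 'r) module set"
where
  "brauer_base_change u R S X = (\<Union>A \<in> X. brauer_class u S (base_change R S A))"

end

theory Submission
  imports Defs
begin

text \<open>
  Let \<open>A\<close> and \<open>B\<close> be Azumaya algebras over \<open>V\<close> whose base changes to \<open>K\<close> are Morita equivalent. The
  equivalence maps the regular module of the first base change to a bimodule \<open>W\<close>, which is finitely
  generated. The \<open>B\<close>-\<open>A\<close>-subbimodule \<open>L\<close> of \<open>W\<close> generated by finitely many generators is finitely
  generated and torsion-free over \<open>V\<close>, hence free of some rank \<open>r\<close>. Because \<open>V\<close> is a valuation ring and
  \<open>A\<close> is Azumaya, the \<open>B\<close>-endomorphisms of \<open>L\<close> are exactly the actions of elements of \<open>A\<close>. As \<open>B\<close> is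
  Azumaya, every endomorphism of the \<open>V\<close>-module \<open>B\<close> is a sum of maps \<open>x \<mapsto> a x b\<close>, which yields
  \<open>B\<^sup>r \<cong> L\<^sup>n\<close> as \<open>B\<close>-modules, where \<open>n\<close> is the rank of \<open>B\<close>. Hence the algebra of \<open>r \<times> r\<close> matrices
  over \<open>B\<close> is isomorphic to that of \<open>n \<times> n\<close> matrices over \<open>A\<close>, and \<open>A\<close> and \<open>B\<close> are Morita equivalent.
\<close>

section \<open>Homomorphisms of modules\<close>

text \<open>The isomorphism \<open>B\<^sup>r \<cong> L\<^sup>n\<close> is a form of the map from the
  tensor product of \<open>B\<close> and \<open>L\<close> over \<open>V\<close> to the
  \<open>V\<close>-linear maps from \<open>B\<close> to \<open>L\<close> that sends
  \<open>a \<otimes> x\<close> to \<open>b \<mapsto> a b x\<close>. A basis of \<open>L\<close>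
  turns the source into \<open>B\<^sup>r\<close>, evaluation on a basis of \<open>B\<close> turns
  the target into \<open>L\<^sup>n\<close>, and bijectivity holds because the operators
  \<open>b \<mapsto> x b y\<close> span all \<open>V\<close>-linear endomorphisms of
  \<open>B\<close>. The valuation acts through one fact: among finitely many elements of
  \<open>K\<close>, not all zero, one divides all the others with quotients in \<open>V\<close>.
  Applied to relations it yields bases. Applied to coordinates it writes a nonzero element of
  \<open>A\<close> as a scalar times an element generating the unit ideal, so that an endomorphism
  of \<open>L\<close>, known at once only over \<open>K\<close>, comes from \<open>A\<close>. Two
  obstacles shape the form. Modules range over one fixed type, so every module built from another
  must be encoded in that type. Brauer classes contain only algebras of sequences, so a base change
  must be copied to that type before it can be an element of a class.\<close>

lemma additive_zero:
  assumes "abelian_group M" "abelian_group N" "f \<in> carrier M \<rightarrow> carrier N"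
    and "\<And>x y. \<lbrakk>x \<in> carrier M; y \<in> carrier M\<rbrakk> \<Longrightarrow> f (x \<oplus>\<^bsub>M\<^esub> y) = f x \<oplus>\<^bsub>N\<^esub> f y"
  shows "f \<zero>\<^bsub>M\<^esub> = \<zero>\<^bsub>N\<^esub>"
proof -
  interpret M: abelian_group M by fact
  interpret N: abelian_group N by fact
  have "f \<zero>\<^bsub>M\<^esub> \<oplus>\<^bsub>N\<^esub> f \<zero>\<^bsub>M\<^esub> = f \<zero>\<^bsub>M\<^esub>" using assms(4)[of "\<zero>\<^bsub>M\<^esub>" "\<zero>\<^bsub>M\<^esub>"] by simp
  moreover have "f \<zero>\<^bsub>M\<^esub> \<in> carrier N" using assms(3) by auto
  ultimately show ?thesis by (metis N.add.r_cancel_one')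
qed

lemma additive_minus:
  assumes "abelian_group M" "abelian_group N" "f \<in> carrier M \<rightarrow> carrier N"
    and "\<And>x y. \<lbrakk>x \<in> carrier M; y \<in> carrier M\<rbrakk> \<Longrightarrow> f (x \<oplus>\<^bsub>M\<^esub> y) = f x \<oplus>\<^bsub>N\<^esub> f y"
    and "x \<in> carrier M"
  shows "f (\<ominus>\<^bsub>M\<^esub> x) = \<ominus>\<^bsub>N\<^esub> f x"
proof -
  interpret M: abelian_group M by fact
  interpret N: abelian_group N by fact
  have "f (\<ominus>\<^bsub>M\<^esub> x) \<oplus>\<^bsub>N\<^esub> f x = \<zero>\<^bsub>N\<^esub>"
    using assms(4)[of "\<ominus>\<^bsub>M\<^esub> x" x] additive_zero[OF assms(1-4)] assms(5) by (simp add: M.l_neg)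
  moreover have "f x \<in> carrier N" "f (\<ominus>\<^bsub>M\<^esub> x) \<in> carrier N" using assms(3,5) by auto
  ultimately show ?thesis by (metis N.minus_equality)
qed

lemma additive_finsum:
  assumes "abelian_group M" "abelian_group N" "f \<in> carrier M \<rightarrow> carrier N"
    and "\<And>x y. \<lbrakk>x \<in> carrier M; y \<in> carrier M\<rbrakk> \<Longrightarrow> f (x \<oplus>\<^bsub>M\<^esub> y) = f x \<oplus>\<^bsub>N\<^esub> f y"
    and "finite I" "g \<in> I \<rightarrow> carrier M"
  shows "f (\<Oplus>\<^bsub>M\<^esub>i\<in>I. g i) = (\<Oplus>\<^bsub>N\<^esub>i\<in>I. f (g i))"
  using assms(5,6)
proof (induction I rule: finite_induct)
  interpret M: abelian_group M by fact
  interpret N: abelian_group N by fact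
  case empty
  then show ?case by (simp add: additive_zero[OF assms(1-4)])
next
  interpret M: abelian_group M by fact
  interpret N: abelian_group N by fact
  case (insert i I)
  have "(\<lambda>i. f (g i)) \<in> I \<rightarrow> carrier N" "f (g i) \<in> carrier N" using insert assms(3) by auto
  then show ?case using insert by (simp add: M.finsum_insert N.finsum_insert assms(4) M.finsum_closed)
qed

section \<open>Finite sums in abelian groups\<close>

lemma (in abelian_group) finsum_swap:
  assumes "finite I" "finite J" "\<And>i j. \<lbrakk>i \<in> I; j \<in> J\<rbrakk> \<Longrightarrow> f i j \<in> carrier G"
  shows "(\<Oplus>i\<in>I. \<Oplus>j\<in>J. f i j) = (\<Oplus>j\<in>J. \<Oplus>i\<in>I. f i j)"
  using assms(1,3)
proof (induction I rule: finite_induct)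
  case empty
  then show ?case by simp
next
  case (insert x I)
  have "(\<Oplus>j\<in>J. \<Oplus>i\<in>insert x I. f i j) = (\<Oplus>j\<in>J. f x j \<oplus> (\<Oplus>i\<in>I. f i j))"
    using insert by (intro finsum_cong') (auto simp: finsum_insert Pi_def intro!: finsum_closed)
  also have "\<dots> = (\<Oplus>j\<in>J. f x j) \<oplus> (\<Oplus>j\<in>J. \<Oplus>i\<in>I. f i j)"
    using insert by (intro finsum_addf) (auto simp: Pi_def intro!: finsum_closed)
  finally show ?case using insert by (simp add: finsum_insert Pi_def finsum_closed)
qed

lemma (in abelian_group) finsum_delta:
  assumes "finite I" "k \<in> I" "f k \<in> carrier G"
  shows "(\<Oplus>i\<in>I. if i = k then f i else \<zero>) = f k"
proof -
  have "(\<Oplus>i\<in>I. if i = k then f i else \<zero>) = (\<Oplus>i\<in>{k}. f i)"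
    using assms by (intro add.finprod_mono_neutral_cong_right) auto
  then show ?thesis using assms by simp
qed

section \<open>Extensional module homomorphisms\<close>

lemma module_homD:
  assumes "f \<in> module_hom A M N"
  shows "f \<in> carrier M \<rightarrow>\<^sub>E carrier N"
    and "x \<in> carrier M \<Longrightarrow> f x \<in> carrier N"
    and "\<lbrakk>x \<in> carrier M; y \<in> carrier M\<rbrakk> \<Longrightarrow> f (x \<oplus>\<^bsub>M\<^esub> y) = f x \<oplus>\<^bsub>N\<^esub> f y"
    and "\<lbrakk>a \<in> carrier A; x \<in> carrier M\<rbrakk> \<Longrightarrow> f (a \<odot>\<^bsub>M\<^esub> x) = a \<odot>\<^bsub>N\<^esub> f x"
  using assms unfolding module_hom_def by auto

lemma module_homI:
  assumes "f \<in> carrier M \<rightarrow>\<^sub>E carrier N"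
    and "\<And>x y. \<lbrakk>x \<in> carrier M; y \<in> carrier M\<rbrakk> \<Longrightarrow> f (x \<oplus>\<^bsub>M\<^esub> y) = f x \<oplus>\<^bsub>N\<^esub> f y"
    and "\<And>a x. \<lbrakk>a \<in> carrier A; x \<in> carrier M\<rbrakk> \<Longrightarrow> f (a \<odot>\<^bsub>M\<^esub> x) = a \<odot>\<^bsub>N\<^esub> f x"
  shows "f \<in> module_hom A M N"
  using assms unfolding module_hom_def by auto

lemma module_hom_restrictI:
  assumes "\<And>x. x \<in> carrier M \<Longrightarrow> f x \<in> carrier N"
    and "\<And>x y. \<lbrakk>x \<in> carrier M; y \<in> carrier M\<rbrakk> \<Longrightarrow> f (x \<oplus>\<^bsub>M\<^esub> y) = f x \<oplus>\<^bsub>N\<^esub> f y"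
    and "\<And>a x. \<lbrakk>a \<in> carrier A; x \<in> carrier M\<rbrakk> \<Longrightarrow> f (a \<odot>\<^bsub>M\<^esub> x) = a \<odot>\<^bsub>N\<^esub> f x"
    and "abelian_group M" "\<And>a x. \<lbrakk>a \<in> carrier A; x \<in> carrier M\<rbrakk> \<Longrightarrow> a \<odot>\<^bsub>M\<^esub> x \<in> carrier M"
  shows "(\<lambda>x\<in>carrier M. f x) \<in> module_hom A M N"
proof -
  interpret abelian_group M by fact
  show ?thesis using assms by (intro module_homI) auto
qed

lemma module_hom_eqI:
  assumes "f \<in> module_hom A M N" "g \<in> module_hom A M N" "\<And>x. x \<in> carrier M \<Longrightarrow> f x = g x"
  shows "f = g"
  using PiE_ext[OF module_homD(1)[OF assms(1)] module_homD(1)[OF assms(2)]] assms(3) by blast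

lemma module_hom_id:
  assumes "left_module A M"
  shows "(\<lambda>x\<in>carrier M. x) \<in> module_hom A M M"
proof -
  interpret left_module A M by fact
  show ?thesis by (rule module_hom_restrictI) (auto simp: smult_closed M.abelian_group_axioms)
qed

lemma module_hom_compose:
  assumes "left_module A L" "f \<in> module_hom A L M" "g \<in> module_hom A M N"
  shows "compose (carrier L) g f \<in> module_hom A L N"
proof -
  interpret left_module A L by fact
  show ?thesis unfolding compose_def
    by (rule module_hom_restrictI)
       (use assms(2,3) in \<open>auto simp: smult_closed module_homD M.abelian_group_axioms\<close>)
qed

lemma module_hom_inv:
  assumes "left_module A M" "left_module A N" "f \<in> module_hom A M N" "bij_betw f (carrier M) (carrier N)"
  obtains g where "g \<in> module_hom A N M" "bij_betw g (carrier N) (carrier M)"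
    "\<And>x. x \<in> carrier M \<Longrightarrow> g (f x) = x" "\<And>y. y \<in> carrier N \<Longrightarrow> f (g y) = y"
proof -
  interpret M: left_module A M by fact
  interpret N: left_module A N by fact
  define g where "g = (\<lambda>y\<in>carrier N. inv_into (carrier M) f y)"
  have gf: "g (f x) = x" if "x \<in> carrier M" for x
    using that assms(4) module_homD(2)[OF assms(3)] unfolding g_def bij_betw_def by (simp add: inv_into_f_f)
  have fg: "f (g y) = y" "g y \<in> carrier M" if "y \<in> carrier N" for y
    using that assms(4) unfolding g_def bij_betw_def by (auto simp: f_inv_into_f inv_into_into)
  have "g \<in> module_hom A N M"
  proof (rule module_homI)
    show "g \<in> carrier N \<rightarrow>\<^sub>E carrier M" using fg by (auto simp: g_def)
  next
    fix x y assume xy: "x \<in> carrier N" "y \<in> carrier N"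
    have "g (x \<oplus>\<^bsub>N\<^esub> y) = g (f (g x \<oplus>\<^bsub>M\<^esub> g y))" using xy fg by (simp add: module_homD(3)[OF assms(3)])
    then show "g (x \<oplus>\<^bsub>N\<^esub> y) = g x \<oplus>\<^bsub>M\<^esub> g y" using xy fg gf by simp
  next
    fix a y assume xy: "a \<in> carrier A" "y \<in> carrier N"
    have "g (a \<odot>\<^bsub>N\<^esub> y) = g (f (a \<odot>\<^bsub>M\<^esub> g y))" using xy fg by (simp add: module_homD(4)[OF assms(3)])
    then show "g (a \<odot>\<^bsub>N\<^esub> y) = a \<odot>\<^bsub>M\<^esub> g y" using xy fg gf by (simp add: M.smult_closed)
  qed
  moreover have "bij_betw g (carrier N) (carrier M)"
    by (rule bij_betwI[where g = f]) (use fg gf module_homD(2)[OF assms(3)] in auto)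
  ultimately show thesis using that fg gf by blast
qed

section \<open>Morita equivalence\<close>

lemma linear_functorD:
  assumes "linear_functor R A B Fo Fm"
  shows "left_module A M \<Longrightarrow> left_module B (Fo M)"
    and "left_module A M \<Longrightarrow> Fm M M (\<lambda>x\<in>carrier M. x) = (\<lambda>y\<in>carrier (Fo M). y)"
    and "\<lbrakk>left_module A M; left_module A N; f \<in> module_hom A M N\<rbrakk> \<Longrightarrow> Fm M N f \<in> module_hom B (Fo M) (Fo N)"
    and "\<lbrakk>left_module A M; left_module A N; f \<in> module_hom A M N; g \<in> module_hom A M N\<rbrakk> \<Longrightarrow>
      Fm M N (\<lambda>x\<in>carrier M. f x \<oplus>\<^bsub>N\<^esub> g x) = (\<lambda>y\<in>carrier (Fo M). Fm M N f y \<oplus>\<^bsub>Fo N\<^esub> Fm M N g y)"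
    and "\<lbrakk>left_module A M; left_module A N; f \<in> module_hom A M N; r \<in> carrier R\<rbrakk> \<Longrightarrow>
      Fm M N (\<lambda>x\<in>carrier M. (r \<odot>\<^bsub>A\<^esub> \<one>\<^bsub>A\<^esub>) \<odot>\<^bsub>N\<^esub> f x) =
        (\<lambda>y\<in>carrier (Fo M). (r \<odot>\<^bsub>B\<^esub> \<one>\<^bsub>B\<^esub>) \<odot>\<^bsub>Fo N\<^esub> Fm M N f y)"
    and "\<lbrakk>left_module A L; left_module A M; left_module A N; f \<in> module_hom A L M; g \<in> module_hom A M N\<rbrakk> \<Longrightarrow>
      Fm L N (compose (carrier L) g f) = compose (carrier (Fo L)) (Fm M N g) (Fm L M f)"
  using assms unfolding linear_functor_def by blast+

lemma linear_functor_compose: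
  assumes F: "linear_functor R A B Fo Fm" and G: "linear_functor R B C Go Gm"
  shows "linear_functor R A C (Go \<circ> Fo) (\<lambda>M N f. Gm (Fo M) (Fo N) (Fm M N f))"
  unfolding linear_functor_def
  by (intro allI impI conjI ballI; (elim conjE)?)
     (simp_all add: linear_functorD[OF F] linear_functorD[OF G])

text \<open>Functoriality carries a two-sided inverse to a two-sided inverse. The equations
  \<open>gf\<close> and \<open>fg\<close> are stated between extensional maps, because it is to
  morphisms that the functor applies.\<close>

lemma linear_functor_bij:
  assumes F: "linear_functor R A B Fo Fm" and M: "left_module A M" and N: "left_module A N"
    and f: "f \<in> module_hom A M N" "bij_betw f (carrier M) (carrier N)"
  shows "bij_betw (Fm M N f) (carrier (Fo M)) (carrier (Fo N))"
proof -
  obtain g where g: "g \<in> module_hom A N M"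
    "\<And>x. x \<in> carrier M \<Longrightarrow> g (f x) = x" "\<And>y. y \<in> carrier N \<Longrightarrow> f (g y) = y"
    using module_hom_inv[OF M N f] by metis
  have gf: "compose (carrier M) g f = (\<lambda>x\<in>carrier M. x)" and fg: "compose (carrier N) f g = (\<lambda>x\<in>carrier N. x)"
    using g by (auto simp: compose_def)
  have 1: "compose (carrier (Fo M)) (Fm N M g) (Fm M N f) = (\<lambda>y\<in>carrier (Fo M). y)"
    using linear_functorD(6)[OF F M N M f(1) g(1)] gf linear_functorD(2)[OF F M] by simp
  have 2: "compose (carrier (Fo N)) (Fm M N f) (Fm N M g) = (\<lambda>y\<in>carrier (Fo N). y)"
    using linear_functorD(6)[OF F N M N g(1) f(1)] fg linear_functorD(2)[OF F N] by simp
  note h = module_homD(2)[OF linear_functorD(3)[OF F M N f(1)]] module_homD(2)[OF linear_functorD(3)[OF F N M g(1)]]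
  show ?thesis
  proof (rule bij_betwI)
    show "Fm N M g (Fm M N f x) = x" if "x \<in> carrier (Fo M)" for x
      using that fun_cong[OF 1, of x] by (simp add: compose_def)
    show "Fm M N f (Fm N M g y) = y" if "y \<in> carrier (Fo N)" for y
      using that fun_cong[OF 2, of y] by (simp add: compose_def)
  qed (use h in auto)
qed

lemma natural_iso_idD:
  assumes "natural_iso_id A Ho Hm \<eta>"
  shows "left_module A M \<Longrightarrow> \<eta> M \<in> module_hom A M (Ho M)"
    and "left_module A M \<Longrightarrow> bij_betw (\<eta> M) (carrier M) (carrier (Ho M))"
    and "\<lbrakk>left_module A M; left_module A N; f \<in> module_hom A M N; x \<in> carrier M\<rbrakk> \<Longrightarrow>
      \<eta> N (f x) = Hm M N f (\<eta> M x)"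
proof -
  show "left_module A M \<Longrightarrow> \<eta> M \<in> module_hom A M (Ho M)"
    "left_module A M \<Longrightarrow> bij_betw (\<eta> M) (carrier M) (carrier (Ho M))"
    using assms unfolding natural_iso_id_def by blast+
  assume "left_module A M" "left_module A N" "f \<in> module_hom A M N" and x: "x \<in> carrier M"
  then have "compose (carrier M) (\<eta> N) f = compose (carrier M) (Hm M N f) (\<eta> M)"
    using assms unfolding natural_iso_id_def by blast
  from fun_cong[OF this, of x] x show "\<eta> N (f x) = Hm M N f (\<eta> M x)" by (simp add: compose_def)
qed

lemma natural_iso_idI:
  assumes "\<And>M. left_module A M \<Longrightarrow> \<eta> M \<in> module_hom A M (Ho M)"
    and "\<And>M. left_module A M \<Longrightarrow> bij_betw (\<eta> M) (carrier M) (carrier (Ho M))"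
    and "\<And>M N f x. \<lbrakk>left_module A M; left_module A N; f \<in> module_hom A M N; x \<in> carrier M\<rbrakk> \<Longrightarrow>
      \<eta> N (f x) = Hm M N f (\<eta> M x)"
  shows "natural_iso_id A Ho Hm \<eta>"
  using assms unfolding natural_iso_id_def compose_def by (auto intro!: restrict_ext)

lemma morita_equivalentI:
  fixes Fo :: "('a, 'u) module \<Rightarrow> ('b, 'u) module" and u :: "'u itself"
  assumes "linear_functor R A B Fo Fm" "linear_functor R B A Go Gm"
    and "natural_iso_id A (Go \<circ> Fo) (\<lambda>M N f. Gm (Fo M) (Fo N) (Fm M N f)) \<eta>"
    and "natural_iso_id B (Fo \<circ> Go) (\<lambda>M N f. Fm (Go M) (Go N) (Gm M N f)) \<epsilon>"
  shows "morita_equivalent u R A B"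
  unfolding morita_equivalent_def
  by (rule exI[of _ Fo], rule exI[of _ Fm], rule exI[of _ Go], rule exI[of _ Gm],
      rule exI[of _ \<eta>], rule exI[of _ \<epsilon>]) (intro conjI assms)

lemma morita_equivalentE:
  fixes u :: "'u itself" and A :: "('r, 'a) module" and B :: "('r, 'b) module"
  assumes "morita_equivalent u R A B"
  obtains Fo :: "('a, 'u) module \<Rightarrow> ('b, 'u) module" and Fm Go Gm \<eta> \<epsilon>
  where "linear_functor R A B Fo Fm" "linear_functor R B A Go Gm"
    "natural_iso_id A (Go \<circ> Fo) (\<lambda>M N f. Gm (Fo M) (Fo N) (Fm M N f)) \<eta>"
    "natural_iso_id B (Fo \<circ> Go) (\<lambda>M N f. Fm (Go M) (Go N) (Gm M N f)) \<epsilon>"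
  using assms unfolding morita_equivalent_def by (elim exE conjE) (rule that)

lemma morita_sym:
  assumes "morita_equivalent u R A B" shows "morita_equivalent u R B A"
  using assms by (elim morita_equivalentE) (rule morita_equivalentI)

text \<open>The unit of the composite equivalence is \<open>\<eta>\<close> followed by the image
  under \<open>Gm\<close> of the component of \<open>\<eta>'\<close> at \<open>Fo M\<close>. Its
  naturality is the pasting of two squares, the inner one being transported by the functor
  \<open>Go\<close>.\<close>

lemma natural_iso_compose:
  fixes A :: "('r, 'a) module" and B :: "('r, 'b) module" and C :: "('r, 'c) module"
    and Fo :: "('a, 'u) module \<Rightarrow> ('b, 'u) module" and Fo' :: "('b, 'u) module \<Rightarrow> ('c, 'u) module"
  assumes F: "linear_functor R A B Fo Fm" and G: "linear_functor R B A Go Gm"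
    and F': "linear_functor R B C Fo' Fm'" and G': "linear_functor R C B Go' Gm'"
    and e: "natural_iso_id A (Go \<circ> Fo) (\<lambda>M N f. Gm (Fo M) (Fo N) (Fm M N f)) \<eta>"
    and e': "natural_iso_id B (Go' \<circ> Fo') (\<lambda>M N f. Gm' (Fo' M) (Fo' N) (Fm' M N f)) \<eta>'"
  shows "natural_iso_id A ((Go \<circ> Go') \<circ> (Fo' \<circ> Fo))
      (\<lambda>M N f. Gm (Go' (Fo' (Fo M))) (Go' (Fo' (Fo N)))
         (Gm' (Fo' (Fo M)) (Fo' (Fo N)) (Fm' (Fo M) (Fo N) (Fm M N f))))
      (\<lambda>M. compose (carrier M) (Gm (Fo M) (Go' (Fo' (Fo M))) (\<eta>' (Fo M))) (\<eta> M))"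
proof (rule natural_iso_idI)
  fix M :: "('a, 'u) module" assume M: "left_module A M"
  note [simp] = linear_functorD(1)[OF F] linear_functorD(1)[OF G] linear_functorD(1)[OF F'] linear_functorD(1)[OF G']
  note 1 = natural_iso_idD(1)[OF e M] natural_iso_idD(2)[OF e M]
  note 2 = natural_iso_idD(1)[OF e', of "Fo M"] natural_iso_idD(2)[OF e', of "Fo M"]
  have 3: "Gm (Fo M) (Go' (Fo' (Fo M))) (\<eta>' (Fo M)) \<in> module_hom A (Go (Fo M)) (Go (Go' (Fo' (Fo M))))"
    using M 2 by (intro linear_functorD(3)[OF G]) auto
  show "compose (carrier M) (Gm (Fo M) (Go' (Fo' (Fo M))) (\<eta>' (Fo M))) (\<eta> M)
      \<in> module_hom A M (((Go \<circ> Go') \<circ> (Fo' \<circ> Fo)) M)"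
    using module_hom_compose[OF M] 1 3 by simp
  have "bij_betw (Gm (Fo M) (Go' (Fo' (Fo M))) (\<eta>' (Fo M))) (carrier (Go (Fo M))) (carrier (Go (Go' (Fo' (Fo M)))))"
    using M 2 by (intro linear_functor_bij[OF G]) auto
  then have "bij_betw (Gm (Fo M) (Go' (Fo' (Fo M))) (\<eta>' (Fo M)) \<circ> \<eta> M) (carrier M) (carrier (Go (Go' (Fo' (Fo M)))))"
    using 1(2) by (auto intro: bij_betw_trans)
  then show "bij_betw (compose (carrier M) (Gm (Fo M) (Go' (Fo' (Fo M))) (\<eta>' (Fo M))) (\<eta> M))
     (carrier M) (carrier (((Go \<circ> Go') \<circ> (Fo' \<circ> Fo)) M))"
    by (subst bij_betw_cong[of _ _ "Gm (Fo M) (Go' (Fo' (Fo M))) (\<eta>' (Fo M)) \<circ> \<eta> M"]) (auto simp: compose_def)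
next
  fix M N :: "('a, 'u) module" and f x assume M: "left_module A M" and N: "left_module A N" and f: "f \<in> module_hom A M N" and x: "x \<in> carrier M"
  note [simp] = linear_functorD(1)[OF F] linear_functorD(1)[OF G] linear_functorD(1)[OF F'] linear_functorD(1)[OF G']
  have fx: "f x \<in> carrier N" using module_homD(2)[OF f x] .
  have ex: "\<eta> M x \<in> carrier (Go (Fo M))" using module_homD(2)[OF natural_iso_idD(1)[OF e M] x] by simp
  define h where "h = Fm M N f"
  define k where "k = Gm' (Fo' (Fo M)) (Fo' (Fo N)) (Fm' (Fo M) (Fo N) h)"
  have h: "h \<in> module_hom B (Fo M) (Fo N)" unfolding h_def using linear_functorD(3)[OF F M N f] .
  have k: "k \<in> module_hom B (Go' (Fo' (Fo M))) (Go' (Fo' (Fo N)))"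
    unfolding k_def using M N h by (intro linear_functorD(3)[OF G'] linear_functorD(3)[OF F']) auto
  have eM: "\<eta>' (Fo M) \<in> module_hom B (Fo M) (Go' (Fo' (Fo M)))" using natural_iso_idD(1)[OF e', of "Fo M"] M by simp
  have eN: "\<eta>' (Fo N) \<in> module_hom B (Fo N) (Go' (Fo' (Fo N)))" using natural_iso_idD(1)[OF e', of "Fo N"] N by simp
  \<comment> \<open>Naturality of \<open>\<eta>'\<close> is restated as an equation between
    extensional homomorphisms, since \<open>Gm\<close> takes morphisms and not values.\<close>
  have "compose (carrier (Fo M)) (\<eta>' (Fo N)) h = compose (carrier (Fo M)) k (\<eta>' (Fo M))"
    using natural_iso_idD(3)[OF e' _ _ h] M N by (auto simp: compose_def k_def intro!: restrict_ext)
  then have "Gm (Fo M) (Go' (Fo' (Fo N))) (compose (carrier (Fo M)) (\<eta>' (Fo N)) h)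
      = Gm (Fo M) (Go' (Fo' (Fo N))) (compose (carrier (Fo M)) k (\<eta>' (Fo M)))" by simp
  then have "compose (carrier (Go (Fo M))) (Gm (Fo N) (Go' (Fo' (Fo N))) (\<eta>' (Fo N))) (Gm (Fo M) (Fo N) h)
     = compose (carrier (Go (Fo M))) (Gm (Go' (Fo' (Fo M))) (Go' (Fo' (Fo N))) k) (Gm (Fo M) (Go' (Fo' (Fo M))) (\<eta>' (Fo M)))"
    using linear_functorD(6)[OF G, of "Fo M" "Fo N" "Go' (Fo' (Fo N))" h "\<eta>' (Fo N)"]
      linear_functorD(6)[OF G, of "Fo M" "Go' (Fo' (Fo M))" "Go' (Fo' (Fo N))" "\<eta>' (Fo M)" k] M N h k eM eN
    by simp
  from fun_cong[OF this, of "\<eta> M x"] ex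
  have "Gm (Fo N) (Go' (Fo' (Fo N))) (\<eta>' (Fo N)) (Gm (Fo M) (Fo N) h (\<eta> M x))
     = Gm (Go' (Fo' (Fo M))) (Go' (Fo' (Fo N))) k (Gm (Fo M) (Go' (Fo' (Fo M))) (\<eta>' (Fo M)) (\<eta> M x))"
    by (simp add: compose_def)
  then show "compose (carrier N) (Gm (Fo N) (Go' (Fo' (Fo N))) (\<eta>' (Fo N))) (\<eta> N) (f x)
     = Gm (Go' (Fo' (Fo M))) (Go' (Fo' (Fo N)))
         (Gm' (Fo' (Fo M)) (Fo' (Fo N)) (Fm' (Fo M) (Fo N) (Fm M N f)))
        (compose (carrier M) (Gm (Fo M) (Go' (Fo' (Fo M))) (\<eta>' (Fo M))) (\<eta> M) x)"
    using natural_iso_idD(3)[OF e M N f x] fx x by (simp add: compose_def h_def k_def)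
qed

lemma morita_trans:
  fixes u :: "'u itself" and A :: "('r, 'a) module" and B :: "('r, 'b) module" and C :: "('r, 'c) module"
  assumes "morita_equivalent u R A B" "morita_equivalent u R B C"
  shows "morita_equivalent u R A C"
proof (rule morita_equivalentE[OF assms(1)], rule morita_equivalentE[OF assms(2)])
  fix Fo :: "('a, 'u) module \<Rightarrow> ('b, 'u) module" and Fm Go Gm \<eta> \<epsilon>
    and Fo' :: "('b, 'u) module \<Rightarrow> ('c, 'u) module" and Fm' Go' Gm' \<eta>' \<epsilon>'
  assume 1: "linear_functor R A B Fo Fm" "linear_functor R B A Go Gm"
    "natural_iso_id A (Go \<circ> Fo) (\<lambda>M N f. Gm (Fo M) (Fo N) (Fm M N f)) \<eta>"
    "natural_iso_id B (Fo \<circ> Go) (\<lambda>M N f. Fm (Go M) (Go N) (Gm M N f)) \<epsilon>"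
  assume 2: "linear_functor R B C Fo' Fm'" "linear_functor R C B Go' Gm'"
    "natural_iso_id B (Go' \<circ> Fo') (\<lambda>M N f. Gm' (Fo' M) (Fo' N) (Fm' M N f)) \<eta>'"
    "natural_iso_id C (Fo' \<circ> Go') (\<lambda>M N f. Fm' (Go' M) (Go' N) (Gm' M N f)) \<epsilon>'"
  \<comment> \<open>The second instance is the counit: the same lemma read from \<open>C\<close> to
    \<open>A\<close>, with forward and backward functors exchanged.\<close>
  note e = natural_iso_compose[OF 1(1,2) 2(1,2)] natural_iso_compose[OF 2(2,1) 1(2,1)]
  have 3: "natural_iso_id A ((Go \<circ> Go') \<circ> (Fo' \<circ> Fo)) (\<lambda>M N f. (\<lambda>M N f. Gm (Go' M) (Go' N) (Gm' M N f))
      ((Fo' \<circ> Fo) M) ((Fo' \<circ> Fo) N) ((\<lambda>M N f. Fm' (Fo M) (Fo N) (Fm M N f)) M N f))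
      (\<lambda>M. compose (carrier M) (Gm (Fo M) (Go' (Fo' (Fo M))) (\<eta>' (Fo M))) (\<eta> M))"
    using e(1)[OF 1(3) 2(3)] by (simp only: o_apply)
  have 4: "natural_iso_id C ((Fo' \<circ> Fo) \<circ> (Go \<circ> Go')) (\<lambda>M N f. (\<lambda>M N f. Fm' (Fo M) (Fo N) (Fm M N f))
      ((Go \<circ> Go') M) ((Go \<circ> Go') N) ((\<lambda>M N f. Gm (Go' M) (Go' N) (Gm' M N f)) M N f))
      (\<lambda>M. compose (carrier M) (Fm' (Go' M) (Fo (Go (Go' M))) (\<epsilon> (Go' M))) (\<epsilon>' M))"
    using e(2)[OF 2(4) 1(4)] by (simp only: o_apply)
  show ?thesis
    by (rule morita_equivalentI[OF linear_functor_compose[OF 1(1) 2(1)] linear_functor_compose[OF 2(2) 1(2)]]) (rule 3, rule 4)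
qed

text \<open>Linearity is required only on the scalars \<open>r 1\<close>, the form in which
  \<open>R\<close> enters \<open>linear_functor\<close>. For ring homomorphisms between associative
  algebras it gives full linearity by multiplying with \<open>r 1\<close>; for matrix algebras it
  can be checked with the ring structure alone.\<close>

definition algebra_iso :: "('r, 'm) ring_scheme \<Rightarrow> ('r, 'a) module \<Rightarrow> ('r, 'b) module \<Rightarrow> ('a \<Rightarrow> 'b) \<Rightarrow> bool" where
  "algebra_iso R A B \<theta> \<longleftrightarrow> \<theta> \<in> ring_iso A B \<and> (\<forall>r\<in>carrier R. \<theta> (r \<odot>\<^bsub>A\<^esub> \<one>\<^bsub>A\<^esub>) = r \<odot>\<^bsub>B\<^esub> \<one>\<^bsub>B\<^esub>)"

text \<open>Restriction of scalars keeps the carrier, so the module stays in the same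
  universe.\<close>

definition restrict_along :: "('b \<Rightarrow> 'a) \<Rightarrow> ('a, 'u) module \<Rightarrow> ('b, 'u) module" where
  "restrict_along \<sigma> M = \<lparr>carrier = carrier M, monoid.mult = monoid.mult M, monoid.one = monoid.one M,
     ring.zero = \<zero>\<^bsub>M\<^esub>, ring.add = ring.add M, smult = (\<lambda>b x. \<sigma> b \<odot>\<^bsub>M\<^esub> x)\<rparr>"

lemma restrict_along_simps [simp]:
  "carrier (restrict_along \<sigma> M) = carrier M" "\<zero>\<^bsub>restrict_along \<sigma> M\<^esub> = \<zero>\<^bsub>M\<^esub>"
  "x \<oplus>\<^bsub>restrict_along \<sigma> M\<^esub> y = x \<oplus>\<^bsub>M\<^esub> y" "b \<odot>\<^bsub>restrict_along \<sigma> M\<^esub> x = \<sigma> b \<odot>\<^bsub>M\<^esub> x"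
  by (simp_all add: restrict_along_def)

lemma left_module_restrict_along:
  assumes "left_module A M" "ring B" "\<sigma> \<in> ring_hom B A"
  shows "left_module B (restrict_along \<sigma> M)"
proof -
  interpret left_module A M by fact
  interpret B: ring B by fact
  have [simp]: "x \<in> carrier B \<Longrightarrow> \<sigma> x \<in> carrier A" for x using ring_hom_closed[OF assms(3)] .
  have "abelian_group (restrict_along \<sigma> M)"
    by (rule abelian_groupI) (auto simp: M.a_ac intro: M.l_neg)
  then show ?thesis using assms
    by (intro left_module.intro left_module_axioms.intro)
       (auto simp: smult_closed smult_l_distr smult_r_distr smult_assoc smult_one ring_hom_add ring_hom_mult ring_hom_one)
qed

lemma linear_functor_restrict_along:
  assumes "ring A" "ring B" "\<sigma> \<in> ring_hom B A" "\<And>r. r \<in> carrier R \<Longrightarrow> \<sigma> (r \<odot>\<^bsub>B\<^esub> \<one>\<^bsub>B\<^esub>) = r \<odot>\<^bsub>A\<^esub> \<one>\<^bsub>A\<^esub>"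
  shows "linear_functor R A B (restrict_along \<sigma>) (\<lambda>M N f. f)"
  using assms ring_hom_closed[OF assms(3)]
  unfolding linear_functor_def by (auto simp: left_module_restrict_along module_hom_def)

text \<open>Restriction along \<open>\<theta>\<close> and along its inverse gives the two functors.
  Restricting twice returns the same additive group, but the action agrees with the old one only for
  scalars in the carrier; the units are therefore identity maps between records that need not be
  equal.\<close>

lemma morita_algebra_iso:
  fixes A :: "('r, 'a) module" and B :: "('r, 'b) module" and u :: "'u itself"
  assumes A: "ring A" and B: "ring B" and \<theta>: "algebra_iso R A B \<theta>"
    and RA: "\<And>r. r \<in> carrier R \<Longrightarrow> r \<odot>\<^bsub>A\<^esub> \<one>\<^bsub>A\<^esub> \<in> carrier A"
  shows "morita_equivalent u R A B"
proof -
  interpret A: ring A by fact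
  interpret B: ring B by fact
  have h: "\<theta> \<in> ring_hom A B" and b: "bij_betw \<theta> (carrier A) (carrier B)" using \<theta> by (auto simp: algebra_iso_def ring_iso_def)
  define \<sigma> where "\<sigma> = inv_into (carrier A) \<theta>"
  have st: "\<sigma> (\<theta> a) = a" if "a \<in> carrier A" for a using that b by (simp add: \<sigma>_def bij_betw_def)
  have ts: "\<theta> (\<sigma> a) = a" "\<sigma> a \<in> carrier A" if "a \<in> carrier B" for a
    using that b by (auto simp: \<sigma>_def bij_betw_def f_inv_into_f inv_into_into)
  have s: "\<sigma> \<in> ring_hom B A"
    unfolding \<sigma>_def using ring_iso_set_sym[OF A] \<theta> unfolding algebra_iso_def ring_iso_def by blast
  have s1: "\<sigma> (r \<odot>\<^bsub>B\<^esub> \<one>\<^bsub>B\<^esub>) = r \<odot>\<^bsub>A\<^esub> \<one>\<^bsub>A\<^esub>" if "r \<in> carrier R" for r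
    using \<theta> that st RA unfolding algebra_iso_def by metis
  have F: "linear_functor R A B (restrict_along \<sigma> :: ('a, 'u) module \<Rightarrow> _) (\<lambda>M N f. f)"
    by (rule linear_functor_restrict_along) (use A B s s1 in auto)
  have G: "linear_functor R B A (restrict_along \<theta> :: ('b, 'u) module \<Rightarrow> _) (\<lambda>M N f. f)"
    by (rule linear_functor_restrict_along) (use A B h \<theta> in \<open>auto simp: algebra_iso_def\<close>)
  have e: "natural_iso_id A (restrict_along \<theta> \<circ> restrict_along \<sigma>) (\<lambda>M N f. f) (\<lambda>M :: ('a, 'u) module. \<lambda>x\<in>carrier M. x)"
  proof (rule natural_iso_idI)
    fix M :: "('a, 'u) module" assume M: "left_module A M"
    then interpret M: left_module A M .
    show "(\<lambda>x\<in>carrier M. x) \<in> module_hom A M ((restrict_along \<theta> \<circ> restrict_along \<sigma>) M)"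
      by (rule module_hom_restrictI) (auto simp: st M.smult_closed M.M.abelian_group_axioms)
  qed (auto simp: bij_betw_def inj_on_def module_homD)
  have e': "natural_iso_id B (restrict_along \<sigma> \<circ> restrict_along \<theta>) (\<lambda>M N f. f) (\<lambda>M :: ('b, 'u) module. \<lambda>x\<in>carrier M. x)"
  proof (rule natural_iso_idI)
    fix M :: "('b, 'u) module" assume M: "left_module B M"
    then interpret M: left_module B M .
    show "(\<lambda>x\<in>carrier M. x) \<in> module_hom B M ((restrict_along \<sigma> \<circ> restrict_along \<theta>) M)"
      by (rule module_hom_restrictI) (auto simp: ts M.smult_closed M.M.abelian_group_axioms)
  qed (auto simp: bij_betw_def inj_on_def module_homD)
  show ?thesis by (rule morita_equivalentI[OF F G]) (rule e, rule e')
qed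

lemma assoc_algebra_unit_closed:
  assumes "assoc_algebra R A" "r \<in> carrier R"
  shows "r \<odot>\<^bsub>A\<^esub> \<one>\<^bsub>A\<^esub> \<in> carrier A"
proof -
  interpret assoc_algebra R A by fact
  show ?thesis using assms(2) by simp
qed

lemma morita_refl:
  assumes "assoc_algebra R A" shows "morita_equivalent u R A A"
proof (rule morita_algebra_iso)
  show "ring A" "ring A" using assms by (simp_all add: assoc_algebra_def)
  show "algebra_iso R A A id" by (simp add: algebra_iso_def ring_iso_def ring_hom_def)
qed (rule assoc_algebra_unit_closed[OF assms])

section \<open>Matrix algebras\<close>

text \<open>Matrices are total functions padded by zero outside the \<open>n\<close> by
  \<open>n\<close> block, so that equality of functions is equality of matrices.\<close>

definition matrix_algebra :: "nat \<Rightarrow> ('r, 'a) module \<Rightarrow> ('r, nat \<Rightarrow> nat \<Rightarrow> 'a) module" where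
  "matrix_algebra n A =
     \<lparr>carrier = {X. \<forall>i j. X i j \<in> carrier A \<and> (n \<le> i \<or> n \<le> j \<longrightarrow> X i j = \<zero>\<^bsub>A\<^esub>)},
      monoid.mult = (\<lambda>X Y i j. \<Oplus>\<^bsub>A\<^esub>k\<in>{..<n}. X i k \<otimes>\<^bsub>A\<^esub> Y k j),
      monoid.one = (\<lambda>i j. if i = j \<and> i < n then \<one>\<^bsub>A\<^esub> else \<zero>\<^bsub>A\<^esub>),
      ring.zero = (\<lambda>i j. \<zero>\<^bsub>A\<^esub>),
      ring.add = (\<lambda>X Y i j. X i j \<oplus>\<^bsub>A\<^esub> Y i j),
      smult = (\<lambda>r X i j. r \<odot>\<^bsub>A\<^esub> X i j)\<rparr>"

lemma matrix_algebra_simps: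
  "X \<in> carrier (matrix_algebra n A) \<longleftrightarrow> (\<forall>i j. X i j \<in> carrier A \<and> (n \<le> i \<or> n \<le> j \<longrightarrow> X i j = \<zero>\<^bsub>A\<^esub>))"
  "(X \<otimes>\<^bsub>matrix_algebra n A\<^esub> Y) i j = (\<Oplus>\<^bsub>A\<^esub>k\<in>{..<n}. X i k \<otimes>\<^bsub>A\<^esub> Y k j)"
  "\<one>\<^bsub>matrix_algebra n A\<^esub> i j = (if i = j \<and> i < n then \<one>\<^bsub>A\<^esub> else \<zero>\<^bsub>A\<^esub>)"
  "\<zero>\<^bsub>matrix_algebra n A\<^esub> i j = \<zero>\<^bsub>A\<^esub>"
  "(X \<oplus>\<^bsub>matrix_algebra n A\<^esub> Y) i j = X i j \<oplus>\<^bsub>A\<^esub> Y i j"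
  "(r \<odot>\<^bsub>matrix_algebra n A\<^esub> X) i j = r \<odot>\<^bsub>A\<^esub> X i j"
  by (simp_all add: matrix_algebra_def)

lemma ring_matrix_algebra:
  assumes "ring A" shows "ring (matrix_algebra n A)"
proof -
  interpret A: ring A by fact
  let ?M = "matrix_algebra n A"
  have "abelian_group ?M"
  proof (rule abelian_groupI)
    fix X assume X: "X \<in> carrier ?M"
    then show "\<exists>Y\<in>carrier ?M. Y \<oplus>\<^bsub>?M\<^esub> X = \<zero>\<^bsub>?M\<^esub>"
      by (intro bexI[of _ "\<lambda>i j. \<ominus>\<^bsub>A\<^esub> X i j"]) (auto simp: matrix_algebra_simps fun_eq_iff A.l_neg)
  qed (auto simp: matrix_algebra_simps fun_eq_iff A.a_ac)
  moreover have "monoid ?M"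
  proof (rule monoidI)
    fix X Y assume X: "X \<in> carrier ?M" and Y: "Y \<in> carrier ?M"
    then have [simp]: "\<And>i j. X i j \<in> carrier A" "\<And>i j. Y i j \<in> carrier A" by (auto simp: matrix_algebra_simps)
    have "(\<Oplus>\<^bsub>A\<^esub>k\<in>{..<n}. X i k \<otimes>\<^bsub>A\<^esub> Y k j) = \<zero>\<^bsub>A\<^esub>" if "n \<le> i \<or> n \<le> j" for i j
    proof -
      have "(\<Oplus>\<^bsub>A\<^esub>k\<in>{..<n}. X i k \<otimes>\<^bsub>A\<^esub> Y k j) = (\<Oplus>\<^bsub>A\<^esub>k\<in>{..<n}. \<zero>\<^bsub>A\<^esub>)"
        by (rule A.finsum_cong') (use that X Y in \<open>auto simp: matrix_algebra_simps\<close>)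
      then show ?thesis by simp
    qed
    then show "X \<otimes>\<^bsub>?M\<^esub> Y \<in> carrier ?M"
      by (simp add: matrix_algebra_simps A.finsum_closed Pi_def)
    fix Z assume "Z \<in> carrier ?M"
    then have [simp]: "\<And>i j. Z i j \<in> carrier A" by (auto simp: matrix_algebra_simps)
    have "(\<Oplus>\<^bsub>A\<^esub>k\<in>{..<n}. (\<Oplus>\<^bsub>A\<^esub>l\<in>{..<n}. X i l \<otimes>\<^bsub>A\<^esub> Y l k) \<otimes>\<^bsub>A\<^esub> Z k j)
      = (\<Oplus>\<^bsub>A\<^esub>l\<in>{..<n}. X i l \<otimes>\<^bsub>A\<^esub> (\<Oplus>\<^bsub>A\<^esub>k\<in>{..<n}. Y l k \<otimes>\<^bsub>A\<^esub> Z k j))" for i j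
    proof -
      have "(\<Oplus>\<^bsub>A\<^esub>k\<in>{..<n}. (\<Oplus>\<^bsub>A\<^esub>l\<in>{..<n}. X i l \<otimes>\<^bsub>A\<^esub> Y l k) \<otimes>\<^bsub>A\<^esub> Z k j)
         = (\<Oplus>\<^bsub>A\<^esub>k\<in>{..<n}. \<Oplus>\<^bsub>A\<^esub>l\<in>{..<n}. X i l \<otimes>\<^bsub>A\<^esub> (Y l k \<otimes>\<^bsub>A\<^esub> Z k j))"
        by (rule A.finsum_cong') (auto simp: A.finsum_ldistr A.m_assoc Pi_def A.finsum_closed)
      also have "\<dots> = (\<Oplus>\<^bsub>A\<^esub>l\<in>{..<n}. \<Oplus>\<^bsub>A\<^esub>k\<in>{..<n}. X i l \<otimes>\<^bsub>A\<^esub> (Y l k \<otimes>\<^bsub>A\<^esub> Z k j))"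
        by (rule A.finsum_swap) auto
      also have "\<dots> = (\<Oplus>\<^bsub>A\<^esub>l\<in>{..<n}. X i l \<otimes>\<^bsub>A\<^esub> (\<Oplus>\<^bsub>A\<^esub>k\<in>{..<n}. Y l k \<otimes>\<^bsub>A\<^esub> Z k j))"
        by (rule A.finsum_cong') (auto simp: A.finsum_rdistr Pi_def A.finsum_closed)
      finally show ?thesis .
    qed
    then show "X \<otimes>\<^bsub>?M\<^esub> Y \<otimes>\<^bsub>?M\<^esub> Z = X \<otimes>\<^bsub>?M\<^esub> (Y \<otimes>\<^bsub>?M\<^esub> Z)"
      by (simp add: matrix_algebra_simps fun_eq_iff)
  next
    fix X assume X: "X \<in> carrier ?M"
    then have [simp]: "\<And>i j. X i j \<in> carrier A" by (auto simp: matrix_algebra_simps)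
    have "(\<Oplus>\<^bsub>A\<^esub>k\<in>{..<n}. (if i = k \<and> i < n then \<one>\<^bsub>A\<^esub> else \<zero>\<^bsub>A\<^esub>) \<otimes>\<^bsub>A\<^esub> X k j) = X i j" for i j
    proof (cases "i < n")
      case True
      have "(\<Oplus>\<^bsub>A\<^esub>k\<in>{..<n}. (if i = k \<and> i < n then \<one>\<^bsub>A\<^esub> else \<zero>\<^bsub>A\<^esub>) \<otimes>\<^bsub>A\<^esub> X k j)
        = (\<Oplus>\<^bsub>A\<^esub>k\<in>{..<n}. if k = i then X k j else \<zero>\<^bsub>A\<^esub>)"
        by (rule A.finsum_cong') (use True in auto)
      then show ?thesis using A.finsum_delta[of "{..<n}" i "\<lambda>k. X k j"] True by simp
    next
      case False
      have "(\<Oplus>\<^bsub>A\<^esub>k\<in>{..<n}. (if i = k \<and> i < n then \<one>\<^bsub>A\<^esub> else \<zero>\<^bsub>A\<^esub>) \<otimes>\<^bsub>A\<^esub> X k j) = (\<Oplus>\<^bsub>A\<^esub>k\<in>{..<n}. \<zero>\<^bsub>A\<^esub>)"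
        by (rule A.finsum_cong') (use False in auto)
      then show ?thesis using X False by (simp add: matrix_algebra_simps)
    qed
    then show "\<one>\<^bsub>?M\<^esub> \<otimes>\<^bsub>?M\<^esub> X = X" by (simp add: matrix_algebra_simps fun_eq_iff)
    have "(\<Oplus>\<^bsub>A\<^esub>k\<in>{..<n}. X i k \<otimes>\<^bsub>A\<^esub> (if k = j \<and> k < n then \<one>\<^bsub>A\<^esub> else \<zero>\<^bsub>A\<^esub>)) = X i j" for i j
    proof (cases "j < n")
      case True
      have "(\<Oplus>\<^bsub>A\<^esub>k\<in>{..<n}. X i k \<otimes>\<^bsub>A\<^esub> (if k = j \<and> k < n then \<one>\<^bsub>A\<^esub> else \<zero>\<^bsub>A\<^esub>))
        = (\<Oplus>\<^bsub>A\<^esub>k\<in>{..<n}. if k = j then X i k else \<zero>\<^bsub>A\<^esub>)"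
        by (rule A.finsum_cong') (use True in auto)
      then show ?thesis using A.finsum_delta[of "{..<n}" j "\<lambda>k. X i k"] True by simp
    next
      case False
      have "(\<Oplus>\<^bsub>A\<^esub>k\<in>{..<n}. X i k \<otimes>\<^bsub>A\<^esub> (if k = j \<and> k < n then \<one>\<^bsub>A\<^esub> else \<zero>\<^bsub>A\<^esub>)) = (\<Oplus>\<^bsub>A\<^esub>k\<in>{..<n}. \<zero>\<^bsub>A\<^esub>)"
        by (rule A.finsum_cong') (use False in auto)
      then show ?thesis using X False by (simp add: matrix_algebra_simps)
    qed
    then show "X \<otimes>\<^bsub>?M\<^esub> \<one>\<^bsub>?M\<^esub> = X" by (simp add: matrix_algebra_simps fun_eq_iff)
  qed (auto simp: matrix_algebra_simps)
  ultimately show ?thesis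
  proof (rule ringI)
    fix X Y Z assume "X \<in> carrier ?M" "Y \<in> carrier ?M" "Z \<in> carrier ?M"
    then have [simp]: "\<And>i j. X i j \<in> carrier A" "\<And>i j. Y i j \<in> carrier A" "\<And>i j. Z i j \<in> carrier A"
      by (auto simp: matrix_algebra_simps)
    have "(\<Oplus>\<^bsub>A\<^esub>k\<in>{..<n}. (X i k \<oplus>\<^bsub>A\<^esub> Y i k) \<otimes>\<^bsub>A\<^esub> Z k j) = (\<Oplus>\<^bsub>A\<^esub>k\<in>{..<n}. X i k \<otimes>\<^bsub>A\<^esub> Z k j \<oplus>\<^bsub>A\<^esub> Y i k \<otimes>\<^bsub>A\<^esub> Z k j)" for i j
      by (rule A.finsum_cong') (auto simp: A.l_distr)
    then show "(X \<oplus>\<^bsub>?M\<^esub> Y) \<otimes>\<^bsub>?M\<^esub> Z = X \<otimes>\<^bsub>?M\<^esub> Z \<oplus>\<^bsub>?M\<^esub> Y \<otimes>\<^bsub>?M\<^esub> Z"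
      by (simp add: matrix_algebra_simps fun_eq_iff A.finsum_addf Pi_def)
    have "(\<Oplus>\<^bsub>A\<^esub>k\<in>{..<n}. Z i k \<otimes>\<^bsub>A\<^esub> (X k j \<oplus>\<^bsub>A\<^esub> Y k j)) = (\<Oplus>\<^bsub>A\<^esub>k\<in>{..<n}. Z i k \<otimes>\<^bsub>A\<^esub> X k j \<oplus>\<^bsub>A\<^esub> Z i k \<otimes>\<^bsub>A\<^esub> Y k j)" for i j
      by (rule A.finsum_cong') (auto simp: A.r_distr)
    then show "Z \<otimes>\<^bsub>?M\<^esub> (X \<oplus>\<^bsub>?M\<^esub> Y) = Z \<otimes>\<^bsub>?M\<^esub> X \<oplus>\<^bsub>?M\<^esub> Z \<otimes>\<^bsub>?M\<^esub> Y"
      by (simp add: matrix_algebra_simps fun_eq_iff A.finsum_addf Pi_def)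
  qed
qed

lemma finsum_matrix_algebra:
  assumes "ring A" "finite I" "F \<in> I \<rightarrow> carrier (matrix_algebra n A)"
  shows "(\<Oplus>\<^bsub>matrix_algebra n A\<^esub>k\<in>I. F k) i j = (\<Oplus>\<^bsub>A\<^esub>k\<in>I. F k i j)"
proof -
  interpret A: ring A by fact
  interpret M: ring "matrix_algebra n A" by (rule ring_matrix_algebra) fact
  show ?thesis
    by (rule additive_finsum[where f = "\<lambda>X. X i j", OF M.is_abelian_group A.is_abelian_group _ _ assms(2,3)])
       (auto simp: matrix_algebra_simps)
qed

section \<open>Morita equivalence of matrix algebras\<close>

lemma linear_functorI:
  assumes "\<And>M. left_module A M \<Longrightarrow> left_module B (Fo M)"
    and "\<And>M. left_module A M \<Longrightarrow> Fm M M (\<lambda>x\<in>carrier M. x) = (\<lambda>y\<in>carrier (Fo M). y)"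
    and "\<And>M N f. \<lbrakk>left_module A M; left_module A N; f \<in> module_hom A M N\<rbrakk> \<Longrightarrow> Fm M N f \<in> module_hom B (Fo M) (Fo N)"
    and "\<And>M N f g. \<lbrakk>left_module A M; left_module A N; f \<in> module_hom A M N; g \<in> module_hom A M N\<rbrakk> \<Longrightarrow>
      Fm M N (\<lambda>x\<in>carrier M. f x \<oplus>\<^bsub>N\<^esub> g x) = (\<lambda>y\<in>carrier (Fo M). Fm M N f y \<oplus>\<^bsub>Fo N\<^esub> Fm M N g y)"
    and "\<And>M N f r. \<lbrakk>left_module A M; left_module A N; f \<in> module_hom A M N; r \<in> carrier R\<rbrakk> \<Longrightarrow>
      Fm M N (\<lambda>x\<in>carrier M. (r \<odot>\<^bsub>A\<^esub> \<one>\<^bsub>A\<^esub>) \<odot>\<^bsub>N\<^esub> f x) =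
        (\<lambda>y\<in>carrier (Fo M). (r \<odot>\<^bsub>B\<^esub> \<one>\<^bsub>B\<^esub>) \<odot>\<^bsub>Fo N\<^esub> Fm M N f y)"
    and "\<And>L M N f g. \<lbrakk>left_module A L; left_module A M; left_module A N; f \<in> module_hom A L M; g \<in> module_hom A M N\<rbrakk> \<Longrightarrow>
      Fm L N (compose (carrier L) g f) = compose (carrier (Fo L)) (Fm M N g) (Fm L M f)"
  shows "linear_functor R A B Fo Fm"
  using assms unfolding linear_functor_def by blast

lemma left_module_finsum_smult:
  assumes "left_module A M" "finite I" "g \<in> I \<rightarrow> carrier M" "a \<in> carrier A"
  shows "a \<odot>\<^bsub>M\<^esub> (\<Oplus>\<^bsub>M\<^esub>i\<in>I. g i) = (\<Oplus>\<^bsub>M\<^esub>i\<in>I. a \<odot>\<^bsub>M\<^esub> g i)"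
proof -
  interpret left_module A M by fact
  show ?thesis
    by (rule additive_finsum[where f = "\<lambda>x. a \<odot>\<^bsub>M\<^esub> x", OF M.abelian_group_axioms M.abelian_group_axioms _ _ assms(2,3)])
       (auto simp: smult_closed smult_r_distr assms)
qed

lemma left_module_smult_finsum:
  assumes "left_module A M" "finite I" "g \<in> I \<rightarrow> carrier A" "x \<in> carrier M"
  shows "(\<Oplus>\<^bsub>A\<^esub>i\<in>I. g i) \<odot>\<^bsub>M\<^esub> x = (\<Oplus>\<^bsub>M\<^esub>i\<in>I. g i \<odot>\<^bsub>M\<^esub> x)"
proof -
  interpret left_module A M by fact
  show ?thesis
    by (rule additive_finsum[where f = "\<lambda>a. a \<odot>\<^bsub>M\<^esub> x", OF A.is_abelian_group M.abelian_group_axioms _ _ assms(2,3)])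
       (auto simp: smult_closed smult_l_distr assms)
qed

lemma left_module_smult_zero:
  assumes "left_module A M"
  shows "x \<in> carrier M \<Longrightarrow> \<zero>\<^bsub>A\<^esub> \<odot>\<^bsub>M\<^esub> x = \<zero>\<^bsub>M\<^esub>" and "a \<in> carrier A \<Longrightarrow> a \<odot>\<^bsub>M\<^esub> \<zero>\<^bsub>M\<^esub> = \<zero>\<^bsub>M\<^esub>"
  using left_module_smult_finsum[OF assms, of "{}" "\<lambda>_. \<zero>\<^bsub>A\<^esub>" x]
    left_module_finsum_smult[OF assms, of "{}" "\<lambda>_. \<zero>\<^bsub>M\<^esub>" a] assms
  by (auto simp: left_module_def abelian_monoid.finsum_empty abelian_group_def ring_def)

lemma module_hom_zero:
  assumes "left_module A M" "left_module A N" "f \<in> module_hom A M N"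
  shows "f \<zero>\<^bsub>M\<^esub> = \<zero>\<^bsub>N\<^esub>"
  by (rule additive_zero) (use assms in \<open>auto simp: module_homD left_module_def\<close>)

lemma module_hom_finsum:
  assumes "left_module A M" "left_module A N" "f \<in> module_hom A M N" "finite I" "g \<in> I \<rightarrow> carrier M"
  shows "f (\<Oplus>\<^bsub>M\<^esub>i\<in>I. g i) = (\<Oplus>\<^bsub>N\<^esub>i\<in>I. f (g i))"
  by (rule additive_finsum) (use assms in \<open>auto simp: module_homD left_module_def\<close>)

text \<open>
  The module of \<open>n\<close>-tuples over \<open>M\<close> has to live in the same universe as \<open>M\<close>: tuples are encoded
  by \<open>\<tau>\<close>, and \<open>\<pi> i\<close> reads off the \<open>i\<close>-th entry.
\<close>

locale matrix_morita = assoc_algebra R A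
  for R :: "('r, 'm) ring_scheme" and A :: "('r, 'a) module" +
  fixes n :: nat and \<tau> :: "(nat \<Rightarrow> 'u) \<Rightarrow> 'u" and \<pi> :: "nat \<Rightarrow> 'u \<Rightarrow> 'u"
  assumes n_pos: "0 < n"
    and \<pi>_\<tau> [simp]: "i < n \<Longrightarrow> \<pi> i (\<tau> f) = f i"
    and \<tau>_cong: "(\<And>i. i < n \<Longrightarrow> f i = g i) \<Longrightarrow> \<tau> f = \<tau> g"
begin

abbreviation "Mat \<equiv> matrix_algebra n A"

sublocale Mat: ring Mat by (rule ring_matrix_algebra) (rule A.ring_axioms)

text \<open>Column vectors over \<open>M\<close>, acted on by matrices from the left. Only codes of
  tuples belong to the carrier, which makes an element determined by its entries below
  \<open>n\<close>.\<close>

definition tuple_module :: "('a, 'u) module \<Rightarrow> (nat \<Rightarrow> nat \<Rightarrow> 'a, 'u) module" where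
  "tuple_module M =
     \<lparr>carrier = {\<tau> f | f. \<forall>i<n. f i \<in> carrier M}, monoid.mult = undefined, monoid.one = undefined,
      ring.zero = \<tau> (\<lambda>i. \<zero>\<^bsub>M\<^esub>), ring.add = (\<lambda>x y. \<tau> (\<lambda>i. \<pi> i x \<oplus>\<^bsub>M\<^esub> \<pi> i y)),
      smult = (\<lambda>X x. \<tau> (\<lambda>i. \<Oplus>\<^bsub>M\<^esub>k\<in>{..<n}. X i k \<odot>\<^bsub>M\<^esub> \<pi> k x))\<rparr>"

definition tuple_hom :: "('a, 'u) module \<Rightarrow> ('a, 'u) module \<Rightarrow> ('u \<Rightarrow> 'u) \<Rightarrow> 'u \<Rightarrow> 'u" where
  "tuple_hom M N f = (\<lambda>x\<in>carrier (tuple_module M). \<tau> (\<lambda>i. f (\<pi> i x)))"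

lemma tuple_module_simps:
  "x \<in> carrier (tuple_module M) \<longleftrightarrow> (\<forall>i<n. \<pi> i x \<in> carrier M) \<and> x = \<tau> (\<lambda>i. \<pi> i x)"
  "\<zero>\<^bsub>tuple_module M\<^esub> = \<tau> (\<lambda>i. \<zero>\<^bsub>M\<^esub>)"
  "x \<oplus>\<^bsub>tuple_module M\<^esub> y = \<tau> (\<lambda>i. \<pi> i x \<oplus>\<^bsub>M\<^esub> \<pi> i y)"
  "X \<odot>\<^bsub>tuple_module M\<^esub> x = \<tau> (\<lambda>i. \<Oplus>\<^bsub>M\<^esub>k\<in>{..<n}. X i k \<odot>\<^bsub>M\<^esub> \<pi> k x)"
proof -
  show "x \<in> carrier (tuple_module M) \<longleftrightarrow> (\<forall>i<n. \<pi> i x \<in> carrier M) \<and> x = \<tau> (\<lambda>i. \<pi> i x)"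
    by (auto simp: tuple_module_def intro: \<tau>_cong)
qed (simp_all add: tuple_module_def)

lemma \<tau>_closed: "(\<And>i. i < n \<Longrightarrow> f i \<in> carrier M) \<Longrightarrow> \<tau> f \<in> carrier (tuple_module M)"
  by (auto simp: tuple_module_def)

lemma \<tau>_eqI: "\<lbrakk>x \<in> carrier (tuple_module M); \<And>i. i < n \<Longrightarrow> f i = \<pi> i x\<rbrakk> \<Longrightarrow> \<tau> f = x"
  unfolding tuple_module_simps(1) by (metis \<tau>_cong)

lemma \<pi>_closed: "\<lbrakk>x \<in> carrier (tuple_module M); i < n\<rbrakk> \<Longrightarrow> \<pi> i x \<in> carrier M"
  by (simp add: tuple_module_simps)

lemma Mat_closed: "X \<in> carrier Mat \<Longrightarrow> X i j \<in> carrier A"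
  by (simp add: matrix_algebra_simps)

lemma left_module_tuple:
  assumes M: "left_module A M"
  shows "left_module Mat (tuple_module M)"
proof -
  interpret M: left_module A M by fact
  note [simp] = M.smult_closed \<pi>_closed Mat_closed
  have "abelian_group (tuple_module M)"
  proof (rule abelian_groupI)
    fix x assume x: "x \<in> carrier (tuple_module M)"
    show "\<exists>y\<in>carrier (tuple_module M). y \<oplus>\<^bsub>tuple_module M\<^esub> x = \<zero>\<^bsub>tuple_module M\<^esub>"
      by (intro bexI[of _ "\<tau> (\<lambda>i. \<ominus>\<^bsub>M\<^esub> \<pi> i x)"])
         (use x in \<open>auto simp: tuple_module_simps(2-) M.M.l_neg intro!: \<tau>_cong \<tau>_closed\<close>)
  qed (auto simp: tuple_module_simps(2-) M.M.a_ac intro!: \<tau>_cong \<tau>_closed \<tau>_eqI)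
  moreover have "left_module_axioms Mat (tuple_module M)"
  proof
    fix X x assume X: "X \<in> carrier Mat" and x: "x \<in> carrier (tuple_module M)"
    show "X \<odot>\<^bsub>tuple_module M\<^esub> x \<in> carrier (tuple_module M)"
      using X x by (auto simp: tuple_module_simps(4) intro!: \<tau>_closed M.M.finsum_closed)
    fix y assume y: "y \<in> carrier (tuple_module M)"
    show "X \<odot>\<^bsub>tuple_module M\<^esub> (x \<oplus>\<^bsub>tuple_module M\<^esub> y) = X \<odot>\<^bsub>tuple_module M\<^esub> x \<oplus>\<^bsub>tuple_module M\<^esub> X \<odot>\<^bsub>tuple_module M\<^esub> y"
      unfolding tuple_module_simps
    proof (rule \<tau>_cong)
      fix i assume i: "i < n"
      have "(\<Oplus>\<^bsub>M\<^esub>k\<in>{..<n}. X i k \<odot>\<^bsub>M\<^esub> \<pi> k (\<tau> (\<lambda>i. \<pi> i x \<oplus>\<^bsub>M\<^esub> \<pi> i y)))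
        = (\<Oplus>\<^bsub>M\<^esub>k\<in>{..<n}. X i k \<odot>\<^bsub>M\<^esub> \<pi> k x \<oplus>\<^bsub>M\<^esub> X i k \<odot>\<^bsub>M\<^esub> \<pi> k y)"
        by (rule M.M.finsum_cong') (use X x y in \<open>auto simp: M.smult_r_distr\<close>)
      then show "(\<Oplus>\<^bsub>M\<^esub>k\<in>{..<n}. X i k \<odot>\<^bsub>M\<^esub> \<pi> k (\<tau> (\<lambda>i. \<pi> i x \<oplus>\<^bsub>M\<^esub> \<pi> i y))) =
         \<pi> i (\<tau> (\<lambda>i. \<Oplus>\<^bsub>M\<^esub>k\<in>{..<n}. X i k \<odot>\<^bsub>M\<^esub> \<pi> k x)) \<oplus>\<^bsub>M\<^esub> \<pi> i (\<tau> (\<lambda>i. \<Oplus>\<^bsub>M\<^esub>k\<in>{..<n}. X i k \<odot>\<^bsub>M\<^esub> \<pi> k y))"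
        using i X x y by (simp add: M.M.finsum_addf Pi_def)
    qed
  next
    fix X Y x assume X: "X \<in> carrier Mat" and Y: "Y \<in> carrier Mat" and x: "x \<in> carrier (tuple_module M)"
    show "(X \<oplus>\<^bsub>Mat\<^esub> Y) \<odot>\<^bsub>tuple_module M\<^esub> x = X \<odot>\<^bsub>tuple_module M\<^esub> x \<oplus>\<^bsub>tuple_module M\<^esub> Y \<odot>\<^bsub>tuple_module M\<^esub> x"
      unfolding tuple_module_simps
    proof (rule \<tau>_cong)
      fix i assume i: "i < n"
      have "(\<Oplus>\<^bsub>M\<^esub>k\<in>{..<n}. (X \<oplus>\<^bsub>Mat\<^esub> Y) i k \<odot>\<^bsub>M\<^esub> \<pi> k x)
        = (\<Oplus>\<^bsub>M\<^esub>k\<in>{..<n}. X i k \<odot>\<^bsub>M\<^esub> \<pi> k x \<oplus>\<^bsub>M\<^esub> Y i k \<odot>\<^bsub>M\<^esub> \<pi> k x)"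
        by (rule M.M.finsum_cong') (use X Y x in \<open>auto simp: M.smult_l_distr matrix_algebra_simps(5)\<close>)
      then show "(\<Oplus>\<^bsub>M\<^esub>k\<in>{..<n}. (X \<oplus>\<^bsub>Mat\<^esub> Y) i k \<odot>\<^bsub>M\<^esub> \<pi> k x) =
         \<pi> i (\<tau> (\<lambda>i. \<Oplus>\<^bsub>M\<^esub>k\<in>{..<n}. X i k \<odot>\<^bsub>M\<^esub> \<pi> k x)) \<oplus>\<^bsub>M\<^esub> \<pi> i (\<tau> (\<lambda>i. \<Oplus>\<^bsub>M\<^esub>k\<in>{..<n}. Y i k \<odot>\<^bsub>M\<^esub> \<pi> k x))"
        using i X Y x by (simp add: M.M.finsum_addf Pi_def)
    qed
    show "(X \<otimes>\<^bsub>Mat\<^esub> Y) \<odot>\<^bsub>tuple_module M\<^esub> x = X \<odot>\<^bsub>tuple_module M\<^esub> (Y \<odot>\<^bsub>tuple_module M\<^esub> x)"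
      unfolding tuple_module_simps
    proof (rule \<tau>_cong)
      fix i assume i: "i < n"
      have "(\<Oplus>\<^bsub>M\<^esub>k\<in>{..<n}. (X \<otimes>\<^bsub>Mat\<^esub> Y) i k \<odot>\<^bsub>M\<^esub> \<pi> k x)
        = (\<Oplus>\<^bsub>M\<^esub>k\<in>{..<n}. \<Oplus>\<^bsub>M\<^esub>l\<in>{..<n}. X i l \<odot>\<^bsub>M\<^esub> (Y l k \<odot>\<^bsub>M\<^esub> \<pi> k x))"
        by (rule M.M.finsum_cong')
           (use X Y x in \<open>auto simp: matrix_algebra_simps(2) left_module_smult_finsum[OF M] M.smult_assoc Pi_def intro!: M.M.finsum_closed\<close>)
      also have "\<dots> = (\<Oplus>\<^bsub>M\<^esub>l\<in>{..<n}. \<Oplus>\<^bsub>M\<^esub>k\<in>{..<n}. X i l \<odot>\<^bsub>M\<^esub> (Y l k \<odot>\<^bsub>M\<^esub> \<pi> k x))"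
        by (rule M.M.finsum_swap) (use X Y x in auto)
      also have "\<dots> = (\<Oplus>\<^bsub>M\<^esub>l\<in>{..<n}. X i l \<odot>\<^bsub>M\<^esub> \<pi> l (\<tau> (\<lambda>i. \<Oplus>\<^bsub>M\<^esub>k\<in>{..<n}. Y i k \<odot>\<^bsub>M\<^esub> \<pi> k x)))"
        by (rule M.M.finsum_cong')
           (use X Y x in \<open>auto simp: left_module_finsum_smult[OF M] Pi_def intro!: M.M.finsum_closed\<close>)
      finally show "(\<Oplus>\<^bsub>M\<^esub>k\<in>{..<n}. (X \<otimes>\<^bsub>Mat\<^esub> Y) i k \<odot>\<^bsub>M\<^esub> \<pi> k x)
         = (\<Oplus>\<^bsub>M\<^esub>l\<in>{..<n}. X i l \<odot>\<^bsub>M\<^esub> \<pi> l (\<tau> (\<lambda>i. \<Oplus>\<^bsub>M\<^esub>k\<in>{..<n}. Y i k \<odot>\<^bsub>M\<^esub> \<pi> k x)))" .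
    qed
  next
    fix x assume x: "x \<in> carrier (tuple_module M)"
    show "\<one>\<^bsub>Mat\<^esub> \<odot>\<^bsub>tuple_module M\<^esub> x = x" unfolding tuple_module_simps
    proof (rule \<tau>_eqI[OF x])
      fix i assume i: "i < n"
      have "(\<Oplus>\<^bsub>M\<^esub>k\<in>{..<n}. \<one>\<^bsub>Mat\<^esub> i k \<odot>\<^bsub>M\<^esub> \<pi> k x) = (\<Oplus>\<^bsub>M\<^esub>k\<in>{..<n}. if k = i then \<pi> k x else \<zero>\<^bsub>M\<^esub>)"
        by (rule M.M.finsum_cong') (use x in \<open>auto simp: matrix_algebra_simps M.smult_one left_module_smult_zero[OF M]\<close>)
      then show "(\<Oplus>\<^bsub>M\<^esub>k\<in>{..<n}. \<one>\<^bsub>Mat\<^esub> i k \<odot>\<^bsub>M\<^esub> \<pi> k x) = \<pi> i x"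
        using M.M.finsum_delta[of "{..<n}" i "\<lambda>k. \<pi> k x"] i x by simp
    qed
  qed
  ultimately show ?thesis using Mat.ring_axioms by (simp add: left_module_def)
qed


lemma linear_functor_tuple: "linear_functor R A Mat tuple_module tuple_hom"
proof -
  have hom: "tuple_hom M N f \<in> module_hom Mat (tuple_module M) (tuple_module N)"
    if M: "left_module A M" and N: "left_module A N" and f: "f \<in> module_hom A M N" for M N f
  proof -
    interpret M: left_module A M by fact
    interpret tM: left_module Mat "tuple_module M" by (rule left_module_tuple) fact
    note [simp] = M.smult_closed \<pi>_closed Mat_closed module_homD[OF f]
    have "f (\<Oplus>\<^bsub>M\<^esub>k\<in>{..<n}. X i k \<odot>\<^bsub>M\<^esub> \<pi> k x) = (\<Oplus>\<^bsub>N\<^esub>k\<in>{..<n}. X i k \<odot>\<^bsub>N\<^esub> f (\<pi> k x))"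
      if "X \<in> carrier Mat" "x \<in> carrier (tuple_module M)" for X x i
    proof -
      have "f (\<Oplus>\<^bsub>M\<^esub>k\<in>{..<n}. X i k \<odot>\<^bsub>M\<^esub> \<pi> k x) = (\<Oplus>\<^bsub>N\<^esub>k\<in>{..<n}. f (X i k \<odot>\<^bsub>M\<^esub> \<pi> k x))"
        by (rule module_hom_finsum[OF M N f]) (use that in auto)
      moreover have "(\<Oplus>\<^bsub>N\<^esub>k\<in>{..<n}. f (X i k \<odot>\<^bsub>M\<^esub> \<pi> k x)) = (\<Oplus>\<^bsub>N\<^esub>k\<in>{..<n}. X i k \<odot>\<^bsub>N\<^esub> f (\<pi> k x))"
        by (rule abelian_monoid.finsum_cong') (use that N in \<open>auto simp: left_module_def abelian_group_def left_module.smult_closed\<close>)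
      ultimately show ?thesis by simp
    qed
    moreover have "(\<Oplus>\<^bsub>N\<^esub>k\<in>{..<n}. X i k \<odot>\<^bsub>N\<^esub> \<pi> k (\<tau> (\<lambda>i. f (\<pi> i x)))) = (\<Oplus>\<^bsub>N\<^esub>k\<in>{..<n}. X i k \<odot>\<^bsub>N\<^esub> f (\<pi> k x))"
      if "X \<in> carrier Mat" "x \<in> carrier (tuple_module M)" for X x i
      by (rule abelian_monoid.finsum_cong') (use that N in \<open>auto simp: left_module_def abelian_group_def left_module.smult_closed\<close>)
    ultimately show ?thesis unfolding tuple_hom_def
      by (intro module_hom_restrictI)
         (auto simp: tM.M.abelian_group_axioms tM.smult_closed tuple_module_simps(2-) intro!: \<tau>_closed \<tau>_cong)
  qed
  have scal: "tuple_hom M N (\<lambda>x\<in>carrier M. (r \<odot>\<^bsub>A\<^esub> \<one>\<^bsub>A\<^esub>) \<odot>\<^bsub>N\<^esub> f x)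
     = (\<lambda>y\<in>carrier (tuple_module M). (r \<odot>\<^bsub>Mat\<^esub> \<one>\<^bsub>Mat\<^esub>) \<odot>\<^bsub>tuple_module N\<^esub> tuple_hom M N f y)"
    if M: "left_module A M" and N: "left_module A N" and f: "f \<in> module_hom A M N" and r: "r \<in> carrier R" for M N f r
  proof -
    interpret N: left_module A N by fact
    have "(r \<odot>\<^bsub>A\<^esub> \<one>\<^bsub>A\<^esub>) \<odot>\<^bsub>N\<^esub> f (\<pi> i x) = (\<Oplus>\<^bsub>N\<^esub>k\<in>{..<n}. (r \<odot>\<^bsub>Mat\<^esub> \<one>\<^bsub>Mat\<^esub>) i k \<odot>\<^bsub>N\<^esub> \<pi> k (\<tau> (\<lambda>i. f (\<pi> i x))))"
      if x: "x \<in> carrier (tuple_module M)" and i: "i < n" for x i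
    proof -
      have "(\<Oplus>\<^bsub>N\<^esub>k\<in>{..<n}. (r \<odot>\<^bsub>Mat\<^esub> \<one>\<^bsub>Mat\<^esub>) i k \<odot>\<^bsub>N\<^esub> \<pi> k (\<tau> (\<lambda>i. f (\<pi> i x))))
        = (\<Oplus>\<^bsub>N\<^esub>k\<in>{..<n}. if k = i then (r \<odot>\<^bsub>A\<^esub> \<one>\<^bsub>A\<^esub>) \<odot>\<^bsub>N\<^esub> f (\<pi> k x) else \<zero>\<^bsub>N\<^esub>)"
        by (rule N.M.finsum_cong')
           (use x r i in \<open>auto simp: matrix_algebra_simps left_module_smult_zero[OF N] module_homD[OF f] \<pi>_closed N.smult_closed\<close>)
      then show ?thesis
        using N.M.finsum_delta[of "{..<n}" i "\<lambda>k. (r \<odot>\<^bsub>A\<^esub> \<one>\<^bsub>A\<^esub>) \<odot>\<^bsub>N\<^esub> f (\<pi> k x)"] x i r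
        by (simp add: module_homD[OF f] \<pi>_closed N.smult_closed)
    qed
    then show ?thesis unfolding tuple_hom_def
      by (intro restrict_ext) (auto simp: tuple_module_simps(4) \<pi>_closed intro!: \<tau>_cong)
  qed
  show ?thesis
  proof (rule linear_functorI)
    fix M :: "('a, 'u) module" assume "left_module A M"
    then show "tuple_hom M M (\<lambda>x\<in>carrier M. x) = (\<lambda>y\<in>carrier (tuple_module M). y)"
      by (auto simp: tuple_hom_def \<pi>_closed intro!: restrict_ext \<tau>_eqI)
  next
    fix M N :: "('a, 'u) module" and f g
    assume f: "f \<in> module_hom A M N" and g: "g \<in> module_hom A M N"
    show "tuple_hom M N (\<lambda>x\<in>carrier M. f x \<oplus>\<^bsub>N\<^esub> g x)
      = (\<lambda>y\<in>carrier (tuple_module M). tuple_hom M N f y \<oplus>\<^bsub>tuple_module N\<^esub> tuple_hom M N g y)"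
      by (auto simp: tuple_hom_def \<pi>_closed tuple_module_simps(3) intro!: restrict_ext \<tau>_cong)
  next
    fix L M N :: "('a, 'u) module" and f g
    assume f: "f \<in> module_hom A L M" and g: "g \<in> module_hom A M N"
    show "tuple_hom L N (compose (carrier L) g f)
      = compose (carrier (tuple_module L)) (tuple_hom M N g) (tuple_hom L M f)"
    proof
      fix x
      have "\<tau> (\<lambda>i. f (\<pi> i x)) \<in> carrier (tuple_module M)" if "x \<in> carrier (tuple_module L)"
        using that by (intro \<tau>_closed module_homD(2)[OF f] \<pi>_closed)
      then show "tuple_hom L N (compose (carrier L) g f) x
          = compose (carrier (tuple_module L)) (tuple_hom M N g) (tuple_hom L M f) x"
        by (auto simp: tuple_hom_def compose_def \<pi>_closed intro!: \<tau>_cong)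
    qed
  qed (auto simp: left_module_tuple hom scal)
qed

section \<open>Matrix units and the functor that cuts out the first corner\<close>

definition single :: "nat \<Rightarrow> nat \<Rightarrow> 'a \<Rightarrow> nat \<Rightarrow> nat \<Rightarrow> 'a" where
  "single i j a = (\<lambda>i' j'. if i' = i \<and> j' = j then a else \<zero>\<^bsub>A\<^esub>)"

lemma single_closed: "\<lbrakk>i < n; j < n; a \<in> carrier A\<rbrakk> \<Longrightarrow> single i j a \<in> carrier Mat"
  by (auto simp: single_def matrix_algebra_simps)

lemma mult_single:
  assumes "i < n" "j < n" "k < n" "l < n" "a \<in> carrier A" "b \<in> carrier A"
  shows "single i j a \<otimes>\<^bsub>Mat\<^esub> single k l b = (if j = k then single i l (a \<otimes>\<^bsub>A\<^esub> b) else \<zero>\<^bsub>Mat\<^esub>)"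
proof (intro ext)
  fix i' j'
  have "(single i j a \<otimes>\<^bsub>Mat\<^esub> single k l b) i' j'
    = (\<Oplus>\<^bsub>A\<^esub>h\<in>{..<n}. if h = j then (if i' = i \<and> j' = l \<and> j = k then a \<otimes>\<^bsub>A\<^esub> b else \<zero>\<^bsub>A\<^esub>) else \<zero>\<^bsub>A\<^esub>)"
    unfolding matrix_algebra_simps by (rule M.finsum_cong') (use assms in \<open>auto simp: single_def\<close>)
  then show "(single i j a \<otimes>\<^bsub>Mat\<^esub> single k l b) i' j' = (if j = k then single i l (a \<otimes>\<^bsub>A\<^esub> b) else \<zero>\<^bsub>Mat\<^esub>) i' j'"
    using M.finsum_delta[of "{..<n}" j "\<lambda>_. if i' = i \<and> j' = l \<and> j = k then a \<otimes>\<^bsub>A\<^esub> b else \<zero>\<^bsub>A\<^esub>"] assms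
    by (auto simp: single_def matrix_algebra_simps)
qed

lemma single_add:
  "\<lbrakk>a \<in> carrier A; b \<in> carrier A\<rbrakk> \<Longrightarrow> single i j (a \<oplus>\<^bsub>A\<^esub> b) = single i j a \<oplus>\<^bsub>Mat\<^esub> single i j b"
  by (auto simp: single_def matrix_algebra_simps fun_eq_iff)

text \<open>Multiplication by the matrix unit at \<open>(0, i)\<close> moves row \<open>i\<close> to
  the top row. This identity makes the map \<open>x \<mapsto> (e\<^sub>0\<^sub>i x)\<^sub>i\<close>,
  the unit for modules over \<open>Mat\<close>, linear over matrices.\<close>

lemma single_row_mult:
  assumes "i < n" "X \<in> carrier Mat"
  shows "single 0 i \<one>\<^bsub>A\<^esub> \<otimes>\<^bsub>Mat\<^esub> X = (\<Oplus>\<^bsub>Mat\<^esub>k\<in>{..<n}. single 0 k (X i k))"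
proof (intro ext)
  fix i' j'
  have "(single 0 i \<one>\<^bsub>A\<^esub> \<otimes>\<^bsub>Mat\<^esub> X) i' j' = (\<Oplus>\<^bsub>A\<^esub>h\<in>{..<n}. if h = i then (if i' = 0 then X i j' else \<zero>\<^bsub>A\<^esub>) else \<zero>\<^bsub>A\<^esub>)"
    unfolding matrix_algebra_simps by (rule M.finsum_cong') (use assms in \<open>auto simp: single_def matrix_algebra_simps\<close>)
  then have 1: "(single 0 i \<one>\<^bsub>A\<^esub> \<otimes>\<^bsub>Mat\<^esub> X) i' j' = (if i' = 0 then X i j' else \<zero>\<^bsub>A\<^esub>)"
    using M.finsum_delta[of "{..<n}" i "\<lambda>_. if i' = 0 then X i j' else \<zero>\<^bsub>A\<^esub>"] assms Mat_closed by auto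
  have "(\<Oplus>\<^bsub>Mat\<^esub>k\<in>{..<n}. single 0 k (X i k)) i' j' = (\<Oplus>\<^bsub>A\<^esub>k\<in>{..<n}. single 0 k (X i k) i' j')"
    by (rule finsum_matrix_algebra[OF A.ring_axioms]) (use assms n_pos in \<open>auto intro!: single_closed Mat_closed\<close>)
  also have "\<dots> = (if i' = 0 then X i j' else \<zero>\<^bsub>A\<^esub>)"
  proof (cases "j' < n")
    case True
    have "(\<Oplus>\<^bsub>A\<^esub>k\<in>{..<n}. single 0 k (X i k) i' j') = (\<Oplus>\<^bsub>A\<^esub>k\<in>{..<n}. if k = j' then (if i' = 0 then X i j' else \<zero>\<^bsub>A\<^esub>) else \<zero>\<^bsub>A\<^esub>)"
      by (rule M.finsum_cong') (use assms in \<open>auto simp: single_def matrix_algebra_simps\<close>)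
    then show ?thesis
      using M.finsum_delta[of "{..<n}" j' "\<lambda>_. if i' = 0 then X i j' else \<zero>\<^bsub>A\<^esub>"] True assms Mat_closed by auto
  next
    case False
    have "(\<Oplus>\<^bsub>A\<^esub>k\<in>{..<n}. single 0 k (X i k) i' j') = (\<Oplus>\<^bsub>A\<^esub>k\<in>{..<n}. \<zero>\<^bsub>A\<^esub>)"
      by (rule M.finsum_cong') (use False in \<open>auto simp: single_def\<close>)
    then show ?thesis using False assms by (simp add: matrix_algebra_simps)
  qed
  finally show "(single 0 i \<one>\<^bsub>A\<^esub> \<otimes>\<^bsub>Mat\<^esub> X) i' j' = (\<Oplus>\<^bsub>Mat\<^esub>k\<in>{..<n}. single 0 k (X i k)) i' j'" using 1 by simp
qed

lemma one_matrix_decomp: "\<one>\<^bsub>Mat\<^esub> = (\<Oplus>\<^bsub>Mat\<^esub>i\<in>{..<n}. single i i \<one>\<^bsub>A\<^esub>)"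
proof (intro ext)
  fix i' j'
  have "(\<Oplus>\<^bsub>Mat\<^esub>i\<in>{..<n}. single i i \<one>\<^bsub>A\<^esub>) i' j' = (\<Oplus>\<^bsub>A\<^esub>i\<in>{..<n}. single i i \<one>\<^bsub>A\<^esub> i' j')"
    by (rule finsum_matrix_algebra[OF A.ring_axioms]) (auto intro: single_closed)
  also have "\<dots> = \<one>\<^bsub>Mat\<^esub> i' j'"
  proof (cases "i' < n")
    case True
    have "(\<Oplus>\<^bsub>A\<^esub>i\<in>{..<n}. single i i \<one>\<^bsub>A\<^esub> i' j') = (\<Oplus>\<^bsub>A\<^esub>i\<in>{..<n}. if i = i' then (if i' = j' then \<one>\<^bsub>A\<^esub> else \<zero>\<^bsub>A\<^esub>) else \<zero>\<^bsub>A\<^esub>)"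
      by (rule M.finsum_cong') (auto simp: single_def)
    then show ?thesis
      using M.finsum_delta[of "{..<n}" i' "\<lambda>_. if i' = j' then \<one>\<^bsub>A\<^esub> else \<zero>\<^bsub>A\<^esub>"] True by (auto simp: matrix_algebra_simps)
  next
    case False
    have "(\<Oplus>\<^bsub>A\<^esub>i\<in>{..<n}. single i i \<one>\<^bsub>A\<^esub> i' j') = (\<Oplus>\<^bsub>A\<^esub>i\<in>{..<n}. \<zero>\<^bsub>A\<^esub>)"
      by (rule M.finsum_cong') (use False in \<open>auto simp: single_def\<close>)
    then show ?thesis using False by (simp add: matrix_algebra_simps)
  qed
  finally show "\<one>\<^bsub>Mat\<^esub> i' j' = (\<Oplus>\<^bsub>Mat\<^esub>i\<in>{..<n}. single i i \<one>\<^bsub>A\<^esub>) i' j'" by simp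
qed

text \<open>The submodule \<open>e N\<close> for the idempotent \<open>e\<close> at position
  \<open>(0, 0)\<close>, which exists by \<open>n_pos\<close>. An element \<open>a\<close> acts as
  the matrix with the single entry \<open>a\<close> at that position.\<close>

definition corner_module :: "(nat \<Rightarrow> nat \<Rightarrow> 'a, 'u) module \<Rightarrow> ('a, 'u) module" where
  "corner_module N =
     \<lparr>carrier = {x \<in> carrier N. single 0 0 \<one>\<^bsub>A\<^esub> \<odot>\<^bsub>N\<^esub> x = x}, monoid.mult = undefined, monoid.one = undefined,
      ring.zero = \<zero>\<^bsub>N\<^esub>, ring.add = ring.add N, smult = (\<lambda>a x. single 0 0 a \<odot>\<^bsub>N\<^esub> x)\<rparr>"

lemma corner_module_simps:
  "x \<in> carrier (corner_module N) \<longleftrightarrow> x \<in> carrier N \<and> single 0 0 \<one>\<^bsub>A\<^esub> \<odot>\<^bsub>N\<^esub> x = x"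
  "\<zero>\<^bsub>corner_module N\<^esub> = \<zero>\<^bsub>N\<^esub>" "x \<oplus>\<^bsub>corner_module N\<^esub> y = x \<oplus>\<^bsub>N\<^esub> y"
  "a \<odot>\<^bsub>corner_module N\<^esub> x = single 0 0 a \<odot>\<^bsub>N\<^esub> x"
  by (simp_all add: corner_module_def)

lemma left_module_corner:
  assumes N: "left_module Mat N"
  shows "left_module A (corner_module N)"
proof -
  interpret N: left_module Mat N by fact
  note [simp] = single_closed n_pos N.smult_closed
  have "abelian_group (corner_module N)"
  proof (rule abelian_groupI)
    fix x assume x: "x \<in> carrier (corner_module N)"
    have "single 0 0 \<one>\<^bsub>A\<^esub> \<odot>\<^bsub>N\<^esub> (\<ominus>\<^bsub>N\<^esub> x) = \<ominus>\<^bsub>N\<^esub> (single 0 0 \<one>\<^bsub>A\<^esub> \<odot>\<^bsub>N\<^esub> x)"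
      by (rule additive_minus[OF N.M.abelian_group_axioms N.M.abelian_group_axioms])
         (use x in \<open>auto simp: corner_module_simps N.smult_r_distr\<close>)
    then show "\<exists>y\<in>carrier (corner_module N). y \<oplus>\<^bsub>corner_module N\<^esub> x = \<zero>\<^bsub>corner_module N\<^esub>"
      using x by (intro bexI[of _ "\<ominus>\<^bsub>N\<^esub> x"]) (auto simp: corner_module_simps N.M.l_neg)
  qed (auto simp: corner_module_simps N.M.a_ac N.smult_r_distr left_module_smult_zero[OF N])
  moreover have "left_module_axioms A (corner_module N)"
    by standard (auto simp: corner_module_simps N.smult_r_distr N.smult_l_distr single_add mult_single
        simp flip: N.smult_assoc)
  ultimately show ?thesis using A.ring_axioms by (simp add: left_module_def)
qed

lemma smult_unit_mult_single:
  assumes "r \<in> carrier R"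
  shows "(r \<odot>\<^bsub>Mat\<^esub> \<one>\<^bsub>Mat\<^esub>) \<otimes>\<^bsub>Mat\<^esub> single 0 0 \<one>\<^bsub>A\<^esub> = single 0 0 (r \<odot>\<^bsub>A\<^esub> \<one>\<^bsub>A\<^esub>)"
proof (intro ext)
  fix i j
  have "((r \<odot>\<^bsub>Mat\<^esub> \<one>\<^bsub>Mat\<^esub>) \<otimes>\<^bsub>Mat\<^esub> single 0 0 \<one>\<^bsub>A\<^esub>) i j
      = (\<Oplus>\<^bsub>A\<^esub>k\<in>{..<n}. if k = 0 then single 0 0 (r \<odot>\<^bsub>A\<^esub> \<one>\<^bsub>A\<^esub>) i j else \<zero>\<^bsub>A\<^esub>)"
    unfolding matrix_algebra_simps
    by (rule M.finsum_cong') (use assms in \<open>auto simp: single_def smult_mult_left\<close>)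
  then show "((r \<odot>\<^bsub>Mat\<^esub> \<one>\<^bsub>Mat\<^esub>) \<otimes>\<^bsub>Mat\<^esub> single 0 0 \<one>\<^bsub>A\<^esub>) i j = single 0 0 (r \<odot>\<^bsub>A\<^esub> \<one>\<^bsub>A\<^esub>) i j"
    using M.finsum_delta[of "{..<n}" 0 "\<lambda>_. single 0 0 (r \<odot>\<^bsub>A\<^esub> \<one>\<^bsub>A\<^esub>) i j"] n_pos assms by (simp add: single_def)
qed

lemma linear_functor_corner:
  "linear_functor R Mat A corner_module (\<lambda>M N f. restrict f (carrier (corner_module M)))"
proof -
  have hom: "restrict f (carrier (corner_module M)) \<in> module_hom A (corner_module M) (corner_module N)"
    if M: "left_module Mat M" and f: "f \<in> module_hom Mat M N" for M N f
  proof -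
    interpret cM: left_module A "corner_module M" by (rule left_module_corner) fact
    have "single 0 0 \<one>\<^bsub>A\<^esub> \<odot>\<^bsub>N\<^esub> f x = f x" if "x \<in> carrier (corner_module M)" for x
      using that n_pos by (simp add: corner_module_simps single_closed flip: module_homD(4)[OF f])
    then show ?thesis
      using n_pos by (intro module_hom_restrictI)
        (auto simp: cM.M.abelian_group_axioms cM.smult_closed,
         auto simp: corner_module_simps module_homD[OF f] single_closed)
  qed
  have scal: "single 0 0 (r \<odot>\<^bsub>A\<^esub> \<one>\<^bsub>A\<^esub>) \<odot>\<^bsub>N\<^esub> f x = (r \<odot>\<^bsub>Mat\<^esub> \<one>\<^bsub>Mat\<^esub>) \<odot>\<^bsub>N\<^esub> f x"
    if M: "left_module Mat M" and N: "left_module Mat N" and f: "f \<in> module_hom Mat M N" and r: "r \<in> carrier R"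
      and x: "x \<in> carrier M" "single 0 0 \<one>\<^bsub>A\<^esub> \<odot>\<^bsub>M\<^esub> x = x" for M N f r x
  proof -
    interpret N: left_module Mat N by fact
    have 1: "r \<odot>\<^bsub>Mat\<^esub> \<one>\<^bsub>Mat\<^esub> \<in> carrier Mat" using r by (auto simp: matrix_algebra_simps)
    have "single 0 0 \<one>\<^bsub>A\<^esub> \<odot>\<^bsub>N\<^esub> f x = f x"
      using x n_pos by (simp add: single_closed flip: module_homD(4)[OF f])
    then show ?thesis
      using N.smult_assoc[OF 1, of "single 0 0 \<one>\<^bsub>A\<^esub>" "f x"] x n_pos r module_homD(2)[OF f]
      by (simp add: single_closed smult_unit_mult_single)
  qed
  show ?thesis
  proof (rule linear_functorI)
    fix M N :: "(nat \<Rightarrow> nat \<Rightarrow> 'a, 'u) module" and f r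
    assume "left_module Mat M" "left_module Mat N" and f: "f \<in> module_hom Mat M N" and "r \<in> carrier R"
    then show "(\<lambda>x\<in>carrier (corner_module M). (\<lambda>x\<in>carrier M. (r \<odot>\<^bsub>Mat\<^esub> \<one>\<^bsub>Mat\<^esub>) \<odot>\<^bsub>N\<^esub> f x) x)
      = (\<lambda>y\<in>carrier (corner_module M). (r \<odot>\<^bsub>A\<^esub> \<one>\<^bsub>A\<^esub>) \<odot>\<^bsub>corner_module N\<^esub> restrict f (carrier (corner_module M)) y)"
      by (intro restrict_ext) (auto simp: corner_module_simps scal)
  next
    fix L M N :: "(nat \<Rightarrow> nat \<Rightarrow> 'a, 'u) module" and f g
    assume L: "left_module Mat L" and f: "f \<in> module_hom Mat L M" and g: "g \<in> module_hom Mat M N"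
    show "restrict (compose (carrier L) g f) (carrier (corner_module L))
      = compose (carrier (corner_module L)) (restrict g (carrier (corner_module M))) (restrict f (carrier (corner_module L)))"
      unfolding compose_def
    proof (rule restrict_ext)
      fix x assume x: "x \<in> carrier (corner_module L)"
      then have "x \<in> carrier L" by (simp add: corner_module_simps)
      moreover have "f x \<in> carrier (corner_module M)" using module_homD(2)[OF hom[OF L f] x] x by simp
      ultimately show "(\<lambda>x\<in>carrier L. g (f x)) x
        = restrict g (carrier (corner_module M)) (restrict f (carrier (corner_module L)) x)" using x by simp
    qed
  qed (auto simp: left_module_corner hom corner_module_simps)
qed

text \<open>The first corner of the module of tuples consists of the tuples supported in entry
  \<open>0\<close>, by \<open>car\<close>; so \<open>m \<mapsto> (m, 0, ..., 0)\<close> identifies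
  it with \<open>M\<close>.\<close>

lemma natural_iso_corner_tuple:
  "natural_iso_id A (corner_module \<circ> tuple_module)
     (\<lambda>M N f. restrict (tuple_hom M N f) (carrier (corner_module (tuple_module M))))
     (\<lambda>M. \<lambda>m\<in>carrier M. \<tau> (\<lambda>i. if i = 0 then m else \<zero>\<^bsub>M\<^esub>))"
proof -
  have smult0: "single 0 0 a \<odot>\<^bsub>tuple_module M\<^esub> y = \<tau> (\<lambda>i. if i = 0 then a \<odot>\<^bsub>M\<^esub> \<pi> 0 y else \<zero>\<^bsub>M\<^esub>)"
    if M: "left_module A M" and a: "a \<in> carrier A" and y: "\<And>i. i < n \<Longrightarrow> \<pi> i y \<in> carrier M" for M a y
    unfolding tuple_module_simps
  proof (rule \<tau>_cong)
    fix i assume i: "i < n"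
    interpret M: left_module A M by fact
    have "(\<Oplus>\<^bsub>M\<^esub>k\<in>{..<n}. single 0 0 a i k \<odot>\<^bsub>M\<^esub> \<pi> k y)
      = (\<Oplus>\<^bsub>M\<^esub>k\<in>{..<n}. if k = 0 then (if i = 0 then a \<odot>\<^bsub>M\<^esub> \<pi> 0 y else \<zero>\<^bsub>M\<^esub>) else \<zero>\<^bsub>M\<^esub>)"
      by (rule M.M.finsum_cong') (use a y n_pos in \<open>auto simp: single_def left_module_smult_zero[OF M] M.smult_closed\<close>)
    then show "(\<Oplus>\<^bsub>M\<^esub>k\<in>{..<n}. single 0 0 a i k \<odot>\<^bsub>M\<^esub> \<pi> k y) = (if i = 0 then a \<odot>\<^bsub>M\<^esub> \<pi> 0 y else \<zero>\<^bsub>M\<^esub>)"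
      using M.M.finsum_delta[of "{..<n}" 0 "\<lambda>_. if i = 0 then a \<odot>\<^bsub>M\<^esub> \<pi> 0 y else \<zero>\<^bsub>M\<^esub>"] n_pos a y
      by (simp add: M.smult_closed)
  qed
  have car: "y \<in> carrier (corner_module (tuple_module M)) \<longleftrightarrow>
      y \<in> carrier (tuple_module M) \<and> (\<forall>i<n. 0 < i \<longrightarrow> \<pi> i y = \<zero>\<^bsub>M\<^esub>)" if M: "left_module A M" for M y
  proof (cases "y \<in> carrier (tuple_module M)")
    case True
    interpret M: left_module A M by fact
    have "single 0 0 \<one>\<^bsub>A\<^esub> \<odot>\<^bsub>tuple_module M\<^esub> y = \<tau> (\<lambda>i. if i = 0 then \<pi> 0 y else \<zero>\<^bsub>M\<^esub>)"
      using smult0[OF M, of "\<one>\<^bsub>A\<^esub>" y] True n_pos M.smult_one[of "\<pi> 0 y"] by (simp add: tuple_module_simps(1) cong: if_cong)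
    moreover have "\<tau> (\<lambda>i. if i = 0 then \<pi> 0 y else \<zero>\<^bsub>M\<^esub>) = y \<longleftrightarrow> (\<forall>i<n. 0 < i \<longrightarrow> \<pi> i y = \<zero>\<^bsub>M\<^esub>)"
    proof
      assume eq: "\<tau> (\<lambda>i. if i = 0 then \<pi> 0 y else \<zero>\<^bsub>M\<^esub>) = y"
      have "\<pi> i y = (if i = 0 then \<pi> 0 y else \<zero>\<^bsub>M\<^esub>)" if "i < n" for i
        using \<pi>_\<tau>[OF that, of "\<lambda>i. if i = 0 then \<pi> 0 y else \<zero>\<^bsub>M\<^esub>"] eq by simp
      then show "\<forall>i<n. 0 < i \<longrightarrow> \<pi> i y = \<zero>\<^bsub>M\<^esub>" by auto
    next
      assume "\<forall>i<n. 0 < i \<longrightarrow> \<pi> i y = \<zero>\<^bsub>M\<^esub>"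
      then show "\<tau> (\<lambda>i. if i = 0 then \<pi> 0 y else \<zero>\<^bsub>M\<^esub>) = y" by (intro \<tau>_eqI[OF True]) auto
    qed
    ultimately show ?thesis using True by (simp add: corner_module_simps)
  qed (simp add: corner_module_simps)
  show ?thesis
  proof (rule natural_iso_idI)
    fix M :: "('a, 'u) module" assume M: "left_module A M"
    interpret M: left_module A M by fact
    show "(\<lambda>m\<in>carrier M. \<tau> (\<lambda>i. if i = 0 then m else \<zero>\<^bsub>M\<^esub>)) \<in> module_hom A M ((corner_module \<circ> tuple_module) M)"
      using n_pos
      by (intro module_hom_restrictI)
         (auto simp: M.M.abelian_group_axioms M.smult_closed car[OF M] corner_module_simps(3-) tuple_module_simps(3) smult0[OF M]
           intro!: \<tau>_cong \<tau>_closed)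
    show "bij_betw (\<lambda>m\<in>carrier M. \<tau> (\<lambda>i. if i = 0 then m else \<zero>\<^bsub>M\<^esub>)) (carrier M) (carrier ((corner_module \<circ> tuple_module) M))"
      by (rule bij_betwI[where g = "\<pi> 0"])
         (use n_pos in \<open>auto simp: car[OF M] \<pi>_closed intro!: \<tau>_closed \<tau>_eqI\<close>)
  next
    fix M N :: "('a, 'u) module" and f x
    assume M: "left_module A M" and N: "left_module A N" and f: "f \<in> module_hom A M N" and x: "x \<in> carrier M"
    interpret M: left_module A M by fact
    have "\<tau> (\<lambda>i. if i = 0 then x else \<zero>\<^bsub>M\<^esub>) \<in> carrier (corner_module (tuple_module M))"
      using x by (auto simp: car[OF M] intro: \<tau>_closed)
    then show "(\<lambda>m\<in>carrier N. \<tau> (\<lambda>i. if i = 0 then m else \<zero>\<^bsub>N\<^esub>)) (f x)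
      = restrict (tuple_hom M N f) (carrier (corner_module (tuple_module M))) ((\<lambda>m\<in>carrier M. \<tau> (\<lambda>i. if i = 0 then m else \<zero>\<^bsub>M\<^esub>)) x)"
      using x by (auto simp: tuple_hom_def corner_module_simps(1) module_homD[OF f] module_hom_zero[OF M N f] intro!: \<tau>_cong)
  qed
qed

lemma finsum_corner:
  assumes "left_module Mat N" "g \<in> {..<n} \<rightarrow> carrier (corner_module N)"
  shows "(\<Oplus>\<^bsub>corner_module N\<^esub>k\<in>{..<n}. g k) = (\<Oplus>\<^bsub>N\<^esub>k\<in>{..<n}. g k)"
  by (rule additive_finsum[where f = "\<lambda>x. x"])
     (use assms left_module_corner[OF assms(1)] in \<open>auto simp: left_module_def corner_module_simps\<close>)

text \<open>The unit sends \<open>x\<close> to the tuple of all \<open>e\<^sub>0\<^sub>i x\<close>,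
  and its inverse \<open>g\<close> sends \<open>y\<close> to the sum of all
  \<open>e\<^sub>i\<^sub>0 y\<^sub>i\<close>. One composite is the identity because the products
  \<open>e\<^sub>i\<^sub>0 e\<^sub>0\<^sub>i\<close> add up to \<open>1\<close>, the other because
  \<open>e\<^sub>0\<^sub>k e\<^sub>i\<^sub>0\<close> is the corner idempotent for
  \<open>i = k\<close> and zero otherwise.\<close>

lemma natural_iso_tuple_corner:
  "natural_iso_id Mat (tuple_module \<circ> corner_module)
     (\<lambda>M N f. tuple_hom (corner_module M) (corner_module N) (restrict f (carrier (corner_module M))))
     (\<lambda>N. \<lambda>x\<in>carrier N. \<tau> (\<lambda>i. single 0 i \<one>\<^bsub>A\<^esub> \<odot>\<^bsub>N\<^esub> x))"
proof -
  have car: "single 0 i \<one>\<^bsub>A\<^esub> \<odot>\<^bsub>N\<^esub> x \<in> carrier (corner_module N)"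
    if "left_module Mat N" "i < n" "x \<in> carrier N" for N x i
  proof -
    interpret N: left_module Mat N by fact
    show ?thesis using that n_pos
      by (simp add: corner_module_simps N.smult_closed single_closed mult_single flip: N.smult_assoc)
  qed
  show ?thesis
  proof (rule natural_iso_idI)
    fix N :: "(nat \<Rightarrow> nat \<Rightarrow> 'a, 'u) module" assume N: "left_module Mat N"
    interpret N: left_module Mat N by fact
    interpret cN: left_module A "corner_module N" by (rule left_module_corner) fact
    note [simp] = single_closed n_pos N.smult_closed car[OF N] Mat_closed
    have sm: "single 0 i \<one>\<^bsub>A\<^esub> \<odot>\<^bsub>N\<^esub> (X \<odot>\<^bsub>N\<^esub> x) = (\<Oplus>\<^bsub>corner_module N\<^esub>k\<in>{..<n}. X i k \<odot>\<^bsub>corner_module N\<^esub> \<pi> k (\<tau> (\<lambda>i. single 0 i \<one>\<^bsub>A\<^esub> \<odot>\<^bsub>N\<^esub> x)))"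
      if i: "i < n" and X: "X \<in> carrier Mat" and x: "x \<in> carrier N" for X x i
    proof -
      have "single 0 i \<one>\<^bsub>A\<^esub> \<odot>\<^bsub>N\<^esub> (X \<odot>\<^bsub>N\<^esub> x) = (\<Oplus>\<^bsub>Mat\<^esub>k\<in>{..<n}. single 0 k (X i k)) \<odot>\<^bsub>N\<^esub> x"
        using i X x by (simp add: single_row_mult flip: N.smult_assoc)
      also have "\<dots> = (\<Oplus>\<^bsub>N\<^esub>k\<in>{..<n}. single 0 k (X i k) \<odot>\<^bsub>N\<^esub> x)"
        by (rule left_module_smult_finsum[OF N]) (use X x in auto)
      also have "\<dots> = (\<Oplus>\<^bsub>N\<^esub>k\<in>{..<n}. X i k \<odot>\<^bsub>corner_module N\<^esub> \<pi> k (\<tau> (\<lambda>i. single 0 i \<one>\<^bsub>A\<^esub> \<odot>\<^bsub>N\<^esub> x)))"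
        by (rule N.M.finsum_cong') (use X x in \<open>auto simp: corner_module_simps(4) mult_single simp flip: N.smult_assoc\<close>)
      also have "\<dots> = (\<Oplus>\<^bsub>corner_module N\<^esub>k\<in>{..<n}. X i k \<odot>\<^bsub>corner_module N\<^esub> \<pi> k (\<tau> (\<lambda>i. single 0 i \<one>\<^bsub>A\<^esub> \<odot>\<^bsub>N\<^esub> x)))"
        by (rule finsum_corner[symmetric, OF N]) (use X x in \<open>auto intro!: cN.smult_closed\<close>)
      finally show ?thesis .
    qed
    show "(\<lambda>x\<in>carrier N. \<tau> (\<lambda>i. single 0 i \<one>\<^bsub>A\<^esub> \<odot>\<^bsub>N\<^esub> x)) \<in> module_hom Mat N ((tuple_module \<circ> corner_module) N)"
      by (rule module_hom_restrictI)
         (auto simp: N.M.abelian_group_axioms tuple_module_simps(3,4) sm N.smult_r_distr corner_module_simps(3) intro!: \<tau>_closed \<tau>_cong)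
    have sec: "(\<Oplus>\<^bsub>N\<^esub>i\<in>{..<n}. single i 0 \<one>\<^bsub>A\<^esub> \<odot>\<^bsub>N\<^esub> (single 0 i \<one>\<^bsub>A\<^esub> \<odot>\<^bsub>N\<^esub> x)) = x" if x: "x \<in> carrier N" for x
    proof -
      have "(\<Oplus>\<^bsub>N\<^esub>i\<in>{..<n}. single i 0 \<one>\<^bsub>A\<^esub> \<odot>\<^bsub>N\<^esub> (single 0 i \<one>\<^bsub>A\<^esub> \<odot>\<^bsub>N\<^esub> x)) = (\<Oplus>\<^bsub>N\<^esub>i\<in>{..<n}. single i i \<one>\<^bsub>A\<^esub> \<odot>\<^bsub>N\<^esub> x)"
        by (rule N.M.finsum_cong') (use x in \<open>auto simp: mult_single simp flip: N.smult_assoc\<close>)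
      also have "\<dots> = (\<Oplus>\<^bsub>Mat\<^esub>i\<in>{..<n}. single i i \<one>\<^bsub>A\<^esub>) \<odot>\<^bsub>N\<^esub> x"
        by (rule left_module_smult_finsum[OF N, symmetric]) (use x in auto)
      finally show ?thesis using x by (simp add: N.smult_one flip: one_matrix_decomp)
    qed
    define g where "g y = (\<Oplus>\<^bsub>N\<^esub>i\<in>{..<n}. single i 0 \<one>\<^bsub>A\<^esub> \<odot>\<^bsub>N\<^esub> \<pi> i y)" for y
    have g: "g y \<in> carrier N" "\<tau> (\<lambda>i. single 0 i \<one>\<^bsub>A\<^esub> \<odot>\<^bsub>N\<^esub> g y) = y"
      if y: "y \<in> carrier (tuple_module (corner_module N))" for y
    proof -
      have yi [simp]: "\<pi> i y \<in> carrier N" "single 0 0 \<one>\<^bsub>A\<^esub> \<odot>\<^bsub>N\<^esub> \<pi> i y = \<pi> i y" if "i < n" for i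
        using \<pi>_closed[OF y that] by (auto simp: corner_module_simps)
      show gy: "g y \<in> carrier N" unfolding g_def by (intro N.M.finsum_closed) auto
      show "\<tau> (\<lambda>i. single 0 i \<one>\<^bsub>A\<^esub> \<odot>\<^bsub>N\<^esub> g y) = y"
      proof (rule \<tau>_eqI[OF y])
        fix k assume k: "k < n"
        have "single 0 k \<one>\<^bsub>A\<^esub> \<odot>\<^bsub>N\<^esub> g y = (\<Oplus>\<^bsub>N\<^esub>i\<in>{..<n}. single 0 k \<one>\<^bsub>A\<^esub> \<odot>\<^bsub>N\<^esub> (single i 0 \<one>\<^bsub>A\<^esub> \<odot>\<^bsub>N\<^esub> \<pi> i y))"
          unfolding g_def by (rule left_module_finsum_smult[OF N]) (use k in auto)
        also have "\<dots> = (\<Oplus>\<^bsub>N\<^esub>i\<in>{..<n}. if i = k then \<pi> i y else \<zero>\<^bsub>N\<^esub>)"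
          by (rule N.M.finsum_cong') (use k in \<open>auto simp: mult_single left_module_smult_zero[OF N] simp flip: N.smult_assoc\<close>)
        finally show "single 0 k \<one>\<^bsub>A\<^esub> \<odot>\<^bsub>N\<^esub> g y = \<pi> k y"
          using N.M.finsum_delta[of "{..<n}" k "\<lambda>i. \<pi> i y"] k by simp
      qed
    qed
    have gl: "g (\<tau> (\<lambda>i. single 0 i \<one>\<^bsub>A\<^esub> \<odot>\<^bsub>N\<^esub> x)) = x" if x: "x \<in> carrier N" for x
    proof -
      have "g (\<tau> (\<lambda>i. single 0 i \<one>\<^bsub>A\<^esub> \<odot>\<^bsub>N\<^esub> x)) = (\<Oplus>\<^bsub>N\<^esub>i\<in>{..<n}. single i 0 \<one>\<^bsub>A\<^esub> \<odot>\<^bsub>N\<^esub> (single 0 i \<one>\<^bsub>A\<^esub> \<odot>\<^bsub>N\<^esub> x))"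
        unfolding g_def by (rule N.M.finsum_cong') (use x in auto)
      then show ?thesis using sec[OF x] by simp
    qed
    show "bij_betw (\<lambda>x\<in>carrier N. \<tau> (\<lambda>i. single 0 i \<one>\<^bsub>A\<^esub> \<odot>\<^bsub>N\<^esub> x)) (carrier N) (carrier ((tuple_module \<circ> corner_module) N))"
      by (rule bij_betwI[where g = g]) (auto simp: g gl intro: \<tau>_closed)
  next
    fix M N :: "(nat \<Rightarrow> nat \<Rightarrow> 'a, 'u) module" and f x
    assume M: "left_module Mat M" and N: "left_module Mat N" and f: "f \<in> module_hom Mat M N" and x: "x \<in> carrier M"
    have "\<tau> (\<lambda>i. single 0 i \<one>\<^bsub>A\<^esub> \<odot>\<^bsub>M\<^esub> x) \<in> carrier (tuple_module (corner_module M))"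
      using x car[OF M] by (auto intro: \<tau>_closed)
    then show "(\<lambda>x\<in>carrier N. \<tau> (\<lambda>i. single 0 i \<one>\<^bsub>A\<^esub> \<odot>\<^bsub>N\<^esub> x)) (f x)
      = tuple_hom (corner_module M) (corner_module N) (restrict f (carrier (corner_module M)))
         ((\<lambda>x\<in>carrier M. \<tau> (\<lambda>i. single 0 i \<one>\<^bsub>A\<^esub> \<odot>\<^bsub>M\<^esub> x)) x)"
      using x n_pos by (auto simp: tuple_hom_def car[OF M] module_homD[OF f] single_closed intro!: \<tau>_cong)
  qed
qed

lemma morita_matrix: "morita_equivalent TYPE('u) R A Mat"
  by (rule morita_equivalentI[OF linear_functor_tuple linear_functor_corner])
     (rule natural_iso_corner_tuple, rule natural_iso_tuple_corner)

end

text \<open>An infinite type is in bijection with its square, so a tuple of length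
  \<open>n + 1\<close> is coded by pairing the code of its first \<open>n\<close> entries with the
  last one. For \<open>n = 0\<close> any constant code serves.\<close>

lemma tuple_coding:
  assumes "infinite (UNIV :: 'u set)"
  shows "\<exists>(\<tau> :: (nat \<Rightarrow> 'u) \<Rightarrow> 'u) \<pi>. (\<forall>i<n. \<forall>f. \<pi> i (\<tau> f) = f i) \<and> (\<forall>f g. (\<forall>i<n. f i = g i) \<longrightarrow> \<tau> f = \<tau> g)"
proof (induction n)
  case 0
  show ?case by (intro exI[of _ "\<lambda>f. undefined"]) auto
next
  case (Suc n)
  obtain p :: "'u \<times> 'u \<Rightarrow> 'u" where "bij_betw p (UNIV \<times> UNIV) UNIV"
    using card_of_Times_same_infinite[OF assms] by (auto simp flip: card_of_ordIso)
  then have p: "inj p" by (simp add: bij_betw_def)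
  obtain \<tau> :: "(nat \<Rightarrow> 'u) \<Rightarrow> 'u" and \<pi> where
    *: "\<And>i f. i < n \<Longrightarrow> \<pi> i (\<tau> f) = f i" "\<And>f g. (\<forall>i<n. f i = g i) \<Longrightarrow> \<tau> f = \<tau> g"
    using Suc.IH by blast
  show ?case
    by (intro exI[of _ "\<lambda>f. p (\<tau> f, f n)"] exI[of _ "\<lambda>i y. if i = n then snd (inv_into UNIV p y) else \<pi> i (fst (inv_into UNIV p y))"])
       (auto simp: p less_Suc_eq * intro: *(2)[THEN arg_cong2[of _ _ _ _ "\<lambda>x y. p (x, y)"]])
qed

lemma morita_equivalent_matrix_algebra:
  fixes A :: "('r, 'a) module"
  assumes "assoc_algebra R A" "0 < n" "infinite (UNIV :: 'u set)"
  shows "morita_equivalent TYPE('u) R A (matrix_algebra n A)"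
proof -
  obtain \<tau> :: "(nat \<Rightarrow> 'u) \<Rightarrow> 'u" and \<pi> where
    *: "\<And>i f. i < n \<Longrightarrow> \<pi> i (\<tau> f) = f i" "\<And>f g. (\<forall>i<n. f i = g i) \<Longrightarrow> \<tau> f = \<tau> g"
    using tuple_coding[OF assms(3), of n] by blast
  interpret matrix_morita R A n \<tau> \<pi>
    by (intro matrix_morita.intro matrix_morita_axioms.intro) (use assms * in auto)
  show ?thesis by (rule morita_matrix)
qed

section \<open>Tensor products\<close>

context
  fixes R :: "('r, 'k) ring_scheme" and M :: "('r, 'a) module" and N :: "('r, 'b) module"
begin

interpretation free: group "free_pairs M N" by simp

section \<open>The tensor product as an abelian group and its universal property\<close>

lemma tensor_relationsI:
  "\<lbrakk>x \<in> carrier M; x' \<in> carrier M; y \<in> carrier N\<rbrakk> \<Longrightarrow>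
    frag_of (x \<oplus>\<^bsub>M\<^esub> x', y) - frag_of (x, y) - frag_of (x', y) \<in> tensor_relations R M N"
  "\<lbrakk>x \<in> carrier M; y \<in> carrier N; y' \<in> carrier N\<rbrakk> \<Longrightarrow>
    frag_of (x, y \<oplus>\<^bsub>N\<^esub> y') - frag_of (x, y) - frag_of (x, y') \<in> tensor_relations R M N"
  "\<lbrakk>r \<in> carrier R; x \<in> carrier M; y \<in> carrier N\<rbrakk> \<Longrightarrow>
    frag_of (r \<odot>\<^bsub>M\<^esub> x, y) - frag_of (x, r \<odot>\<^bsub>N\<^esub> y) \<in> tensor_relations R M N"
  unfolding tensor_relations_def by blast+

lemma tensor_relationsE:
  assumes "n \<in> tensor_relations R M N"
  obtains (left) x x' y where "x \<in> carrier M" "x' \<in> carrier M" "y \<in> carrier N"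
      "n = frag_of (x \<oplus>\<^bsub>M\<^esub> x', y) - frag_of (x, y) - frag_of (x', y)"
    | (right) x y y' where "x \<in> carrier M" "y \<in> carrier N" "y' \<in> carrier N"
      "n = frag_of (x, y \<oplus>\<^bsub>N\<^esub> y') - frag_of (x, y) - frag_of (x, y')"
    | (balanced) r x y where "r \<in> carrier R" "x \<in> carrier M" "y \<in> carrier N"
      "n = frag_of (r \<odot>\<^bsub>M\<^esub> x, y) - frag_of (x, r \<odot>\<^bsub>N\<^esub> y)"
  using assms unfolding tensor_relations_def by blast

lemma tensor_relations_subset: "module R M \<Longrightarrow> module R N \<Longrightarrow> tensor_relations R M N \<subseteq> carrier (free_pairs M N)"
proof -
  assume "module R M" "module R N"
  then interpret M: module R M + N: module R N by auto
  show ?thesis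
    unfolding tensor_relations_def
    by (auto simp: free_Abelian_group_def dest!: subsetD[OF keys_diff] split: if_splits)
qed

lemma tensor_null_keys:
  assumes "module R M" "module R N" "p \<in> tensor_null R M N"
  shows "Poly_Mapping.keys p \<subseteq> carrier M \<times> carrier N"
  using subsetD[OF free.generate_incl[OF tensor_relations_subset[OF assms(1,2)]]] assms(3)
  unfolding tensor_null_def carrier_free_Abelian_group_iff[symmetric] .

lemma tensor_null_zero: "0 \<in> tensor_null R M N"
  unfolding tensor_null_def using generate.one[of "free_pairs M N"] by simp

lemma tensor_null_rel: "p \<in> tensor_relations R M N \<Longrightarrow> p \<in> tensor_null R M N"
  unfolding tensor_null_def by (rule generate.incl)

lemma tensor_null_add: "\<lbrakk>p \<in> tensor_null R M N; q \<in> tensor_null R M N\<rbrakk> \<Longrightarrow> p + q \<in> tensor_null R M N"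
  unfolding tensor_null_def using generate.eng[of p "free_pairs M N" _ q] by simp

lemma tensor_null_minus:
  assumes "module R M" "module R N" "p \<in> tensor_null R M N"
  shows "- p \<in> tensor_null R M N"
  using free.generate_m_inv_closed[OF tensor_relations_subset[OF assms(1,2)], of p] assms
    tensor_null_keys[OF assms]
  unfolding tensor_null_def by simp

lemma tensor_null_diff:
  "\<lbrakk>module R M; module R N; p \<in> tensor_null R M N; q \<in> tensor_null R M N\<rbrakk> \<Longrightarrow> p - q \<in> tensor_null R M N"
  using tensor_null_add[of p "- q"] tensor_null_minus[of q] by simp

text \<open>Closure under differences replaces the two closure rules of \<open>generate\<close>: the
  inverse of \<open>p\<close> is \<open>0 - p\<close>, and the product of \<open>p\<close> and
  \<open>q\<close> is \<open>p - (- q)\<close>.\<close>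

lemma tensor_null_induct [consumes 3, case_names zero rel diff]:
  assumes "module R M" "module R N" "p \<in> tensor_null R M N"
    and "P 0" "\<And>p. p \<in> tensor_relations R M N \<Longrightarrow> P p"
    and "\<And>p q. \<lbrakk>p \<in> tensor_null R M N; q \<in> tensor_null R M N; P p; P q\<rbrakk> \<Longrightarrow> P (p - q)"
  shows "P p"
proof -
  have m: "P (- p)" if "p \<in> tensor_null R M N" "P p" for p
    using assms(6)[of 0 p] assms(4) that tensor_null_zero by simp
  have "p \<in> tensor_null R M N \<and> P p"
    using assms(3) unfolding tensor_null_def
  proof (induction p rule: generate.induct)
    case (inv h)
    then have "inv\<^bsub>free_pairs M N\<^esub> h = - h" using tensor_relations_subset[OF assms(1,2)] by auto
    then show ?case using m[of h] inv assms(5) tensor_null_minus[OF assms(1,2)]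
      by (simp add: tensor_null_rel flip: tensor_null_def)
  next
    case (eng h1 h2)
    then show ?case using assms(6)[of h1 "- h2"] m[of h2] tensor_null_minus[OF assms(1,2)]
      by (simp add: tensor_null_add flip: tensor_null_def)
  qed (auto simp: assms(4,5) tensor_null_zero tensor_null_rel simp flip: tensor_null_def)
  then show ?thesis ..
qed

lemma tensor_class_eq: "tensor_class R M N p = {n + p | n. n \<in> tensor_null R M N}"
  unfolding tensor_class_def r_coset_def by auto

lemma tensor_class_eq_iff:
  assumes "module R M" "module R N"
  shows "tensor_class R M N p = tensor_class R M N q \<longleftrightarrow> p - q \<in> tensor_null R M N"
proof
  assume "tensor_class R M N p = tensor_class R M N q"
  moreover have "p \<in> tensor_class R M N p" using tensor_null_zero by (force simp: tensor_class_eq)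
  ultimately show "p - q \<in> tensor_null R M N" by (auto simp: tensor_class_eq)
next
  assume *: "p - q \<in> tensor_null R M N"
  have "\<exists>n'. n + p = n' + q \<and> n' \<in> tensor_null R M N" if "n \<in> tensor_null R M N" for n
    using tensor_null_add[OF that *] by (intro exI[of _ "n + (p - q)"]) simp
  moreover have "\<exists>n'. n + q = n' + p \<and> n' \<in> tensor_null R M N" if "n \<in> tensor_null R M N" for n
    using tensor_null_diff[OF assms that *] by (intro exI[of _ "n - (p - q)"]) simp
  ultimately show "tensor_class R M N p = tensor_class R M N q" unfolding tensor_class_eq by blast
qed

lemma tensor_carrier_iff:
  "X \<in> carrier (tensor_algebra R M N) \<longleftrightarrow>
     (\<exists>p. Poly_Mapping.keys p \<subseteq> carrier M \<times> carrier N \<and> X = tensor_class R M N p)"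
  by (auto simp: tensor_algebra_def FactGroup_def RCOSETS_def tensor_class_def Bex_def)

lemma tensor_class_closed:
  "Poly_Mapping.keys p \<subseteq> carrier M \<times> carrier N \<Longrightarrow> tensor_class R M N p \<in> carrier (tensor_algebra R M N)"
  by (auto simp: tensor_carrier_iff)

lemma tensor_add_class:
  "tensor_class R M N p \<oplus>\<^bsub>tensor_algebra R M N\<^esub> tensor_class R M N q = tensor_class R M N (p + q)"
proof -
  have "set_mult (free_pairs M N) (tensor_class R M N p) (tensor_class R M N q) = tensor_class R M N (p + q)"
  proof (intro equalityI subsetI)
    fix x assume "x \<in> set_mult (free_pairs M N) (tensor_class R M N p) (tensor_class R M N q)"
    then obtain m n where "x = (m + n) + (p + q)" "m \<in> tensor_null R M N" "n \<in> tensor_null R M N"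
      unfolding set_mult_def tensor_class_eq by (auto simp: algebra_simps)
    then show "x \<in> tensor_class R M N (p + q)" unfolding tensor_class_eq using tensor_null_add by blast
  next
    fix x assume "x \<in> tensor_class R M N (p + q)"
    then obtain n where n: "n \<in> tensor_null R M N" "x = (n + p) + (0 + q)"
      unfolding tensor_class_eq by (auto simp: algebra_simps)
    then show "x \<in> set_mult (free_pairs M N) (tensor_class R M N p) (tensor_class R M N q)"
      unfolding set_mult_def tensor_class_eq using tensor_null_zero by force
  qed
  then show ?thesis by (simp add: tensor_algebra_def FactGroup_def)
qed

lemma tensor_zero_class: "\<zero>\<^bsub>tensor_algebra R M N\<^esub> = tensor_class R M N 0"
  by (auto simp: tensor_algebra_def tensor_class_eq)

lemma abelian_group_tensor: "abelian_group (tensor_algebra R M N)"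
proof (rule abelian_groupI)
  fix X assume "X \<in> carrier (tensor_algebra R M N)"
  then obtain p where p: "Poly_Mapping.keys p \<subseteq> carrier M \<times> carrier N" "X = tensor_class R M N p"
    by (auto simp: tensor_carrier_iff)
  then show "\<exists>Y\<in>carrier (tensor_algebra R M N). Y \<oplus>\<^bsub>tensor_algebra R M N\<^esub> X = \<zero>\<^bsub>tensor_algebra R M N\<^esub>"
    by (intro bexI[of _ "tensor_class R M N (- p)"]) (auto simp: tensor_add_class tensor_zero_class tensor_class_closed)
next
  fix X Y assume "X \<in> carrier (tensor_algebra R M N)" "Y \<in> carrier (tensor_algebra R M N)"
  then show "X \<oplus>\<^bsub>tensor_algebra R M N\<^esub> Y \<in> carrier (tensor_algebra R M N)"
    unfolding tensor_carrier_iff using keys_add by (metis (no_types, lifting) Un_least order_trans tensor_add_class)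
qed (auto simp: tensor_carrier_iff tensor_add_class tensor_zero_class ac_simps intro: exI[of _ 0])

lemma pure_tensor_closed:
  "\<lbrakk>x \<in> carrier M; y \<in> carrier N\<rbrakk> \<Longrightarrow> pure_tensor R M N x y \<in> carrier (tensor_algebra R M N)"
  unfolding pure_tensor_def by (rule tensor_class_closed) simp

context
  assumes M: "module R M" and N: "module R N"
begin

lemma pure_tensor_add_left:
  "\<lbrakk>x \<in> carrier M; x' \<in> carrier M; y \<in> carrier N\<rbrakk> \<Longrightarrow>
   pure_tensor R M N (x \<oplus>\<^bsub>M\<^esub> x') y = pure_tensor R M N x y \<oplus>\<^bsub>tensor_algebra R M N\<^esub> pure_tensor R M N x' y"
  unfolding pure_tensor_def tensor_add_class tensor_class_eq_iff[OF M N] diff_diff_eq[symmetric]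
  by (rule tensor_null_rel, rule tensor_relationsI)

lemma pure_tensor_add_right:
  "\<lbrakk>x \<in> carrier M; y \<in> carrier N; y' \<in> carrier N\<rbrakk> \<Longrightarrow>
   pure_tensor R M N x (y \<oplus>\<^bsub>N\<^esub> y') = pure_tensor R M N x y \<oplus>\<^bsub>tensor_algebra R M N\<^esub> pure_tensor R M N x y'"
  unfolding pure_tensor_def tensor_add_class tensor_class_eq_iff[OF M N] diff_diff_eq[symmetric]
  by (rule tensor_null_rel, rule tensor_relationsI)

lemma pure_tensor_balanced:
  "\<lbrakk>r \<in> carrier R; x \<in> carrier M; y \<in> carrier N\<rbrakk> \<Longrightarrow>
   pure_tensor R M N (r \<odot>\<^bsub>M\<^esub> x) y = pure_tensor R M N x (r \<odot>\<^bsub>N\<^esub> y)"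
  unfolding pure_tensor_def tensor_class_eq_iff[OF M N]
  by (rule tensor_null_rel, rule tensor_relationsI)

text \<open>The formal negative of a generator is again represented by a generator. The relation for
  \<open>x + (- x)\<close> leaves a surplus term \<open>(0, y)\<close>, which the relation for
  \<open>0 + 0\<close> cancels.\<close>

lemma tensor_class_minus_of:
  assumes "x \<in> carrier M" "y \<in> carrier N"
  shows "tensor_class R M N (- frag_of (x, y)) = pure_tensor R M N (\<ominus>\<^bsub>M\<^esub> x) y"
proof -
  interpret M: module R M by (rule M)
  interpret N: module R N by (rule N)
  let ?n = "\<lambda>x x'. frag_of (x \<oplus>\<^bsub>M\<^esub> x', y) - frag_of (x, y) - frag_of (x', y)"
  have 1: "?n x (\<ominus>\<^bsub>M\<^esub> x) \<in> tensor_null R M N"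
    by (rule tensor_null_rel, rule tensor_relationsI) (use assms in auto)
  have 2: "?n \<zero>\<^bsub>M\<^esub> \<zero>\<^bsub>M\<^esub> \<in> tensor_null R M N"
    by (rule tensor_null_rel, rule tensor_relationsI) (use assms in auto)
  have "?n x (\<ominus>\<^bsub>M\<^esub> x) - - ?n \<zero>\<^bsub>M\<^esub> \<zero>\<^bsub>M\<^esub> = - frag_of (x, y) - frag_of (\<ominus>\<^bsub>M\<^esub> x, y)"
    using assms by (simp add: M.M.r_neg)
  then have "- frag_of (x, y) - frag_of (\<ominus>\<^bsub>M\<^esub> x, y) \<in> tensor_null R M N"
    using tensor_null_diff[OF M N 1 tensor_null_minus[OF M N 2]] by metis
  then show ?thesis unfolding pure_tensor_def tensor_class_eq_iff[OF M N] .
qed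

lemma tensor_induct_pure:
  assumes "X \<in> carrier (tensor_algebra R M N)"
    and "P \<zero>\<^bsub>tensor_algebra R M N\<^esub>"
    and pure: "\<And>x y. \<lbrakk>x \<in> carrier M; y \<in> carrier N\<rbrakk> \<Longrightarrow> P (pure_tensor R M N x y)"
    and add: "\<And>X Y. \<lbrakk>X \<in> carrier (tensor_algebra R M N); Y \<in> carrier (tensor_algebra R M N); P X; P Y\<rbrakk> \<Longrightarrow>
      P (X \<oplus>\<^bsub>tensor_algebra R M N\<^esub> Y)"
  shows "P X"
proof -
  interpret M: module R M by (rule M)
  obtain p where p: "Poly_Mapping.keys p \<subseteq> carrier M \<times> carrier N" "X = tensor_class R M N p"
    using assms(1) by (auto simp: tensor_carrier_iff)
  \<comment> \<open>Induction over the free abelian group works with differences, whereas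
    \<open>add\<close> provides only sums; carrying the claim for \<open>- p\<close> along turns
    differences into sums.\<close>
  have "P (tensor_class R M N p) \<and> P (tensor_class R M N (- p))"
  proof (rule free_Abelian_group_induct[OF p(1)])
    show "P (tensor_class R M N 0) \<and> P (tensor_class R M N (- 0))"
      using assms(2) by (simp add: tensor_zero_class)
  next
    fix p q :: "'a \<times> 'b \<Rightarrow>\<^sub>0 int"
    assume *: "Poly_Mapping.keys p \<subseteq> carrier M \<times> carrier N" "Poly_Mapping.keys q \<subseteq> carrier M \<times> carrier N"
      "P (tensor_class R M N p) \<and> P (tensor_class R M N (- p))" "P (tensor_class R M N q) \<and> P (tensor_class R M N (- q))"
    have "P (tensor_class R M N (p + - q))"
      unfolding tensor_add_class[symmetric] by (rule add) (use * in \<open>simp_all add: tensor_class_closed\<close>)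
    moreover have "P (tensor_class R M N (q + - p))"
      unfolding tensor_add_class[symmetric] by (rule add) (use * in \<open>simp_all add: tensor_class_closed\<close>)
    ultimately show "P (tensor_class R M N (p - q)) \<and> P (tensor_class R M N (- (p - q)))" by simp
  next
    fix a :: "'a \<times> 'b" assume "a \<in> carrier M \<times> carrier N"
    then show "P (tensor_class R M N (frag_of a)) \<and> P (tensor_class R M N (- frag_of a))"
      using pure by (cases a) (simp add: tensor_class_minus_of flip: pure_tensor_def)
  qed
  then show ?thesis using p by simp
qed

lemma tensor_universal:
  assumes G: "abelian_group G"
    and closed: "\<And>x y. \<lbrakk>x \<in> carrier M; y \<in> carrier N\<rbrakk> \<Longrightarrow> \<beta> x y \<in> carrier G"
    and \<beta>_left: "\<And>x x' y. \<lbrakk>x \<in> carrier M; x' \<in> carrier M; y \<in> carrier N\<rbrakk> \<Longrightarrow> \<beta> (x \<oplus>\<^bsub>M\<^esub> x') y = \<beta> x y \<oplus>\<^bsub>G\<^esub> \<beta> x' y"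
    and \<beta>_right: "\<And>x y y'. \<lbrakk>x \<in> carrier M; y \<in> carrier N; y' \<in> carrier N\<rbrakk> \<Longrightarrow> \<beta> x (y \<oplus>\<^bsub>N\<^esub> y') = \<beta> x y \<oplus>\<^bsub>G\<^esub> \<beta> x y'"
    and \<beta>_balanced: "\<And>r x y. \<lbrakk>r \<in> carrier R; x \<in> carrier M; y \<in> carrier N\<rbrakk> \<Longrightarrow> \<beta> (r \<odot>\<^bsub>M\<^esub> x) y = \<beta> x (r \<odot>\<^bsub>N\<^esub> y)"
  obtains h where "h \<in> carrier (tensor_algebra R M N) \<rightarrow> carrier G"
    "\<And>X Y. \<lbrakk>X \<in> carrier (tensor_algebra R M N); Y \<in> carrier (tensor_algebra R M N)\<rbrakk> \<Longrightarrow>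
      h (X \<oplus>\<^bsub>tensor_algebra R M N\<^esub> Y) = h X \<oplus>\<^bsub>G\<^esub> h Y"
    "\<And>x y. \<lbrakk>x \<in> carrier M; y \<in> carrier N\<rbrakk> \<Longrightarrow> h (pure_tensor R M N x y) = \<beta> x y"
proof -
  interpret M: module R M by (rule M)
  interpret N: module R N by (rule N)
  interpret G: abelian_group G by fact
  have "(\<lambda>(x, y). \<beta> x y) ` (carrier M \<times> carrier N) \<subseteq> carrier (add_monoid G)" using closed by auto
  from comm_group.free_Abelian_group_universal[OF G.a_comm_group this] obtain h0 where h0: "h0 \<in> hom (free_pairs M N) (add_monoid G)"
    "\<And>a. a \<in> carrier M \<times> carrier N \<Longrightarrow> h0 (frag_of a) = (\<lambda>(x, y). \<beta> x y) a" by blast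
  have h0c: "h0 p \<in> carrier G" if "Poly_Mapping.keys p \<subseteq> carrier M \<times> carrier N" for p
    using h0(1) that by (auto simp: hom_def Pi_iff)
  have h0a: "h0 (p + q) = h0 p \<oplus>\<^bsub>G\<^esub> h0 q"
    if "Poly_Mapping.keys p \<subseteq> carrier M \<times> carrier N" "Poly_Mapping.keys q \<subseteq> carrier M \<times> carrier N" for p q
    using h0(1) that by (auto simp: hom_def)
  have h0d: "h0 (p - q) = h0 p \<ominus>\<^bsub>G\<^esub> h0 q"
    if "Poly_Mapping.keys p \<subseteq> carrier M \<times> carrier N" "Poly_Mapping.keys q \<subseteq> carrier M \<times> carrier N" for p q
  proof -
    have pq: "Poly_Mapping.keys (p - q) \<subseteq> carrier M \<times> carrier N" using that keys_diff[of p q] by blast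
    have "h0 p = h0 (p - q) \<oplus>\<^bsub>G\<^esub> h0 q" using h0a[OF pq that(2)] by simp
    moreover have "h0 (p - q) \<in> carrier G" using pq by (rule h0c)
    ultimately show ?thesis using that h0c by (simp add: G.minus_eq G.a_assoc G.r_neg)
  qed
  have null: "h0 p = \<zero>\<^bsub>G\<^esub>" if "p \<in> tensor_null R M N" for p
  using M N that proof (induction p rule: tensor_null_induct)
    case zero
    have "h0 0 \<oplus>\<^bsub>G\<^esub> h0 0 = h0 0" using h0a[of 0 0] by simp
    then show ?case using h0c[of 0] by (metis G.add.r_cancel_one' empty_subsetI keys_zero)
  next
    case (rel p)
    have k: "Poly_Mapping.keys (frag_of a - frag_of b) \<subseteq> carrier M \<times> carrier N"
      if "a \<in> carrier M \<times> carrier N" "b \<in> carrier M \<times> carrier N" for a b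
      using that keys_diff[of "frag_of a" "frag_of b"] by (auto split: if_splits)
    from rel show ?case
    proof (cases rule: tensor_relationsE)
      case (left x x' y)
      then show ?thesis
        by (simp add: h0d k h0(2) \<beta>_left closed G.minus_eq) (simp add: G.r_neg G.r_neg1 closed G.minus_add G.a_ac)
    next
      case (right x y y')
      then show ?thesis
        by (simp add: h0d k h0(2) \<beta>_right closed G.minus_eq) (simp add: G.r_neg G.r_neg1 closed G.minus_add G.a_ac)
    next
      case (balanced r x y)
      then show ?thesis by (simp add: h0d h0(2) \<beta>_balanced closed G.r_neg G.minus_eq)
    qed
  next
    case (diff p q)
    then show ?case using tensor_null_keys[OF M N] by (simp add: h0d G.minus_eq)
  qed
  \<comment> \<open>Since \<open>h0\<close> vanishes on \<open>tensor_null\<close>, it is constant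
    on every coset, and \<open>h\<close> picks the one value.\<close>
  define h where "h X = the_elem (h0 ` X)" for X
  have h: "h (tensor_class R M N p) = h0 p" if "Poly_Mapping.keys p \<subseteq> carrier M \<times> carrier N" for p
  proof -
    have "h0 (n + p) = h0 p" if "n \<in> tensor_null R M N" for n
      using that \<open>Poly_Mapping.keys p \<subseteq> _\<close> tensor_null_keys[OF M N that] by (simp add: h0a null h0c)
    then have "h0 ` tensor_class R M N p = {h0 p}"
      unfolding tensor_class_eq using tensor_null_zero by auto
    then show ?thesis by (simp add: h_def)
  qed
  show thesis
  proof
    show "h \<in> carrier (tensor_algebra R M N) \<rightarrow> carrier G" by (auto simp: tensor_carrier_iff h h0c)
    show "h (X \<oplus>\<^bsub>tensor_algebra R M N\<^esub> Y) = h X \<oplus>\<^bsub>G\<^esub> h Y"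
      if "X \<in> carrier (tensor_algebra R M N)" "Y \<in> carrier (tensor_algebra R M N)" for X Y
    proof -
      obtain p q where pq: "Poly_Mapping.keys p \<subseteq> carrier M \<times> carrier N" "X = tensor_class R M N p"
        "Poly_Mapping.keys q \<subseteq> carrier M \<times> carrier N" "Y = tensor_class R M N q"
        using \<open>X \<in> _\<close> \<open>Y \<in> _\<close> unfolding tensor_carrier_iff by auto
      then have "Poly_Mapping.keys (p + q) \<subseteq> carrier M \<times> carrier N" using keys_add[of p q] by blast
      then show ?thesis using pq by (simp add: tensor_add_class h h0a)
    qed
    show "h (pure_tensor R M N x y) = \<beta> x y" if "x \<in> carrier M" "y \<in> carrier N" for x y
      using that by (simp add: pure_tensor_def h h0(2))
  qed
qed

end
end

lemmas tensor_induct [consumes 3, case_names zero pure add] = tensor_induct_pure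

section \<open>Multiplication on the tensor product of two algebras\<close>

lemma frag_mult_of [simp]: "frag_mult A B (frag_of (a, b)) (frag_of (c, d)) = frag_of (a \<otimes>\<^bsub>A\<^esub> c, b \<otimes>\<^bsub>B\<^esub> d)"
  by (simp add: frag_mult_def)

lemma frag_mult_zero [simp]: "frag_mult A B 0 q = 0" "frag_mult A B p 0 = 0"
  by (simp_all add: frag_mult_def frag_extend_eq_0 split: prod.split)

lemma frag_mult_diff:
  "frag_mult A B (p - p') q = frag_mult A B p q - frag_mult A B p' q"
  "frag_mult A B p (q - q') = frag_mult A B p q - frag_mult A B p q'"
proof -
  show "frag_mult A B (p - p') q = frag_mult A B p q - frag_mult A B p' q"
    by (simp add: frag_mult_def frag_extend_diff)
  have "frag_mult A B p (q - q') = frag_mult A B p q - frag_mult A B p q'" if "Poly_Mapping.keys p \<subseteq> UNIV"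
    using that
  proof (induction p rule: frag_induction)
    case (one x)
    then show ?case by (cases x) (simp add: frag_mult_def frag_extend_diff)
  next
    case (diff a b)
    then show ?case unfolding frag_mult_def frag_extend_diff by (simp add: algebra_simps)
  qed simp
  then show "frag_mult A B p (q - q') = frag_mult A B p q - frag_mult A B p q'" by simp
qed

lemma frag_mult_add:
  "frag_mult A B (p + p') q = frag_mult A B p q + frag_mult A B p' q"
  "frag_mult A B p (q + q') = frag_mult A B p q + frag_mult A B p q'"
  using frag_mult_diff(1)[of A B p "0 - p'" q] frag_mult_diff(1)[of A B 0 p' q]
    frag_mult_diff(2)[of A B p q "0 - q'"] frag_mult_diff(2)[of A B p 0 q'] by simp_all

lemma frag_pair_induct [consumes 2, case_names zero_left zero_right of diff_left diff_right]:
  assumes "Poly_Mapping.keys p \<subseteq> S" "Poly_Mapping.keys q \<subseteq> T"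
    and "\<And>q. P 0 q" "\<And>p. P p 0" "\<And>a b. \<lbrakk>a \<in> S; b \<in> T\<rbrakk> \<Longrightarrow> P (frag_of a) (frag_of b)"
    and "\<And>p p' q. \<lbrakk>P p q; P p' q\<rbrakk> \<Longrightarrow> P (p - p') q" "\<And>p q q'. \<lbrakk>P p q; P p q'\<rbrakk> \<Longrightarrow> P p (q - q')"
  shows "P p q"
  using assms(1)
proof (induction p rule: frag_induction)
  case (one x)
  show ?case using assms(2) by (induction q rule: frag_induction) (use one assms(3-) in auto)
qed (use assms(3-) in auto)

context
  fixes R :: "('r, 'k) ring_scheme" and A :: "('r, 'a) module" and B :: "('r, 'b) module"
  assumes A: "assoc_algebra R A" and B: "assoc_algebra R B"
begin

interpretation A: assoc_algebra R A by (rule A)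
interpretation B: assoc_algebra R B by (rule B)

lemma frag_mult_keys:
  assumes "Poly_Mapping.keys p \<subseteq> carrier A \<times> carrier B" "Poly_Mapping.keys q \<subseteq> carrier A \<times> carrier B"
  shows "Poly_Mapping.keys (frag_mult A B p q) \<subseteq> carrier A \<times> carrier B"
  using assms
proof (induction p q rule: frag_pair_induct)
  case (diff_left p p' q)
  then show ?case using keys_diff[of "frag_mult A B p q" "frag_mult A B p' q"] by (auto simp: frag_mult_diff)
next
  case (diff_right p q q')
  then show ?case using keys_diff[of "frag_mult A B p q" "frag_mult A B p q'"] by (auto simp: frag_mult_diff)
qed auto

lemma frag_mult_assoc:
  assumes "Poly_Mapping.keys p \<subseteq> carrier A \<times> carrier B" "Poly_Mapping.keys q \<subseteq> carrier A \<times> carrier B"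
    "Poly_Mapping.keys r \<subseteq> carrier A \<times> carrier B"
  shows "frag_mult A B (frag_mult A B p q) r = frag_mult A B p (frag_mult A B q r)"
  using assms(1,2)
proof (induction p q rule: frag_pair_induct)
  case (of a b)
  show ?case using assms(3)
    by (induction r rule: frag_induction) (use of in \<open>auto simp: frag_mult_diff A.A.m_assoc B.A.m_assoc\<close>)
qed (auto simp: frag_mult_diff)

lemma frag_mult_one:
  assumes "Poly_Mapping.keys p \<subseteq> carrier A \<times> carrier B"
  shows "frag_mult A B (frag_of (\<one>\<^bsub>A\<^esub>, \<one>\<^bsub>B\<^esub>)) p = p" "frag_mult A B p (frag_of (\<one>\<^bsub>A\<^esub>, \<one>\<^bsub>B\<^esub>)) = p"
proof -
  have "frag_mult A B (frag_of (\<one>\<^bsub>A\<^esub>, \<one>\<^bsub>B\<^esub>)) p = p \<and> frag_mult A B p (frag_of (\<one>\<^bsub>A\<^esub>, \<one>\<^bsub>B\<^esub>)) = p"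
    using assms by (induction p rule: frag_induction) (auto simp: frag_mult_diff)
  then show "frag_mult A B (frag_of (\<one>\<^bsub>A\<^esub>, \<one>\<^bsub>B\<^esub>)) p = p" "frag_mult A B p (frag_of (\<one>\<^bsub>A\<^esub>, \<one>\<^bsub>B\<^esub>)) = p" by auto
qed

text \<open>A relation multiplied by a generator from either side is a relation of the same kind, by
  distributivity in both algebras and by the compatibility of scalars with products. Hence the null
  subgroup absorbs products, and multiplication descends to cosets.\<close>

lemma frag_mult_null:
  assumes "n \<in> tensor_null R A B" "Poly_Mapping.keys q \<subseteq> carrier A \<times> carrier B"
  shows "frag_mult A B n q \<in> tensor_null R A B" "frag_mult A B q n \<in> tensor_null R A B"
proof -
  note m = A.module_axioms B.module_axioms
  have of: "frag_mult A B n (frag_of (c, d)) \<in> tensor_relations R A B \<and> frag_mult A B (frag_of (c, d)) n \<in> tensor_relations R A B"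
    if n: "n \<in> tensor_relations R A B" and c: "c \<in> carrier A" and d: "d \<in> carrier B" for n c d
    using n
  proof (cases rule: tensor_relationsE)
    case (left x x' y)
    then show ?thesis
      using c d tensor_relationsI(1)[of "x \<otimes>\<^bsub>A\<^esub> c" A "x' \<otimes>\<^bsub>A\<^esub> c" "y \<otimes>\<^bsub>B\<^esub> d" B R]
        tensor_relationsI(1)[of "c \<otimes>\<^bsub>A\<^esub> x" A "c \<otimes>\<^bsub>A\<^esub> x'" "d \<otimes>\<^bsub>B\<^esub> y" B R]
      by (simp add: frag_mult_diff A.A.l_distr A.A.r_distr)
  next
    case (right x y y')
    then show ?thesis
      using c d tensor_relationsI(2)[of "x \<otimes>\<^bsub>A\<^esub> c" A "y \<otimes>\<^bsub>B\<^esub> d" B "y' \<otimes>\<^bsub>B\<^esub> d" R]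
        tensor_relationsI(2)[of "c \<otimes>\<^bsub>A\<^esub> x" A "d \<otimes>\<^bsub>B\<^esub> y" B "d \<otimes>\<^bsub>B\<^esub> y'" R]
      by (simp add: frag_mult_diff B.A.l_distr B.A.r_distr)
  next
    case (balanced r x y)
    then show ?thesis
      using c d tensor_relationsI(3)[of r R "x \<otimes>\<^bsub>A\<^esub> c" A "y \<otimes>\<^bsub>B\<^esub> d" B]
        tensor_relationsI(3)[of r R "c \<otimes>\<^bsub>A\<^esub> x" A "d \<otimes>\<^bsub>B\<^esub> y" B]
      by (simp add: frag_mult_diff A.smult_mult_left A.smult_mult_right B.smult_mult_left B.smult_mult_right)
  qed
  have "frag_mult A B n q \<in> tensor_null R A B \<and> frag_mult A B q n \<in> tensor_null R A B"
    using m assms(1)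
  proof (induction n rule: tensor_null_induct)
    case (rel p)
    show ?case using assms(2)
    proof (induction q rule: frag_induction)
      case (one x)
      then show ?case using of[OF rel] by (cases x) (auto intro: tensor_null_rel)
    qed (auto simp: frag_mult_diff tensor_null_zero tensor_null_diff m)
  qed (auto simp: frag_mult_diff tensor_null_zero tensor_null_diff m)
  then show "frag_mult A B n q \<in> tensor_null R A B" "frag_mult A B q n \<in> tensor_null R A B" by auto
qed

text \<open>Changing representatives by null elements changes the product by three null terms, so
  all cosets in the union defining \<open>tensor_mult\<close> coincide.\<close>

lemma tensor_mult_class:
  assumes p: "Poly_Mapping.keys p \<subseteq> carrier A \<times> carrier B" and q: "Poly_Mapping.keys q \<subseteq> carrier A \<times> carrier B"
  shows "tensor_mult R A B (tensor_class R A B p) (tensor_class R A B q) = tensor_class R A B (frag_mult A B p q)"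
proof -
  note m = A.module_axioms B.module_axioms
  have "tensor_class R A B (frag_mult A B (n + p) (n' + q)) = tensor_class R A B (frag_mult A B p q)"
    if n: "n \<in> tensor_null R A B" and n': "n' \<in> tensor_null R A B" for n n'
  proof -
    have "frag_mult A B n n' \<in> tensor_null R A B" "frag_mult A B n q \<in> tensor_null R A B" "frag_mult A B p n' \<in> tensor_null R A B"
      using frag_mult_null n n' p q tensor_null_keys[OF m n'] by auto
    then show ?thesis unfolding tensor_class_eq_iff[OF m]
      by (simp add: frag_mult_add tensor_null_add)
  qed
  note * = this
  have "tensor_class R A B (frag_mult A B p' q') = tensor_class R A B (frag_mult A B p q)"
    if pq': "p' \<in> tensor_class R A B p" "q' \<in> tensor_class R A B q" for p' q'
  proof -
    obtain n n' where "p' = n + p" "q' = n' + q" "n \<in> tensor_null R A B" "n' \<in> tensor_null R A B"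
      using pq' by (auto simp: tensor_class_eq)
    then show ?thesis using * by simp
  qed
  moreover have "p \<in> tensor_class R A B p" "q \<in> tensor_class R A B q"
    using tensor_null_zero by (force simp: tensor_class_eq)+
  ultimately show ?thesis unfolding tensor_mult_def by blast
qed

lemma ring_tensor_algebra: "ring (tensor_algebra R A B)"
proof -
  let ?T = "tensor_algebra R A B"
  have mult: "X \<otimes>\<^bsub>?T\<^esub> Y = tensor_mult R A B X Y" for X Y by (simp add: tensor_algebra_def)
  have one: "\<one>\<^bsub>?T\<^esub> = tensor_class R A B (frag_of (\<one>\<^bsub>A\<^esub>, \<one>\<^bsub>B\<^esub>))" by (simp add: tensor_algebra_def pure_tensor_def)
  note s = mult one tensor_mult_class tensor_add_class frag_mult_keys tensor_class_closed
  have ka: "Poly_Mapping.keys (p + q) \<subseteq> carrier A \<times> carrier B"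
    if "Poly_Mapping.keys p \<subseteq> carrier A \<times> carrier B" "Poly_Mapping.keys q \<subseteq> carrier A \<times> carrier B" for p q :: "'a \<times> 'b \<Rightarrow>\<^sub>0 int"
    using that keys_add[of p q] by blast
  show ?thesis
  proof (rule ringI)
    show "abelian_group ?T" by (rule abelian_group_tensor)
    show "monoid ?T"
    proof (rule monoidI)
      fix X Y assume "X \<in> carrier ?T" "Y \<in> carrier ?T"
      then show "X \<otimes>\<^bsub>?T\<^esub> Y \<in> carrier ?T"
        by (auto simp: tensor_carrier_iff[of X] tensor_carrier_iff[of Y] s)
    next
      show "\<one>\<^bsub>?T\<^esub> \<in> carrier ?T" by (simp add: s)
    qed (auto simp: tensor_carrier_iff[of _ R A B] s frag_mult_assoc frag_mult_one)
  qed (auto simp: tensor_carrier_iff[of _ R A B] s ka frag_mult_add)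
qed

lemma pure_tensor_mult:
  "\<lbrakk>a \<in> carrier A; b \<in> carrier B; c \<in> carrier A; d \<in> carrier B\<rbrakk> \<Longrightarrow>
   pure_tensor R A B a b \<otimes>\<^bsub>tensor_algebra R A B\<^esub> pure_tensor R A B c d = pure_tensor R A B (a \<otimes>\<^bsub>A\<^esub> c) (b \<otimes>\<^bsub>B\<^esub> d)"
  by (simp add: pure_tensor_def tensor_algebra_def tensor_mult_class)

end

section \<open>Free modules over valuation rings\<close>

definition torsion_free :: "('r, 'm) ring_scheme \<Rightarrow> ('r, 'a, 'n) module_scheme \<Rightarrow> bool" where
  "torsion_free R M \<longleftrightarrow>
     (\<forall>c\<in>carrier R. \<forall>x\<in>carrier M. c \<odot>\<^bsub>M\<^esub> x = \<zero>\<^bsub>M\<^esub> \<longrightarrow> c = \<zero>\<^bsub>R\<^esub> \<or> x = \<zero>\<^bsub>M\<^esub>)"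

text \<open>A free module of rank \<open>n\<close>, given by a basis together with its coordinate
  functionals. The functionals are part of the data because the later arguments read off
  coordinates.\<close>

locale based_module = module R M for R :: "('r, 'm) ring_scheme" and M :: "('r, 'a, 'n) module_scheme" +
  fixes n :: nat and e :: "nat \<Rightarrow> 'a" and d :: "nat \<Rightarrow> 'a \<Rightarrow> 'r"
  assumes e_closed: "i < n \<Longrightarrow> e i \<in> carrier M"
    and d_closed: "\<lbrakk>i < n; x \<in> carrier M\<rbrakk> \<Longrightarrow> d i x \<in> carrier R"
    and d_add: "\<lbrakk>i < n; x \<in> carrier M; y \<in> carrier M\<rbrakk> \<Longrightarrow> d i (x \<oplus>\<^bsub>M\<^esub> y) = d i x \<oplus>\<^bsub>R\<^esub> d i y"
    and d_smult: "\<lbrakk>i < n; r \<in> carrier R; x \<in> carrier M\<rbrakk> \<Longrightarrow> d i (r \<odot>\<^bsub>M\<^esub> x) = r \<otimes>\<^bsub>R\<^esub> d i x"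
    and d_e: "\<lbrakk>i < n; j < n\<rbrakk> \<Longrightarrow> d i (e j) = (if i = j then \<one>\<^bsub>R\<^esub> else \<zero>\<^bsub>R\<^esub>)"
    and expand: "x \<in> carrier M \<Longrightarrow> (\<Oplus>\<^bsub>M\<^esub>i\<in>{..<n}. d i x \<odot>\<^bsub>M\<^esub> e i) = x"
begin

lemma coord_eqI:
  assumes "x \<in> carrier M" "y \<in> carrier M" "\<And>i. i < n \<Longrightarrow> d i x = d i y"
  shows "x = y"
proof -
  have "(\<Oplus>\<^bsub>M\<^esub>i\<in>{..<n}. d i x \<odot>\<^bsub>M\<^esub> e i) = (\<Oplus>\<^bsub>M\<^esub>i\<in>{..<n}. d i y \<odot>\<^bsub>M\<^esub> e i)"
    by (rule M.finsum_cong') (use assms d_closed e_closed in auto)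
  then show ?thesis using expand assms by simp
qed

lemma d_zero: "i < n \<Longrightarrow> d i \<zero>\<^bsub>M\<^esub> = \<zero>\<^bsub>R\<^esub>"
  using d_smult[of i "\<zero>\<^bsub>R\<^esub>" "\<zero>\<^bsub>M\<^esub>"] d_closed by simp

lemma d_finsum:
  assumes "i < n" "finite I" "g \<in> I \<rightarrow> carrier M"
  shows "d i (\<Oplus>\<^bsub>M\<^esub>k\<in>I. g k) = (\<Oplus>\<^bsub>R\<^esub>k\<in>I. d i (g k))"
  by (rule additive_finsum[OF M.abelian_group_axioms R.abelian_group_axioms _ _ assms(2,3)])
     (use assms(1) d_closed d_add in auto)

lemma d_combination:
  assumes "i < n" "\<And>k. k < n \<Longrightarrow> c k \<in> carrier R"
  shows "d i (\<Oplus>\<^bsub>M\<^esub>k\<in>{..<n}. c k \<odot>\<^bsub>M\<^esub> e k) = c i"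
proof -
  have "d i (\<Oplus>\<^bsub>M\<^esub>k\<in>{..<n}. c k \<odot>\<^bsub>M\<^esub> e k) = (\<Oplus>\<^bsub>R\<^esub>k\<in>{..<n}. d i (c k \<odot>\<^bsub>M\<^esub> e k))"
    by (rule d_finsum) (use assms e_closed in auto)
  also have "\<dots> = (\<Oplus>\<^bsub>R\<^esub>k\<in>{..<n}. if k = i then c k else \<zero>\<^bsub>R\<^esub>)"
    by (rule R.finsum_cong') (use assms e_closed in \<open>auto simp: d_smult d_e\<close>)
  finally show ?thesis using R.finsum_delta[of "{..<n}" i c] assms by simp
qed

lemma inj_on_e: "\<one>\<^bsub>R\<^esub> \<noteq> \<zero>\<^bsub>R\<^esub> \<Longrightarrow> inj_on e {..<n}"
  by (intro inj_onI) (metis d_e lessThan_iff)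

text \<open>Generators form a set rather than a family, so the expansion in the basis has to be
  reindexed along \<open>e\<close>; this calls for the injectivity of \<open>e\<close>, which holds
  when \<open>1\<close> differs from \<open>0\<close>.\<close>

lemma based_finitely_generated:
  assumes "\<one>\<^bsub>R\<^esub> \<noteq> \<zero>\<^bsub>R\<^esub>" shows "finitely_generated R M"
  unfolding finitely_generated_def
proof (intro exI[of _ "e ` {..<n}"] conjI ballI)
  fix x assume x: "x \<in> carrier M"
  let ?c = "\<lambda>s. d (inv_into {..<n} e s) x"
  have "(\<Oplus>\<^bsub>M\<^esub>s\<in>e ` {..<n}. ?c s \<odot>\<^bsub>M\<^esub> s) = (\<Oplus>\<^bsub>M\<^esub>i\<in>{..<n}. ?c (e i) \<odot>\<^bsub>M\<^esub> e i)"
    by (rule M.finsum_reindex) (use inj_on_e[OF assms] e_closed d_closed x in auto)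
  also have "\<dots> = (\<Oplus>\<^bsub>M\<^esub>i\<in>{..<n}. d i x \<odot>\<^bsub>M\<^esub> e i)"
    by (rule M.finsum_cong') (use inj_on_e[OF assms] e_closed d_closed x in auto)
  finally have "x = (\<Oplus>\<^bsub>M\<^esub>s\<in>e ` {..<n}. ?c s \<odot>\<^bsub>M\<^esub> s)" using expand[OF x] by simp
  moreover have "?c \<in> e ` {..<n} \<rightarrow> carrier R" using inj_on_e[OF assms] d_closed x by auto
  ultimately show "\<exists>c\<in>e ` {..<n} \<rightarrow> carrier R. x = (\<Oplus>\<^bsub>M\<^esub>s\<in>e ` {..<n}. c s \<odot>\<^bsub>M\<^esub> s)"
    by (rule bexI[of _ ?c])
qed (use e_closed in auto)

lemma based_projective:
  assumes "\<one>\<^bsub>R\<^esub> \<noteq> \<zero>\<^bsub>R\<^esub>" shows "projective_module R M"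
proof -
  \<comment> \<open>The basis elements themselves index the free module, because
    \<open>projective_module\<close> asks for indices in the type of the module.\<close>
  let ?I = "e ` {..<n}" and ?ix = "inv_into {..<n} e"
  let ?F = "free_module R ?I"
  define s where "s = (\<lambda>x\<in>carrier M. \<lambda>b. if b \<in> ?I then d (?ix b) x else \<zero>\<^bsub>R\<^esub>)"
  define p where "p = (\<lambda>f\<in>carrier ?F. \<Oplus>\<^bsub>M\<^esub>i\<in>{..<n}. f (e i) \<odot>\<^bsub>M\<^esub> e i)"
  have ix [simp]: "?ix (e i) = i" if "i < n" for i using that inj_on_e[OF assms] by simp
  have Fcar: "f \<in> carrier ?F \<longleftrightarrow> (\<forall>b. f b \<in> carrier R) \<and> (\<forall>b. b \<notin> ?I \<longrightarrow> f b = \<zero>\<^bsub>R\<^esub>)" for f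
  proof -
    have "{b. f b \<noteq> \<zero>\<^bsub>R\<^esub>} \<subseteq> ?I \<longleftrightarrow> (\<forall>b. b \<notin> ?I \<longrightarrow> f b = \<zero>\<^bsub>R\<^esub>)" by blast
    moreover have "finite {b. f b \<noteq> \<zero>\<^bsub>R\<^esub>}" if "{b. f b \<noteq> \<zero>\<^bsub>R\<^esub>} \<subseteq> ?I" using that by (rule finite_subset) simp
    ultimately show ?thesis by (auto simp: free_module_def)
  qed
  have Fop: "f \<oplus>\<^bsub>?F\<^esub> g = (\<lambda>b. f b \<oplus>\<^bsub>R\<^esub> g b)" "r \<odot>\<^bsub>?F\<^esub> f = (\<lambda>b. r \<otimes>\<^bsub>R\<^esub> f b)" for f g r
    by (simp_all add: free_module_def)
  have s: "s \<in> module_hom R M ?F" unfolding s_def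
    by (rule module_hom_restrictI)
       (auto simp: Fcar Fop d_closed d_add d_smult fun_eq_iff M.abelian_group_axioms split: if_splits)
  have pc: "f (e i) \<odot>\<^bsub>M\<^esub> e i \<in> carrier M" if "f \<in> carrier ?F" "i < n" for f i
    using that e_closed by (auto simp: Fcar)
  have add: "(\<Oplus>\<^bsub>M\<^esub>i\<in>{..<n}. (f (e i) \<oplus>\<^bsub>R\<^esub> g (e i)) \<odot>\<^bsub>M\<^esub> e i)
      = (\<Oplus>\<^bsub>M\<^esub>i\<in>{..<n}. f (e i) \<odot>\<^bsub>M\<^esub> e i) \<oplus>\<^bsub>M\<^esub> (\<Oplus>\<^bsub>M\<^esub>i\<in>{..<n}. g (e i) \<odot>\<^bsub>M\<^esub> e i)"
    if "f \<in> carrier ?F" "g \<in> carrier ?F" for f g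
  proof -
    have "(\<Oplus>\<^bsub>M\<^esub>i\<in>{..<n}. (f (e i) \<oplus>\<^bsub>R\<^esub> g (e i)) \<odot>\<^bsub>M\<^esub> e i) = (\<Oplus>\<^bsub>M\<^esub>i\<in>{..<n}. f (e i) \<odot>\<^bsub>M\<^esub> e i \<oplus>\<^bsub>M\<^esub> g (e i) \<odot>\<^bsub>M\<^esub> e i)"
      by (rule M.finsum_cong') (use that e_closed in \<open>auto simp: Fcar smult_l_distr\<close>)
    then show ?thesis using that by (simp add: M.finsum_addf Pi_def pc)
  qed
  have smult: "(\<Oplus>\<^bsub>M\<^esub>i\<in>{..<n}. (r \<otimes>\<^bsub>R\<^esub> f (e i)) \<odot>\<^bsub>M\<^esub> e i) = r \<odot>\<^bsub>M\<^esub> (\<Oplus>\<^bsub>M\<^esub>i\<in>{..<n}. f (e i) \<odot>\<^bsub>M\<^esub> e i)"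
    if "f \<in> carrier ?F" "r \<in> carrier R" for f r
  proof -
    have "(\<Oplus>\<^bsub>M\<^esub>i\<in>{..<n}. (r \<otimes>\<^bsub>R\<^esub> f (e i)) \<odot>\<^bsub>M\<^esub> e i) = (\<Oplus>\<^bsub>M\<^esub>i\<in>{..<n}. r \<odot>\<^bsub>M\<^esub> (f (e i) \<odot>\<^bsub>M\<^esub> e i))"
      by (rule M.finsum_cong') (use that e_closed in \<open>auto simp: Fcar smult_assoc1\<close>)
    then show ?thesis using that by (simp add: finsum_smult_ldistr Pi_def pc)
  qed
  have Fc: "(\<lambda>i. f i \<oplus>\<^bsub>R\<^esub> g i) \<in> carrier ?F" "(\<lambda>i. r \<otimes>\<^bsub>R\<^esub> f i) \<in> carrier ?F"
    if "f \<in> carrier ?F" "g \<in> carrier ?F" "r \<in> carrier R" for f g r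
    using that by (auto simp: Fcar)
  have p: "p \<in> module_hom R ?F M"
  proof (rule module_homI)
    show "p \<in> carrier ?F \<rightarrow>\<^sub>E carrier M" unfolding p_def by (auto intro!: M.finsum_closed pc)
    fix f g r assume fg: "f \<in> carrier ?F" "g \<in> carrier ?F"
    show "p (f \<oplus>\<^bsub>?F\<^esub> g) = p f \<oplus>\<^bsub>M\<^esub> p g"
      using Fc(1)[OF fg R.zero_closed] fg add[OF fg] by (simp add: p_def Fop)
  next
    fix f r assume fg: "f \<in> carrier ?F" "r \<in> carrier R"
    show "p (r \<odot>\<^bsub>?F\<^esub> f) = r \<odot>\<^bsub>M\<^esub> p f"
      using Fc(2)[OF fg(1) fg] fg smult[OF fg] by (simp add: p_def Fop)
  qed
  have "p (s x) = x" if x: "x \<in> carrier M" for x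
  proof -
    have "(\<Oplus>\<^bsub>M\<^esub>i\<in>{..<n}. s x (e i) \<odot>\<^bsub>M\<^esub> e i) = (\<Oplus>\<^bsub>M\<^esub>i\<in>{..<n}. d i x \<odot>\<^bsub>M\<^esub> e i)"
      by (rule M.finsum_cong') (use x d_closed e_closed in \<open>auto simp: s_def\<close>)
    then show ?thesis using module_homD(2)[OF s x] expand[OF x] by (simp add: p_def)
  qed
  then show ?thesis unfolding projective_module_def using s p by blast
qed

end

text \<open>The section \<open>s\<close> embeds \<open>M\<close> into a module of functions with
  values in the domain \<open>R\<close>, where torsion can be tested at a single index.\<close>

lemma projective_torsion_free:
  fixes R :: "('r, 'm) ring_scheme" and M :: "('r, 'a, 'n) module_scheme"
  assumes "module R M" "domain R" "projective_module R M"
  shows "torsion_free R M"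
  unfolding torsion_free_def
proof (intro ballI impI)
  interpret module R M by fact
  interpret D: domain R by fact
  fix c x assume c: "c \<in> carrier R" and x: "x \<in> carrier M" and cx: "c \<odot>\<^bsub>M\<^esub> x = \<zero>\<^bsub>M\<^esub>"
  obtain I :: "'a set" and s p where s: "s \<in> module_hom R M (free_module R I)"
    and p: "p \<in> module_hom R (free_module R I) M" and ps: "\<And>x. x \<in> carrier M \<Longrightarrow> p (s x) = x"
    using assms(3) unfolding projective_module_def by blast
  show "c = \<zero>\<^bsub>R\<^esub> \<or> x = \<zero>\<^bsub>M\<^esub>"
  proof (rule disjCI)
    assume "x \<noteq> \<zero>\<^bsub>M\<^esub>"
    have z: "\<zero>\<^bsub>R\<^esub> \<odot>\<^bsub>free_module R I\<^esub> s x = (\<lambda>i. \<zero>\<^bsub>R\<^esub>)"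
      using module_homD(2)[OF s x] by (auto simp: free_module_def)
    have "s \<zero>\<^bsub>M\<^esub> = (\<lambda>i. \<zero>\<^bsub>R\<^esub>)" using module_homD(4)[OF s R.zero_closed x] x z by simp
    then have cs: "c \<otimes>\<^bsub>R\<^esub> s x i = \<zero>\<^bsub>R\<^esub>" for i
      using module_homD(4)[OF s c x] cx by (simp add: free_module_def fun_eq_iff)
    have "s x \<noteq> (\<lambda>i. \<zero>\<^bsub>R\<^esub>)"
    proof
      assume "s x = (\<lambda>i. \<zero>\<^bsub>R\<^esub>)"
      then have "x = \<zero>\<^bsub>M\<^esub>"
        using ps[OF x] z module_homD(4)[OF p R.zero_closed module_homD(2)[OF s x]] x by simp
      then show False using \<open>x \<noteq> \<zero>\<^bsub>M\<^esub>\<close> by simp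
    qed
    then obtain i where "s x i \<noteq> \<zero>\<^bsub>R\<^esub>" by (auto simp: fun_eq_iff)
    moreover have "s x i \<in> carrier R" using module_homD(2)[OF s x] by (simp add: free_module_def)
    ultimately show "c = \<zero>\<^bsub>R\<^esub>" using D.integral[OF cs[of i] c] by simp
  qed
qed

section \<open>Divisibility in a valuation ring and bases of its torsion-free modules\<close>

locale valued_field = K: field K for K :: "('k, 'm) ring_scheme" + fixes V :: "'k set"
  assumes valuation: "valuation_ring V K"
begin

abbreviation "R \<equiv> K\<lparr>carrier := V\<rparr>"

lemma V_subring: "subring V K" using valuation by (simp add: valuation_ring_def)

lemmas V_closed = subringE[OF V_subring]

lemma V_sub: "a \<in> V \<Longrightarrow> a \<in> carrier K" using V_closed(1) by auto

sublocale R: domain R by (rule K.subring_is_domain[OF V_subring])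

text \<open>This is comparability of values in \<open>K\<close>: the quotient of two nonzero
  elements or its inverse lies in \<open>V\<close>. The second alternative records that
  \<open>a\<close> is nonzero, so that \<open>a\<close> can serve as the new divisor.\<close>

lemma V_total:
  assumes "a \<in> carrier K" "b \<in> carrier K" "b \<noteq> \<zero>\<^bsub>K\<^esub>"
  obtains c where "c \<in> V" "a = c \<otimes>\<^bsub>K\<^esub> b" | c where "a \<noteq> \<zero>\<^bsub>K\<^esub>" "c \<in> V" "b = c \<otimes>\<^bsub>K\<^esub> a"
proof (cases "a = \<zero>\<^bsub>K\<^esub>")
  case True
  then show ?thesis using that(1)[of "\<zero>\<^bsub>K\<^esub>"] assms V_closed by simp
next
  case False
  have u: "a \<in> Units K" "b \<in> Units K" using assms False K.field_Units by auto
  have ab: "a \<otimes>\<^bsub>K\<^esub> inv\<^bsub>K\<^esub> b \<in> carrier K" "a \<otimes>\<^bsub>K\<^esub> inv\<^bsub>K\<^esub> b \<noteq> \<zero>\<^bsub>K\<^esub>"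
    using u K.Units_m_closed[of a "inv\<^bsub>K\<^esub> b"] K.field_Units by auto
  then have "a \<otimes>\<^bsub>K\<^esub> inv\<^bsub>K\<^esub> b \<in> V \<or> inv\<^bsub>K\<^esub> (a \<otimes>\<^bsub>K\<^esub> inv\<^bsub>K\<^esub> b) \<in> V"
    using valuation by (auto simp: valuation_ring_def)
  moreover have azb: "a = (a \<otimes>\<^bsub>K\<^esub> inv\<^bsub>K\<^esub> b) \<otimes>\<^bsub>K\<^esub> b"
    using K.m_assoc[of a "inv\<^bsub>K\<^esub> b" b] u assms by simp
  moreover have "b = inv\<^bsub>K\<^esub> (a \<otimes>\<^bsub>K\<^esub> inv\<^bsub>K\<^esub> b) \<otimes>\<^bsub>K\<^esub> a"
  proof -
    have z: "a \<otimes>\<^bsub>K\<^esub> inv\<^bsub>K\<^esub> b \<in> Units K" using ab K.field_Units by simp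
    then show ?thesis
      using K.m_assoc[of "inv\<^bsub>K\<^esub> (a \<otimes>\<^bsub>K\<^esub> inv\<^bsub>K\<^esub> b)" "a \<otimes>\<^bsub>K\<^esub> inv\<^bsub>K\<^esub> b" b] ab(1) assms azb by simp
  qed
  ultimately show ?thesis using that(1)[of "a \<otimes>\<^bsub>K\<^esub> inv\<^bsub>K\<^esub> b"] that(2)[of "inv\<^bsub>K\<^esub> (a \<otimes>\<^bsub>K\<^esub> inv\<^bsub>K\<^esub> b)"] False by metis
qed

text \<open>The index \<open>t\<close> belongs to a coefficient of least value. In the induction the
  new coefficient is compared with the divisor found so far; if it replaces that divisor, the
  quotients multiply.\<close>

lemma dominant_element:
  assumes "finite S" "c \<in> S \<rightarrow> carrier K" "s \<in> S" "c s \<noteq> \<zero>\<^bsub>K\<^esub>"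
  obtains t q where "t \<in> S" "c t \<noteq> \<zero>\<^bsub>K\<^esub>" "q \<in> S \<rightarrow> V" "q t = \<one>\<^bsub>K\<^esub>" "\<And>s. s \<in> S \<Longrightarrow> c s = q s \<otimes>\<^bsub>K\<^esub> c t"
proof -
  have "\<exists>t\<in>S. c t \<noteq> \<zero>\<^bsub>K\<^esub> \<and> (\<forall>s\<in>S. \<exists>q\<in>V. c s = q \<otimes>\<^bsub>K\<^esub> c t)"
    using assms
  proof (induction S arbitrary: s rule: finite_induct)
    case (insert x S)
    have cc: "\<And>s. s \<in> insert x S \<Longrightarrow> c s \<in> carrier K" using insert.prems by auto
    have self: "\<exists>q\<in>V. c s = q \<otimes>\<^bsub>K\<^esub> c s" if "s \<in> insert x S" for s
      using cc[OF that] V_closed(3) by (intro bexI[of _ "\<one>\<^bsub>K\<^esub>"]) auto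
    show ?case
    proof (cases "\<exists>s\<in>S. c s \<noteq> \<zero>\<^bsub>K\<^esub>")
      case False
      then have "c x \<noteq> \<zero>\<^bsub>K\<^esub>" using insert.prems by auto
      moreover have "\<exists>q\<in>V. c s = q \<otimes>\<^bsub>K\<^esub> c x" if "s \<in> S" for s
        using False that cc V_closed(2) by (intro bexI[of _ "\<zero>\<^bsub>K\<^esub>"]) auto
      ultimately show ?thesis using self by blast
    next
      case True
      then obtain t where t: "t \<in> S" "c t \<noteq> \<zero>\<^bsub>K\<^esub>" "\<forall>s\<in>S. \<exists>q\<in>V. c s = q \<otimes>\<^bsub>K\<^esub> c t"
        using insert.IH insert.prems by blast
      have "c x \<in> carrier K" "c t \<in> carrier K" using cc t by auto
      then show ?thesis
      proof (rule V_total[OF _ _ t(2)])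
        fix q assume "q \<in> V" "c x = q \<otimes>\<^bsub>K\<^esub> c t"
        then show ?thesis using t by blast
      next
        fix q assume q: "c x \<noteq> \<zero>\<^bsub>K\<^esub>" "q \<in> V" "c t = q \<otimes>\<^bsub>K\<^esub> c x"
        have "\<exists>q\<in>V. c s = q \<otimes>\<^bsub>K\<^esub> c x" if s: "s \<in> S" for s
        proof -
          obtain q' where q': "q' \<in> V" "c s = q' \<otimes>\<^bsub>K\<^esub> c t" using bspec[OF t(3) s] by blast
          have "c s = (q' \<otimes>\<^bsub>K\<^esub> q) \<otimes>\<^bsub>K\<^esub> c x"
            using q'(2) K.m_assoc[of q' q "c x"] V_sub q(2) q'(1) \<open>c x \<in> carrier K\<close> unfolding q(3) by metis
          then show ?thesis using V_closed(6)[OF q'(1) q(2)] by blast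
        qed
        then show ?thesis using q(1) self by blast
      qed
    qed
  qed simp
  then obtain t where t: "t \<in> S" "c t \<noteq> \<zero>\<^bsub>K\<^esub>" and q: "\<forall>s\<in>S. \<exists>q\<in>V. c s = q \<otimes>\<^bsub>K\<^esub> c t" by blast
  obtain q where q': "\<And>s. s \<in> S \<Longrightarrow> q s \<in> V \<and> c s = q s \<otimes>\<^bsub>K\<^esub> c t" using q by metis
  have ct: "c t \<in> carrier K" using t assms by auto
  show thesis
  \<comment> \<open>Cancelling \<open>c t\<close> would force the quotient at \<open>t\<close> to be
    \<open>1\<close>; overwriting the value there sets it directly.\<close>
  proof (rule that[of t "q(t := \<one>\<^bsub>K\<^esub>)"])
    fix s assume "s \<in> S"
    show "c s = (q(t := \<one>\<^bsub>K\<^esub>)) s \<otimes>\<^bsub>K\<^esub> c t"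
    proof (cases "s = t")
      case False
      then have "(q(t := \<one>\<^bsub>K\<^esub>)) s = q s" by simp
      then show ?thesis using q'[OF \<open>s \<in> S\<close>] by metis
    qed (simp add: ct)
  next
    show "q(t := \<one>\<^bsub>K\<^esub>) \<in> S \<rightarrow> V" using V_closed(3) q' by (metis Pi_I fun_upd_apply)
  qed (use t in auto)
qed

text \<open>
  A generating set of least size is a basis: dividing a relation by its dominant coefficient
  expresses one generator through the others.
\<close>

lemma basis_exists:
  assumes M: "module R M" and tf: "torsion_free R M" and fg: "finitely_generated R M"
  obtains n e d where "based_module R M n e d"
proof -
  interpret M: module R M by fact
  define gen where "gen S \<longleftrightarrow> finite S \<and> S \<subseteq> carrier M \<and>
        (\<forall>x \<in> carrier M. \<exists>c \<in> S \<rightarrow> V. x = (\<Oplus>\<^bsub>M\<^esub>s \<in> S. c s \<odot>\<^bsub>M\<^esub> s))" for S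
  have "\<exists>S. gen S" using fg unfolding finitely_generated_def gen_def by simp
  then obtain S where S: "gen S" and min: "\<And>S'. gen S' \<Longrightarrow> card S \<le> card S'"
    using ex_has_least_nat[of gen _ card] by metis
  have fin: "finite S" and sub: "S \<subseteq> carrier M" using S by (auto simp: gen_def)
  have cl: "(\<lambda>s. c s \<odot>\<^bsub>M\<^esub> s) \<in> S \<rightarrow> carrier M" if "c \<in> S \<rightarrow> V" for c
    using that sub M.smult_closed by (auto simp: Pi_iff subset_iff)
  have indep: "c s = \<zero>\<^bsub>K\<^esub>" if c: "c \<in> S \<rightarrow> V" and z: "(\<Oplus>\<^bsub>M\<^esub>s \<in> S. c s \<odot>\<^bsub>M\<^esub> s) = \<zero>\<^bsub>M\<^esub>" and s: "s \<in> S" for c s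
  proof (rule ccontr)
    assume nz: "c s \<noteq> \<zero>\<^bsub>K\<^esub>"
    have cK: "c \<in> S \<rightarrow> carrier K" using c V_sub by auto
    obtain t q where t: "t \<in> S" "c t \<noteq> \<zero>\<^bsub>K\<^esub>" and q: "q \<in> S \<rightarrow> V" "q t = \<one>\<^bsub>K\<^esub>"
      "\<And>s. s \<in> S \<Longrightarrow> c s = q s \<otimes>\<^bsub>K\<^esub> c t"
      using dominant_element[OF fin cK s nz] by metis
    have ct: "c t \<in> V" using c t by auto
    have "c t \<odot>\<^bsub>M\<^esub> (\<Oplus>\<^bsub>M\<^esub>s \<in> S. q s \<odot>\<^bsub>M\<^esub> s) = (\<Oplus>\<^bsub>M\<^esub>s \<in> S. c t \<odot>\<^bsub>M\<^esub> (q s \<odot>\<^bsub>M\<^esub> s))"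
      using ct cl[OF q(1)] fin by (simp add: M.finsum_smult_ldistr)
    also have "\<dots> = (\<Oplus>\<^bsub>M\<^esub>s \<in> S. c s \<odot>\<^bsub>M\<^esub> s)"
    proof (rule M.M.finsum_cong')
      fix s assume s: "s \<in> S"
      then have sM: "s \<in> carrier M" and qs: "q s \<in> V" using q sub by auto
      have "c t \<odot>\<^bsub>M\<^esub> (q s \<odot>\<^bsub>M\<^esub> s) = (c t \<otimes>\<^bsub>K\<^esub> q s) \<odot>\<^bsub>M\<^esub> s"
        using M.smult_assoc1[of "c t" "q s" s] ct qs sM by simp
      also have "c t \<otimes>\<^bsub>K\<^esub> q s = c s" using q(3)[OF s] V_sub[OF ct] V_sub[OF qs] by (simp add: K.m_comm)
      finally show "c t \<odot>\<^bsub>M\<^esub> (q s \<odot>\<^bsub>M\<^esub> s) = c s \<odot>\<^bsub>M\<^esub> s" .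
    qed (use cl[OF c] in auto)
    \<comment> \<open>Torsion-freeness cancels the dominant coefficient \<open>c t\<close>; what
      remains is a relation with coefficient \<open>1\<close> at \<open>t\<close>.\<close>
    finally have "(\<Oplus>\<^bsub>M\<^esub>s \<in> S. q s \<odot>\<^bsub>M\<^esub> s) = \<zero>\<^bsub>M\<^esub>"
      using tf t(2) ct M.M.finsum_closed[OF cl[OF q(1)]] z unfolding torsion_free_def by auto
    note qz = this
    have "gen (S - {t})" unfolding gen_def
    proof (intro conjI ballI)
      fix x assume x: "x \<in> carrier M"
      obtain a where a: "a \<in> S \<rightarrow> V" "x = (\<Oplus>\<^bsub>M\<^esub>s \<in> S. a s \<odot>\<^bsub>M\<^esub> s)" using S x by (auto simp: gen_def)
      \<comment> \<open>Subtracting \<open>a t\<close> times the relation with coefficients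
        \<open>q\<close> does not change the sum and makes the coefficient at \<open>t\<close> zero,
        as \<open>q t = 1\<close>.\<close>
      define b where "b s = a s \<ominus>\<^bsub>K\<^esub> a t \<otimes>\<^bsub>K\<^esub> q s" for s
      have at: "a t \<in> V" using a t by auto
      have bs: "b s \<in> V" if "s \<in> S" for s
        using that a q at V_closed(5-7) by (auto simp: b_def a_minus_def Pi_iff)
      have "(\<Oplus>\<^bsub>M\<^esub>s \<in> S. b s \<odot>\<^bsub>M\<^esub> s) \<oplus>\<^bsub>M\<^esub> a t \<odot>\<^bsub>M\<^esub> (\<Oplus>\<^bsub>M\<^esub>s \<in> S. q s \<odot>\<^bsub>M\<^esub> s)
         = (\<Oplus>\<^bsub>M\<^esub>s \<in> S. b s \<odot>\<^bsub>M\<^esub> s \<oplus>\<^bsub>M\<^esub> a t \<odot>\<^bsub>M\<^esub> (q s \<odot>\<^bsub>M\<^esub> s))"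
        using fin sub bs at q(1)
        by (subst M.M.finsum_addf) (auto simp: M.finsum_smult_ldistr Pi_def subset_iff)
      also have "\<dots> = (\<Oplus>\<^bsub>M\<^esub>s \<in> S. a s \<odot>\<^bsub>M\<^esub> s)"
      proof (rule M.M.finsum_cong')
        fix s assume s: "s \<in> S"
        then have sM: "s \<in> carrier M" and qs: "q s \<in> V" and as: "a s \<in> V" using q a sub by auto
        have "b s \<odot>\<^bsub>M\<^esub> s \<oplus>\<^bsub>M\<^esub> a t \<odot>\<^bsub>M\<^esub> (q s \<odot>\<^bsub>M\<^esub> s) = (b s \<oplus>\<^bsub>K\<^esub> a t \<otimes>\<^bsub>K\<^esub> q s) \<odot>\<^bsub>M\<^esub> s"
          using M.smult_assoc1[of "a t" "q s" s] M.smult_l_distr[of "b s" "a t \<otimes>\<^bsub>K\<^esub> q s" s] at qs sM bs[OF s] V_closed(6) by simp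
        also have "b s \<oplus>\<^bsub>K\<^esub> a t \<otimes>\<^bsub>K\<^esub> q s = a s"
          using at qs as V_sub by (simp add: b_def a_minus_def K.a_assoc K.l_neg)
        finally show "b s \<odot>\<^bsub>M\<^esub> s \<oplus>\<^bsub>M\<^esub> a t \<odot>\<^bsub>M\<^esub> (q s \<odot>\<^bsub>M\<^esub> s) = a s \<odot>\<^bsub>M\<^esub> s" .
      qed (use cl[OF a(1)] in auto)
      finally have "x = (\<Oplus>\<^bsub>M\<^esub>s \<in> S. b s \<odot>\<^bsub>M\<^esub> s)"
        using a qz at bs cl[of b] by (simp add: M.M.finsum_closed)
      also have "\<dots> = b t \<odot>\<^bsub>M\<^esub> t \<oplus>\<^bsub>M\<^esub> (\<Oplus>\<^bsub>M\<^esub>s \<in> S - {t}. b s \<odot>\<^bsub>M\<^esub> s)"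
        using M.M.finsum_insert[of "S - {t}" t "\<lambda>s. b s \<odot>\<^bsub>M\<^esub> s"] fin bs sub t(1) insert_Diff[OF t(1)]
        by (auto simp: Pi_def subset_iff)
      also have "b t = \<zero>\<^bsub>K\<^esub>" using at V_sub by (simp add: b_def q(2) a_minus_def K.r_neg)
      also have "\<zero>\<^bsub>K\<^esub> \<odot>\<^bsub>M\<^esub> t \<oplus>\<^bsub>M\<^esub> (\<Oplus>\<^bsub>M\<^esub>s \<in> S - {t}. b s \<odot>\<^bsub>M\<^esub> s) = (\<Oplus>\<^bsub>M\<^esub>s \<in> S - {t}. b s \<odot>\<^bsub>M\<^esub> s)"
        using M.smult_l_null[of t] t sub bs by (subst M.M.l_zero[symmetric]) (auto intro!: M.M.finsum_closed)
      finally show "\<exists>c\<in>S - {t} \<rightarrow> V. x = (\<Oplus>\<^bsub>M\<^esub>s\<in>S - {t}. c s \<odot>\<^bsub>M\<^esub> s)" using bs by blast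
    qed (use fin sub in auto)
    from min[OF this] show False using card_Diff1_less[OF fin t(1)] by simp
  qed
  \<comment> \<open>The coefficients are chosen arbitrarily here. By independence they are unique,
    and uniqueness makes them additive and linear in \<open>x\<close>, so they serve as coordinate
    functionals.\<close>
  obtain a where a: "\<And>x. x \<in> carrier M \<Longrightarrow> a x \<in> S \<rightarrow> V \<and> x = (\<Oplus>\<^bsub>M\<^esub>s \<in> S. a x s \<odot>\<^bsub>M\<^esub> s)"
    using S unfolding gen_def by metis
  have uniq: "a x s = c s" if x: "x \<in> carrier M" and c: "c \<in> S \<rightarrow> V" "x = (\<Oplus>\<^bsub>M\<^esub>s \<in> S. c s \<odot>\<^bsub>M\<^esub> s)" and s: "s \<in> S" for x c s
  proof -
    define b where "b s = a x s \<ominus>\<^bsub>K\<^esub> c s" for s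
    have ax: "a x \<in> S \<rightarrow> V" "x = (\<Oplus>\<^bsub>M\<^esub>s \<in> S. a x s \<odot>\<^bsub>M\<^esub> s)" using a[OF x] by auto
    have b: "b \<in> S \<rightarrow> V" using ax(1) c(1) V_closed(5,7) by (auto simp: b_def a_minus_def Pi_iff)
    have "(\<Oplus>\<^bsub>M\<^esub>s \<in> S. b s \<odot>\<^bsub>M\<^esub> s) \<oplus>\<^bsub>M\<^esub> (\<Oplus>\<^bsub>M\<^esub>s \<in> S. c s \<odot>\<^bsub>M\<^esub> s) = (\<Oplus>\<^bsub>M\<^esub>s \<in> S. b s \<odot>\<^bsub>M\<^esub> s \<oplus>\<^bsub>M\<^esub> c s \<odot>\<^bsub>M\<^esub> s)"
      using cl[OF b] cl[OF c(1)] by (simp add: M.M.finsum_addf)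
    also have "\<dots> = (\<Oplus>\<^bsub>M\<^esub>s \<in> S. a x s \<odot>\<^bsub>M\<^esub> s)"
    proof (rule M.M.finsum_cong')
      fix s assume s: "s \<in> S"
      then have sM: "s \<in> carrier M" and "b s \<in> V" "c s \<in> V" "a x s \<in> V" using b c ax sub by auto
      then have "b s \<odot>\<^bsub>M\<^esub> s \<oplus>\<^bsub>M\<^esub> c s \<odot>\<^bsub>M\<^esub> s = (b s \<oplus>\<^bsub>K\<^esub> c s) \<odot>\<^bsub>M\<^esub> s" "b s \<oplus>\<^bsub>K\<^esub> c s = a x s"
        using M.smult_l_distr[of "b s" "c s" s] V_sub by (simp_all add: b_def a_minus_def K.a_assoc K.l_neg)
      then show "b s \<odot>\<^bsub>M\<^esub> s \<oplus>\<^bsub>M\<^esub> c s \<odot>\<^bsub>M\<^esub> s = a x s \<odot>\<^bsub>M\<^esub> s" by simp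
    qed (use cl[OF ax(1)] in auto)
    finally have "(\<Oplus>\<^bsub>M\<^esub>s \<in> S. b s \<odot>\<^bsub>M\<^esub> s) = \<zero>\<^bsub>M\<^esub>"
      using c(2) ax(2) x M.M.finsum_closed[OF cl[OF b]] by (metis M.M.add.r_cancel_one')
    then have "b s = \<zero>\<^bsub>K\<^esub>" using indep[OF b _ s] by simp
    then show ?thesis using ax c s V_sub by (auto simp: b_def Pi_iff)
  qed
  obtain e where e: "bij_betw e {..<card S} S" using ex_bij_betw_nat_finite[OF fin] by (auto simp: atLeast0LessThan)
  have eS: "e i \<in> S" if "i < card S" for i using e that by (auto simp: bij_betw_def)
  have ein: "inj_on e {..<card S}" and eim: "e ` {..<card S} = S" using e by (auto simp: bij_betw_def)
  have "based_module R M (card S) e (\<lambda>i x. a x (e i))"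
  proof (intro based_module.intro based_module_axioms.intro M)
    fix i assume i: "i < card S"
    show "e i \<in> carrier M" using eS[OF i] sub by auto
    fix x assume x: "x \<in> carrier M"
    show "a x (e i) \<in> carrier R" using a[OF x] eS[OF i] by auto
    have ax: "a x \<in> S \<rightarrow> V" "(\<Oplus>\<^bsub>M\<^esub>s \<in> S. a x s \<odot>\<^bsub>M\<^esub> s) = x" using a[OF x] by auto
    {
      fix y assume y: "y \<in> carrier M"
      have ay: "a y \<in> S \<rightarrow> V" "(\<Oplus>\<^bsub>M\<^esub>s \<in> S. a y s \<odot>\<^bsub>M\<^esub> s) = y" using a[OF y] by auto
      have "(\<Oplus>\<^bsub>M\<^esub>s \<in> S. (a x s \<oplus>\<^bsub>K\<^esub> a y s) \<odot>\<^bsub>M\<^esub> s) = (\<Oplus>\<^bsub>M\<^esub>s \<in> S. a x s \<odot>\<^bsub>M\<^esub> s \<oplus>\<^bsub>M\<^esub> a y s \<odot>\<^bsub>M\<^esub> s)"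
        using ax(1) ay(1) sub M.smult_l_distr
        by (intro M.M.finsum_cong') (auto simp: Pi_iff subset_iff)
      also have "\<dots> = x \<oplus>\<^bsub>M\<^esub> y" using M.M.finsum_addf[OF cl[OF ax(1)] cl[OF ay(1)]] ax(2) ay(2) by simp
      finally have eq: "x \<oplus>\<^bsub>M\<^esub> y = (\<Oplus>\<^bsub>M\<^esub>s \<in> S. (a x s \<oplus>\<^bsub>K\<^esub> a y s) \<odot>\<^bsub>M\<^esub> s)" by simp
      have "(\<lambda>s. a x s \<oplus>\<^bsub>K\<^esub> a y s) \<in> S \<rightarrow> V" using ax(1) ay(1) V_closed(7) by (auto simp: Pi_iff)
      from uniq[OF M.M.a_closed[OF x y] this eq eS[OF i]]
      show "a (x \<oplus>\<^bsub>M\<^esub> y) (e i) = a x (e i) \<oplus>\<^bsub>R\<^esub> a y (e i)" by simp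
    }
    {
      fix r assume "r \<in> carrier R"
      then have r: "r \<in> V" by simp
      have "(\<Oplus>\<^bsub>M\<^esub>s \<in> S. (r \<otimes>\<^bsub>K\<^esub> a x s) \<odot>\<^bsub>M\<^esub> s) = (\<Oplus>\<^bsub>M\<^esub>s \<in> S. r \<odot>\<^bsub>M\<^esub> (a x s \<odot>\<^bsub>M\<^esub> s))"
        using ax(1) r sub M.smult_assoc1
        by (intro M.M.finsum_cong') (auto simp: Pi_iff subset_iff)
      also have "\<dots> = r \<odot>\<^bsub>M\<^esub> x" using M.finsum_smult_ldistr[OF fin, of r "\<lambda>s. a x s \<odot>\<^bsub>M\<^esub> s"] cl[OF ax(1)] ax(2) r by simp
      finally have eq: "r \<odot>\<^bsub>M\<^esub> x = (\<Oplus>\<^bsub>M\<^esub>s \<in> S. (r \<otimes>\<^bsub>K\<^esub> a x s) \<odot>\<^bsub>M\<^esub> s)" by simp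
      have "(\<lambda>s. r \<otimes>\<^bsub>K\<^esub> a x s) \<in> S \<rightarrow> V" using ax(1) r V_closed(6) by (auto simp: Pi_iff)
      from uniq[OF M.smult_closed[OF \<open>r \<in> carrier R\<close> x] this eq eS[OF i]]
      show "a (r \<odot>\<^bsub>M\<^esub> x) (e i) = r \<otimes>\<^bsub>R\<^esub> a x (e i)" by simp
    }
  next
    fix i j assume i: "i < card S" and j: "j < card S"
    have "(\<Oplus>\<^bsub>M\<^esub>s \<in> S. (if s = e j then \<one>\<^bsub>K\<^esub> else \<zero>\<^bsub>K\<^esub>) \<odot>\<^bsub>M\<^esub> s) = (\<Oplus>\<^bsub>M\<^esub>s \<in> S. if s = e j then s else \<zero>\<^bsub>M\<^esub>)"
      using sub M.smult_one M.smult_l_null by (intro M.M.finsum_cong') (auto simp: subset_iff)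
    also have "\<dots> = e j" using M.M.finsum_delta[of S "e j" "\<lambda>s. s"] fin eS[OF j] sub by auto
    finally have eq: "e j = (\<Oplus>\<^bsub>M\<^esub>s \<in> S. (if s = e j then \<one>\<^bsub>K\<^esub> else \<zero>\<^bsub>K\<^esub>) \<odot>\<^bsub>M\<^esub> s)" by simp
    have "(\<lambda>s. if s = e j then \<one>\<^bsub>K\<^esub> else \<zero>\<^bsub>K\<^esub>) \<in> S \<rightarrow> V" using V_closed(2,3) by auto
    from uniq[OF _ this eq eS[OF i]] have "a (e j) (e i) = (if e i = e j then \<one>\<^bsub>K\<^esub> else \<zero>\<^bsub>K\<^esub>)"
      using eS[OF j] sub by auto
    then show "a (e j) (e i) = (if i = j then \<one>\<^bsub>R\<^esub> else \<zero>\<^bsub>R\<^esub>)"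
      using inj_onD[OF ein, of i j] i j by auto
  next
    fix x assume x: "x \<in> carrier M"
    have "(\<Oplus>\<^bsub>M\<^esub>s\<in>e ` {..<card S}. a x s \<odot>\<^bsub>M\<^esub> s) = (\<Oplus>\<^bsub>M\<^esub>i\<in>{..<card S}. a x (e i) \<odot>\<^bsub>M\<^esub> e i)"
      by (rule M.M.finsum_reindex) (use ein eim cl a[OF x] in auto)
    then show "(\<Oplus>\<^bsub>M\<^esub>i\<in>{..<card S}. a x (e i) \<odot>\<^bsub>M\<^esub> e i) = x" using eim a[OF x] by simp
  qed
  then show thesis by (rule that)
qed

end

text \<open>Regarding \<open>K\<close> as a valuation ring of itself makes
  \<open>basis_exists\<close> available for finite-dimensional vector spaces over
  \<open>K\<close>.\<close>

lemma valued_field_trivial: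
  assumes "field K" shows "valued_field K (carrier K)"
proof -
  interpret field K by fact
  show ?thesis by unfold_locales (simp add: valuation_ring_def carrier_is_subring)
qed

section \<open>Azumaya algebras over valuation rings\<close>

text \<open>These are the operators \<open>x \<mapsto> a\<^sub>1 x b\<^sub>1 + ... + a\<^sub>m x
  b\<^sub>m\<close>, that is, the image of the tensor product of \<open>A\<close> with its opposite.
  The empty sum is missing; the zero operator arises from \<open>a = 0\<close>. The functions live
  on the whole type, so they are compared only on the carrier.\<close>

inductive sandwich :: "('r, 'a, 'm) module_scheme \<Rightarrow> ('a \<Rightarrow> 'a) \<Rightarrow> bool" for A where
  single: "\<lbrakk>a \<in> carrier A; b \<in> carrier A\<rbrakk> \<Longrightarrow> sandwich A (\<lambda>x. a \<otimes>\<^bsub>A\<^esub> x \<otimes>\<^bsub>A\<^esub> b)"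
| add: "\<lbrakk>sandwich A f; sandwich A g\<rbrakk> \<Longrightarrow> sandwich A (\<lambda>x. f x \<oplus>\<^bsub>A\<^esub> g x)"

lemma sandwich_closed:
  assumes "sandwich A f" "ring A" "x \<in> carrier A" shows "f x \<in> carrier A"
proof -
  interpret ring A by fact
  show ?thesis using assms(1) by induction (use assms(3) in auto)
qed

text \<open>The surjectivity half of the Azumaya condition.\<close>

definition sandwich_complete :: "('r, 'm) ring_scheme \<Rightarrow> ('r, 'a) module \<Rightarrow> bool" where
  "sandwich_complete R A \<longleftrightarrow>
     (\<forall>f \<in> module_hom R A A. \<exists>g. sandwich A g \<and> (\<forall>x \<in> carrier A. g x = f x))"

lemma assoc_algebra_opposite:
  assumes "assoc_algebra R A" shows "assoc_algebra R (opposite_algebra A)"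
proof -
  interpret assoc_algebra R A by fact
  have ab: "abelian_group (opposite_algebra A)"
    by (rule abelian_groupI) (auto simp: opposite_algebra_def M.a_ac intro: M.l_neg)
  have mod: "module R (opposite_algebra A)"
    by (rule moduleI[OF R.is_cring ab])
       (auto simp: opposite_algebra_def smult_l_distr smult_r_distr smult_assoc1)
  have mon: "monoid (opposite_algebra A)"
    by (rule monoidI) (auto simp: opposite_algebra_def A.m_assoc)
  have "ring (opposite_algebra A)"
    by (rule ringI[OF ab mon]) (auto simp: opposite_algebra_def A.l_distr A.r_distr)
  then show ?thesis
    by (intro assoc_algebra.intro assoc_algebra_axioms.intro mod)
       (auto simp: opposite_algebra_def smult_mult_left smult_mult_right)
qed

lemma opposite_simps [simp]:
  "carrier (opposite_algebra A) = carrier A" "x \<otimes>\<^bsub>opposite_algebra A\<^esub> y = y \<otimes>\<^bsub>A\<^esub> x"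
  "x \<oplus>\<^bsub>opposite_algebra A\<^esub> y = x \<oplus>\<^bsub>A\<^esub> y" "r \<odot>\<^bsub>opposite_algebra A\<^esub> x = r \<odot>\<^bsub>A\<^esub> x"
  "\<one>\<^bsub>opposite_algebra A\<^esub> = \<one>\<^bsub>A\<^esub>" "\<zero>\<^bsub>opposite_algebra A\<^esub> = \<zero>\<^bsub>A\<^esub>"
  by (simp_all add: opposite_algebra_def)

lemma pure_tensor_zero:
  fixes M :: "('r, 'a) module" and N :: "('r, 'b) module"
  assumes "module R M" "module R N"
  shows "y \<in> carrier N \<Longrightarrow> pure_tensor R M N \<zero>\<^bsub>M\<^esub> y = \<zero>\<^bsub>tensor_algebra R M N\<^esub>"
    and "x \<in> carrier M \<Longrightarrow> pure_tensor R M N x \<zero>\<^bsub>N\<^esub> = \<zero>\<^bsub>tensor_algebra R M N\<^esub>"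
proof -
  interpret M: module R M by fact
  interpret N: module R N by fact
  show "pure_tensor R M N \<zero>\<^bsub>M\<^esub> y = \<zero>\<^bsub>tensor_algebra R M N\<^esub>" if "y \<in> carrier N"
    by (rule additive_zero[OF M.M.abelian_group_axioms abelian_group_tensor, where f = "\<lambda>x. pure_tensor R M N x y"])
       (use that assms in \<open>auto simp: pure_tensor_closed pure_tensor_add_left\<close>)
  show "pure_tensor R M N x \<zero>\<^bsub>N\<^esub> = \<zero>\<^bsub>tensor_algebra R M N\<^esub>" if "x \<in> carrier M"
    by (rule additive_zero[OF N.M.abelian_group_axioms abelian_group_tensor, where f = "\<lambda>y. pure_tensor R M N x y"])
       (use that assms in \<open>auto simp: pure_tensor_closed pure_tensor_add_right\<close>)
qed

text \<open>A preimage of \<open>f\<close> under the Azumaya isomorphism is a sum of pure tensors,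
  and pure tensors act by two-sided multiplication.\<close>

lemma azumaya_sandwich_complete:
  assumes "azumaya R A" shows "sandwich_complete R A"
  unfolding sandwich_complete_def
proof
  have alg: "assoc_algebra R A" using assms by (simp add: azumaya_def)
  interpret assoc_algebra R A by (rule alg)
  interpret op: assoc_algebra R "opposite_algebra A" by (rule assoc_algebra_opposite[OF alg])
  let ?O = "opposite_algebra A" and ?T = "tensor_algebra R A (opposite_algebra A)"
  obtain \<phi> where \<phi>: "\<phi> \<in> ring_iso ?T (endomorphism_ring R A)"
    and pure: "\<forall>a \<in> carrier A. \<forall>b \<in> carrier A. \<phi> (pure_tensor R A ?O a b) = (\<lambda>x \<in> carrier A. a \<otimes>\<^bsub>A\<^esub> x \<otimes>\<^bsub>A\<^esub> b)"
    using assms unfolding azumaya_def by blast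
  fix f assume f: "f \<in> module_hom R A A"
  have "f \<in> \<phi> ` carrier ?T"
    using \<phi> f by (auto simp: ring_iso_def bij_betw_def endomorphism_ring_def)
  then obtain X where X: "X \<in> carrier ?T" "f = \<phi> X" by auto
  have "\<exists>g. sandwich A g \<and> (\<forall>x\<in>carrier A. g x = \<phi> X x)"
    using module_axioms op.module_axioms X(1)
  proof (induction X rule: tensor_induct)
    case zero
    have "\<phi> \<zero>\<^bsub>?T\<^esub> = (\<lambda>x \<in> carrier A. \<zero>\<^bsub>A\<^esub> \<otimes>\<^bsub>A\<^esub> x \<otimes>\<^bsub>A\<^esub> \<one>\<^bsub>A\<^esub>)"
      using pure pure_tensor_zero(1)[OF module_axioms op.module_axioms, of "\<one>\<^bsub>A\<^esub>"] by (metis A.one_closed M.zero_closed opposite_simps(1))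
    then show ?case using sandwich.single[OF M.zero_closed A.one_closed] by (intro exI) auto
  next
    case (pure a b)
    then show ?case using \<open>\<forall>a \<in> carrier A. _ a\<close> sandwich.single[of a A b] by (intro exI) auto
  next
    case (add X Y)
    then obtain g h where gh: "sandwich A g" "sandwich A h"
      "\<forall>x\<in>carrier A. g x = \<phi> X x" "\<forall>x\<in>carrier A. h x = \<phi> Y x" by blast
    have "\<phi> (X \<oplus>\<^bsub>?T\<^esub> Y) = \<phi> X \<oplus>\<^bsub>endomorphism_ring R A\<^esub> \<phi> Y"
      using \<phi> add(1,2) by (simp add: ring_iso_def ring_hom_def)
    then have "\<forall>x\<in>carrier A. g x \<oplus>\<^bsub>A\<^esub> h x = \<phi> (X \<oplus>\<^bsub>?T\<^esub> Y) x"
      using gh(3,4) by (simp add: endomorphism_ring_def)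
    then show ?case using sandwich.add[OF gh(1,2)] by blast
  qed
  then show "\<exists>g. sandwich A g \<and> (\<forall>x\<in>carrier A. g x = f x)" using X(2) by simp
qed

text \<open>In the zero algebra \<open>1\<close> of \<open>R\<close> annihilates everything, against
  faithfulness.\<close>

lemma azumaya_nontrivial:
  assumes "azumaya R A" "\<one>\<^bsub>R\<^esub> \<noteq> \<zero>\<^bsub>R\<^esub>" shows "\<one>\<^bsub>A\<^esub> \<noteq> \<zero>\<^bsub>A\<^esub>"
proof
  assume *: "\<one>\<^bsub>A\<^esub> = \<zero>\<^bsub>A\<^esub>"
  interpret assoc_algebra R A using assms(1) by (simp add: azumaya_def)
  have "x = \<zero>\<^bsub>A\<^esub>" if "x \<in> carrier A" for x using A.l_one[OF that] A.l_null[OF that] * by simp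
  then have "\<forall>x\<in>carrier A. \<one>\<^bsub>R\<^esub> \<odot>\<^bsub>A\<^esub> x = \<zero>\<^bsub>A\<^esub>" by simp
  moreover have "faithful_module R A" using assms(1) by (simp add: azumaya_def)
  ultimately show False using assms(2) unfolding faithful_module_def by blast
qed

text \<open>For an algebra with a basis these two axioms imply the whole Azumaya property, as
  \<open>azumaya\<close> shows. They are easier to carry over to the algebra extended to
  \<open>K\<close> than the definition, which speaks of tensor products.\<close>

locale based_algebra = assoc_algebra R A + based_module R A n e d
  for R :: "('r, 'm) ring_scheme" and A :: "('r, 'a) module" and n e d +
  assumes nontrivial: "\<one>\<^bsub>A\<^esub> \<noteq> \<zero>\<^bsub>A\<^esub>" and complete: "sandwich_complete R A"
begin

lemma R_nontrivial: "\<one>\<^bsub>R\<^esub> \<noteq> \<zero>\<^bsub>R\<^esub>"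
proof
  assume "\<one>\<^bsub>R\<^esub> = \<zero>\<^bsub>R\<^esub>"
  then have "\<one>\<^bsub>A\<^esub> = \<zero>\<^bsub>R\<^esub> \<odot>\<^bsub>A\<^esub> \<one>\<^bsub>A\<^esub>" using smult_one[of "\<one>\<^bsub>A\<^esub>"] by simp
  then show False using nontrivial by simp
qed

lemma n_pos: "0 < n"
proof (rule ccontr)
  assume "\<not> 0 < n"
  then have "\<one>\<^bsub>A\<^esub> = \<zero>\<^bsub>A\<^esub>" using expand[OF A.one_closed] by simp
  then show False using nontrivial by simp
qed

lemma endo_sandwich:
  assumes "\<And>x. x \<in> carrier A \<Longrightarrow> f x \<in> carrier A"
    and "\<And>x y. \<lbrakk>x \<in> carrier A; y \<in> carrier A\<rbrakk> \<Longrightarrow> f (x \<oplus>\<^bsub>A\<^esub> y) = f x \<oplus>\<^bsub>A\<^esub> f y"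
    and "\<And>r x. \<lbrakk>r \<in> carrier R; x \<in> carrier A\<rbrakk> \<Longrightarrow> f (r \<odot>\<^bsub>A\<^esub> x) = r \<odot>\<^bsub>A\<^esub> f x"
  obtains g where "sandwich A g" "\<And>x. x \<in> carrier A \<Longrightarrow> g x = f x"
proof -
  have "restrict f (carrier A) \<in> module_hom R A A"
    using assms by (intro module_hom_restrictI) (auto simp: M.abelian_group_axioms)
  then obtain g where "sandwich A g" "\<forall>x\<in>carrier A. g x = restrict f (carrier A) x"
    using complete unfolding sandwich_complete_def by blast
  then show thesis using that by simp
qed

text \<open>This is how completeness is put to use: a coordinate of an element is read off inside
  the algebra by two-sided multiplications.\<close>

lemma coord_sandwich:
  assumes "i < n"
  obtains g where "sandwich A g" "\<And>x. x \<in> carrier A \<Longrightarrow> g x = d i x \<odot>\<^bsub>A\<^esub> \<one>\<^bsub>A\<^esub>"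
  by (rule endo_sandwich[of "\<lambda>x. d i x \<odot>\<^bsub>A\<^esub> \<one>\<^bsub>A\<^esub>"])
     (use assms in \<open>auto simp: d_closed d_add d_smult smult_l_distr smult_assoc1\<close>)

text \<open>
  Injectivity of the Azumaya map comes for free from its surjectivity: apply the sandwich operators
  \<open>d k\<close> to the second factors.
\<close>

lemma sandwich_sum_zero:
  assumes y: "\<And>s. s < n \<Longrightarrow> y s \<in> carrier A"
    and zero: "\<And>x. x \<in> carrier A \<Longrightarrow> (\<Oplus>\<^bsub>A\<^esub>s\<in>{..<n}. e s \<otimes>\<^bsub>A\<^esub> x \<otimes>\<^bsub>A\<^esub> y s) = \<zero>\<^bsub>A\<^esub>"
    and s: "s < n"
  shows "y s = \<zero>\<^bsub>A\<^esub>"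
proof (rule coord_eqI)
  fix k assume k: "k < n"
  obtain g where g: "sandwich A g" "\<And>x. x \<in> carrier A \<Longrightarrow> g x = d k x \<odot>\<^bsub>A\<^esub> \<one>\<^bsub>A\<^esub>"
    using coord_sandwich[OF k] by blast
  \<comment> \<open>Since the hypothesis holds for every \<open>x\<close>, the left factor
    \<open>a\<close> of an operator is absorbed into \<open>x\<close>, while the right factor
    \<open>b\<close> is pulled out of the sum.\<close>
  have "(\<Oplus>\<^bsub>A\<^esub>s\<in>{..<n}. e s \<otimes>\<^bsub>A\<^esub> x \<otimes>\<^bsub>A\<^esub> f (y s)) = \<zero>\<^bsub>A\<^esub>" if "sandwich A f" "x \<in> carrier A" for f x
    using that
  proof (induction arbitrary: x)
    case (single a b)
    have "(\<Oplus>\<^bsub>A\<^esub>s\<in>{..<n}. e s \<otimes>\<^bsub>A\<^esub> x \<otimes>\<^bsub>A\<^esub> (a \<otimes>\<^bsub>A\<^esub> y s \<otimes>\<^bsub>A\<^esub> b))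
        = (\<Oplus>\<^bsub>A\<^esub>s\<in>{..<n}. (e s \<otimes>\<^bsub>A\<^esub> (x \<otimes>\<^bsub>A\<^esub> a) \<otimes>\<^bsub>A\<^esub> y s) \<otimes>\<^bsub>A\<^esub> b)"
      by (rule M.finsum_cong') (use single y e_closed in \<open>auto simp: A.m_assoc\<close>)
    also have "\<dots> = (\<Oplus>\<^bsub>A\<^esub>s\<in>{..<n}. e s \<otimes>\<^bsub>A\<^esub> (x \<otimes>\<^bsub>A\<^esub> a) \<otimes>\<^bsub>A\<^esub> y s) \<otimes>\<^bsub>A\<^esub> b"
      by (rule A.finsum_ldistr[symmetric]) (use single y e_closed in auto)
    finally show ?case using zero[of "x \<otimes>\<^bsub>A\<^esub> a"] single by simp
  next
    case (add f g)
    have fg: "f (y s) \<in> carrier A" "g (y s) \<in> carrier A" if "s < n" for s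
      using sandwich_closed[OF add(1) A.ring_axioms y[OF that]] sandwich_closed[OF add(2) A.ring_axioms y[OF that]] by auto
    have "(\<Oplus>\<^bsub>A\<^esub>s\<in>{..<n}. e s \<otimes>\<^bsub>A\<^esub> x \<otimes>\<^bsub>A\<^esub> (f (y s) \<oplus>\<^bsub>A\<^esub> g (y s)))
        = (\<Oplus>\<^bsub>A\<^esub>s\<in>{..<n}. e s \<otimes>\<^bsub>A\<^esub> x \<otimes>\<^bsub>A\<^esub> f (y s) \<oplus>\<^bsub>A\<^esub> e s \<otimes>\<^bsub>A\<^esub> x \<otimes>\<^bsub>A\<^esub> g (y s))"
      by (rule M.finsum_cong') (use add.prems fg e_closed in \<open>auto simp: A.r_distr\<close>)
    also have "\<dots> = (\<Oplus>\<^bsub>A\<^esub>s\<in>{..<n}. e s \<otimes>\<^bsub>A\<^esub> x \<otimes>\<^bsub>A\<^esub> f (y s)) \<oplus>\<^bsub>A\<^esub> (\<Oplus>\<^bsub>A\<^esub>s\<in>{..<n}. e s \<otimes>\<^bsub>A\<^esub> x \<otimes>\<^bsub>A\<^esub> g (y s))"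
      by (rule M.finsum_addf) (use add.prems fg e_closed in auto)
    finally show ?case using add.IH add.prems by simp
  qed
  from this[OF g(1) A.one_closed] have 1: "(\<Oplus>\<^bsub>A\<^esub>s\<in>{..<n}. e s \<otimes>\<^bsub>A\<^esub> \<one>\<^bsub>A\<^esub> \<otimes>\<^bsub>A\<^esub> g (y s)) = \<zero>\<^bsub>A\<^esub>" .
  \<comment> \<open>With \<open>x = 1\<close> and the operator reading off coordinate
    \<open>k\<close>, the vanishing sum becomes a linear combination of the basis whose coefficients
    are the \<open>d k (y s)\<close>.\<close>
  have "(\<Oplus>\<^bsub>A\<^esub>s\<in>{..<n}. d k (y s) \<odot>\<^bsub>A\<^esub> e s) = (\<Oplus>\<^bsub>A\<^esub>s\<in>{..<n}. e s \<otimes>\<^bsub>A\<^esub> \<one>\<^bsub>A\<^esub> \<otimes>\<^bsub>A\<^esub> g (y s))"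
    by (rule M.finsum_cong') (use y e_closed d_closed k in \<open>auto simp: g smult_mult_right\<close>)
  then have "d s (\<Oplus>\<^bsub>A\<^esub>s\<in>{..<n}. d k (y s) \<odot>\<^bsub>A\<^esub> e s) = \<zero>\<^bsub>R\<^esub>" using 1 d_zero s by simp
  moreover have "d s (\<Oplus>\<^bsub>A\<^esub>s\<in>{..<n}. d k (y s) \<odot>\<^bsub>A\<^esub> e s) = d k (y s)"
    by (rule d_combination) (use s k y d_closed in auto)
  ultimately show "d k (y s) = d k \<zero>\<^bsub>A\<^esub>" using d_zero k by simp
qed (use y s in auto)

lemma faithful: "faithful_module R A"
  unfolding faithful_module_def
proof (intro ballI impI)
  fix a assume a: "a \<in> carrier R" "\<forall>x\<in>carrier A. a \<odot>\<^bsub>A\<^esub> x = \<zero>\<^bsub>A\<^esub>"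
  then have "d 0 (a \<odot>\<^bsub>A\<^esub> e 0) = \<zero>\<^bsub>R\<^esub>" using n_pos e_closed d_zero by simp
  then show "a = \<zero>\<^bsub>R\<^esub>" using a(1) n_pos e_closed[of 0] d_smult[of 0 a "e 0"] d_e[of 0 0] by simp
qed

text \<open>The operator attached to a tensor is assembled from its values. It is surjective onto
  the endomorphisms by completeness; it is injective because every tensor has the form of a sum of
  \<open>e s \<otimes> y s\<close>, for which \<open>sandwich_sum_zero\<close> gives
  \<open>y s = 0\<close>.\<close>

theorem azumaya: "azumaya R A"
proof -
  have alg: "assoc_algebra R A" by (rule assoc_algebra_axioms)
  interpret op: assoc_algebra R "opposite_algebra A" by (rule assoc_algebra_opposite[OF alg])
  let ?O = "opposite_algebra A" and ?T = "tensor_algebra R A (opposite_algebra A)"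
  note mods = module_axioms op.module_axioms
  interpret T: ring ?T by (rule ring_tensor_algebra[OF alg op.assoc_algebra_axioms])
  \<comment> \<open>The universal property yields maps into abelian groups; with \<open>A\<close> as
    the target there is one map for each \<open>x\<close>, namely evaluation at \<open>x\<close> of
    the operator attached to a tensor.\<close>
  have "\<forall>x\<in>carrier A. \<exists>h. h \<in> carrier ?T \<rightarrow> carrier A \<and>
     (\<forall>X\<in>carrier ?T. \<forall>Y\<in>carrier ?T. h (X \<oplus>\<^bsub>?T\<^esub> Y) = h X \<oplus>\<^bsub>A\<^esub> h Y) \<and>
     (\<forall>a\<in>carrier A. \<forall>b\<in>carrier A. h (pure_tensor R A ?O a b) = a \<otimes>\<^bsub>A\<^esub> x \<otimes>\<^bsub>A\<^esub> b)"
  proof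
    fix x assume x: "x \<in> carrier A"
    obtain h where "h \<in> carrier ?T \<rightarrow> carrier A"
      "\<And>X Y. \<lbrakk>X \<in> carrier ?T; Y \<in> carrier ?T\<rbrakk> \<Longrightarrow> h (X \<oplus>\<^bsub>?T\<^esub> Y) = h X \<oplus>\<^bsub>A\<^esub> h Y"
      "\<And>a b. \<lbrakk>a \<in> carrier A; b \<in> carrier ?O\<rbrakk> \<Longrightarrow> h (pure_tensor R A ?O a b) = a \<otimes>\<^bsub>A\<^esub> x \<otimes>\<^bsub>A\<^esub> b"
      by (rule tensor_universal[OF mods M.abelian_group_axioms, of "\<lambda>a b. a \<otimes>\<^bsub>A\<^esub> x \<otimes>\<^bsub>A\<^esub> b"])
         (use x in \<open>auto simp: A.l_distr A.r_distr smult_mult_left smult_mult_right\<close>)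
    then show "\<exists>h. h \<in> carrier ?T \<rightarrow> carrier A \<and>
     (\<forall>X\<in>carrier ?T. \<forall>Y\<in>carrier ?T. h (X \<oplus>\<^bsub>?T\<^esub> Y) = h X \<oplus>\<^bsub>A\<^esub> h Y) \<and>
     (\<forall>a\<in>carrier A. \<forall>b\<in>carrier A. h (pure_tensor R A ?O a b) = a \<otimes>\<^bsub>A\<^esub> x \<otimes>\<^bsub>A\<^esub> b)"
      by (intro exI[of _ h]) simp
  qed
  from bchoice[OF this] obtain h where H: "\<forall>x\<in>carrier A. h x \<in> carrier ?T \<rightarrow> carrier A \<and>
     (\<forall>X\<in>carrier ?T. \<forall>Y\<in>carrier ?T. h x (X \<oplus>\<^bsub>?T\<^esub> Y) = h x X \<oplus>\<^bsub>A\<^esub> h x Y) \<and>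
     (\<forall>a\<in>carrier A. \<forall>b\<in>carrier A. h x (pure_tensor R A ?O a b) = a \<otimes>\<^bsub>A\<^esub> x \<otimes>\<^bsub>A\<^esub> b)" ..
  have h: "h x X \<in> carrier A" if "x \<in> carrier A" "X \<in> carrier ?T" for x X
    using bspec[OF H that(1)] that(2) by (simp add: Pi_iff)
  have hadd: "h x (X \<oplus>\<^bsub>?T\<^esub> Y) = h x X \<oplus>\<^bsub>A\<^esub> h x Y" if "x \<in> carrier A" "X \<in> carrier ?T" "Y \<in> carrier ?T" for x X Y
    using bspec[OF H that(1)] that(2,3) by simp
  have hpure: "h x (pure_tensor R A ?O a b) = a \<otimes>\<^bsub>A\<^esub> x \<otimes>\<^bsub>A\<^esub> b"
    if "x \<in> carrier A" "a \<in> carrier A" "b \<in> carrier A" for x a b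
    using bspec[OF H that(1)] that(2,3) by simp
  have hzero: "h x \<zero>\<^bsub>?T\<^esub> = \<zero>\<^bsub>A\<^esub>" if x: "x \<in> carrier A" for x
    by (rule additive_zero[OF T.is_abelian_group M.abelian_group_axioms]) (use x h hadd in auto)
  note pcl = pure_tensor_closed[of _ A _ ?O R, simplified]
  have hlin1: "h (x \<oplus>\<^bsub>A\<^esub> y) X = h x X \<oplus>\<^bsub>A\<^esub> h y X"
    if X: "X \<in> carrier ?T" and xy: "x \<in> carrier A" "y \<in> carrier A" "r \<in> carrier R" for X x y r
    using mods X
  proof (induction X rule: tensor_induct)
    case zero
    then show ?case using xy by (simp add: hzero)
  next
    case (pure a b)
    then show ?case using xy
      by (simp add: hpure A.l_distr A.r_distr smult_mult_left smult_mult_right)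
  next
    case (add X Y)
    then show ?case using xy h[OF xy(1)] h[OF xy(2)] by (simp add: hadd smult_r_distr M.a_ac)
  qed
  have hlin2: "h (r \<odot>\<^bsub>A\<^esub> x) X = r \<odot>\<^bsub>A\<^esub> h x X"
    if X: "X \<in> carrier ?T" and xy: "x \<in> carrier A" "y \<in> carrier A" "r \<in> carrier R" for X x y r
    using mods X
  proof (induction X rule: tensor_induct)
    case zero
    then show ?case using xy by (simp add: hzero)
  next
    case (pure a b)
    then show ?case using xy
      by (simp add: hpure A.l_distr A.r_distr smult_mult_left smult_mult_right)
  next
    case (add X Y)
    then show ?case using xy h[OF xy(1)] h[OF xy(2)] by (simp add: hadd smult_r_distr M.a_ac)
  qed
  \<comment> \<open>Second factors multiply in the opposite order, so \<open>(a a') x (b' b)\<close>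
    is the operator of the first tensor applied after that of the second.\<close>
  have hmult: "h x (X \<otimes>\<^bsub>?T\<^esub> Y) = h (h x Y) X"
    if X: "X \<in> carrier ?T" and Y: "Y \<in> carrier ?T" and x: "x \<in> carrier A" for X Y x
    using mods X
  proof (induction X rule: tensor_induct)
    case zero
    then show ?case using x Y h by (simp add: hzero)
  next
    case (pure a b)
    then have ab: "a \<in> carrier A" "b \<in> carrier A" by simp_all
    have "h x (pure_tensor R A ?O a b \<otimes>\<^bsub>?T\<^esub> Y) = a \<otimes>\<^bsub>A\<^esub> h x Y \<otimes>\<^bsub>A\<^esub> b"
      using mods Y
    proof (induction Y rule: tensor_induct)
      case zero
      then show ?case using x ab pcl by (simp add: hzero)
    next
      case (pure a' b')
      then show ?case
        using ab x pure_tensor_mult[OF alg op.assoc_algebra_axioms, of a b a' b'] by (simp add: hpure A.m_assoc)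
    next
      case (add Y Z)
      then show ?case using ab x pcl h[OF x] by (simp add: T.r_distr hadd A.l_distr A.r_distr)
    qed
    then show ?case using ab h[OF x Y] by (simp add: hpure)
  next
    case (add X Z)
    then show ?case using x Y h[OF x Y] by (simp add: T.l_distr hadd)
  qed
  \<comment> \<open>Expanding first factors in the basis and moving the scalars across the tensor
    sign brings each tensor into the shape required by \<open>sandwich_sum_zero\<close>.\<close>
  have rep: "\<exists>y. (\<forall>s<n. y s \<in> carrier A) \<and> X = (\<Oplus>\<^bsub>?T\<^esub>s\<in>{..<n}. pure_tensor R A ?O (e s) (y s))"
    if X: "X \<in> carrier ?T" for X
    using mods X
  proof (induction X rule: tensor_induct)
    case zero
    have "(\<Oplus>\<^bsub>?T\<^esub>s\<in>{..<n}. pure_tensor R A ?O (e s) \<zero>\<^bsub>A\<^esub>) = (\<Oplus>\<^bsub>?T\<^esub>s\<in>{..<n}. \<zero>\<^bsub>?T\<^esub>)"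
      by (rule T.finsum_cong') (use pure_tensor_zero(2)[OF mods] e_closed in auto)
    then show ?case by (intro exI[of _ "\<lambda>_. \<zero>\<^bsub>A\<^esub>"]) simp
  next
    case (pure a b)
    then have ab: "a \<in> carrier A" "b \<in> carrier A" by simp_all
    have "pure_tensor R A ?O a b = pure_tensor R A ?O (\<Oplus>\<^bsub>A\<^esub>s\<in>{..<n}. d s a \<odot>\<^bsub>A\<^esub> e s) b"
      using expand[OF ab(1)] by simp
    also have "\<dots> = (\<Oplus>\<^bsub>?T\<^esub>s\<in>{..<n}. pure_tensor R A ?O (d s a \<odot>\<^bsub>A\<^esub> e s) b)"
      by (rule additive_finsum[where f = "\<lambda>x. pure_tensor R A ?O x b", OF M.abelian_group_axioms T.is_abelian_group])
         (use ab e_closed d_closed pcl pure_tensor_add_left[OF mods] in auto)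
    also have "\<dots> = (\<Oplus>\<^bsub>?T\<^esub>s\<in>{..<n}. pure_tensor R A ?O (e s) (d s a \<odot>\<^bsub>A\<^esub> b))"
      by (rule T.finsum_cong') (use ab e_closed d_closed pcl pure_tensor_balanced[OF mods] in auto)
    finally show ?case using ab d_closed by (intro exI[of _ "\<lambda>s. d s a \<odot>\<^bsub>A\<^esub> b"]) auto
  next
    case (add X Y)
    from add.IH(1) obtain y where y: "\<forall>s<n. y s \<in> carrier A"
      "X = (\<Oplus>\<^bsub>?T\<^esub>s\<in>{..<n}. pure_tensor R A ?O (e s) (y s))" by (elim exE conjE)
    from add.IH(2) obtain z where z: "\<forall>s<n. z s \<in> carrier A"
      "Y = (\<Oplus>\<^bsub>?T\<^esub>s\<in>{..<n}. pure_tensor R A ?O (e s) (z s))" by (elim exE conjE)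
    have "X \<oplus>\<^bsub>?T\<^esub> Y = (\<Oplus>\<^bsub>?T\<^esub>s\<in>{..<n}. pure_tensor R A ?O (e s) (y s) \<oplus>\<^bsub>?T\<^esub> pure_tensor R A ?O (e s) (z s))"
      unfolding y(2) z(2) by (rule T.finsum_addf[symmetric]) (use y z e_closed pcl in auto)
    also have "\<dots> = (\<Oplus>\<^bsub>?T\<^esub>s\<in>{..<n}. pure_tensor R A ?O (e s) (y s \<oplus>\<^bsub>A\<^esub> z s))"
      by (rule T.finsum_cong') (use y z e_closed pcl pure_tensor_add_right[OF mods] in auto)
    finally show ?case using y z by (intro exI[of _ "\<lambda>s. y s \<oplus>\<^bsub>A\<^esub> z s"]) auto
  qed
  have ker: "X = \<zero>\<^bsub>?T\<^esub>" if X: "X \<in> carrier ?T" and z: "\<And>x. x \<in> carrier A \<Longrightarrow> h x X = \<zero>\<^bsub>A\<^esub>" for X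
  proof -
    from rep[OF X] obtain y where y: "\<forall>s<n. y s \<in> carrier A"
      "X = (\<Oplus>\<^bsub>?T\<^esub>s\<in>{..<n}. pure_tensor R A ?O (e s) (y s))" by (elim exE conjE)
    have sum0: "(\<Oplus>\<^bsub>A\<^esub>s\<in>{..<n}. e s \<otimes>\<^bsub>A\<^esub> x \<otimes>\<^bsub>A\<^esub> y s) = \<zero>\<^bsub>A\<^esub>" if x: "x \<in> carrier A" for x
    proof -
      have "h x X = (\<Oplus>\<^bsub>A\<^esub>s\<in>{..<n}. h x (pure_tensor R A ?O (e s) (y s)))"
        unfolding y(2) by (rule additive_finsum[OF T.is_abelian_group M.abelian_group_axioms])
          (use x h hadd y e_closed pcl in auto)
      also have "\<dots> = (\<Oplus>\<^bsub>A\<^esub>s\<in>{..<n}. e s \<otimes>\<^bsub>A\<^esub> x \<otimes>\<^bsub>A\<^esub> y s)"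
        by (rule M.finsum_cong') (use x y e_closed hpure in auto)
      finally show ?thesis using z[OF x] by simp
    qed
    have ys: "y s = \<zero>\<^bsub>A\<^esub>" if "s < n" for s
      by (rule sandwich_sum_zero[OF _ sum0 that]) (use y(1) in auto)
    have "X = (\<Oplus>\<^bsub>?T\<^esub>s\<in>{..<n}. \<zero>\<^bsub>?T\<^esub>)"
      unfolding y(2) by (rule T.finsum_cong') (use ys pure_tensor_zero(2)[OF mods] e_closed in auto)
    then show ?thesis by simp
  qed
  define \<phi> where "\<phi> X = (\<lambda>x\<in>carrier A. h x X)" for X
  have \<phi>c: "\<phi> X \<in> module_hom R A A" if "X \<in> carrier ?T" for X
    unfolding \<phi>_def using hlin1[OF that] hlin2[OF that] h[OF _ that]
    by (intro module_hom_restrictI) (auto simp: M.abelian_group_axioms)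
  have hom: "\<phi> \<in> ring_hom ?T (endomorphism_ring R A)"
  proof (rule ring_hom_memI)
    fix X assume X: "X \<in> carrier ?T"
    show "\<phi> X \<in> carrier (endomorphism_ring R A)" using \<phi>c[OF X] by (simp add: endomorphism_ring_def)
    fix Y assume Y: "Y \<in> carrier ?T"
    show "\<phi> (X \<otimes>\<^bsub>?T\<^esub> Y) = \<phi> X \<otimes>\<^bsub>endomorphism_ring R A\<^esub> \<phi> Y"
      using hmult[OF X Y] h[OF _ Y] by (auto simp: endomorphism_ring_def \<phi>_def compose_def)
    show "\<phi> (X \<oplus>\<^bsub>?T\<^esub> Y) = \<phi> X \<oplus>\<^bsub>endomorphism_ring R A\<^esub> \<phi> Y"
      using hadd[OF _ X Y] by (auto simp: endomorphism_ring_def \<phi>_def)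
  next
    show "\<phi> \<one>\<^bsub>?T\<^esub> = \<one>\<^bsub>endomorphism_ring R A\<^esub>"
      using hpure[OF _ A.one_closed A.one_closed] by (auto simp: endomorphism_ring_def \<phi>_def tensor_algebra_def)
  qed
  have "inj_on \<phi> (carrier ?T)"
  proof (rule inj_onI)
    fix X Y assume X: "X \<in> carrier ?T" and Y: "Y \<in> carrier ?T" and eq: "\<phi> X = \<phi> Y"
    have hXY: "h x X = h x Y" if "x \<in> carrier A" for x using fun_cong[OF eq, of x] that by (simp add: \<phi>_def)
    have "h x (X \<ominus>\<^bsub>?T\<^esub> Y) = \<zero>\<^bsub>A\<^esub>" if x: "x \<in> carrier A" for x
    proof -
      have "h x (\<ominus>\<^bsub>?T\<^esub> Y) = \<ominus>\<^bsub>A\<^esub> h x Y"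
        by (rule additive_minus[OF T.is_abelian_group M.abelian_group_axioms]) (use x h hadd Y in auto)
      then show ?thesis using x X Y hadd[of x X "\<ominus>\<^bsub>?T\<^esub> Y"] hXY h by (simp add: a_minus_def M.r_neg)
    qed
    then have "X \<ominus>\<^bsub>?T\<^esub> Y = \<zero>\<^bsub>?T\<^esub>" using ker X Y by simp
    then show "X = Y" using X Y by simp
  qed
  moreover have "\<phi> ` carrier ?T = module_hom R A A"
  proof (intro equalityI subsetI)
    fix f assume f: "f \<in> module_hom R A A"
    then obtain g where g: "sandwich A g" "\<forall>x\<in>carrier A. g x = f x"
      using complete unfolding sandwich_complete_def by blast
    from g(1) have "\<exists>X\<in>carrier ?T. \<forall>x\<in>carrier A. h x X = g x"
    proof induction
      case (single a b)
      then show ?case using hpure pcl by (intro bexI[of _ "pure_tensor R A ?O a b"]) auto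
    next
      case (add f g)
      from add.IH obtain X Y where "X \<in> carrier ?T" "Y \<in> carrier ?T"
        "\<forall>x\<in>carrier A. h x X = f x" "\<forall>x\<in>carrier A. h x Y = g x" by (elim bexE)
      then show ?case using hadd by (intro bexI[of _ "X \<oplus>\<^bsub>?T\<^esub> Y"]) auto
    qed
    then obtain X where X: "X \<in> carrier ?T" "\<forall>x\<in>carrier A. h x X = g x" by (elim bexE)
    have "\<phi> X = f" by (rule module_hom_eqI[OF \<phi>c[OF X(1)] f]) (use X g in \<open>auto simp: \<phi>_def\<close>)
    then show "f \<in> \<phi> ` carrier ?T" using X(1) by blast
  qed (use \<phi>c in auto)
  ultimately have "\<phi> \<in> ring_iso ?T (endomorphism_ring R A)"
    using hom by (simp add: ring_iso_def bij_betw_def endomorphism_ring_def)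
  moreover have "\<forall>a\<in>carrier A. \<forall>b\<in>carrier A. \<phi> (pure_tensor R A ?O a b) = (\<lambda>x\<in>carrier A. a \<otimes>\<^bsub>A\<^esub> x \<otimes>\<^bsub>A\<^esub> b)"
    using hpure by (auto simp: \<phi>_def)
  ultimately show ?thesis
    unfolding azumaya_def
    by (intro conjI alg based_finitely_generated[OF R_nontrivial] based_projective[OF R_nontrivial] faithful bexI[of _ \<phi>])
qed

end

context valued_field
begin

text \<open>Over the domain \<open>V\<close> projective modules are torsion-free, and finitely
  generated torsion-free modules over a valuation ring have bases.\<close>

lemma azumaya_based:
  assumes "azumaya R A"
  obtains n e d where "based_algebra R A n e d"
proof -
  have alg: "assoc_algebra R A" and fg: "finitely_generated R A" and pr: "projective_module R A"
    using assms by (simp_all add: azumaya_def)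
  then interpret A: assoc_algebra R A by simp
  have "torsion_free R A" by (rule projective_torsion_free[OF A.module_axioms R.domain_axioms pr])
  then obtain n e d where "based_module R A n e d" using basis_exists[OF A.module_axioms _ fg] by blast
  moreover have "\<one>\<^bsub>A\<^esub> \<noteq> \<zero>\<^bsub>A\<^esub>" using azumaya_nontrivial[OF assms] by simp
  ultimately show thesis
    by (intro that based_algebra.intro based_algebra_axioms.intro alg azumaya_sandwich_complete[OF assms])
qed

end

section \<open>Base change to the field of fractions\<close>

text \<open>A description of the extension of \<open>A\<close> to \<open>K\<close> up to
  isomorphism: \<open>\<iota>\<close> embeds \<open>A\<close>, and every element of \<open>E\<close>
  has a nonzero multiple in the image by a scalar of \<open>V\<close>. The actual base change and
  its copies on other types are both instances.\<close>

locale generic_fibre = valued_field K V + based_algebra "K\<lparr>carrier := V\<rparr>" A n e d + E: assoc_algebra K E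
  for K :: "('k, 'm) ring_scheme" and V :: "'k set" and A :: "('k, 'a) module" and n e d
    and E :: "('k, 'b) module" +
  fixes \<iota> :: "'a \<Rightarrow> 'b"
  assumes \<iota>_hom: "\<iota> \<in> ring_hom A E"
    and \<iota>_smult: "\<lbrakk>c \<in> V; a \<in> carrier A\<rbrakk> \<Longrightarrow> \<iota> (c \<odot>\<^bsub>A\<^esub> a) = c \<odot>\<^bsub>E\<^esub> \<iota> a"
    and \<iota>_inj: "inj_on \<iota> (carrier A)"
    and denominator: "x \<in> carrier E \<Longrightarrow> \<exists>c\<in>V. c \<noteq> \<zero>\<^bsub>K\<^esub> \<and> (\<exists>a\<in>carrier A. c \<odot>\<^bsub>E\<^esub> x = \<iota> a)"
begin

lemma \<iota>_simps:
  "a \<in> carrier A \<Longrightarrow> \<iota> a \<in> carrier E"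
  "\<lbrakk>a \<in> carrier A; b \<in> carrier A\<rbrakk> \<Longrightarrow> \<iota> (a \<otimes>\<^bsub>A\<^esub> b) = \<iota> a \<otimes>\<^bsub>E\<^esub> \<iota> b"
  "\<lbrakk>a \<in> carrier A; b \<in> carrier A\<rbrakk> \<Longrightarrow> \<iota> (a \<oplus>\<^bsub>A\<^esub> b) = \<iota> a \<oplus>\<^bsub>E\<^esub> \<iota> b"
  "\<iota> \<one>\<^bsub>A\<^esub> = \<one>\<^bsub>E\<^esub>"
  using \<iota>_hom by (simp_all add: ring_hom_closed ring_hom_mult ring_hom_add ring_hom_one)

lemma \<iota>_zero: "\<iota> \<zero>\<^bsub>A\<^esub> = \<zero>\<^bsub>E\<^esub>"
  by (rule additive_zero[OF M.abelian_group_axioms E.M.abelian_group_axioms]) (simp_all add: \<iota>_simps)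

lemma \<iota>_finsum: "\<lbrakk>finite I; g \<in> I \<rightarrow> carrier A\<rbrakk> \<Longrightarrow> \<iota> (\<Oplus>\<^bsub>A\<^esub>i\<in>I. g i) = (\<Oplus>\<^bsub>E\<^esub>i\<in>I. \<iota> (g i))"
  by (rule additive_finsum[OF M.abelian_group_axioms E.M.abelian_group_axioms]) (simp_all add: \<iota>_simps)

lemma E_nontrivial: "\<one>\<^bsub>E\<^esub> \<noteq> \<zero>\<^bsub>E\<^esub>"
  using nontrivial inj_onD[OF \<iota>_inj, of "\<one>\<^bsub>A\<^esub>" "\<zero>\<^bsub>A\<^esub>"] by (auto simp: \<iota>_simps \<iota>_zero)

lemma E_cancel:
  assumes "c \<in> carrier K" "c \<noteq> \<zero>\<^bsub>K\<^esub>" "x \<in> carrier E"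
  shows "inv\<^bsub>K\<^esub> c \<in> carrier K" and "inv\<^bsub>K\<^esub> c \<noteq> \<zero>\<^bsub>K\<^esub>" and "inv\<^bsub>K\<^esub> c \<otimes>\<^bsub>K\<^esub> c = \<one>\<^bsub>K\<^esub>"
    and "inv\<^bsub>K\<^esub> c \<odot>\<^bsub>E\<^esub> (c \<odot>\<^bsub>E\<^esub> x) = x" and "c \<odot>\<^bsub>E\<^esub> (inv\<^bsub>K\<^esub> c \<odot>\<^bsub>E\<^esub> x) = x"
proof -
  have u: "c \<in> Units K" using assms K.field_Units by simp
  then show i: "inv\<^bsub>K\<^esub> c \<in> carrier K" and l: "inv\<^bsub>K\<^esub> c \<otimes>\<^bsub>K\<^esub> c = \<one>\<^bsub>K\<^esub>" by simp_all
  show "inv\<^bsub>K\<^esub> c \<noteq> \<zero>\<^bsub>K\<^esub>"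
  proof
    assume "inv\<^bsub>K\<^esub> c = \<zero>\<^bsub>K\<^esub>"
    then show False using l assms(1) by simp
  qed
  show "inv\<^bsub>K\<^esub> c \<odot>\<^bsub>E\<^esub> (c \<odot>\<^bsub>E\<^esub> x) = x"
    using E.smult_assoc1[OF i assms(1,3)] l assms(3) by simp
  show "c \<odot>\<^bsub>E\<^esub> (inv\<^bsub>K\<^esub> c \<odot>\<^bsub>E\<^esub> x) = x"
    using E.smult_assoc1[OF assms(1) i assms(3)] u assms(3) by simp
qed

lemma E_torsion_free: "torsion_free K E"
  unfolding torsion_free_def
proof (intro ballI impI)
  fix c x assume c: "c \<in> carrier K" and x: "x \<in> carrier E" and z: "c \<odot>\<^bsub>E\<^esub> x = \<zero>\<^bsub>E\<^esub>"
  show "c = \<zero>\<^bsub>K\<^esub> \<or> x = \<zero>\<^bsub>E\<^esub>"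
    using E_cancel(4)[OF c _ x] E_cancel(1)[OF c _ x] z by (cases "c = \<zero>\<^bsub>K\<^esub>") simp_all
qed

lemma fraction:
  assumes "x \<in> carrier E"
  obtains c a where "c \<in> carrier K" "c \<noteq> \<zero>\<^bsub>K\<^esub>" "a \<in> carrier A" "x = c \<odot>\<^bsub>E\<^esub> \<iota> a"
proof -
  obtain c a where c: "c \<in> V" "c \<noteq> \<zero>\<^bsub>K\<^esub>" "a \<in> carrier A" "c \<odot>\<^bsub>E\<^esub> x = \<iota> a" using denominator[OF assms] by blast
  have "inv\<^bsub>K\<^esub> c \<odot>\<^bsub>E\<^esub> \<iota> a = x" using E_cancel(4)[OF V_sub[OF c(1)] c(2) assms] c(4) by simp
  then show thesis using that[of "inv\<^bsub>K\<^esub> c" a] E_cancel(1,2)[OF V_sub[OF c(1)] c(2) assms] c(3) by simp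
qed

lemma \<iota>_e_span:
  assumes "x \<in> carrier E"
  obtains c where "\<And>i. i < n \<Longrightarrow> c i \<in> carrier K" "x = (\<Oplus>\<^bsub>E\<^esub>i\<in>{..<n}. c i \<odot>\<^bsub>E\<^esub> \<iota> (e i))"
proof -
  obtain c a where c: "c \<in> carrier K" "a \<in> carrier A" "x = c \<odot>\<^bsub>E\<^esub> \<iota> a" using fraction[OF assms] by metis
  have dV: "d i a \<in> V" if "i < n" for i using d_closed[OF that c(2)] by simp
  have "\<iota> a = \<iota> (\<Oplus>\<^bsub>A\<^esub>i\<in>{..<n}. d i a \<odot>\<^bsub>A\<^esub> e i)" using expand[OF c(2)] by simp
  also have "\<dots> = (\<Oplus>\<^bsub>E\<^esub>i\<in>{..<n}. \<iota> (d i a \<odot>\<^bsub>A\<^esub> e i))"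
    by (rule \<iota>_finsum) (use dV e_closed in auto)
  also have "\<dots> = (\<Oplus>\<^bsub>E\<^esub>i\<in>{..<n}. d i a \<odot>\<^bsub>E\<^esub> \<iota> (e i))"
    by (rule E.M.finsum_cong') (use dV e_closed V_sub in \<open>simp_all add: \<iota>_smult \<iota>_simps Pi_iff\<close>)
  finally have "x = c \<odot>\<^bsub>E\<^esub> (\<Oplus>\<^bsub>E\<^esub>i\<in>{..<n}. d i a \<odot>\<^bsub>E\<^esub> \<iota> (e i))" using c(3) by simp
  also have "\<dots> = (\<Oplus>\<^bsub>E\<^esub>i\<in>{..<n}. c \<odot>\<^bsub>E\<^esub> (d i a \<odot>\<^bsub>E\<^esub> \<iota> (e i)))"
    by (rule E.finsum_smult_ldistr) (use c dV e_closed V_sub in \<open>simp_all add: \<iota>_simps Pi_iff\<close>)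
  also have "\<dots> = (\<Oplus>\<^bsub>E\<^esub>i\<in>{..<n}. (c \<otimes>\<^bsub>K\<^esub> d i a) \<odot>\<^bsub>E\<^esub> \<iota> (e i))"
    by (rule E.M.finsum_cong') (use c dV e_closed V_sub in \<open>simp_all add: E.smult_assoc1 \<iota>_simps Pi_iff\<close>)
  finally show thesis using that[of "\<lambda>i. c \<otimes>\<^bsub>K\<^esub> d i a"] c dV V_sub by simp
qed

lemma E_finitely_generated: "finitely_generated K E"
  unfolding finitely_generated_def
proof (intro exI[of _ "(\<iota> \<circ> e) ` {..<n}"] conjI ballI)
  have inj: "inj_on (\<iota> \<circ> e) {..<n}"
    by (rule comp_inj_on[OF inj_on_e[OF R_nontrivial] inj_on_subset[OF \<iota>_inj]]) (use e_closed in auto)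
  fix x assume "x \<in> carrier E"
  then obtain c where c: "\<And>i. i < n \<Longrightarrow> c i \<in> carrier K" "x = (\<Oplus>\<^bsub>E\<^esub>i\<in>{..<n}. c i \<odot>\<^bsub>E\<^esub> \<iota> (e i))" using \<iota>_e_span by metis
  let ?c = "\<lambda>s. c (inv_into {..<n} (\<iota> \<circ> e) s)"
  have iv: "inv_into {..<n} (\<iota> \<circ> e) ((\<iota> \<circ> e) i) = i" if "i < n" for i using inv_into_f_f[OF inj] that by simp
  have cc: "?c ((\<iota> \<circ> e) i) = c i" if "i < n" for i using iv[OF that] by simp
  have cl: "(\<lambda>i. ?c i \<odot>\<^bsub>E\<^esub> i) \<in> (\<iota> \<circ> e) ` {..<n} \<rightarrow> carrier E"
  proof
    fix s assume "s \<in> (\<iota> \<circ> e) ` {..<n}"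
    then obtain i where "i < n" "s = (\<iota> \<circ> e) i" by auto
    then show "?c s \<odot>\<^bsub>E\<^esub> s \<in> carrier E" using cc c(1) e_closed by (simp add: \<iota>_simps)
  qed
  have "(\<Oplus>\<^bsub>E\<^esub>s\<in>(\<iota> \<circ> e) ` {..<n}. ?c s \<odot>\<^bsub>E\<^esub> s) = (\<Oplus>\<^bsub>E\<^esub>i\<in>{..<n}. ?c ((\<iota> \<circ> e) i) \<odot>\<^bsub>E\<^esub> (\<iota> \<circ> e) i)"
    by (rule E.M.finsum_reindex[OF cl inj])
  also have "\<dots> = x" unfolding c(2)
    by (rule E.M.finsum_cong') (use cc c(1) e_closed in \<open>simp_all add: \<iota>_simps Pi_iff\<close>)
  finally have "x = (\<Oplus>\<^bsub>E\<^esub>s\<in>(\<iota> \<circ> e) ` {..<n}. ?c s \<odot>\<^bsub>E\<^esub> s)" ..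
  moreover have "?c \<in> (\<iota> \<circ> e) ` {..<n} \<rightarrow> carrier K"
  proof
    fix s assume "s \<in> (\<iota> \<circ> e) ` {..<n}"
    then obtain i where "i < n" "s = (\<iota> \<circ> e) i" by auto
    then show "?c s \<in> carrier K" using cc c(1) by simp
  qed
  ultimately show "\<exists>c\<in>(\<iota> \<circ> e) ` {..<n} \<rightarrow> carrier K. x = (\<Oplus>\<^bsub>E\<^esub>s\<in>(\<iota> \<circ> e) ` {..<n}. c s \<odot>\<^bsub>E\<^esub> s)"
    by (rule bexI[of _ ?c])
qed (use e_closed in \<open>auto simp: \<iota>_simps\<close>)

text \<open>The product of the separate denominators works for all elements, as the image of
  \<open>A\<close> is stable under \<open>V\<close>.\<close>

lemma common_denominator:
  fixes m :: nat
  assumes "\<And>i. i < m \<Longrightarrow> x i \<in> carrier E"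
  shows "\<exists>c\<in>V. c \<noteq> \<zero>\<^bsub>K\<^esub> \<and> (\<forall>i<m. c \<odot>\<^bsub>E\<^esub> x i \<in> \<iota> ` carrier A)"
  using assms
proof (induction m)
  case 0
  then show ?case using V_closed(3) by (intro bexI[of _ "\<one>\<^bsub>K\<^esub>"]) auto
next
  case (Suc m)
  then obtain c where c: "c \<in> V" "c \<noteq> \<zero>\<^bsub>K\<^esub>" "\<forall>i<m. c \<odot>\<^bsub>E\<^esub> x i \<in> \<iota> ` carrier A" by auto
  obtain c' a where c': "c' \<in> V" "c' \<noteq> \<zero>\<^bsub>K\<^esub>" "a \<in> carrier A" "c' \<odot>\<^bsub>E\<^esub> x m = \<iota> a"
    using denominator[OF Suc.prems[of m]] by auto
  have im: "r \<odot>\<^bsub>E\<^esub> \<iota> b \<in> \<iota> ` carrier A" if "r \<in> V" "b \<in> carrier A" for r b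
    by (rule image_eqI[where x = "r \<odot>\<^bsub>A\<^esub> b"]) (use \<iota>_smult[OF that] smult_closed[of r b] that in simp_all)
  have "(c \<otimes>\<^bsub>K\<^esub> c') \<odot>\<^bsub>E\<^esub> x i \<in> \<iota> ` carrier A" if i: "i < Suc m" for i
  proof (cases "i = m")
    case True
    then show ?thesis using E.smult_assoc1[of c c' "x m"] c c' Suc.prems[of m] V_sub im[of c a] by simp
  next
    case False
    then have "c \<odot>\<^bsub>E\<^esub> x i \<in> \<iota> ` carrier A" using c(3) i by simp
    then obtain b where b: "b \<in> carrier A" "c \<odot>\<^bsub>E\<^esub> x i = \<iota> b" by (elim imageE)
    have "(c' \<otimes>\<^bsub>K\<^esub> c) \<odot>\<^bsub>E\<^esub> x i \<in> \<iota> ` carrier A"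
      using E.smult_assoc1[of c' c "x i"] c(1) c'(1) Suc.prems[OF i] V_sub b im[of c' b] by simp
    then show ?thesis using K.m_comm[of c c'] c(1) c'(1) V_sub by simp
  qed
  moreover have "c \<otimes>\<^bsub>K\<^esub> c' \<noteq> \<zero>\<^bsub>K\<^esub>" using K.integral[of c c'] c(1,2) c'(1,2) V_sub by auto
  ultimately show ?case using V_closed(6)[OF c(1) c'(1)] by blast
qed

lemma sandwich_lift:
  assumes "sandwich A g"
  shows "\<exists>g'. sandwich E g' \<and> (\<forall>a\<in>carrier A. g' (\<iota> a) = \<iota> (g a))"
  using assms
proof induction
  case (single a b)
  then show ?case
    by (intro exI[of _ "\<lambda>x. \<iota> a \<otimes>\<^bsub>E\<^esub> x \<otimes>\<^bsub>E\<^esub> \<iota> b"] conjI sandwich.single) (simp_all add: \<iota>_simps)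
next
  case (add f g)
  then obtain f' g' where "sandwich E f'" "\<forall>a\<in>carrier A. f' (\<iota> a) = \<iota> (f a)"
    "sandwich E g'" "\<forall>a\<in>carrier A. g' (\<iota> a) = \<iota> (g a)" by blast
  then show ?case using sandwich_closed[OF add.hyps(1) A.ring_axioms] sandwich_closed[OF add.hyps(2) A.ring_axioms]
    by (intro exI[of _ "\<lambda>x. f' x \<oplus>\<^bsub>E\<^esub> g' x"] conjI sandwich.add) (simp_all add: \<iota>_simps)
qed

lemma sandwich_linear:
  assumes "sandwich E g" "x \<in> carrier E" "r \<in> carrier K"
  shows "g (r \<odot>\<^bsub>E\<^esub> x) = r \<odot>\<^bsub>E\<^esub> g x"
  using assms(1)
proof induction
  case (single a b)
  then show ?case using assms by (simp add: E.smult_mult_left E.smult_mult_right)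
next
  case (add f g)
  then show ?case using assms sandwich_closed[OF _ E.A.ring_axioms assms(2)] by (simp add: E.smult_r_distr)
qed

lemma sandwich_smult:
  assumes "sandwich E g" "r \<in> carrier K"
  shows "\<exists>g'. sandwich E g' \<and> (\<forall>x\<in>carrier E. g' x = r \<odot>\<^bsub>E\<^esub> g x)"
  using assms(1)
proof induction
  case (single a b)
  then show ?case using assms(2)
    by (intro exI[of _ "\<lambda>x. (r \<odot>\<^bsub>E\<^esub> a) \<otimes>\<^bsub>E\<^esub> x \<otimes>\<^bsub>E\<^esub> b"] conjI sandwich.single) (simp_all add: E.smult_mult_left)
next
  case (add f g)
  then obtain f' g' where "sandwich E f'" "\<forall>x\<in>carrier E. f' x = r \<odot>\<^bsub>E\<^esub> f x"
    "sandwich E g'" "\<forall>x\<in>carrier E. g' x = r \<odot>\<^bsub>E\<^esub> g x" by blast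
  then show ?case using assms(2) sandwich_closed[OF add.hyps(1) E.A.ring_axioms] sandwich_closed[OF add.hyps(2) E.A.ring_axioms]
    by (intro exI[of _ "\<lambda>x. f' x \<oplus>\<^bsub>E\<^esub> g' x"] conjI sandwich.add) (simp_all add: E.smult_r_distr)
qed

text \<open>After clearing the denominators of the values of \<open>f\<close> on the basis,
  \<open>c f\<close> restricts to a \<open>V\<close>-linear endomorphism of \<open>A\<close>. The
  latter is a sandwich operator; its coefficients are pushed forward by \<open>\<iota>\<close>, and
  the scalar \<open>c\<close> is divided out again.\<close>

lemma E_sandwich_complete: "sandwich_complete K E"
  unfolding sandwich_complete_def
proof
  fix f assume f: "f \<in> module_hom K E E"
  obtain c where c: "c \<in> V" "c \<noteq> \<zero>\<^bsub>K\<^esub>" "\<forall>i<n. c \<odot>\<^bsub>E\<^esub> f (\<iota> (e i)) \<in> \<iota> ` carrier A"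
    using common_denominator[of n "\<lambda>i. f (\<iota> (e i))"] module_homD(2)[OF f] e_closed \<iota>_simps(1) by blast
  have cK: "c \<in> carrier K" using V_sub[OF c(1)] .
  define u where "u i = inv_into (carrier A) \<iota> (c \<odot>\<^bsub>E\<^esub> f (\<iota> (e i)))" for i
  have u: "u i \<in> carrier A" "\<iota> (u i) = c \<odot>\<^bsub>E\<^esub> f (\<iota> (e i))" if "i < n" for i
    using c(3) that unfolding u_def by (simp_all add: inv_into_into f_inv_into_f)
  \<comment> \<open>The restriction of \<open>c f\<close> to \<open>A\<close>, defined by its values
    \<open>u i\<close> on the basis.\<close>
  define g where "g a = (\<Oplus>\<^bsub>A\<^esub>i\<in>{..<n}. d i a \<odot>\<^bsub>A\<^esub> u i)" for a
  have gc: "g a \<in> carrier A" if "a \<in> carrier A" for a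
    unfolding g_def by (rule M.finsum_closed) (use that u d_closed in auto)
  have ig: "\<iota> (g a) = c \<odot>\<^bsub>E\<^esub> f (\<iota> a)" if a: "a \<in> carrier A" for a
  proof -
    have dV: "d i a \<in> V" if "i < n" for i using d_closed[OF that a] by simp
    have "\<iota> (g a) = (\<Oplus>\<^bsub>E\<^esub>i\<in>{..<n}. \<iota> (d i a \<odot>\<^bsub>A\<^esub> u i))"
      unfolding g_def by (rule \<iota>_finsum) (use u dV in auto)
    also have "\<dots> = (\<Oplus>\<^bsub>E\<^esub>i\<in>{..<n}. c \<odot>\<^bsub>E\<^esub> f (\<iota> (d i a \<odot>\<^bsub>A\<^esub> e i)))"
    proof (rule E.M.finsum_cong')
      fix i assume "i \<in> {..<n}"
      then have i: "i < n" by simp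
      have fe: "f (\<iota> (e i)) \<in> carrier E" using module_homD(2)[OF f] e_closed[OF i] \<iota>_simps(1) by simp
      have dK: "d i a \<in> carrier K" using dV[OF i] V_sub by simp
      have "f (\<iota> (d i a \<odot>\<^bsub>A\<^esub> e i)) = d i a \<odot>\<^bsub>E\<^esub> f (\<iota> (e i))"
        using \<iota>_smult[OF dV[OF i] e_closed[OF i]] module_homD(4)[OF f dK] \<iota>_simps(1)[OF e_closed[OF i]] by simp
      then show "\<iota> (d i a \<odot>\<^bsub>A\<^esub> u i) = c \<odot>\<^bsub>E\<^esub> f (\<iota> (d i a \<odot>\<^bsub>A\<^esub> e i))"
        using \<iota>_smult[OF dV[OF i] u(1)[OF i]] u(2)[OF i] E.smult_assoc1[OF dK cK fe] E.smult_assoc1[OF cK dK fe] K.m_comm[OF dK cK]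
        by simp
    next
      show "(\<lambda>i. c \<odot>\<^bsub>E\<^esub> f (\<iota> (d i a \<odot>\<^bsub>A\<^esub> e i))) \<in> {..<n} \<rightarrow> carrier E"
        using cK module_homD(2)[OF f] \<iota>_simps(1) dV e_closed by auto
    qed simp
    also have "\<dots> = c \<odot>\<^bsub>E\<^esub> f (\<iota> (\<Oplus>\<^bsub>A\<^esub>i\<in>{..<n}. d i a \<odot>\<^bsub>A\<^esub> e i))"
      by (rule additive_finsum[symmetric, where f = "\<lambda>x. c \<odot>\<^bsub>E\<^esub> f (\<iota> x)", OF M.abelian_group_axioms E.M.abelian_group_axioms])
         (use cK module_homD(2,3)[OF f] \<iota>_simps(1,3) dV e_closed in \<open>auto simp: E.smult_r_distr\<close>)
    finally show ?thesis using expand[OF a] by simp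
  qed
  have eqI: "a = b" if "a \<in> carrier A" "b \<in> carrier A" "\<iota> a = \<iota> b" for a b using inj_onD[OF \<iota>_inj] that by blast
  have cf: "f (\<iota> a) \<in> carrier E" if "a \<in> carrier A" for a using module_homD(2)[OF f \<iota>_simps(1)[OF that]] .
  \<comment> \<open>The properties of \<open>g\<close> are inherited from \<open>f\<close> after
    applying the injective map \<open>\<iota>\<close>.\<close>
  have g_add: "g (x \<oplus>\<^bsub>A\<^esub> y) = g x \<oplus>\<^bsub>A\<^esub> g y" if xy: "x \<in> carrier A" "y \<in> carrier A" for x y
  proof (rule eqI)
    show "\<iota> (g (x \<oplus>\<^bsub>A\<^esub> y)) = \<iota> (g x \<oplus>\<^bsub>A\<^esub> g y)"
      using xy gc ig cf cK by (simp add: \<iota>_simps module_homD(3)[OF f] E.smult_r_distr)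
  qed (use xy gc in simp_all)
  have g_smult: "g (r \<odot>\<^bsub>A\<^esub> x) = r \<odot>\<^bsub>A\<^esub> g x" if r: "r \<in> carrier R" and x: "x \<in> carrier A" for r x
  proof (rule eqI)
    have rV: "r \<in> V" and rK: "r \<in> carrier K" using r V_sub by simp_all
    show "\<iota> (g (r \<odot>\<^bsub>A\<^esub> x)) = \<iota> (r \<odot>\<^bsub>A\<^esub> g x)"
      using ig[OF smult_closed[OF r x]] ig[OF x] \<iota>_smult[OF rV x] \<iota>_smult[OF rV gc[OF x]]
        module_homD(4)[OF f rK \<iota>_simps(1)[OF x]] E.smult_assoc1[OF rK cK cf[OF x]] E.smult_assoc1[OF cK rK cf[OF x]]
        K.m_comm[OF rK cK] by simp
    show "g (r \<odot>\<^bsub>A\<^esub> x) \<in> carrier A" by (rule gc[OF smult_closed[OF r x]])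
    show "r \<odot>\<^bsub>A\<^esub> g x \<in> carrier A" by (rule smult_closed[OF r gc[OF x]])
  qed
  obtain G where G: "sandwich A G" "\<And>a. a \<in> carrier A \<Longrightarrow> G a = g a"
    by (rule endo_sandwich[OF gc g_add g_smult], assumption+) (rule that)
  obtain G' where G': "sandwich E G'" "\<forall>a\<in>carrier A. G' (\<iota> a) = \<iota> (G a)" using sandwich_lift[OF G(1)] by blast
  \<comment> \<open>Both sides are \<open>K\<close>-linear and agree on the image of
    \<open>A\<close>, of which every element of \<open>E\<close> is a multiple.\<close>
  have "inv\<^bsub>K\<^esub> c \<odot>\<^bsub>E\<^esub> G' x = f x" if x: "x \<in> carrier E" for x
  proof -
    obtain k a where k: "k \<in> carrier K" "a \<in> carrier A" "x = k \<odot>\<^bsub>E\<^esub> \<iota> a" using fraction[OF x] by metis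
    have ia: "\<iota> a \<in> carrier E" using \<iota>_simps(1)[OF k(2)] .
    have "G' x = k \<odot>\<^bsub>E\<^esub> (c \<odot>\<^bsub>E\<^esub> f (\<iota> a))"
      using sandwich_linear[OF G'(1) ia k(1)] G'(2) G(2)[OF k(2)] ig[OF k(2)] k by simp
    also have "\<dots> = c \<odot>\<^bsub>E\<^esub> (k \<odot>\<^bsub>E\<^esub> f (\<iota> a))"
      using E.smult_assoc1[OF k(1) cK cf[OF k(2)]] E.smult_assoc1[OF cK k(1) cf[OF k(2)]] K.m_comm[OF k(1) cK] by simp
    also have "k \<odot>\<^bsub>E\<^esub> f (\<iota> a) = f x" using module_homD(4)[OF f k(1) ia] k(3) by simp
    finally show ?thesis using E_cancel(4)[OF cK c(2) module_homD(2)[OF f x]] by simp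
  qed
  moreover obtain G'' where "sandwich E G''" "\<forall>x\<in>carrier E. G'' x = inv\<^bsub>K\<^esub> c \<odot>\<^bsub>E\<^esub> G' x"
    using sandwich_smult[OF G'(1) E_cancel(1)[OF cK c(2) E.A.one_closed]] by blast
  ultimately show "\<exists>g. sandwich E g \<and> (\<forall>x\<in>carrier E. g x = f x)" by (intro exI[of _ G'']) simp
qed

text \<open>For the trivial valuation ring the theorem on bases applies to \<open>E\<close> as a
  vector space over \<open>K\<close>, so that the criterion for algebras with a basis can be used a
  second time, now over the field.\<close>

lemma E_azumaya: "azumaya K E"
proof -
  interpret KK: valued_field K "carrier K" by (rule valued_field_trivial) (rule K.field_axioms)
  have "module (K\<lparr>carrier := carrier K\<rparr>) E" using E.module_axioms by simp
  moreover have "torsion_free (K\<lparr>carrier := carrier K\<rparr>) E" using E_torsion_free by simp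
  moreover have "finitely_generated (K\<lparr>carrier := carrier K\<rparr>) E" using E_finitely_generated by simp
  ultimately obtain n' e' d' where b: "based_module (K\<lparr>carrier := carrier K\<rparr>) E n' e' d'" using KK.basis_exists by blast
  then have "based_algebra K E n' e' d'"
    by (intro based_algebra.intro based_algebra_axioms.intro E.assoc_algebra_axioms E_nontrivial E_sandwich_complete) simp
  then show ?thesis by (rule based_algebra.azumaya)
qed

text \<open>The only two-sided ideals of \<open>A\<close> are the multiples \<open>c A\<close>.\<close>

lemma primitive_part:
  assumes "a \<in> carrier A" "a \<noteq> \<zero>\<^bsub>A\<^esub>"
  obtains c b g where "c \<in> V" "c \<noteq> \<zero>\<^bsub>K\<^esub>" "b \<in> carrier A" "a = c \<odot>\<^bsub>A\<^esub> b" "sandwich A g" "g b = \<one>\<^bsub>A\<^esub>"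
proof -
  have "\<exists>i<n. d i a \<noteq> \<zero>\<^bsub>K\<^esub>"
  proof (rule ccontr)
    assume "\<not> (\<exists>i<n. d i a \<noteq> \<zero>\<^bsub>K\<^esub>)"
    then have "a = \<zero>\<^bsub>A\<^esub>" by (intro coord_eqI assms(1)) (simp_all add: d_zero)
    then show False using assms(2) by simp
  qed
  then obtain i where i: "i < n" "d i a \<noteq> \<zero>\<^bsub>K\<^esub>" by blast
  have dV: "d j a \<in> V" if "j < n" for j using d_closed[OF that assms(1)] by simp
  have "(\<lambda>j. d j a) \<in> {..<n} \<rightarrow> carrier K" using dV V_sub by auto
  \<comment> \<open>The index \<open>t\<close> is that of a dominant coordinate of \<open>a\<close>.
    Dividing by it gives an element \<open>b\<close> with coordinate \<open>1\<close> at
    \<open>t\<close>, which the operator reading off coordinate \<open>t\<close> sends to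
    \<open>1\<close>.\<close>
  then obtain t q where t: "t < n" "d t a \<noteq> \<zero>\<^bsub>K\<^esub>" "q \<in> {..<n} \<rightarrow> V" "q t = \<one>\<^bsub>K\<^esub>"
    and q: "\<And>s. s < n \<Longrightarrow> d s a = q s \<otimes>\<^bsub>K\<^esub> d t a"
    using dominant_element[of "{..<n}" "\<lambda>j. d j a" i] i by (metis finite_lessThan lessThan_iff)
  have qV: "q s \<in> V" if "s < n" for s using t(3) that by auto
  define b where "b = (\<Oplus>\<^bsub>A\<^esub>s\<in>{..<n}. q s \<odot>\<^bsub>A\<^esub> e s)"
  have b: "b \<in> carrier A" unfolding b_def by (rule M.finsum_closed) (use qV e_closed in auto)
  have db: "d s b = q s" if "s < n" for s unfolding b_def by (rule d_combination) (use that qV in auto)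
  have "a = d t a \<odot>\<^bsub>A\<^esub> b"
  proof (rule coord_eqI)
    fix s assume s: "s < n"
    have "d s (d t a \<odot>\<^bsub>A\<^esub> b) = d t a \<otimes>\<^bsub>K\<^esub> q s" using d_smult[OF s _ b, of "d t a"] dV[OF t(1)] db[OF s] by simp
    then show "d s a = d s (d t a \<odot>\<^bsub>A\<^esub> b)" using q[OF s] K.m_comm[of "d t a" "q s"] dV[OF t(1)] qV[OF s] V_sub by metis
  qed (use assms(1) b dV[OF t(1)] in auto)
  moreover obtain g where "sandwich A g" "\<And>x. x \<in> carrier A \<Longrightarrow> g x = d t x \<odot>\<^bsub>A\<^esub> \<one>\<^bsub>A\<^esub>"
    using coord_sandwich[OF t(1)] by blast
  moreover have "d t b \<odot>\<^bsub>A\<^esub> \<one>\<^bsub>A\<^esub> = \<one>\<^bsub>A\<^esub>" using db[OF t(1)] t(4) smult_one[of "\<one>\<^bsub>A\<^esub>"] by simp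
  ultimately show thesis using that[of "d t a" b g] dV[OF t(1)] t(2) b by simp
qed

text \<open>A nonzero element is a nonzero scalar times the image of some \<open>b\<close> in
  \<open>A\<close> that two-sided multiplications carry to \<open>1\<close>. Lifting these
  multiplications to \<open>E\<close> and dividing by the scalar shows that \<open>E\<close> is a
  simple ring.\<close>

lemma E_simple:
  assumes "z \<in> carrier E" "z \<noteq> \<zero>\<^bsub>E\<^esub>"
  obtains g where "sandwich E g" "g z = \<one>\<^bsub>E\<^esub>"
proof -
  obtain c a where c: "c \<in> carrier K" "c \<noteq> \<zero>\<^bsub>K\<^esub>" "a \<in> carrier A" "z = c \<odot>\<^bsub>E\<^esub> \<iota> a" using fraction[OF assms(1)] .
  have "a \<noteq> \<zero>\<^bsub>A\<^esub>" using c assms(2) by (auto simp: \<iota>_zero)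
  then obtain k b g where k: "k \<in> V" "k \<noteq> \<zero>\<^bsub>K\<^esub>" "b \<in> carrier A" "a = k \<odot>\<^bsub>A\<^esub> b" "sandwich A g" "g b = \<one>\<^bsub>A\<^esub>"
    using primitive_part[OF c(3)] by metis
  have kK: "k \<in> carrier K" using V_sub[OF k(1)] .
  obtain G where G: "sandwich E G" "\<forall>a\<in>carrier A. G (\<iota> a) = \<iota> (g a)" using sandwich_lift[OF k(5)] by blast
  have z: "z = (c \<otimes>\<^bsub>K\<^esub> k) \<odot>\<^bsub>E\<^esub> \<iota> b"
    using c(4) k(4) \<iota>_smult[OF k(1,3)] E.smult_assoc1[OF c(1) kK \<iota>_simps(1)[OF k(3)]] by simp
  have ck: "c \<otimes>\<^bsub>K\<^esub> k \<in> carrier K" "c \<otimes>\<^bsub>K\<^esub> k \<noteq> \<zero>\<^bsub>K\<^esub>" using c kK k(2) K.integral[of c k] by auto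
  have Gz: "G z = (c \<otimes>\<^bsub>K\<^esub> k) \<odot>\<^bsub>E\<^esub> \<one>\<^bsub>E\<^esub>"
    unfolding z using sandwich_linear[OF G(1) \<iota>_simps(1)[OF k(3)] ck(1)] G(2) k(3,6) \<iota>_simps(4) by simp
  obtain G' where G': "sandwich E G'" "\<forall>x\<in>carrier E. G' x = inv\<^bsub>K\<^esub> (c \<otimes>\<^bsub>K\<^esub> k) \<odot>\<^bsub>E\<^esub> G x"
    using sandwich_smult[OF G(1) E_cancel(1)[OF ck E.A.one_closed]] by blast
  have "G' z = \<one>\<^bsub>E\<^esub>" using G'(2) assms(1) Gz E_cancel(4)[OF ck E.A.one_closed] by simp
  then show thesis using that G'(1) by blast
qed

end

subsection \<open>Copies of algebras\<close>

text \<open>Transport of structure along an injection \<open>g\<close>. It moves a base change,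
  whose elements are cosets, to the type of sequences where Brauer classes have their
  elements.\<close>

definition algebra_copy :: "('b \<Rightarrow> 'c) \<Rightarrow> ('r, 'b) module \<Rightarrow> ('r, 'c) module" where
  "algebra_copy g E =
     (let h = inv_into (carrier E) g in
     \<lparr>carrier = g ` carrier E, monoid.mult = (\<lambda>x y. g (h x \<otimes>\<^bsub>E\<^esub> h y)), monoid.one = g \<one>\<^bsub>E\<^esub>,
      ring.zero = g \<zero>\<^bsub>E\<^esub>, ring.add = (\<lambda>x y. g (h x \<oplus>\<^bsub>E\<^esub> h y)), smult = (\<lambda>r x. g (r \<odot>\<^bsub>E\<^esub> h x))\<rparr>)"

lemma algebra_copy_simps:
  assumes "inj_on g (carrier E)"
  shows "carrier (algebra_copy g E) = g ` carrier E"
    "\<one>\<^bsub>algebra_copy g E\<^esub> = g \<one>\<^bsub>E\<^esub>" "\<zero>\<^bsub>algebra_copy g E\<^esub> = g \<zero>\<^bsub>E\<^esub>"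
    "\<lbrakk>x \<in> carrier E; y \<in> carrier E\<rbrakk> \<Longrightarrow> g x \<otimes>\<^bsub>algebra_copy g E\<^esub> g y = g (x \<otimes>\<^bsub>E\<^esub> y)"
    "\<lbrakk>x \<in> carrier E; y \<in> carrier E\<rbrakk> \<Longrightarrow> g x \<oplus>\<^bsub>algebra_copy g E\<^esub> g y = g (x \<oplus>\<^bsub>E\<^esub> y)"
    "x \<in> carrier E \<Longrightarrow> r \<odot>\<^bsub>algebra_copy g E\<^esub> g x = g (r \<odot>\<^bsub>E\<^esub> x)"
  using inv_into_f_f[OF assms] by (simp_all add: algebra_copy_def Let_def)

lemma assoc_algebra_copy:
  assumes E: "assoc_algebra K E" and g: "inj_on g (carrier E)"
  shows "assoc_algebra K (algebra_copy g E)"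
proof -
  interpret E: assoc_algebra K E by fact
  note s = algebra_copy_simps[OF g]
  have ab: "abelian_group (algebra_copy g E)"
  proof (rule abelian_groupI)
    fix x assume "x \<in> carrier (algebra_copy g E)"
    then obtain x' where "x' \<in> carrier E" "x = g x'" by (auto simp: s(1))
    then show "\<exists>y\<in>carrier (algebra_copy g E). y \<oplus>\<^bsub>algebra_copy g E\<^esub> x = \<zero>\<^bsub>algebra_copy g E\<^esub>"
      by (intro bexI[of _ "g (\<ominus>\<^bsub>E\<^esub> x')"]) (simp_all add: s E.M.l_neg)
  qed (auto simp: s E.M.a_ac)
  have mod: "module K (algebra_copy g E)"
    by (rule moduleI[OF E.R.is_cring ab])
       (auto simp: s E.smult_l_distr E.smult_r_distr E.smult_assoc1)
  have mon: "monoid (algebra_copy g E)" by (rule monoidI) (auto simp: s E.A.m_assoc)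
  have "ring (algebra_copy g E)" by (rule ringI[OF ab mon]) (auto simp: s E.A.l_distr E.A.r_distr)
  then show ?thesis
    by (intro assoc_algebra.intro assoc_algebra_axioms.intro mod)
       (auto simp: s E.smult_mult_left E.smult_mult_right)
qed

lemma algebra_iso_copy:
  assumes E: "assoc_algebra K E" and g: "inj_on g (carrier E)"
  shows "algebra_iso K E (algebra_copy g E) g"
proof -
  interpret E: assoc_algebra K E by fact
  note s = algebra_copy_simps[OF g]
  have "g \<in> ring_hom E (algebra_copy g E)" by (rule ring_hom_memI) (simp_all add: s)
  then show ?thesis using g by (simp add: algebra_iso_def ring_iso_def bij_betw_def s)
qed

lemma (in generic_fibre) generic_fibre_copy:
  assumes g: "inj_on g (carrier E)"
  shows "generic_fibre K V A n e d (algebra_copy g E) (g \<circ> \<iota>)"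
proof -
  note s = algebra_copy_simps[OF g]
  have "inj_on (g \<circ> \<iota>) (carrier A)"
    by (rule comp_inj_on[OF \<iota>_inj inj_on_subset[OF g]]) (use \<iota>_simps(1) in auto)
  moreover have "g \<circ> \<iota> \<in> ring_hom A (algebra_copy g E)" by (rule ring_hom_memI) (simp_all add: s \<iota>_simps)
  moreover have "\<exists>c\<in>V. c \<noteq> \<zero>\<^bsub>K\<^esub> \<and> (\<exists>a\<in>carrier A. c \<odot>\<^bsub>algebra_copy g E\<^esub> x = (g \<circ> \<iota>) a)"
    if x: "x \<in> carrier (algebra_copy g E)" for x
  proof -
    obtain y where y: "y \<in> carrier E" "x = g y" using x by (auto simp: s(1))
    obtain c a where "c \<in> V" "c \<noteq> \<zero>\<^bsub>K\<^esub>" "a \<in> carrier A" "c \<odot>\<^bsub>E\<^esub> y = \<iota> a" using denominator[OF y(1)] by blast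
    then show ?thesis using y by (intro bexI[of _ c] conjI bexI[of _ a]) (simp_all add: s)
  qed
  ultimately show ?thesis
    by (intro generic_fibre.intro generic_fibre_axioms.intro valued_field_axioms based_algebra_axioms
        assoc_algebra_copy[OF E.assoc_algebra_axioms g]) (simp_all add: s \<iota>_simps \<iota>_smult)
qed

lemma (in generic_fibre) injection_into_sequences:
  fixes j :: "'a \<Rightarrow> nat \<Rightarrow> 'k"
  assumes j: "inj_on j (carrier A)"
  obtains g :: "'b \<Rightarrow> nat \<Rightarrow> 'k" where "inj_on g (carrier E)"
proof -
  have "\<forall>x\<in>carrier E. \<exists>p. fst p \<in> carrier K \<and> snd p \<in> carrier A \<and> x = fst p \<odot>\<^bsub>E\<^esub> \<iota> (snd p)"
  proof
    fix x assume "x \<in> carrier E"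
    then obtain c a where "c \<in> carrier K" "a \<in> carrier A" "x = c \<odot>\<^bsub>E\<^esub> \<iota> a" using fraction by metis
    then show "\<exists>p. fst p \<in> carrier K \<and> snd p \<in> carrier A \<and> x = fst p \<odot>\<^bsub>E\<^esub> \<iota> (snd p)"
      by (intro exI[of _ "(c, a)"]) simp
  qed
  from bchoice[OF this] obtain p where
    p: "\<forall>x\<in>carrier E. fst (p x) \<in> carrier K \<and> snd (p x) \<in> carrier A \<and> x = fst (p x) \<odot>\<^bsub>E\<^esub> \<iota> (snd (p x))" ..
  \<comment> \<open>Position \<open>0\<close> holds the scalar; the sequence of the element of
    \<open>A\<close> is shifted by one.\<close>
  define g where "g x = (\<lambda>m. case m of 0 \<Rightarrow> fst (p x) | Suc m \<Rightarrow> j (snd (p x)) m)" for x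
  have "inj_on g (carrier E)"
  proof (rule inj_onI)
    fix x y assume x: "x \<in> carrier E" and y: "y \<in> carrier E" and eq: "g x = g y"
    have "fst (p x) = fst (p y)" using fun_cong[OF eq, of 0] by (simp add: g_def)
    moreover have "j (snd (p x)) = j (snd (p y))"
    proof
      fix m show "j (snd (p x)) m = j (snd (p y)) m" using fun_cong[OF eq, of "Suc m"] by (simp add: g_def)
    qed
    then have "snd (p x) = snd (p y)" using inj_onD[OF j] p x y by blast
    ultimately show "x = y" using bspec[OF p x] bspec[OF p y] by metis
  qed
  then show thesis using that by blast
qed

subsection \<open>The base change of an Azumaya algebra\<close>

context valued_field
begin

lemma assoc_algebra_self: "assoc_algebra R (self_algebra K)"
proof -
  have ab: "abelian_group (self_algebra K)"
    by (rule abelian_groupI) (auto simp: self_algebra_def K.a_ac intro: K.l_neg)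
  have mod: "module R (self_algebra K)"
    by (rule moduleI[OF R.is_cring ab]) (auto simp: self_algebra_def V_sub K.l_distr K.r_distr K.m_assoc)
  have mon: "monoid (self_algebra K)"
    by (rule monoidI) (auto simp: self_algebra_def K.m_assoc)
  have "ring (self_algebra K)" by (rule ringI[OF ab mon]) (auto simp: self_algebra_def K.l_distr K.r_distr)
  then show ?thesis
    by (intro assoc_algebra.intro assoc_algebra_axioms.intro mod) (auto simp: self_algebra_def V_sub K.m_ac)
qed

lemma base_change_simps:
  "carrier (base_change R K A) = carrier (tensor_algebra R A (self_algebra K))"
  "x \<otimes>\<^bsub>base_change R K A\<^esub> y = x \<otimes>\<^bsub>tensor_algebra R A (self_algebra K)\<^esub> y"
  "x \<oplus>\<^bsub>base_change R K A\<^esub> y = x \<oplus>\<^bsub>tensor_algebra R A (self_algebra K)\<^esub> y"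
  "\<one>\<^bsub>base_change R K A\<^esub> = \<one>\<^bsub>tensor_algebra R A (self_algebra K)\<^esub>"
  "\<zero>\<^bsub>base_change R K A\<^esub> = \<zero>\<^bsub>tensor_algebra R A (self_algebra K)\<^esub>"
  "c \<odot>\<^bsub>base_change R K A\<^esub> x = pure_tensor R A (self_algebra K) \<one>\<^bsub>A\<^esub> c \<otimes>\<^bsub>tensor_algebra R A (self_algebra K)\<^esub> x"
  by (simp_all add: base_change_def tensor_algebra_def)

lemma self_simps:
  "carrier (self_algebra K) = carrier K" "x \<otimes>\<^bsub>self_algebra K\<^esub> y = x \<otimes>\<^bsub>K\<^esub> y" "x \<oplus>\<^bsub>self_algebra K\<^esub> y = x \<oplus>\<^bsub>K\<^esub> y"
  "\<one>\<^bsub>self_algebra K\<^esub> = \<one>\<^bsub>K\<^esub>" "\<zero>\<^bsub>self_algebra K\<^esub> = \<zero>\<^bsub>K\<^esub>" "r \<odot>\<^bsub>self_algebra K\<^esub> x = r \<otimes>\<^bsub>K\<^esub> x"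
  by (simp_all add: self_algebra_def)

text \<open>The base change satisfies the axioms because the coordinates of \<open>a\<close> can be
  recovered from \<open>a \<otimes> 1\<close>, and because each scalar of \<open>K\<close> either
  lies in \<open>V\<close> or has its inverse there.\<close>

lemma generic_fibre_base_change:
  fixes A :: "('k, 'a) module"
  assumes "based_algebra R A n e d"
  shows "generic_fibre K V A n e d (base_change R K A) (\<lambda>a. pure_tensor R A (self_algebra K) a \<one>\<^bsub>K\<^esub>)"
proof -
  interpret A: based_algebra R A n e d by fact
  let ?S = "self_algebra K"
  let ?T = "tensor_algebra R A ?S" and ?E = "base_change R K A" and ?p = "pure_tensor R A ?S"
  have algs: "assoc_algebra R A" "assoc_algebra R ?S" by (rule A.assoc_algebra_axioms, rule assoc_algebra_self)
  then have mods: "module R A" "module R ?S" by (simp_all add: assoc_algebra_def)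
  interpret T: ring ?T by (rule ring_tensor_algebra[OF algs])
  note s = base_change_simps self_simps
  have pcl: "?p a c \<in> carrier ?T" if "a \<in> carrier A" "c \<in> carrier K" for a c
    by (rule pure_tensor_closed) (use that in \<open>simp_all add: self_simps\<close>)
  have pm: "?p a c \<otimes>\<^bsub>?T\<^esub> ?p b k = ?p (a \<otimes>\<^bsub>A\<^esub> b) (c \<otimes>\<^bsub>K\<^esub> k)"
    if "a \<in> carrier A" "b \<in> carrier A" "c \<in> carrier K" "k \<in> carrier K" for a b c k
    using pure_tensor_mult[OF algs, of a c b k] that by (simp add: self_simps)
  have pl: "?p (a \<oplus>\<^bsub>A\<^esub> b) c = ?p a c \<oplus>\<^bsub>?T\<^esub> ?p b c" if "a \<in> carrier A" "b \<in> carrier A" "c \<in> carrier K" for a b c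
    using pure_tensor_add_left[OF mods, of a b c] that by (simp add: self_simps)
  have pr: "?p a (c \<oplus>\<^bsub>K\<^esub> k) = ?p a c \<oplus>\<^bsub>?T\<^esub> ?p a k" if "a \<in> carrier A" "c \<in> carrier K" "k \<in> carrier K" for a c k
    using pure_tensor_add_right[OF mods, of a c k] that by (simp add: self_simps)
  have pb: "?p (r \<odot>\<^bsub>A\<^esub> a) c = ?p a (r \<otimes>\<^bsub>K\<^esub> c)" if "r \<in> V" "a \<in> carrier A" "c \<in> carrier K" for r a c
    using pure_tensor_balanced[OF mods, of r a c] that by (simp add: self_simps)
  have one: "\<one>\<^bsub>?T\<^esub> = ?p \<one>\<^bsub>A\<^esub> \<one>\<^bsub>K\<^esub>" by (simp add: tensor_algebra_def self_simps)
  have ab: "abelian_group ?E"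
    by (rule abelian_groupI) (auto simp: s T.add.m_ac intro: T.l_neg)
  \<comment> \<open>Scalars act by multiplication with the elements \<open>1 \<otimes> c\<close>, so
    the algebra axioms amount to these being central.\<close>
  have central: "X \<otimes>\<^bsub>?T\<^esub> ?p \<one>\<^bsub>A\<^esub> c = ?p \<one>\<^bsub>A\<^esub> c \<otimes>\<^bsub>?T\<^esub> X" if X: "X \<in> carrier ?T" and c: "c \<in> carrier K" for X c
    using mods X
  proof (induction X rule: tensor_induct)
    case zero
    then show ?case using pcl[OF A.A.one_closed c] by simp
  next
    case (pure a k)
    then show ?case using c K.m_comm[of c k] by (simp add: pm self_simps)
  next
    case (add X Y)
    then show ?case using pcl[OF A.A.one_closed c] by (simp add: T.l_distr T.r_distr)
  qed
  have mod: "module K ?E"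
  proof (rule moduleI[OF K.is_cring ab])
    fix c k x assume "c \<in> carrier K" "k \<in> carrier K" "x \<in> carrier ?E"
    then show "(c \<otimes>\<^bsub>K\<^esub> k) \<odot>\<^bsub>?E\<^esub> x = c \<odot>\<^bsub>?E\<^esub> (k \<odot>\<^bsub>?E\<^esub> x)"
      using pcl[OF A.A.one_closed] pm[of "\<one>\<^bsub>A\<^esub>" "\<one>\<^bsub>A\<^esub>" c k] T.m_assoc[of "?p \<one>\<^bsub>A\<^esub> c" "?p \<one>\<^bsub>A\<^esub> k" x] by (simp add: s)
  next
    fix x assume "x \<in> carrier ?E"
    then show "\<one>\<^bsub>K\<^esub> \<odot>\<^bsub>?E\<^esub> x = x" by (simp add: s flip: one)
  qed (use pcl[OF A.A.one_closed] pr[OF A.A.one_closed] in \<open>simp_all add: s T.l_distr T.r_distr\<close>)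
  have mon: "monoid ?E" by (rule monoidI) (auto simp: s T.m_assoc)
  have "ring ?E" by (rule ringI[OF ab mon]) (auto simp: s T.l_distr T.r_distr)
  then have E: "assoc_algebra K ?E"
  proof (intro assoc_algebra.intro assoc_algebra_axioms.intro mod)
    fix c x y assume c: "c \<in> carrier K" and x: "x \<in> carrier ?E" and y: "y \<in> carrier ?E"
    show "(c \<odot>\<^bsub>?E\<^esub> x) \<otimes>\<^bsub>?E\<^esub> y = c \<odot>\<^bsub>?E\<^esub> (x \<otimes>\<^bsub>?E\<^esub> y)"
      using x y T.m_assoc[OF pcl[OF A.A.one_closed c]] by (simp add: s)
    show "x \<otimes>\<^bsub>?E\<^esub> (c \<odot>\<^bsub>?E\<^esub> y) = c \<odot>\<^bsub>?E\<^esub> (x \<otimes>\<^bsub>?E\<^esub> y)"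
      using x y pcl[OF A.A.one_closed c] central[OF _ c, of x]
        T.m_assoc[of x "?p \<one>\<^bsub>A\<^esub> c" y] T.m_assoc[of "?p \<one>\<^bsub>A\<^esub> c" x y] by (simp add: s)
  qed
  have inj: "inj_on (\<lambda>a. ?p a \<one>\<^bsub>K\<^esub>) (carrier A)"
  proof (rule inj_onI)
    fix a b assume a: "a \<in> carrier A" and b: "b \<in> carrier A" and eq: "?p a \<one>\<^bsub>K\<^esub> = ?p b \<one>\<^bsub>K\<^esub>"
    show "a = b"
    proof (rule A.coord_eqI[OF a b])
      fix i assume i: "i < n"
      have dV: "d i x \<in> V" "d i x \<in> carrier K" if "x \<in> carrier A" for x using A.d_closed[OF i that] V_sub by simp_all
      have bal: "d i (r \<odot>\<^bsub>A\<^esub> x) \<otimes>\<^bsub>K\<^esub> y = d i x \<otimes>\<^bsub>K\<^esub> (r \<otimes>\<^bsub>K\<^esub> y)"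
        if "r \<in> V" "x \<in> carrier A" "y \<in> carrier K" for r x y
        using A.d_smult[OF i, of r x] that dV V_sub by (simp add: K.m_ac)
      \<comment> \<open>The coordinate functional \<open>d i\<close> extended to the tensor product;
        it takes the value \<open>d i a\<close> at \<open>a \<otimes> 1\<close>.\<close>
      obtain h where h: "h \<in> carrier ?T \<rightarrow> carrier K"
        "\<And>X Y. \<lbrakk>X \<in> carrier ?T; Y \<in> carrier ?T\<rbrakk> \<Longrightarrow> h (X \<oplus>\<^bsub>?T\<^esub> Y) = h X \<oplus>\<^bsub>K\<^esub> h Y"
        "\<And>x y. \<lbrakk>x \<in> carrier A; y \<in> carrier ?S\<rbrakk> \<Longrightarrow> h (?p x y) = d i x \<otimes>\<^bsub>K\<^esub> y"
        by (rule tensor_universal[OF mods K.abelian_group_axioms, of "\<lambda>a k. d i a \<otimes>\<^bsub>K\<^esub> k"])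
           (use dV A.d_add[OF i] bal in \<open>simp_all add: self_simps K.l_distr K.r_distr\<close>)
      have "h (?p a \<one>\<^bsub>K\<^esub>) = d i a" "h (?p b \<one>\<^bsub>K\<^esub>) = d i b" using h(3)[of _ "\<one>\<^bsub>K\<^esub>"] a b dV by (simp_all add: self_simps)
      then show "d i a = d i b" using eq by simp
    qed
  qed
  have den: "\<exists>c\<in>V. c \<noteq> \<zero>\<^bsub>K\<^esub> \<and> (\<exists>a\<in>carrier A. c \<odot>\<^bsub>?E\<^esub> x = ?p a \<one>\<^bsub>K\<^esub>)" if x: "x \<in> carrier ?T" for x
    using mods x
  proof (induction x rule: tensor_induct)
    case zero
    have "\<one>\<^bsub>K\<^esub> \<odot>\<^bsub>?E\<^esub> \<zero>\<^bsub>?T\<^esub> = ?p \<zero>\<^bsub>A\<^esub> \<one>\<^bsub>K\<^esub>"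
      using pure_tensor_zero(1)[OF mods, of "\<one>\<^bsub>K\<^esub>"] pcl[OF A.A.one_closed K.one_closed] by (simp add: s)
    then show ?case using V_closed(3) by (intro bexI[of _ "\<one>\<^bsub>K\<^esub>"] conjI bexI[of _ "\<zero>\<^bsub>A\<^esub>"]) simp_all
  next
    case (pure a k)
    then have a: "a \<in> carrier A" and k: "k \<in> carrier K" by (simp_all add: self_simps)
    show ?case
    proof (cases "k \<in> V")
      case True
      have "\<one>\<^bsub>K\<^esub> \<odot>\<^bsub>?E\<^esub> ?p a k = ?p (k \<odot>\<^bsub>A\<^esub> a) \<one>\<^bsub>K\<^esub>"
        using pb[OF True a K.one_closed] pm[of "\<one>\<^bsub>A\<^esub>" a "\<one>\<^bsub>K\<^esub>" k] a k by (simp add: s)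
      then show ?thesis using V_closed(3) A.smult_closed[of k a] True a
        by (intro bexI[of _ "\<one>\<^bsub>K\<^esub>"] conjI bexI[of _ "k \<odot>\<^bsub>A\<^esub> a"]) simp_all
    next
      case False
      then have k0: "k \<noteq> \<zero>\<^bsub>K\<^esub>" using V_closed(2) by auto
      \<comment> \<open>If \<open>k\<close> is outside \<open>V\<close>, its inverse lies in
        \<open>V\<close> and is a denominator of \<open>a \<otimes> k\<close>.\<close>
      then have iV: "inv\<^bsub>K\<^esub> k \<in> V" using valuation k False by (auto simp: valuation_ring_def)
      have u: "k \<in> Units K" using k k0 K.field_Units by simp
      have iz: "inv\<^bsub>K\<^esub> k \<noteq> \<zero>\<^bsub>K\<^esub>"
      proof
        assume "inv\<^bsub>K\<^esub> k = \<zero>\<^bsub>K\<^esub>"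
        then show False using K.Units_l_inv[OF u] k by simp
      qed
      have "inv\<^bsub>K\<^esub> k \<odot>\<^bsub>?E\<^esub> ?p a k = ?p a \<one>\<^bsub>K\<^esub>"
        using pm[of "\<one>\<^bsub>A\<^esub>" a "inv\<^bsub>K\<^esub> k" k] a k u by (simp add: s)
      then show ?thesis using iV iz a by (intro bexI[of _ "inv\<^bsub>K\<^esub> k"] conjI bexI[of _ a]) simp_all
    qed
  next
    case (add X Y)
    interpret E: assoc_algebra K ?E by (rule E)
    from add.IH(1) obtain c a where c: "c \<in> V" "c \<noteq> \<zero>\<^bsub>K\<^esub>" "a \<in> carrier A" "c \<odot>\<^bsub>?E\<^esub> X = ?p a \<one>\<^bsub>K\<^esub>"
      by (elim bexE conjE)
    from add.IH(2) obtain k b where k: "k \<in> V" "k \<noteq> \<zero>\<^bsub>K\<^esub>" "b \<in> carrier A" "k \<odot>\<^bsub>?E\<^esub> Y = ?p b \<one>\<^bsub>K\<^esub>"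
      by (elim bexE conjE)
    have cK: "c \<in> carrier K" "k \<in> carrier K" using c k V_sub by auto
    have XE: "X \<in> carrier ?E" "Y \<in> carrier ?E" using add.hyps by (simp_all add: s)
    have sm: "r \<odot>\<^bsub>?E\<^esub> ?p x \<one>\<^bsub>K\<^esub> = ?p (r \<odot>\<^bsub>A\<^esub> x) \<one>\<^bsub>K\<^esub>" if "r \<in> V" "x \<in> carrier A" for r x
      using pb[OF that K.one_closed] pm[of "\<one>\<^bsub>A\<^esub>" x r "\<one>\<^bsub>K\<^esub>"] that V_sub by (simp add: s)
    have 1: "(c \<otimes>\<^bsub>K\<^esub> k) \<odot>\<^bsub>?E\<^esub> X = ?p (k \<odot>\<^bsub>A\<^esub> a) \<one>\<^bsub>K\<^esub>"
      using E.smult_assoc1[OF cK(2,1) XE(1)] K.m_comm[OF cK] c(4) sm[OF k(1) c(3)] by simp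
    have 2: "(c \<otimes>\<^bsub>K\<^esub> k) \<odot>\<^bsub>?E\<^esub> Y = ?p (c \<odot>\<^bsub>A\<^esub> b) \<one>\<^bsub>K\<^esub>"
      using E.smult_assoc1[OF cK XE(2)] k(4) sm[OF c(1) k(3)] by simp
    have ka: "k \<odot>\<^bsub>A\<^esub> a \<in> carrier A" "c \<odot>\<^bsub>A\<^esub> b \<in> carrier A" using c k A.smult_closed by auto
    have "(c \<otimes>\<^bsub>K\<^esub> k) \<odot>\<^bsub>?E\<^esub> (X \<oplus>\<^bsub>?T\<^esub> Y) = ?p (k \<odot>\<^bsub>A\<^esub> a \<oplus>\<^bsub>A\<^esub> c \<odot>\<^bsub>A\<^esub> b) \<one>\<^bsub>K\<^esub>"
      using E.smult_r_distr[OF K.m_closed[OF cK] XE] 1 2 pl[OF ka K.one_closed] by (simp add: s(3))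
    moreover have "c \<otimes>\<^bsub>K\<^esub> k \<noteq> \<zero>\<^bsub>K\<^esub>" using K.integral[OF _ cK] c(2) k(2) by auto
    ultimately show ?case using V_closed(6)[OF c(1) k(1)] ka
      by (intro bexI[of _ "c \<otimes>\<^bsub>K\<^esub> k"] conjI bexI[of _ "k \<odot>\<^bsub>A\<^esub> a \<oplus>\<^bsub>A\<^esub> c \<odot>\<^bsub>A\<^esub> b"]) simp_all
  qed
  show ?thesis
  proof (intro generic_fibre.intro generic_fibre_axioms.intro valued_field_axioms assms E inj)
    show "(\<lambda>a. ?p a \<one>\<^bsub>K\<^esub>) \<in> ring_hom A ?E"
      by (rule ring_hom_memI) (simp_all add: s pcl pm pl one)
    show "?p (c \<odot>\<^bsub>A\<^esub> a) \<one>\<^bsub>K\<^esub> = c \<odot>\<^bsub>?E\<^esub> ?p a \<one>\<^bsub>K\<^esub>" if "c \<in> V" "a \<in> carrier A" for c a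
      using pb[OF that K.one_closed] pm[of "\<one>\<^bsub>A\<^esub>" a c "\<one>\<^bsub>K\<^esub>"] that V_sub by (simp add: s)
    show "\<exists>c\<in>V. c \<noteq> \<zero>\<^bsub>K\<^esub> \<and> (\<exists>a\<in>carrier A. c \<odot>\<^bsub>?E\<^esub> x = ?p a \<one>\<^bsub>K\<^esub>)" if "x \<in> carrier ?E" for x
      using den that by (simp add: s(1))
  qed
qed

end

section \<open>The bimodule of an equivalence\<close>

lemma linear_functor_zero:
  assumes F: "linear_functor R A B Fo Fm" and M: "left_module A M" and N: "left_module A N"
  shows "Fm M N (\<lambda>x\<in>carrier M. \<zero>\<^bsub>N\<^esub>) = (\<lambda>y\<in>carrier (Fo M). \<zero>\<^bsub>Fo N\<^esub>)"
proof -
  interpret M: left_module A M by fact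
  interpret N: left_module A N by fact
  interpret FN: left_module B "Fo N" by (rule linear_functorD(1)[OF F N])
  let ?z = "\<lambda>x\<in>carrier M. \<zero>\<^bsub>N\<^esub>"
  have z: "?z \<in> module_hom A M N"
    by (rule module_hom_restrictI)
       (simp_all add: M.M.abelian_group_axioms M.smult_closed left_module_smult_zero[OF N])
  have Fz: "Fm M N ?z \<in> module_hom B (Fo M) (Fo N)" by (rule linear_functorD(3)[OF F M N z])
  \<comment> \<open>The zero map is characterised by \<open>z + z = z\<close>, an equation that an
    additive functor preserves.\<close>
  have "(\<lambda>x\<in>carrier M. ?z x \<oplus>\<^bsub>N\<^esub> ?z x) = ?z" by (rule restrict_ext) simp
  then have eq: "Fm M N ?z = (\<lambda>y\<in>carrier (Fo M). Fm M N ?z y \<oplus>\<^bsub>Fo N\<^esub> Fm M N ?z y)"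
    using linear_functorD(4)[OF F M N z z] by simp
  show ?thesis
  proof
    fix y
    show "Fm M N ?z y = (\<lambda>y\<in>carrier (Fo M). \<zero>\<^bsub>Fo N\<^esub>) y"
    proof (cases "y \<in> carrier (Fo M)")
      case True
      then have "Fm M N ?z y = Fm M N ?z y \<oplus>\<^bsub>Fo N\<^esub> Fm M N ?z y" using fun_cong[OF eq, of y] by simp
      then show ?thesis using FN.M.add.r_cancel_one'[OF module_homD(2)[OF Fz True] module_homD(2)[OF Fz True]] True by simp
    next
      case False
      then show ?thesis using fun_cong[OF eq, of y] by simp
    qed
  qed
qed

text \<open>Naturality recovers \<open>f\<close> from \<open>Hm M N f\<close> because the components
  of \<open>\<eta>\<close> are injective. Used for the composite \<open>Go \<circ> Fo\<close>, it
  shows that \<open>Fm\<close> is already injective on morphisms.\<close>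

lemma functor_faithful:
  assumes e: "natural_iso_id A Ho Hm \<eta>" and M: "left_module A M" and N: "left_module A N"
    and f: "f \<in> module_hom A M N" and g: "g \<in> module_hom A M N" and eq: "Hm M N f = Hm M N g"
  shows "f = g"
proof (rule module_hom_eqI[OF f g])
  fix x assume x: "x \<in> carrier M"
  have "\<eta> N (f x) = \<eta> N (g x)"
    using natural_iso_idD(3)[OF e M N f x] natural_iso_idD(3)[OF e M N g x] eq by simp
  moreover have "inj_on (\<eta> N) (carrier N)" using natural_iso_idD(2)[OF e N] by (simp add: bij_betw_def)
  ultimately show "f x = g x" using module_homD(2)[OF f x] module_homD(2)[OF g x] by (simp add: inj_on_eq_iff)
qed

text \<open>The preimage of \<open>h\<close> is \<open>Gm\<close> of \<open>h\<close> conjugated by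
  \<open>\<eta>\<close>. By naturality its image under both functors is the image of
  \<open>h\<close> under \<open>Gm\<close>, and \<open>Gm\<close> is injective on morphisms because
  the other composite is naturally isomorphic to the identity.\<close>

lemma functor_full:
  assumes F: "linear_functor R A B Fo Fm" and G: "linear_functor R B A Go Gm"
    and e: "natural_iso_id A (Go \<circ> Fo) (\<lambda>M N f. Gm (Fo M) (Fo N) (Fm M N f)) \<eta>"
    and e': "natural_iso_id B (Fo \<circ> Go) (\<lambda>M N f. Fm (Go M) (Go N) (Gm M N f)) \<epsilon>"
    and M: "left_module A M" and N: "left_module A N" and h: "h \<in> module_hom B (Fo M) (Fo N)"
  obtains f where "f \<in> module_hom A M N" "Fm M N f = h"
proof -
  note FM = linear_functorD(1)[OF F M] and FN = linear_functorD(1)[OF F N]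
  note GFM = linear_functorD(1)[OF G FM] and GFN = linear_functorD(1)[OF G FN]
  define k where "k = Gm (Fo M) (Fo N) h"
  have k: "k \<in> module_hom A (Go (Fo M)) (Go (Fo N))" unfolding k_def by (rule linear_functorD(3)[OF G FM FN h])
  have \<eta>M: "\<eta> M \<in> module_hom A M (Go (Fo M))" "bij_betw (\<eta> M) (carrier M) (carrier (Go (Fo M)))"
    using natural_iso_idD(1,2)[OF e M] by simp_all
  have \<eta>N: "\<eta> N \<in> module_hom A N (Go (Fo N))" "bij_betw (\<eta> N) (carrier N) (carrier (Go (Fo N)))"
    using natural_iso_idD(1,2)[OF e N] by simp_all
  obtain i where i: "i \<in> module_hom A (Go (Fo N)) N" "\<And>y. y \<in> carrier (Go (Fo N)) \<Longrightarrow> \<eta> N (i y) = y"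
    using module_hom_inv[OF N GFN \<eta>N] by metis
  define f where "f = compose (carrier M) i (compose (carrier M) k (\<eta> M))"
  have f: "f \<in> module_hom A M N" unfolding f_def by (rule module_hom_compose[OF M module_hom_compose[OF M \<eta>M(1) k] i(1)])
  have "Gm (Fo M) (Fo N) (Fm M N f) = k"
  proof (rule module_hom_eqI[OF _ k])
    show "Gm (Fo M) (Fo N) (Fm M N f) \<in> module_hom A (Go (Fo M)) (Go (Fo N))"
      by (rule linear_functorD(3)[OF G FM FN linear_functorD(3)[OF F M N f]])
    fix y assume "y \<in> carrier (Go (Fo M))"
    then obtain x where x: "x \<in> carrier M" "y = \<eta> M x" using \<eta>M(2) unfolding bij_betw_def by blast
    have "Gm (Fo M) (Fo N) (Fm M N f) y = \<eta> N (f x)" using natural_iso_idD(3)[OF e M N f x(1)] x(2) by simp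
    also have "\<dots> = k y" using i(2)[of "k y"] module_homD(2)[OF k] module_homD(2)[OF \<eta>M(1) x(1)] x by (simp add: f_def compose_def)
    finally show "Gm (Fo M) (Fo N) (Fm M N f) y = k y" .
  qed
  then have "Fm M N f = h"
    unfolding k_def by (intro functor_faithful[OF e' FM FN linear_functorD(3)[OF F M N f] h]) simp
  then show thesis using that f by blast
qed

section \<open>Regular modules inside the universe and sums of generators\<close>

definition regular_module :: "('a \<Rightarrow> 'u) \<Rightarrow> ('r, 'a) module \<Rightarrow> ('a, 'u) module" where
  "regular_module g A =
     (let h = inv_into (carrier A) g in
     \<lparr>carrier = g ` carrier A, monoid.mult = undefined, monoid.one = undefined,
      ring.zero = g \<zero>\<^bsub>A\<^esub>, ring.add = (\<lambda>x y. g (h x \<oplus>\<^bsub>A\<^esub> h y)), smult = (\<lambda>a x. g (a \<otimes>\<^bsub>A\<^esub> h x))\<rparr>)"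

lemma regular_module_simps:
  assumes "inj_on g (carrier A)"
  shows "carrier (regular_module g A) = g ` carrier A" "\<zero>\<^bsub>regular_module g A\<^esub> = g \<zero>\<^bsub>A\<^esub>"
    "\<lbrakk>x \<in> carrier A; y \<in> carrier A\<rbrakk> \<Longrightarrow> g x \<oplus>\<^bsub>regular_module g A\<^esub> g y = g (x \<oplus>\<^bsub>A\<^esub> y)"
    "x \<in> carrier A \<Longrightarrow> a \<odot>\<^bsub>regular_module g A\<^esub> g x = g (a \<otimes>\<^bsub>A\<^esub> x)"
  using inv_into_f_f[OF assms] by (simp_all add: regular_module_def Let_def)

lemma left_module_regular:
  assumes A: "ring A" and g: "inj_on g (carrier A)"
  shows "left_module A (regular_module g A)"
proof -
  interpret A: ring A by fact
  note s = regular_module_simps[OF g]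
  have "abelian_group (regular_module g A)"
  proof (rule abelian_groupI)
    fix x assume "x \<in> carrier (regular_module g A)"
    then obtain x' where "x' \<in> carrier A" "x = g x'" by (auto simp: s(1))
    then show "\<exists>y\<in>carrier (regular_module g A). y \<oplus>\<^bsub>regular_module g A\<^esub> x = \<zero>\<^bsub>regular_module g A\<^esub>"
      by (intro bexI[of _ "g (\<ominus>\<^bsub>A\<^esub> x')"]) (simp_all add: s A.l_neg)
  qed (auto simp: s A.add.m_ac)
  then show ?thesis
    by (intro left_module.intro left_module_axioms.intro A) (auto simp: s A.l_distr A.r_distr A.m_assoc)
qed

lemma regular_hom:
  assumes A: "ring A" and g: "inj_on g (carrier A)" and M: "left_module A M" and x: "x \<in> carrier M"
  shows "(\<lambda>y\<in>g ` carrier A. inv_into (carrier A) g y \<odot>\<^bsub>M\<^esub> x) \<in> module_hom A (regular_module g A) M"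
proof -
  interpret A: ring A by fact
  interpret M: left_module A M by fact
  interpret P: left_module A "regular_module g A" by (rule left_module_regular[OF A g])
  note s = regular_module_simps[OF g]
  have "(\<lambda>y\<in>carrier (regular_module g A). inv_into (carrier A) g y \<odot>\<^bsub>M\<^esub> x) \<in> module_hom A (regular_module g A) M"
    by (rule module_hom_restrictI)
       (use x in \<open>auto simp: s inv_into_f_f[OF g] M.smult_closed M.smult_l_distr M.smult_assoc P.M.abelian_group_axioms\<close>)
  then show ?thesis by (simp add: s)
qed

text \<open>The submonoid generated by \<open>X\<close>. In the applications \<open>X\<close> is
  stable under negation, being formed with coefficients from a ring, so that the span is a
  subgroup.\<close>

inductive_set additive_span :: "('b, 'm) ring_scheme \<Rightarrow> 'b set \<Rightarrow> 'b set" for M X where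
  zero: "\<zero>\<^bsub>M\<^esub> \<in> additive_span M X"
| base: "x \<in> X \<Longrightarrow> x \<in> additive_span M X"
| add: "\<lbrakk>x \<in> additive_span M X; y \<in> additive_span M X\<rbrakk> \<Longrightarrow> x \<oplus>\<^bsub>M\<^esub> y \<in> additive_span M X"

lemma additive_span_mono: "\<lbrakk>x \<in> additive_span M X; X \<subseteq> Y\<rbrakk> \<Longrightarrow> x \<in> additive_span M Y"
  by (induction rule: additive_span.induct) (auto intro: additive_span.intros)

lemma additive_span_closed:
  assumes "abelian_group M" "X \<subseteq> carrier M" "x \<in> additive_span M X"
  shows "x \<in> carrier M"
proof -
  interpret abelian_group M by fact
  show ?thesis using assms(3) by induction (use assms(2) in auto)
qed

lemma additive_span_image:
  assumes M: "abelian_group M" and N: "abelian_group N" and X: "X \<subseteq> carrier M" and f: "f \<in> carrier M \<rightarrow> carrier N"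
    and add: "\<And>x y. \<lbrakk>x \<in> carrier M; y \<in> carrier M\<rbrakk> \<Longrightarrow> f (x \<oplus>\<^bsub>M\<^esub> y) = f x \<oplus>\<^bsub>N\<^esub> f y"
    and im: "\<And>x. x \<in> X \<Longrightarrow> f x \<in> additive_span N Y" and x: "x \<in> additive_span M X"
  shows "f x \<in> additive_span N Y"
  using x
proof induction
  case zero
  then show ?case using additive_zero[OF M N f add] additive_span.zero by metis
next
  case (add x y)
  then show ?case using additive_span_closed[OF M X] assms(5) additive_span.add by metis
qed (rule im)

text \<open>
  The image \<open>W\<close> of the regular module is an invertible bimodule. It is finitely generated over \<open>A\<close>:
  if \<open>\<phi>\<close> is a nonzero \<open>B\<close>-linear functional on \<open>W\<close>, then each \<open>w \<mapsto> \<phi>(w) b v\<close> is the action of an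
  element of \<open>A\<close>, and \<open>1\<close> is a sum of elements \<open>\<phi>(w) b\<close>, as \<open>B\<close> is simple.
\<close>

lemma morita_bimodule:
  fixes A :: "('r, 'a) module" and B :: "('r, 'b) module" and u :: "'u itself"
    and jA :: "'a \<Rightarrow> 'u" and jB :: "'b \<Rightarrow> 'u"
  assumes A: "assoc_algebra R A" and B: "assoc_algebra R B" and "morita_equivalent u R A B"
    and A1: "\<one>\<^bsub>A\<^esub> \<noteq> \<zero>\<^bsub>A\<^esub>" and jA: "inj_on jA (carrier A)" and jB: "inj_on jB (carrier B)"
    and simple: "\<And>z. \<lbrakk>z \<in> carrier B; z \<noteq> \<zero>\<^bsub>B\<^esub>\<rbrakk> \<Longrightarrow> \<exists>g. sandwich B g \<and> g z = \<one>\<^bsub>B\<^esub>"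
    and B1: "\<one>\<^bsub>B\<^esub> \<noteq> \<zero>\<^bsub>B\<^esub>"
  obtains W :: "('b, 'u) module" and act :: "'a \<Rightarrow> 'u \<Rightarrow> 'u" and S
  where "left_module B W"
    "\<And>a. a \<in> carrier A \<Longrightarrow> act a \<in> module_hom B W W"
    "\<And>x. x \<in> carrier W \<Longrightarrow> act \<one>\<^bsub>A\<^esub> x = x"
    "\<And>a b x. \<lbrakk>a \<in> carrier A; b \<in> carrier A; x \<in> carrier W\<rbrakk> \<Longrightarrow> act (a \<otimes>\<^bsub>A\<^esub> b) x = act b (act a x)"
    "\<And>a b x. \<lbrakk>a \<in> carrier A; b \<in> carrier A; x \<in> carrier W\<rbrakk> \<Longrightarrow> act (a \<oplus>\<^bsub>A\<^esub> b) x = act a x \<oplus>\<^bsub>W\<^esub> act b x"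
    "\<And>r x. \<lbrakk>r \<in> carrier R; x \<in> carrier W\<rbrakk> \<Longrightarrow> act (r \<odot>\<^bsub>A\<^esub> \<one>\<^bsub>A\<^esub>) x = (r \<odot>\<^bsub>B\<^esub> \<one>\<^bsub>B\<^esub>) \<odot>\<^bsub>W\<^esub> x"
    "\<And>h. h \<in> module_hom B W W \<Longrightarrow> \<exists>a\<in>carrier A. act a = h"
    "\<And>a. \<lbrakk>a \<in> carrier A; \<And>x. x \<in> carrier W \<Longrightarrow> act a x = \<zero>\<^bsub>W\<^esub>\<rbrakk> \<Longrightarrow> a = \<zero>\<^bsub>A\<^esub>"
    "finite S" "S \<subseteq> carrier W"
    "\<And>w. w \<in> carrier W \<Longrightarrow> w \<in> additive_span W {act a s | a s. a \<in> carrier A \<and> s \<in> S}"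
proof (rule morita_equivalentE[OF assms(3)])
  fix Fo :: "('a, 'u) module \<Rightarrow> ('b, 'u) module" and Fm Go Gm \<eta> \<epsilon>
  assume F: "linear_functor R A B Fo Fm" and G: "linear_functor R B A Go Gm"
    and e: "natural_iso_id A (Go \<circ> Fo) (\<lambda>M N f. Gm (Fo M) (Fo N) (Fm M N f)) \<eta>"
    and e': "natural_iso_id B (Fo \<circ> Go) (\<lambda>M N f. Fm (Go M) (Go N) (Gm M N f)) \<epsilon>"
  interpret A: assoc_algebra R A by (rule A)
  interpret B: assoc_algebra R B by (rule B)
  \<comment> \<open>The functors see only modules carried by the universe, so both regular modules
    enter as copies under \<open>jA\<close> and \<open>jB\<close>.\<close>
  define P where "P = regular_module jA A"
  define Q where "Q = regular_module jB B"
  note Ps = regular_module_simps[OF jA, folded P_def] and Qs = regular_module_simps[OF jB, folded Q_def]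
  have P: "left_module A P" unfolding P_def by (rule left_module_regular[OF A.A.ring_axioms jA])
  have Q: "left_module B Q" unfolding Q_def by (rule left_module_regular[OF B.A.ring_axioms jB])
  interpret P: left_module A P by (rule P)
  interpret Q: left_module B Q by (rule Q)
  define W where "W = Fo P"
  have W: "left_module B W" unfolding W_def by (rule linear_functorD(1)[OF F P])
  interpret W: left_module B W by (rule W)
  \<comment> \<open>Right multiplication by \<open>a\<close>. The operator of a product
    \<open>a b\<close> is that of \<open>a\<close> followed by that of \<open>b\<close>, so
    \<open>act\<close> is a right action of \<open>A\<close>.\<close>
  define r where "r a = (\<lambda>y\<in>jA ` carrier A. inv_into (carrier A) jA y \<odot>\<^bsub>P\<^esub> jA a)" for a
  have r: "r a \<in> module_hom A P P" if "a \<in> carrier A" for a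
    unfolding r_def P_def
    by (rule regular_hom[OF A.A.ring_axioms jA P[unfolded P_def]]) (use that in \<open>simp add: regular_module_simps[OF jA]\<close>)
  have rj: "r a (jA x) = jA (x \<otimes>\<^bsub>A\<^esub> a)" if "a \<in> carrier A" "x \<in> carrier A" for a x
    using that inv_into_f_f[OF jA] by (simp add: r_def Ps)
  define act where "act a = Fm P P (r a)" for a
  have act: "act a \<in> module_hom B W W" if "a \<in> carrier A" for a
    unfolding act_def W_def by (rule linear_functorD(3)[OF F P P r[OF that]])
  have req: "r a = h" if "a \<in> carrier A" "h \<in> module_hom A P P" "\<And>x. x \<in> carrier A \<Longrightarrow> h (jA x) = jA (x \<otimes>\<^bsub>A\<^esub> a)" for a h
    by (rule module_hom_eqI[OF r that(2)]) (use that rj in \<open>auto simp: Ps(1)\<close>)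
  have "r \<one>\<^bsub>A\<^esub> = (\<lambda>x\<in>carrier P. x)"
    by (rule req[OF _ module_hom_id[OF P]]) (simp_all add: Ps(1))
  then have act1: "act \<one>\<^bsub>A\<^esub> x = x" if "x \<in> carrier W" for x
    using linear_functorD(2)[OF F P] that by (simp add: act_def W_def)
  have actm: "act (a \<otimes>\<^bsub>A\<^esub> b) x = act b (act a x)" if a: "a \<in> carrier A" and b: "b \<in> carrier A" and x: "x \<in> carrier W" for a b x
  proof -
    have "r (a \<otimes>\<^bsub>A\<^esub> b) = compose (carrier P) (r b) (r a)"
      by (rule req[OF _ module_hom_compose[OF P r[OF a] r[OF b]]])
         (use a b in \<open>simp_all add: Ps(1) rj compose_def A.A.m_assoc\<close>)
    then show ?thesis
      using linear_functorD(6)[OF F P P P r[OF a] r[OF b]] x by (simp add: act_def W_def compose_def)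
  qed
  have acta: "act (a \<oplus>\<^bsub>A\<^esub> b) x = act a x \<oplus>\<^bsub>W\<^esub> act b x" if a: "a \<in> carrier A" and b: "b \<in> carrier A" and x: "x \<in> carrier W" for a b x
  proof -
    have "r (a \<oplus>\<^bsub>A\<^esub> b) = (\<lambda>x\<in>carrier P. r a x \<oplus>\<^bsub>P\<^esub> r b x)"
    proof
      fix y
      show "r (a \<oplus>\<^bsub>A\<^esub> b) y = (\<lambda>x\<in>carrier P. r a x \<oplus>\<^bsub>P\<^esub> r b x) y"
      proof (cases "y \<in> jA ` carrier A")
        case True
        then obtain x where "x \<in> carrier A" "y = jA x" by blast
        then show ?thesis using a b by (simp add: rj Ps A.A.r_distr)
      qed (simp add: r_def Ps(1))
    qed
    then show ?thesis
      using linear_functorD(4)[OF F P P r[OF a] r[OF b]] x by (simp add: act_def W_def)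
  qed
  have actr: "act (c \<odot>\<^bsub>A\<^esub> \<one>\<^bsub>A\<^esub>) x = (c \<odot>\<^bsub>B\<^esub> \<one>\<^bsub>B\<^esub>) \<odot>\<^bsub>W\<^esub> x" if c: "c \<in> carrier R" and x: "x \<in> carrier W" for c x
  proof -
    let ?i = "\<lambda>x\<in>carrier P. x"
    have "r (c \<odot>\<^bsub>A\<^esub> \<one>\<^bsub>A\<^esub>) = (\<lambda>x\<in>carrier P. (c \<odot>\<^bsub>A\<^esub> \<one>\<^bsub>A\<^esub>) \<odot>\<^bsub>P\<^esub> ?i x)"
    proof
      fix y
      show "r (c \<odot>\<^bsub>A\<^esub> \<one>\<^bsub>A\<^esub>) y = (\<lambda>x\<in>carrier P. (c \<odot>\<^bsub>A\<^esub> \<one>\<^bsub>A\<^esub>) \<odot>\<^bsub>P\<^esub> ?i x) y"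
      proof (cases "y \<in> jA ` carrier A")
        case True
        then obtain x where "x \<in> carrier A" "y = jA x" by blast
        then show ?thesis using c by (simp add: rj Ps A.smult_mult_left A.smult_mult_right)
      qed (simp add: r_def Ps(1))
    qed
    then show ?thesis
      using linear_functorD(5)[OF F P P module_hom_id[OF P] c] linear_functorD(2)[OF F P] x by (simp add: act_def W_def)
  qed
  \<comment> \<open>By \<open>functor_full\<close> an endomorphism of \<open>W\<close> comes from
    one of the regular module, and the latter is right multiplication by the image of
    \<open>1\<close>.\<close>
  have full: "\<exists>a\<in>carrier A. act a = h" if h: "h \<in> module_hom B W W" for h
  proof -
    obtain f where f: "f \<in> module_hom A P P" "Fm P P f = h"
      using functor_full[OF F G e e' P P h[unfolded W_def]] .
    have "jA \<one>\<^bsub>A\<^esub> \<in> carrier P" by (simp add: Ps(1))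
    then have "f (jA \<one>\<^bsub>A\<^esub>) \<in> jA ` carrier A" using module_homD(2)[OF f(1)] by (simp add: Ps(1))
    then obtain a where a: "a \<in> carrier A" "f (jA \<one>\<^bsub>A\<^esub>) = jA a" by blast
    have "f (jA x) = jA (x \<otimes>\<^bsub>A\<^esub> a)" if x: "x \<in> carrier A" for x
      using module_homD(4)[OF f(1) x \<open>jA \<one>\<^bsub>A\<^esub> \<in> carrier P\<close>] x a by (simp add: Ps)
    then have "r a = f" by (intro req[OF a(1) f(1)])
    then show ?thesis using a(1) f(2) by (intro bexI[of _ a]) (simp_all add: act_def)
  qed
  have zhom: "(\<lambda>x\<in>carrier P. \<zero>\<^bsub>N\<^esub>) \<in> module_hom A P N" if N: "left_module A N" for N
  proof -
    interpret N: left_module A N by (rule N)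
    show ?thesis
      by (rule module_hom_restrictI)
         (simp_all add: P.M.abelian_group_axioms P.smult_closed left_module_smult_zero[OF N])
  qed
  have faithful: "a = \<zero>\<^bsub>A\<^esub>" if a: "a \<in> carrier A" and z: "\<And>x. x \<in> carrier W \<Longrightarrow> act a x = \<zero>\<^bsub>W\<^esub>" for a
  proof -
    have "Fm P P (r a) = Fm P P (\<lambda>x\<in>carrier P. \<zero>\<^bsub>P\<^esub>)"
      unfolding linear_functor_zero[OF F P P]
    proof (rule module_hom_eqI[OF linear_functorD(3)[OF F P P r[OF a]]])
      show "(\<lambda>y\<in>carrier (Fo P). \<zero>\<^bsub>Fo P\<^esub>) \<in> module_hom B (Fo P) (Fo P)"
        using linear_functorD(3)[OF F P P zhom[OF P]] unfolding linear_functor_zero[OF F P P] .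
    qed (use z in \<open>simp add: act_def W_def\<close>)
    then have "r a = (\<lambda>x\<in>carrier P. \<zero>\<^bsub>P\<^esub>)" by (intro functor_faithful[OF e P P r[OF a] zhom[OF P]]) simp
    then have "jA a = jA \<zero>\<^bsub>A\<^esub>" using rj[OF a A.A.one_closed] a by (simp add: Ps(1,2))
    then show ?thesis using inj_onD[OF jA] a by simp
  qed
  \<comment> \<open>Otherwise the identity and the zero map of \<open>Q\<close> would have the same
    image under the functor, and \<open>1 = 0\<close> in \<open>B\<close>.\<close>
  have "\<exists>x\<in>carrier (Go Q). x \<noteq> \<zero>\<^bsub>Go Q\<^esub>"
  proof (rule ccontr)
    assume "\<not> ?thesis"
    then have z: "\<And>x. x \<in> carrier (Go Q) \<Longrightarrow> x = \<zero>\<^bsub>Go Q\<^esub>" by blast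
    have zQ: "(\<lambda>x\<in>carrier Q. \<zero>\<^bsub>Q\<^esub>) \<in> module_hom B Q Q"
      by (rule module_hom_restrictI) (simp_all add: Q.M.abelian_group_axioms Q.smult_closed left_module_smult_zero[OF Q])
    have "Gm Q Q (\<lambda>x\<in>carrier Q. x) = Gm Q Q (\<lambda>x\<in>carrier Q. \<zero>\<^bsub>Q\<^esub>)"
      unfolding linear_functorD(2)[OF G Q] linear_functor_zero[OF G Q Q] by (rule restrict_ext) (rule z)
    then have "(\<lambda>x\<in>carrier Q. x) = (\<lambda>x\<in>carrier Q. \<zero>\<^bsub>Q\<^esub>)"
      by (intro functor_faithful[OF e' Q Q module_hom_id[OF Q] zQ]) simp
    from fun_cong[OF this, of "jB \<one>\<^bsub>B\<^esub>"] have "jB \<one>\<^bsub>B\<^esub> = jB \<zero>\<^bsub>B\<^esub>" by (simp add: Qs(1,2))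
    then show False using inj_onD[OF jB] B1 by simp
  qed
  then obtain x0 where x0: "x0 \<in> carrier (Go Q)" "x0 \<noteq> \<zero>\<^bsub>Go Q\<^esub>" by blast
  have GQ: "left_module A (Go Q)" by (rule linear_functorD(1)[OF G Q])
  then interpret GQ: left_module A "Go Q" .
  have FGQ: "left_module B (Fo (Go Q))" by (rule linear_functorD(1)[OF F GQ])
  \<comment> \<open>The map with \<open>1 \<mapsto> x0\<close>. It is nonzero, so its image under
    the functor is nonzero, and followed by the inverse \<open>i\<close> of the counit at
    \<open>Q\<close> it becomes a nonzero functional on \<open>W\<close>.\<close>
  define t where "t = (\<lambda>y\<in>jA ` carrier A. inv_into (carrier A) jA y \<odot>\<^bsub>Go Q\<^esub> x0)"
  have t: "t \<in> module_hom A P (Go Q)"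
    unfolding t_def P_def by (rule regular_hom[OF A.A.ring_axioms jA GQ x0(1)])
  have t1: "t (jA \<one>\<^bsub>A\<^esub>) = x0" using inv_into_f_f[OF jA] x0(1) by (simp add: t_def GQ.smult_one)
  have Ft: "Fm P (Go Q) t \<in> module_hom B W (Fo (Go Q))" unfolding W_def by (rule linear_functorD(3)[OF F P GQ t])
  have "\<exists>w\<in>carrier W. Fm P (Go Q) t w \<noteq> \<zero>\<^bsub>Fo (Go Q)\<^esub>"
  proof (rule ccontr)
    assume "\<not> ?thesis"
    then have "Fm P (Go Q) t = Fm P (Go Q) (\<lambda>x\<in>carrier P. \<zero>\<^bsub>Go Q\<^esub>)"
      unfolding linear_functor_zero[OF F P GQ]
      using Ft linear_functorD(3)[OF F P GQ zhom[OF GQ], unfolded linear_functor_zero[OF F P GQ]]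
      by (intro module_hom_eqI[of _ B W "Fo (Go Q)"]) (simp_all add: W_def)
    then have "t = (\<lambda>x\<in>carrier P. \<zero>\<^bsub>Go Q\<^esub>)" by (intro functor_faithful[OF e P GQ t zhom[OF GQ]]) simp
    then show False using t1 x0(2) by (simp add: Ps(1))
  qed
  then obtain w0 where w0: "w0 \<in> carrier W" "Fm P (Go Q) t w0 \<noteq> \<zero>\<^bsub>Fo (Go Q)\<^esub>" by blast
  have \<epsilon>Q: "\<epsilon> Q \<in> module_hom B Q (Fo (Go Q))" "bij_betw (\<epsilon> Q) (carrier Q) (carrier (Fo (Go Q)))"
    using natural_iso_idD(1,2)[OF e' Q] by simp_all
  obtain i where i: "i \<in> module_hom B (Fo (Go Q)) Q" "bij_betw i (carrier (Fo (Go Q))) (carrier Q)"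
    using module_hom_inv[OF Q FGQ \<epsilon>Q] by metis
  define \<phi>0 where "\<phi>0 = compose (carrier W) i (Fm P (Go Q) t)"
  have \<phi>0: "\<phi>0 \<in> module_hom B W Q" unfolding \<phi>0_def by (rule module_hom_compose[OF W Ft i(1)])
  define \<phi> where "\<phi> w = inv_into (carrier B) jB (\<phi>0 w)" for w
  have \<phi>j: "jB (\<phi> w) = \<phi>0 w" "\<phi> w \<in> carrier B" if "w \<in> carrier W" for w
  proof -
    have "\<phi>0 w \<in> jB ` carrier B" using module_homD(2)[OF \<phi>0 that] by (simp add: Qs(1))
    then show "jB (\<phi> w) = \<phi>0 w" "\<phi> w \<in> carrier B" unfolding \<phi>_def by (simp_all add: f_inv_into_f inv_into_into)
  qed
  have \<phi>add: "\<phi> (x \<oplus>\<^bsub>W\<^esub> y) = \<phi> x \<oplus>\<^bsub>B\<^esub> \<phi> y" if "x \<in> carrier W" "y \<in> carrier W" for x y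
  proof (rule inj_onD[OF jB])
    show "jB (\<phi> (x \<oplus>\<^bsub>W\<^esub> y)) = jB (\<phi> x \<oplus>\<^bsub>B\<^esub> \<phi> y)"
      using \<phi>j[OF that(1)] \<phi>j[OF that(2)] \<phi>j(1)[OF W.M.a_closed[OF that]] module_homD(3)[OF \<phi>0 that] Qs(3)[of "\<phi> x" "\<phi> y"] by simp
  qed (use \<phi>j that in simp_all)
  have \<phi>smult: "\<phi> (b \<odot>\<^bsub>W\<^esub> x) = b \<otimes>\<^bsub>B\<^esub> \<phi> x" if "b \<in> carrier B" "x \<in> carrier W" for b x
  proof (rule inj_onD[OF jB])
    show "jB (\<phi> (b \<odot>\<^bsub>W\<^esub> x)) = jB (b \<otimes>\<^bsub>B\<^esub> \<phi> x)"
      using \<phi>j[OF that(2)] \<phi>j(1)[OF W.smult_closed[OF that]] module_homD(4)[OF \<phi>0 that] Qs(4)[of "\<phi> x" b] by simp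
  qed (use \<phi>j that W.smult_closed in simp_all)
  have "\<phi> w0 \<noteq> \<zero>\<^bsub>B\<^esub>"
  proof
    assume "\<phi> w0 = \<zero>\<^bsub>B\<^esub>"
    then have "\<phi>0 w0 = \<zero>\<^bsub>Q\<^esub>" using \<phi>j(1)[OF w0(1)] by (simp add: Qs(2))
    then have "i (Fm P (Go Q) t w0) = i \<zero>\<^bsub>Fo (Go Q)\<^esub>"
      using w0(1) module_hom_zero[OF FGQ Q i(1)] by (simp add: \<phi>0_def compose_def)
    moreover have "\<zero>\<^bsub>Fo (Go Q)\<^esub> \<in> carrier (Fo (Go Q))"
      using FGQ by (simp add: left_module_def abelian_group_def abelian_monoid.zero_closed)
    ultimately show False using inj_onD[OF bij_betw_imp_inj_on[OF i(2)]] module_homD(2)[OF Ft w0(1)] w0(2) by blast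
  qed
  then obtain g where g: "sandwich B g" "g (\<phi> w0) = \<one>\<^bsub>B\<^esub>" using simple[OF \<phi>j(2)[OF w0(1)]] by blast
  let ?X = "\<lambda>S. {act a s | a s. a \<in> carrier A \<and> s \<in> S}"
  \<comment> \<open>The set \<open>S\<close> collects the translates \<open>x w0\<close> for the
    left factors \<open>x\<close> of the operator \<open>g\<close>. Sums of operators take unions of
    such sets, and \<open>g (\<phi> w0) = 1\<close> turns the statement into generation of
    \<open>W\<close>.\<close>
  have "\<exists>S. finite S \<and> S \<subseteq> carrier W \<and> (\<forall>v\<in>carrier W. g (\<phi> w0) \<odot>\<^bsub>W\<^esub> v \<in> additive_span W (?X S))"
    using g(1)
  proof induction
    case (single x y)
    have "(x \<otimes>\<^bsub>B\<^esub> \<phi> w0 \<otimes>\<^bsub>B\<^esub> y) \<odot>\<^bsub>W\<^esub> v \<in> additive_span W (?X {x \<odot>\<^bsub>W\<^esub> w0})" if v: "v \<in> carrier W" for v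
    proof -
      have "(\<lambda>w\<in>carrier W. \<phi> w \<odot>\<^bsub>W\<^esub> (y \<odot>\<^bsub>W\<^esub> v)) \<in> module_hom B W W"
        by (rule module_hom_restrictI)
           (use v single \<phi>j(2) in \<open>simp_all add: W.M.abelian_group_axioms W.smult_closed \<phi>add \<phi>smult W.smult_l_distr W.smult_assoc\<close>)
      then obtain a where a: "a \<in> carrier A" "act a = (\<lambda>w\<in>carrier W. \<phi> w \<odot>\<^bsub>W\<^esub> (y \<odot>\<^bsub>W\<^esub> v))" using full by blast
      have "act a (x \<odot>\<^bsub>W\<^esub> w0) = (x \<otimes>\<^bsub>B\<^esub> \<phi> w0 \<otimes>\<^bsub>B\<^esub> y) \<odot>\<^bsub>W\<^esub> v"
        using a(2) single w0(1) v \<phi>j(2)[OF w0(1)] by (simp add: W.smult_closed \<phi>smult W.smult_assoc)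
      then show ?thesis using a(1) by (intro additive_span.base) force
    qed
    then show ?case using single w0(1) by (intro exI[of _ "{x \<odot>\<^bsub>W\<^esub> w0}"] conjI ballI) (simp_all add: W.smult_closed)
  next
    case (add f g)
    from add.IH obtain S S' where S: "finite S" "S \<subseteq> carrier W" "\<forall>v\<in>carrier W. f (\<phi> w0) \<odot>\<^bsub>W\<^esub> v \<in> additive_span W (?X S)"
      and S': "finite S'" "S' \<subseteq> carrier W" "\<forall>v\<in>carrier W. g (\<phi> w0) \<odot>\<^bsub>W\<^esub> v \<in> additive_span W (?X S')"
      by (elim exE conjE)
    have fg: "f (\<phi> w0) \<in> carrier B" "g (\<phi> w0) \<in> carrier B"
      using sandwich_closed[OF add.hyps(1) B.A.ring_axioms] sandwich_closed[OF add.hyps(2) B.A.ring_axioms] \<phi>j(2)[OF w0(1)] by auto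
    have "(f (\<phi> w0) \<oplus>\<^bsub>B\<^esub> g (\<phi> w0)) \<odot>\<^bsub>W\<^esub> v \<in> additive_span W (?X (S \<union> S'))" if v: "v \<in> carrier W" for v
    proof -
      have "f (\<phi> w0) \<odot>\<^bsub>W\<^esub> v \<in> additive_span W (?X (S \<union> S'))"
        by (rule additive_span_mono[OF bspec[OF S(3) v]]) blast
      moreover have "g (\<phi> w0) \<odot>\<^bsub>W\<^esub> v \<in> additive_span W (?X (S \<union> S'))"
        by (rule additive_span_mono[OF bspec[OF S'(3) v]]) blast
      ultimately show ?thesis unfolding W.smult_l_distr[OF fg v] by (rule additive_span.add)
    qed
    then show ?case using S S' by (intro exI[of _ "S \<union> S'"] conjI ballI) simp_all
  qed
  then obtain S where S: "finite S" "S \<subseteq> carrier W" "\<forall>v\<in>carrier W. g (\<phi> w0) \<odot>\<^bsub>W\<^esub> v \<in> additive_span W (?X S)"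
    by (elim exE conjE)
  have span: "v \<in> additive_span W (?X S)" if "v \<in> carrier W" for v
    using bspec[OF S(3) that] g(2) that by (simp add: W.smult_one)
  show thesis
  proof (rule that[of W act S])
    show "a = \<zero>\<^bsub>A\<^esub>" if "a \<in> carrier A" "\<And>x. x \<in> carrier W \<Longrightarrow> act a x = \<zero>\<^bsub>W\<^esub>" for a
      using that by (rule faithful)
  qed (simp_all add: W act act1 actm acta actr full S(1,2) span)
qed

section \<open>A lattice in the bimodule\<close>

text \<open>Repeated uses of the same generator are collected by adding their coefficients, which
  gives a sum over the set \<open>T\<close> with one coefficient per element.\<close>

lemma additive_span_combination:
  assumes M: "module R M" and T: "finite T" "T \<subseteq> carrier M"
    and x: "x \<in> additive_span M {c \<odot>\<^bsub>M\<^esub> t | c t. c \<in> carrier R \<and> t \<in> T}"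
  shows "\<exists>c\<in>T \<rightarrow> carrier R. x = (\<Oplus>\<^bsub>M\<^esub>t\<in>T. c t \<odot>\<^bsub>M\<^esub> t)"
proof -
  interpret M: module R M by (rule M)
  have cl: "(\<lambda>t. c t \<odot>\<^bsub>M\<^esub> t) \<in> T \<rightarrow> carrier M" if "c \<in> T \<rightarrow> carrier R" for c
    using that T(2) M.smult_closed by (auto simp: Pi_iff subset_iff)
  from x show ?thesis
  proof induction
    case zero
    have "(\<Oplus>\<^bsub>M\<^esub>t\<in>T. \<zero>\<^bsub>R\<^esub> \<odot>\<^bsub>M\<^esub> t) = (\<Oplus>\<^bsub>M\<^esub>t\<in>T. \<zero>\<^bsub>M\<^esub>)"
      by (rule M.M.finsum_cong') (use T(2) in auto)
    then show ?case by (intro bexI[of _ "\<lambda>_. \<zero>\<^bsub>R\<^esub>"]) simp_all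
  next
    case (base x)
    then obtain c s where c: "x = c \<odot>\<^bsub>M\<^esub> s" "c \<in> carrier R" "s \<in> T" by auto
    let ?c = "\<lambda>t. if t = s then c else \<zero>\<^bsub>R\<^esub>"
    have "(\<Oplus>\<^bsub>M\<^esub>t\<in>T. ?c t \<odot>\<^bsub>M\<^esub> t) = (\<Oplus>\<^bsub>M\<^esub>t\<in>T. if t = s then c \<odot>\<^bsub>M\<^esub> t else \<zero>\<^bsub>M\<^esub>)"
      by (rule M.M.finsum_cong') (use T(2) c in auto)
    also have "\<dots> = x" using M.M.finsum_delta[OF T(1) c(3), of "\<lambda>t. c \<odot>\<^bsub>M\<^esub> t"] c T(2) by auto
    finally show ?case using c(2) by (intro bexI[of _ ?c]) simp_all
  next
    case (add x y)
    from add.IH obtain c k where c: "c \<in> T \<rightarrow> carrier R" "x = (\<Oplus>\<^bsub>M\<^esub>t\<in>T. c t \<odot>\<^bsub>M\<^esub> t)"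
      and k: "k \<in> T \<rightarrow> carrier R" "y = (\<Oplus>\<^bsub>M\<^esub>t\<in>T. k t \<odot>\<^bsub>M\<^esub> t)" by (elim bexE)
    have "x \<oplus>\<^bsub>M\<^esub> y = (\<Oplus>\<^bsub>M\<^esub>t\<in>T. c t \<odot>\<^bsub>M\<^esub> t \<oplus>\<^bsub>M\<^esub> k t \<odot>\<^bsub>M\<^esub> t)"
      unfolding c(2) k(2) by (rule M.M.finsum_addf[symmetric]) (rule cl[OF c(1)], rule cl[OF k(1)])
    also have "\<dots> = (\<Oplus>\<^bsub>M\<^esub>t\<in>T. (c t \<oplus>\<^bsub>R\<^esub> k t) \<odot>\<^bsub>M\<^esub> t)"
      by (rule M.M.finsum_cong') (use c(1) k(1) T(2) in \<open>auto simp: M.smult_l_distr Pi_iff subset_iff\<close>)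
    finally show ?case using c(1) k(1) by (intro bexI[of _ "\<lambda>t. c t \<oplus>\<^bsub>R\<^esub> k t"]) (auto simp: Pi_iff)
  qed
qed

lemma additive_span_finsum:
  assumes "abelian_group M" "X \<subseteq> carrier M" "finite I" "\<And>i. i \<in> I \<Longrightarrow> g i \<in> additive_span M X"
  shows "(\<Oplus>\<^bsub>M\<^esub>i\<in>I. g i) \<in> additive_span M X"
  using assms(3,4)
proof (induction I rule: finite_induct)
  interpret abelian_group M by fact
  case empty
  then show ?case by (simp add: additive_span.zero)
next
  interpret abelian_group M by fact
  case (insert i I)
  have "g \<in> I \<rightarrow> carrier M" "g i \<in> carrier M" using insert.prems additive_span_closed[OF assms(1,2)] by auto
  then show ?case using insert by (simp add: finsum_insert additive_span.add)
qed

text \<open>The axioms on \<open>W\<close> are the conclusions of \<open>morita_bimodule\<close> for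
  the two generic fibres. Here \<open>act\<close> is a right action of \<open>EA\<close> commuting
  with the left action of \<open>EB\<close>.\<close>

locale bimodule_lattice =
  FA: generic_fibre K V A nA eA dA EA \<iota>A + FB: generic_fibre K V B nB eB dB EB \<iota>B
  for K :: "('k, 'm) ring_scheme" and V
    and A :: "('k, 'a) module" and nA eA dA and EA :: "('k, 'c) module" and \<iota>A
    and B :: "('k, 'b) module" and nB eB dB and EB :: "('k, 'd) module" and \<iota>B +
  fixes W :: "('d, 'u) module" and act :: "'c \<Rightarrow> 'u \<Rightarrow> 'u" and S :: "'u set"
  assumes W: "left_module EB W"
    and act_hom: "a \<in> carrier EA \<Longrightarrow> act a \<in> module_hom EB W W"
    and act_one: "x \<in> carrier W \<Longrightarrow> act \<one>\<^bsub>EA\<^esub> x = x"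
    and act_mult: "\<lbrakk>a \<in> carrier EA; b \<in> carrier EA; x \<in> carrier W\<rbrakk> \<Longrightarrow> act (a \<otimes>\<^bsub>EA\<^esub> b) x = act b (act a x)"
    and act_add: "\<lbrakk>a \<in> carrier EA; b \<in> carrier EA; x \<in> carrier W\<rbrakk> \<Longrightarrow> act (a \<oplus>\<^bsub>EA\<^esub> b) x = act a x \<oplus>\<^bsub>W\<^esub> act b x"
    and act_scalar: "\<lbrakk>r \<in> carrier K; x \<in> carrier W\<rbrakk> \<Longrightarrow> act (r \<odot>\<^bsub>EA\<^esub> \<one>\<^bsub>EA\<^esub>) x = (r \<odot>\<^bsub>EB\<^esub> \<one>\<^bsub>EB\<^esub>) \<odot>\<^bsub>W\<^esub> x"
    and act_full: "h \<in> module_hom EB W W \<Longrightarrow> \<exists>a\<in>carrier EA. act a = h"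
    and act_faithful: "\<lbrakk>a \<in> carrier EA; \<And>x. x \<in> carrier W \<Longrightarrow> act a x = \<zero>\<^bsub>W\<^esub>\<rbrakk> \<Longrightarrow> a = \<zero>\<^bsub>EA\<^esub>"
    and S: "finite S" "S \<subseteq> carrier W"
    and S_span: "w \<in> carrier W \<Longrightarrow> w \<in> additive_span W {act a s | a s. a \<in> carrier EA \<and> s \<in> S}"
begin

sublocale W: left_module EB W by (rule W)

abbreviation "R \<equiv> K\<lparr>carrier := V\<rparr>"

section \<open>The actions of \<open>B\<close>, \<open>A\<close> and \<open>K\<close> on
  \<open>W\<close>\<close>

definition lact :: "'b \<Rightarrow> 'u \<Rightarrow> 'u" where "lact b x = \<iota>B b \<odot>\<^bsub>W\<^esub> x"
definition ract :: "'a \<Rightarrow> 'u \<Rightarrow> 'u" where "ract a x = act (\<iota>A a) x"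
text \<open>Scalars act through the elements \<open>c 1\<close> of \<open>EB\<close>; by
  \<open>act_scalar\<close> the elements \<open>c 1\<close> of \<open>EA\<close> give the same
  operators.\<close>

definition sc :: "'k \<Rightarrow> 'u \<Rightarrow> 'u" where "sc c x = (c \<odot>\<^bsub>EB\<^esub> \<one>\<^bsub>EB\<^esub>) \<odot>\<^bsub>W\<^esub> x"

lemma act_closed: "\<lbrakk>a \<in> carrier EA; x \<in> carrier W\<rbrakk> \<Longrightarrow> act a x \<in> carrier W"
  by (rule module_homD(2)[OF act_hom])

lemma act_linear:
  "\<lbrakk>a \<in> carrier EA; x \<in> carrier W; y \<in> carrier W\<rbrakk> \<Longrightarrow> act a (x \<oplus>\<^bsub>W\<^esub> y) = act a x \<oplus>\<^bsub>W\<^esub> act a y"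
  "\<lbrakk>a \<in> carrier EA; b \<in> carrier EB; x \<in> carrier W\<rbrakk> \<Longrightarrow> act a (b \<odot>\<^bsub>W\<^esub> x) = b \<odot>\<^bsub>W\<^esub> act a x"
  by (rule module_homD(3)[OF act_hom], assumption+) (rule module_homD(4)[OF act_hom], assumption+)

lemma closed [simp]:
  "\<lbrakk>b \<in> carrier B; x \<in> carrier W\<rbrakk> \<Longrightarrow> lact b x \<in> carrier W"
  "\<lbrakk>a \<in> carrier A; x \<in> carrier W\<rbrakk> \<Longrightarrow> ract a x \<in> carrier W"
  "\<lbrakk>c \<in> carrier K; x \<in> carrier W\<rbrakk> \<Longrightarrow> sc c x \<in> carrier W"
  by (simp_all add: lact_def ract_def sc_def W.smult_closed act_closed FA.\<iota>_simps FB.\<iota>_simps)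

lemma lact_simps:
  "\<lbrakk>b \<in> carrier B; x \<in> carrier W; y \<in> carrier W\<rbrakk> \<Longrightarrow> lact b (x \<oplus>\<^bsub>W\<^esub> y) = lact b x \<oplus>\<^bsub>W\<^esub> lact b y"
  "\<lbrakk>b \<in> carrier B; b' \<in> carrier B; x \<in> carrier W\<rbrakk> \<Longrightarrow> lact (b \<oplus>\<^bsub>B\<^esub> b') x = lact b x \<oplus>\<^bsub>W\<^esub> lact b' x"
  "\<lbrakk>b \<in> carrier B; b' \<in> carrier B; x \<in> carrier W\<rbrakk> \<Longrightarrow> lact (b \<otimes>\<^bsub>B\<^esub> b') x = lact b (lact b' x)"
  "x \<in> carrier W \<Longrightarrow> lact \<one>\<^bsub>B\<^esub> x = x"
  by (simp_all add: lact_def W.smult_r_distr W.smult_l_distr W.smult_assoc W.smult_one FB.\<iota>_simps)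

lemma ract_simps:
  "\<lbrakk>a \<in> carrier A; x \<in> carrier W; y \<in> carrier W\<rbrakk> \<Longrightarrow> ract a (x \<oplus>\<^bsub>W\<^esub> y) = ract a x \<oplus>\<^bsub>W\<^esub> ract a y"
  "\<lbrakk>a \<in> carrier A; a' \<in> carrier A; x \<in> carrier W\<rbrakk> \<Longrightarrow> ract (a \<oplus>\<^bsub>A\<^esub> a') x = ract a x \<oplus>\<^bsub>W\<^esub> ract a' x"
  "\<lbrakk>a \<in> carrier A; a' \<in> carrier A; x \<in> carrier W\<rbrakk> \<Longrightarrow> ract (a \<otimes>\<^bsub>A\<^esub> a') x = ract a' (ract a x)"
  "x \<in> carrier W \<Longrightarrow> ract \<one>\<^bsub>A\<^esub> x = x"
  by (simp_all add: ract_def act_linear act_add act_mult act_one FA.\<iota>_simps)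

lemma ract_lact: "\<lbrakk>a \<in> carrier A; b \<in> carrier B; x \<in> carrier W\<rbrakk> \<Longrightarrow> ract a (lact b x) = lact b (ract a x)"
  by (simp add: ract_def lact_def act_linear FA.\<iota>_simps FB.\<iota>_simps)

lemma sc_one_mult:
  "\<lbrakk>c \<in> carrier K; k \<in> carrier K\<rbrakk> \<Longrightarrow> (c \<otimes>\<^bsub>K\<^esub> k) \<odot>\<^bsub>EB\<^esub> \<one>\<^bsub>EB\<^esub> = (c \<odot>\<^bsub>EB\<^esub> \<one>\<^bsub>EB\<^esub>) \<otimes>\<^bsub>EB\<^esub> (k \<odot>\<^bsub>EB\<^esub> \<one>\<^bsub>EB\<^esub>)"
  by (simp add: FB.E.smult_mult_left FB.E.smult_assoc1)

lemma sc_simps: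
  "\<lbrakk>c \<in> carrier K; x \<in> carrier W; y \<in> carrier W\<rbrakk> \<Longrightarrow> sc c (x \<oplus>\<^bsub>W\<^esub> y) = sc c x \<oplus>\<^bsub>W\<^esub> sc c y"
  "\<lbrakk>c \<in> carrier K; k \<in> carrier K; x \<in> carrier W\<rbrakk> \<Longrightarrow> sc (c \<oplus>\<^bsub>K\<^esub> k) x = sc c x \<oplus>\<^bsub>W\<^esub> sc k x"
  "\<lbrakk>c \<in> carrier K; k \<in> carrier K; x \<in> carrier W\<rbrakk> \<Longrightarrow> sc (c \<otimes>\<^bsub>K\<^esub> k) x = sc c (sc k x)"
  "x \<in> carrier W \<Longrightarrow> sc \<one>\<^bsub>K\<^esub> x = x"
  by (simp_all add: sc_def W.smult_r_distr W.smult_l_distr sc_one_mult W.smult_assoc W.smult_one FB.E.smult_l_distr)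

lemma sc_smult:
  assumes "c \<in> carrier K" "b \<in> carrier EB" "x \<in> carrier W"
  shows "(c \<odot>\<^bsub>EB\<^esub> b) \<odot>\<^bsub>W\<^esub> x = sc c (b \<odot>\<^bsub>W\<^esub> x)" and "b \<odot>\<^bsub>W\<^esub> sc c x = sc c (b \<odot>\<^bsub>W\<^esub> x)"
proof -
  have "c \<odot>\<^bsub>EB\<^esub> b = (c \<odot>\<^bsub>EB\<^esub> \<one>\<^bsub>EB\<^esub>) \<otimes>\<^bsub>EB\<^esub> b" "c \<odot>\<^bsub>EB\<^esub> b = b \<otimes>\<^bsub>EB\<^esub> (c \<odot>\<^bsub>EB\<^esub> \<one>\<^bsub>EB\<^esub>)"
    using assms by (simp_all add: FB.E.smult_mult_left FB.E.smult_mult_right)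
  then show "(c \<odot>\<^bsub>EB\<^esub> b) \<odot>\<^bsub>W\<^esub> x = sc c (b \<odot>\<^bsub>W\<^esub> x)" "b \<odot>\<^bsub>W\<^esub> sc c x = sc c (b \<odot>\<^bsub>W\<^esub> x)"
    using assms W.smult_assoc[of "c \<odot>\<^bsub>EB\<^esub> \<one>\<^bsub>EB\<^esub>" b x] W.smult_assoc[of b "c \<odot>\<^bsub>EB\<^esub> \<one>\<^bsub>EB\<^esub>" x] by (simp_all add: sc_def)
qed

lemma sc_act:
  assumes "c \<in> carrier K" "a \<in> carrier EA" "x \<in> carrier W"
  shows "act (c \<odot>\<^bsub>EA\<^esub> a) x = sc c (act a x)" and "act a (sc c x) = sc c (act a x)"
proof -
  have "c \<odot>\<^bsub>EA\<^esub> a = a \<otimes>\<^bsub>EA\<^esub> (c \<odot>\<^bsub>EA\<^esub> \<one>\<^bsub>EA\<^esub>)" using assms by (simp add: FA.E.smult_mult_right)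
  then show "act (c \<odot>\<^bsub>EA\<^esub> a) x = sc c (act a x)"
    using assms act_mult[of a "c \<odot>\<^bsub>EA\<^esub> \<one>\<^bsub>EA\<^esub>" x] act_scalar[of c "act a x"] act_closed by (simp add: sc_def)
  show "act a (sc c x) = sc c (act a x)" using assms by (simp add: sc_def act_linear)
qed

lemma sc_lact_ract:
  "\<lbrakk>c \<in> V; b \<in> carrier B; x \<in> carrier W\<rbrakk> \<Longrightarrow> lact (c \<odot>\<^bsub>B\<^esub> b) x = sc c (lact b x)"
  "\<lbrakk>c \<in> carrier K; b \<in> carrier B; x \<in> carrier W\<rbrakk> \<Longrightarrow> lact b (sc c x) = sc c (lact b x)"
  "\<lbrakk>c \<in> V; a \<in> carrier A; x \<in> carrier W\<rbrakk> \<Longrightarrow> ract (c \<odot>\<^bsub>A\<^esub> a) x = sc c (ract a x)"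
  "\<lbrakk>c \<in> carrier K; a \<in> carrier A; x \<in> carrier W\<rbrakk> \<Longrightarrow> ract a (sc c x) = sc c (ract a x)"
  by (simp_all add: lact_def ract_def FA.\<iota>_smult FB.\<iota>_smult sc_smult sc_act FA.V_sub FA.\<iota>_simps FB.\<iota>_simps)

lemma sc_cancel:
  assumes "c \<in> carrier K" "c \<noteq> \<zero>\<^bsub>K\<^esub>" "x \<in> carrier W"
  shows "sc (inv\<^bsub>K\<^esub> c) (sc c x) = x" "sc c (sc (inv\<^bsub>K\<^esub> c) x) = x"
proof -
  have u: "c \<in> Units K" using assms FA.K.field_Units by simp
  then show "sc (inv\<^bsub>K\<^esub> c) (sc c x) = x" "sc c (sc (inv\<^bsub>K\<^esub> c) x) = x"
    using sc_simps(3)[of "inv\<^bsub>K\<^esub> c" c x] sc_simps(3)[of c "inv\<^bsub>K\<^esub> c" x] sc_simps(4)[OF assms(3)] assms by simp_all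
qed

lemma W_group: "abelian_group W" by (rule W.M.abelian_group_axioms)

lemma finsum_actions:
  "\<lbrakk>finite I; g \<in> I \<rightarrow> carrier W; b \<in> carrier B\<rbrakk> \<Longrightarrow> lact b (\<Oplus>\<^bsub>W\<^esub>i\<in>I. g i) = (\<Oplus>\<^bsub>W\<^esub>i\<in>I. lact b (g i))"
  "\<lbrakk>finite I; h \<in> I \<rightarrow> carrier B; x \<in> carrier W\<rbrakk> \<Longrightarrow> lact (\<Oplus>\<^bsub>B\<^esub>i\<in>I. h i) x = (\<Oplus>\<^bsub>W\<^esub>i\<in>I. lact (h i) x)"
  "\<lbrakk>finite I; g \<in> I \<rightarrow> carrier W; a \<in> carrier A\<rbrakk> \<Longrightarrow> ract a (\<Oplus>\<^bsub>W\<^esub>i\<in>I. g i) = (\<Oplus>\<^bsub>W\<^esub>i\<in>I. ract a (g i))"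
  "\<lbrakk>finite I; k \<in> I \<rightarrow> carrier A; x \<in> carrier W\<rbrakk> \<Longrightarrow> ract (\<Oplus>\<^bsub>A\<^esub>i\<in>I. k i) x = (\<Oplus>\<^bsub>W\<^esub>i\<in>I. ract (k i) x)"
proof -
  show "lact b (\<Oplus>\<^bsub>W\<^esub>i\<in>I. g i) = (\<Oplus>\<^bsub>W\<^esub>i\<in>I. lact b (g i))" if "finite I" "g \<in> I \<rightarrow> carrier W" "b \<in> carrier B"
    by (rule additive_finsum[OF W_group W_group _ _ that(1,2)]) (use that(3) in \<open>auto simp: lact_simps\<close>)
  show "ract a (\<Oplus>\<^bsub>W\<^esub>i\<in>I. g i) = (\<Oplus>\<^bsub>W\<^esub>i\<in>I. ract a (g i))" if "finite I" "g \<in> I \<rightarrow> carrier W" "a \<in> carrier A"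
    by (rule additive_finsum[OF W_group W_group _ _ that(1,2)]) (use that(3) in \<open>auto simp: ract_simps\<close>)
  show "lact (\<Oplus>\<^bsub>B\<^esub>i\<in>I. h i) x = (\<Oplus>\<^bsub>W\<^esub>i\<in>I. lact (h i) x)" if "finite I" "h \<in> I \<rightarrow> carrier B" "x \<in> carrier W"
    by (rule additive_finsum[where f = "\<lambda>b. lact b x", OF FB.A.is_abelian_group W_group _ _ that(1,2)])
       (use that(3) in \<open>auto simp: lact_simps\<close>)
  show "ract (\<Oplus>\<^bsub>A\<^esub>i\<in>I. k i) x = (\<Oplus>\<^bsub>W\<^esub>i\<in>I. ract (k i) x)" if "finite I" "k \<in> I \<rightarrow> carrier A" "x \<in> carrier W"
    by (rule additive_finsum[where f = "\<lambda>a. ract a x", OF FA.A.is_abelian_group W_group _ _ that(1,2)])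
       (use that(3) in \<open>auto simp: ract_simps\<close>)
qed

lemma actions_zero:
  "b \<in> carrier B \<Longrightarrow> lact b \<zero>\<^bsub>W\<^esub> = \<zero>\<^bsub>W\<^esub>" "x \<in> carrier W \<Longrightarrow> lact \<zero>\<^bsub>B\<^esub> x = \<zero>\<^bsub>W\<^esub>"
  "a \<in> carrier A \<Longrightarrow> ract a \<zero>\<^bsub>W\<^esub> = \<zero>\<^bsub>W\<^esub>" "x \<in> carrier W \<Longrightarrow> ract \<zero>\<^bsub>A\<^esub> x = \<zero>\<^bsub>W\<^esub>"
  "c \<in> carrier K \<Longrightarrow> sc c \<zero>\<^bsub>W\<^esub> = \<zero>\<^bsub>W\<^esub>"
  using finsum_actions(1)[of "{}" "\<lambda>_. \<zero>\<^bsub>W\<^esub>" b] finsum_actions(2)[of "{}" "\<lambda>_. \<zero>\<^bsub>B\<^esub>" x]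
    finsum_actions(3)[of "{}" "\<lambda>_. \<zero>\<^bsub>W\<^esub>" a] finsum_actions(4)[of "{}" "\<lambda>_. \<zero>\<^bsub>A\<^esub>" x]
  by (simp_all add: sc_def left_module_smult_zero[OF W])

section \<open>The lattice generated by \<open>S\<close>\<close>

definition gens :: "'u set" where
  "gens = {lact b (ract a s) | a b s. a \<in> carrier A \<and> b \<in> carrier B \<and> s \<in> S}"

definition L :: "'u set" where "L = additive_span W gens"

lemma gens_sub: "gens \<subseteq> carrier W" using S(2) by (auto simp: gens_def)

lemma L_sub: "x \<in> L \<Longrightarrow> x \<in> carrier W"
  unfolding L_def by (rule additive_span_closed[OF W_group gens_sub])

lemma L_zero: "\<zero>\<^bsub>W\<^esub> \<in> L" and L_add: "\<lbrakk>x \<in> L; y \<in> L\<rbrakk> \<Longrightarrow> x \<oplus>\<^bsub>W\<^esub> y \<in> L"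
  unfolding L_def by (rule additive_span.zero, rule additive_span.add)

lemma L_lact:
  assumes b: "b \<in> carrier B" and x: "x \<in> L" shows "lact b x \<in> L"
  unfolding L_def
proof (rule additive_span_image[OF W_group W_group gens_sub _ _ _ x[unfolded L_def]])
  fix y assume "y \<in> gens"
  then obtain a b' s where y: "y = lact b' (ract a s)" "a \<in> carrier A" "b' \<in> carrier B" "s \<in> S" unfolding gens_def by blast
  have "lact b y = lact (b \<otimes>\<^bsub>B\<^esub> b') (ract a s)" using y b S(2) by (auto simp: lact_simps(3))
  moreover have "b \<otimes>\<^bsub>B\<^esub> b' \<in> carrier B" using b y by simp
  ultimately have "lact b y \<in> gens" unfolding gens_def using y by blast
  then show "lact b y \<in> additive_span W gens" by (rule additive_span.base)
qed (use b in \<open>auto simp: lact_simps\<close>)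

lemma L_ract:
  assumes a: "a \<in> carrier A" and x: "x \<in> L" shows "ract a x \<in> L"
  unfolding L_def
proof (rule additive_span_image[OF W_group W_group gens_sub _ _ _ x[unfolded L_def]])
  fix y assume "y \<in> gens"
  then obtain a' b s where y: "y = lact b (ract a' s)" "a' \<in> carrier A" "b \<in> carrier B" "s \<in> S" unfolding gens_def by blast
  have "ract a y = lact b (ract (a' \<otimes>\<^bsub>A\<^esub> a) s)" using y a S(2) by (auto simp: ract_simps(3) ract_lact)
  moreover have "a' \<otimes>\<^bsub>A\<^esub> a \<in> carrier A" using a y by simp
  ultimately have "ract a y \<in> gens" unfolding gens_def using y by blast
  then show "ract a y \<in> additive_span W gens" by (rule additive_span.base)
qed (use a in \<open>auto simp: ract_simps\<close>)

lemma L_sc: "\<lbrakk>c \<in> V; x \<in> L\<rbrakk> \<Longrightarrow> sc c x \<in> L"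
  using L_lact[of "c \<odot>\<^bsub>B\<^esub> \<one>\<^bsub>B\<^esub>" x] sc_lact_ract(1)[of c "\<one>\<^bsub>B\<^esub>" x] L_sub FB.smult_closed[of c "\<one>\<^bsub>B\<^esub>"] by (simp add: lact_simps)

text \<open>The lattice spans \<open>W\<close> over \<open>K\<close>: a generator
  \<open>act a s\<close> reaches \<open>L\<close> once a denominator of \<open>a\<close> is cleared,
  and products of denominators handle sums.\<close>

lemma L_denominator:
  assumes "w \<in> carrier W"
  shows "\<exists>c\<in>V. c \<noteq> \<zero>\<^bsub>K\<^esub> \<and> sc c w \<in> L"
  using S_span[OF assms]
proof induction
  case zero
  then show ?case using FA.V_closed(3) FA.K.one_not_zero by (intro bexI[of _ "\<one>\<^bsub>K\<^esub>"]) (simp_all add: actions_zero L_zero)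
next
  case (base x)
  then obtain a s where as: "x = act a s" "a \<in> carrier EA" "s \<in> S" by blast
  obtain c b where c: "c \<in> V" "c \<noteq> \<zero>\<^bsub>K\<^esub>" "b \<in> carrier A" "c \<odot>\<^bsub>EA\<^esub> a = \<iota>A b" using FA.denominator[OF as(2)] by blast
  have sW: "s \<in> carrier W" using as S(2) by blast
  have "sc c x = lact \<one>\<^bsub>B\<^esub> (ract b s)"
    using sc_act(1)[OF FA.V_sub[OF c(1)] as(2) sW] c(3,4) as(1) sW
      lact_simps(4)[OF closed(2)[OF c(3) sW]] by (simp add: ract_def)
  then have "sc c x \<in> gens" unfolding gens_def using c(3) as(3) FB.A.one_closed by (intro CollectI exI conjI)
  then have "sc c x \<in> L" unfolding L_def by (rule additive_span.base)
  then show ?case using c(1,2) by (intro bexI[of _ c] conjI)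
next
  case (add x y)
  have xy: "x \<in> carrier W" "y \<in> carrier W"
    using additive_span_closed[OF W_group _ add.hyps(1)] additive_span_closed[OF W_group _ add.hyps(2)] S(2) act_closed by blast+
  from add.IH obtain c k where c: "c \<in> V" "c \<noteq> \<zero>\<^bsub>K\<^esub>" "sc c x \<in> L" and k: "k \<in> V" "k \<noteq> \<zero>\<^bsub>K\<^esub>" "sc k y \<in> L" by blast
  have cK: "c \<in> carrier K" "k \<in> carrier K" using c k FA.V_sub by auto
  have "sc (c \<otimes>\<^bsub>K\<^esub> k) (x \<oplus>\<^bsub>W\<^esub> y) = sc k (sc c x) \<oplus>\<^bsub>W\<^esub> sc c (sc k y)"
    using sc_simps(1)[of "c \<otimes>\<^bsub>K\<^esub> k" x y] sc_simps(3)[OF cK xy(2)] sc_simps(3)[OF cK(2,1) xy(1)] FA.K.m_comm[OF cK] cK xy by simp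
  then have "sc (c \<otimes>\<^bsub>K\<^esub> k) (x \<oplus>\<^bsub>W\<^esub> y) \<in> L" using L_add[OF L_sc[OF k(1) c(3)] L_sc[OF c(1) k(3)]] by simp
  moreover have "c \<otimes>\<^bsub>K\<^esub> k \<noteq> \<zero>\<^bsub>K\<^esub>" using FA.K.integral[OF _ cK] c(2) k(2) by blast
  ultimately show ?case using FA.V_closed(6)[OF c(1) k(1)] by blast
qed

definition L_module :: "('k, 'u) module" where
  "L_module = \<lparr>carrier = L, monoid.mult = undefined, monoid.one = undefined, ring.zero = \<zero>\<^bsub>W\<^esub>,
     ring.add = ring.add W, smult = sc\<rparr>"

lemma L_module_simps:
  "carrier L_module = L" "\<zero>\<^bsub>L_module\<^esub> = \<zero>\<^bsub>W\<^esub>" "x \<oplus>\<^bsub>L_module\<^esub> y = x \<oplus>\<^bsub>W\<^esub> y" "c \<odot>\<^bsub>L_module\<^esub> x = sc c x"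
  by (simp_all add: L_module_def)

lemma module_L: "module R L_module"
proof -
  \<comment> \<open>The additive span is closed under sums only; negatives come from the scalar
    \<open>- 1\<close> in \<open>V\<close>.\<close>
  have neg: "\<exists>y\<in>L. y \<oplus>\<^bsub>W\<^esub> x = \<zero>\<^bsub>W\<^esub>" if x: "x \<in> L" for x
  proof
    have o: "\<one>\<^bsub>K\<^esub> \<in> V" "\<ominus>\<^bsub>K\<^esub> \<one>\<^bsub>K\<^esub> \<in> V" using FA.V_closed(3,5) by auto
    show "sc (\<ominus>\<^bsub>K\<^esub> \<one>\<^bsub>K\<^esub>) x \<in> L" by (rule L_sc[OF o(2) x])
    have "sc (\<ominus>\<^bsub>K\<^esub> \<one>\<^bsub>K\<^esub>) x \<oplus>\<^bsub>W\<^esub> x = sc (\<ominus>\<^bsub>K\<^esub> \<one>\<^bsub>K\<^esub> \<oplus>\<^bsub>K\<^esub> \<one>\<^bsub>K\<^esub>) x"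
      using sc_simps(2)[of "\<ominus>\<^bsub>K\<^esub> \<one>\<^bsub>K\<^esub>" "\<one>\<^bsub>K\<^esub>" x] sc_simps(4)[OF L_sub[OF x]] L_sub[OF x] by simp
    also have "\<dots> = \<zero>\<^bsub>W\<^esub>" using L_sub[OF x] by (simp add: FA.K.l_neg sc_def left_module_smult_zero[OF W])
    finally show "sc (\<ominus>\<^bsub>K\<^esub> \<one>\<^bsub>K\<^esub>) x \<oplus>\<^bsub>W\<^esub> x = \<zero>\<^bsub>W\<^esub>" .
  qed
  have ab: "abelian_group L_module"
    by (rule abelian_groupI) (auto simp: L_module_simps L_add L_zero L_sub W.M.a_assoc neg intro: W.M.a_comm)
  show ?thesis
    by (rule moduleI[OF FA.R.is_cring ab]) (simp_all add: L_module_simps L_sc L_sub FA.V_sub sc_simps)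
qed

lemma finsum_L: "\<lbrakk>finite I; g \<in> I \<rightarrow> L\<rbrakk> \<Longrightarrow> (\<Oplus>\<^bsub>L_module\<^esub>i\<in>I. g i) = (\<Oplus>\<^bsub>W\<^esub>i\<in>I. g i)"
  by (rule additive_finsum[where f = "\<lambda>x. x", OF module.axioms(2)[OF module_L] W_group])
     (auto simp: L_module_simps L_sub)

lemma torsion_free_L: "torsion_free R L_module"
  unfolding torsion_free_def
proof (intro ballI impI)
  fix c x assume c: "c \<in> carrier R" and x: "x \<in> carrier L_module" and z: "c \<odot>\<^bsub>L_module\<^esub> x = \<zero>\<^bsub>L_module\<^esub>"
  then have cK: "c \<in> carrier K" and xW: "x \<in> carrier W" by (simp_all add: FA.V_sub L_module_simps L_sub)
  show "c = \<zero>\<^bsub>R\<^esub> \<or> x = \<zero>\<^bsub>L_module\<^esub>"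
  proof (cases "c = \<zero>\<^bsub>K\<^esub>")
    case False
    then have "c \<in> Units K" using cK FA.K.field_Units by simp
    then show ?thesis using sc_cancel(1)[OF cK False xW] z actions_zero(5)[of "inv\<^bsub>K\<^esub> c"] by (simp add: L_module_simps)
  qed simp
qed

text \<open>The finitely many products of basis elements of \<open>B\<close>, elements of
  \<open>S\<close> and basis elements of \<open>A\<close>. They generate \<open>L\<close> over
  \<open>V\<close>; the nested unions make finiteness immediate.\<close>

definition basis_gens :: "'u set" where
  "basis_gens = (\<Union>i\<in>{..<nB}. \<Union>j\<in>{..<nA}. (\<lambda>s. lact (eB i) (ract (eA j) s)) ` S)"

lemma basis_gens_L: "t \<in> basis_gens \<Longrightarrow> t \<in> L"
proof -
  assume "t \<in> basis_gens"
  then obtain i where i: "i \<in> {..<nB}" "t \<in> (\<Union>j\<in>{..<nA}. (\<lambda>s. lact (eB i) (ract (eA j) s)) ` S)"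
    unfolding basis_gens_def by (rule UN_E)
  from i(2) obtain j where j: "j \<in> {..<nA}" "t \<in> (\<lambda>s. lact (eB i) (ract (eA j) s)) ` S" by (rule UN_E)
  from j(2) obtain s where t: "t = lact (eB i) (ract (eA j) s)" and s: "s \<in> S" by (rule imageE)
  have "t \<in> gens" unfolding gens_def t
    by (rule CollectI, rule exI[of _ "eA j"], rule exI[of _ "eB i"], rule exI[of _ s])
       (use i(1) j(1) s in \<open>simp add: FA.e_closed FB.e_closed\<close>)
  then show "t \<in> L" unfolding L_def by (rule additive_span.base)
qed

definition combinations :: "'u set" where "combinations = {sc c t | c t. c \<in> V \<and> t \<in> basis_gens}"

lemma combinations_L: "x \<in> combinations \<Longrightarrow> x \<in> L"
  unfolding combinations_def by (elim CollectE exE conjE) (simp add: L_sc basis_gens_L)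

text \<open>Both coefficients of a generator are expanded in the bases, and the coordinates become
  scalars because \<open>V\<close> acts in the same way through \<open>A\<close>, through
  \<open>B\<close> and through \<open>K\<close>.\<close>

lemma gens_span:
  assumes x: "x \<in> gens" shows "x \<in> additive_span W combinations"
proof -
  have XW: "combinations \<subseteq> carrier W" by (intro subsetI L_sub combinations_L)
  obtain a b s where y: "x = lact b (ract a s)" "a \<in> carrier A" "b \<in> carrier B" "s \<in> S"
    using x unfolding gens_def by (elim CollectE exE conjE)
  have sW: "s \<in> carrier W" by (rule subsetD[OF S(2) y(4)])
  have da: "dA j a \<in> V" if "j < nA" for j using FA.d_closed[OF that y(2)] by simp
  have db: "dB i b \<in> V" if "i < nB" for i using FB.d_closed[OF that y(3)] by simp
  have ea: "eA j \<in> carrier A" if "j < nA" for j using FA.e_closed[OF that] .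
  have eb: "eB i \<in> carrier B" if "i < nB" for i using FB.e_closed[OF that] .
  have sa: "dA j a \<odot>\<^bsub>A\<^esub> eA j \<in> carrier A" if "j < nA" for j using FA.smult_closed[of "dA j a" "eA j"] da[OF that] ea[OF that] by simp
  have sb: "dB i b \<odot>\<^bsub>B\<^esub> eB i \<in> carrier B" if "i < nB" for i using FB.smult_closed[of "dB i b" "eB i"] db[OF that] eb[OF that] by simp
  have rs: "ract a s = (\<Oplus>\<^bsub>W\<^esub>j\<in>{..<nA}. ract (dA j a \<odot>\<^bsub>A\<^esub> eA j) s)"
    using finsum_actions(4)[of "{..<nA}" "\<lambda>j. dA j a \<odot>\<^bsub>A\<^esub> eA j" s] sa sW FA.expand[OF y(2)] by (simp add: Pi_iff)
  have "x = (\<Oplus>\<^bsub>W\<^esub>i\<in>{..<nB}. lact (dB i b \<odot>\<^bsub>B\<^esub> eB i) (ract a s))"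
    using finsum_actions(2)[of "{..<nB}" "\<lambda>i. dB i b \<odot>\<^bsub>B\<^esub> eB i" "ract a s"] sb sW y(1,2) FB.expand[OF y(3)] by (simp add: Pi_iff)
  also have "\<dots> = (\<Oplus>\<^bsub>W\<^esub>i\<in>{..<nB}. \<Oplus>\<^bsub>W\<^esub>j\<in>{..<nA}. lact (dB i b \<odot>\<^bsub>B\<^esub> eB i) (ract (dA j a \<odot>\<^bsub>A\<^esub> eA j) s))"
  proof (rule W.M.finsum_cong')
    fix i assume "i \<in> {..<nB}"
    then have i: "i < nB" by simp
    show "lact (dB i b \<odot>\<^bsub>B\<^esub> eB i) (ract a s) = (\<Oplus>\<^bsub>W\<^esub>j\<in>{..<nA}. lact (dB i b \<odot>\<^bsub>B\<^esub> eB i) (ract (dA j a \<odot>\<^bsub>A\<^esub> eA j) s))"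
      unfolding rs by (rule finsum_actions(1)) (use sa sb[OF i] sW in auto)
  qed (use sa sb sW in \<open>auto intro!: W.M.finsum_closed\<close>)
  finally have xeq: "x = (\<Oplus>\<^bsub>W\<^esub>i\<in>{..<nB}. \<Oplus>\<^bsub>W\<^esub>j\<in>{..<nA}. lact (dB i b \<odot>\<^bsub>B\<^esub> eB i) (ract (dA j a \<odot>\<^bsub>A\<^esub> eA j) s))" .
  have mem: "lact (dB i b \<odot>\<^bsub>B\<^esub> eB i) (ract (dA j a \<odot>\<^bsub>A\<^esub> eA j) s) \<in> additive_span W combinations" if i: "i < nB" and j: "j < nA" for i j
  proof (rule additive_span.base)
    have rW: "ract (eA j) s \<in> carrier W" using ea[OF j] sW by simp
    have "lact (dB i b \<odot>\<^bsub>B\<^esub> eB i) (ract (dA j a \<odot>\<^bsub>A\<^esub> eA j) s) = sc (dB i b \<otimes>\<^bsub>K\<^esub> dA j a) (lact (eB i) (ract (eA j) s))"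
      using sc_lact_ract(1)[OF db[OF i] eb[OF i]] sc_lact_ract(3)[OF da[OF j] ea[OF j] sW]
        sc_lact_ract(2)[OF FA.V_sub[OF da[OF j]] eb[OF i] rW] sc_simps(3)[OF FA.V_sub[OF db[OF i]] FA.V_sub[OF da[OF j]]]
        eb[OF i] rW FA.V_sub[OF da[OF j]] by simp
    moreover have "dB i b \<otimes>\<^bsub>K\<^esub> dA j a \<in> V" using FA.V_closed(6) db[OF i] da[OF j] by simp
    moreover have "lact (eB i) (ract (eA j) s) \<in> basis_gens" unfolding basis_gens_def
      by (rule UN_I[of i], simp add: i, rule UN_I[of j], simp add: j, rule imageI, rule y(4))
    ultimately show "lact (dB i b \<odot>\<^bsub>B\<^esub> eB i) (ract (dA j a \<odot>\<^bsub>A\<^esub> eA j) s) \<in> combinations"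
      unfolding combinations_def by (intro CollectI exI conjI)
  qed
  show ?thesis unfolding xeq
    by (rule additive_span_finsum[OF W_group XW finite_lessThan], rule additive_span_finsum[OF W_group XW finite_lessThan], rule mem)
       simp_all
qed

lemma finitely_generated_L: "finitely_generated R L_module"
proof -
  have fT: "finite basis_gens" unfolding basis_gens_def using S(1) by (intro finite_UN_I finite_imageI finite_lessThan)
  have T: "basis_gens \<subseteq> carrier L_module" using basis_gens_L by (auto simp: L_module_simps)
  have comb: "combinations = {c \<odot>\<^bsub>L_module\<^esub> t | c t. c \<in> carrier R \<and> t \<in> basis_gens}"
    by (simp add: combinations_def L_module_simps)
  have span: "x \<in> additive_span L_module combinations" if "x \<in> additive_span W combinations" for x
    using that
  proof induction
    case zero
    then show ?case using additive_span.zero[of L_module combinations] by (simp add: L_module_simps)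
  next
    case (add x y)
    then show ?case using additive_span.add[of x L_module combinations y] by (simp add: L_module_simps(3))
  qed (rule additive_span.base)
  have "\<exists>c\<in>basis_gens \<rightarrow> carrier R. x = (\<Oplus>\<^bsub>L_module\<^esub>s\<in>basis_gens. c s \<odot>\<^bsub>L_module\<^esub> s)" if x: "x \<in> carrier L_module" for x
  proof -
    have "x \<in> additive_span W gens" using x by (simp add: L_module_simps L_def)
    then have "x \<in> additive_span W combinations"
      by (rule additive_span_image[OF W_group W_group gens_sub, where f = "\<lambda>x. x", rotated 3]) (auto intro: gens_span)
    then have "x \<in> additive_span L_module combinations" by (rule span)
    from additive_span_combination[OF module_L fT T this[unfolded comb]] show ?thesis .
  qed
  then show ?thesis unfolding finitely_generated_def by (intro exI[of _ basis_gens] conjI fT T ballI)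
qed

text \<open>
  By fullness a \<open>B\<close>-endomorphism of \<open>L\<close> is the action of some \<open>t b\<close>, where \<open>b \<in> A\<close> generates \<open>A\<close> as a
  two-sided ideal. If \<open>t\<close> were not in \<open>V\<close>, then \<open>L b \<subseteq> t\<inverse> L\<close> would give \<open>L \<subseteq> t\<inverse> L\<close>.
\<close>

lemma lattice_endomorphism:
  assumes based: "based_module R L_module n l d" and n: "0 < n"
    and fL: "\<And>x. x \<in> L \<Longrightarrow> f x \<in> L"
    and f_add: "\<And>x y. \<lbrakk>x \<in> L; y \<in> L\<rbrakk> \<Longrightarrow> f (x \<oplus>\<^bsub>W\<^esub> y) = f x \<oplus>\<^bsub>W\<^esub> f y"
    and f_lact: "\<And>b x. \<lbrakk>b \<in> carrier B; x \<in> L\<rbrakk> \<Longrightarrow> f (lact b x) = lact b (f x)"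
  obtains a where "a \<in> carrier A" "\<And>x. x \<in> L \<Longrightarrow> f x = ract a x"
proof -
  interpret L: based_module R L_module n l d by (rule based)
  have fW: "f x \<in> carrier W" if "x \<in> L" for x using L_sub[OF fL[OF that]] .
  have f_sc: "f (sc c x) = sc c (f x)" if c: "c \<in> V" and x: "x \<in> L" for c x
  proof -
    have cb: "c \<odot>\<^bsub>B\<^esub> \<one>\<^bsub>B\<^esub> \<in> carrier B" using FB.smult_closed[of c "\<one>\<^bsub>B\<^esub>"] c by simp
    have "lact (c \<odot>\<^bsub>B\<^esub> \<one>\<^bsub>B\<^esub>) z = sc c z" if "z \<in> carrier W" for z
      using sc_lact_ract(1)[OF c FB.A.one_closed that] lact_simps(4)[OF that] by simp
    then show ?thesis using f_lact[OF cb x] L_sub[OF x] fW[OF x] by simp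
  qed
  define den where "den x c \<longleftrightarrow> c \<in> V \<and> c \<noteq> \<zero>\<^bsub>K\<^esub> \<and> sc c x \<in> L" for x c
  have denE: "\<exists>c. den x c" if "x \<in> carrier W" for x using L_denominator[OF that] unfolding den_def by blast
  \<comment> \<open>The extension of \<open>f\<close> to \<open>W\<close>, by clearing some
    denominator \<open>c\<close> of \<open>x\<close> and dividing by it afterwards.\<close>
  define F where "F x = sc (inv\<^bsub>K\<^esub> (SOME c. den x c)) (f (sc (SOME c. den x c) x))" for x
  have ik: "inv\<^bsub>K\<^esub> c \<in> carrier K" "c \<in> carrier K" if "den x c" for x c
  proof -
    show cK: "c \<in> carrier K" using that FA.V_sub by (simp add: den_def)
    then have "c \<in> Units K" using that FA.K.field_Units by (simp add: den_def)
    then show "inv\<^bsub>K\<^esub> c \<in> carrier K" by simp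
  qed
  \<comment> \<open>The formula holds for every denominator of \<open>x\<close> and not only for the
    chosen one, so that common denominators can be used below.\<close>
  have F: "sc c (F x) = f (sc c x)" and FW: "F x \<in> carrier W" if x: "x \<in> carrier W" and c: "den x c" for x c
  proof -
    define k where "k = (SOME c. den x c)"
    have k: "den x k" unfolding k_def using denE[OF x] by (rule someI_ex)
    note ck = c[unfolded den_def] k[unfolded den_def]
    have Fk: "F x = sc (inv\<^bsub>K\<^esub> k) (f (sc k x))" by (simp add: F_def k_def)
    show "F x \<in> carrier W" unfolding Fk using ik[OF k] fW ck by simp
    have "sc k (sc c (F x)) = sc c (sc k (F x))"
      using sc_simps(3)[OF ik(2)[OF k] ik(2)[OF c]] sc_simps(3)[OF ik(2)[OF c] ik(2)[OF k]] FA.K.m_comm[OF ik(2)[OF k] ik(2)[OF c]]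
        \<open>F x \<in> carrier W\<close> by simp
    also have "sc k (F x) = f (sc k x)" unfolding Fk using sc_cancel(2)[OF ik(2)[OF k]] ck fW by simp
    also have "sc c (f (sc k x)) = f (sc c (sc k x))" using f_sc ck by simp
    also have "sc c (sc k x) = sc k (sc c x)"
      using sc_simps(3)[OF ik(2)[OF k] ik(2)[OF c] x] sc_simps(3)[OF ik(2)[OF c] ik(2)[OF k] x] FA.K.m_comm[OF ik(2)[OF k] ik(2)[OF c]] by simp
    also have "f (sc k (sc c x)) = sc k (f (sc c x))" using f_sc ck by simp
    finally have eq: "sc k (sc c (F x)) = sc k (f (sc c x))" .
    have "sc c (F x) = sc (inv\<^bsub>K\<^esub> k) (sc k (sc c (F x)))"
      using sc_cancel(1)[OF ik(2)[OF k]] ck \<open>F x \<in> carrier W\<close> ik(2)[OF c] by simp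
    also have "\<dots> = f (sc c x)" unfolding eq using sc_cancel(1)[OF ik(2)[OF k]] ck fW by simp
    finally show "sc c (F x) = f (sc c x)" .
  qed
  have sc_inj: "x = y" if "c \<in> carrier K" "c \<noteq> \<zero>\<^bsub>K\<^esub>" "x \<in> carrier W" "y \<in> carrier W" "sc c x = sc c y" for c x y
  proof -
    have "sc (inv\<^bsub>K\<^esub> c) (sc c x) = sc (inv\<^bsub>K\<^esub> c) (sc c y)" unfolding that(5) ..
    then show ?thesis unfolding sc_cancel(1)[OF that(1,2,3)] sc_cancel(1)[OF that(1,2,4)] .
  qed
  have denm: "den x (c \<otimes>\<^bsub>K\<^esub> k)" "den x (k \<otimes>\<^bsub>K\<^esub> c)" if x: "x \<in> carrier W" and c: "den x c" and k: "k \<in> V" "k \<noteq> \<zero>\<^bsub>K\<^esub>" for x c k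
  proof -
    have cK: "c \<in> carrier K" "k \<in> carrier K" using ik(2)[OF c] k FA.V_sub by auto
    have "k \<otimes>\<^bsub>K\<^esub> c \<noteq> \<zero>\<^bsub>K\<^esub>" using FA.K.integral[OF _ cK(2,1)] c k by (auto simp: den_def)
    moreover have "sc (k \<otimes>\<^bsub>K\<^esub> c) x \<in> L" using sc_simps(3)[OF cK(2,1) x] L_sc[OF k(1)] c by (simp add: den_def)
    ultimately show "den x (k \<otimes>\<^bsub>K\<^esub> c)" using FA.V_closed(6) c k by (simp add: den_def)
    then show "den x (c \<otimes>\<^bsub>K\<^esub> k)" using FA.K.m_comm[OF cK] by simp
  qed
  have "(\<lambda>x\<in>carrier W. F x) \<in> module_hom EB W W"
  proof (rule module_hom_restrictI)
    fix x assume x: "x \<in> carrier W"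
    obtain c where c: "den x c" using denE[OF x] by blast
    show "F x \<in> carrier W" by (rule FW[OF x c])
    {
      fix y assume y: "y \<in> carrier W"
      obtain k where k: "den y k" using denE[OF y] by blast
      \<comment> \<open>A common denominator of \<open>x\<close>, \<open>y\<close> and their
        sum.\<close>
      let ?m = "c \<otimes>\<^bsub>K\<^esub> k"
      have mx: "den x ?m" using denm(1)[OF x c] k by (simp add: den_def)
      have my: "den y ?m" using denm(2)[OF y k] c by (simp add: den_def)
      have mK: "?m \<in> carrier K" using ik(2)[OF mx] .
      have mxy: "den (x \<oplus>\<^bsub>W\<^esub> y) ?m" using mx my L_add sc_simps(1)[OF mK x y] by (simp add: den_def)
      show "F (x \<oplus>\<^bsub>W\<^esub> y) = F x \<oplus>\<^bsub>W\<^esub> F y"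
      proof (rule sc_inj[OF mK])
        show "sc ?m (F (x \<oplus>\<^bsub>W\<^esub> y)) = sc ?m (F x \<oplus>\<^bsub>W\<^esub> F y)"
          using F[OF _ mxy] F[OF x mx] F[OF y my] sc_simps(1)[OF mK x y] sc_simps(1)[OF mK FW[OF x mx] FW[OF y my]]
            f_add mx my x y by (simp add: den_def)
      qed (use mx x y FW[OF x mx] FW[OF y my] FW[OF _ mxy] in \<open>simp_all add: den_def\<close>)
    }
    {
      fix b assume b: "b \<in> carrier EB"
      obtain k b' where k: "k \<in> V" "k \<noteq> \<zero>\<^bsub>K\<^esub>" "b' \<in> carrier B" "k \<odot>\<^bsub>EB\<^esub> b = \<iota>B b'" using FB.denominator[OF b] by blast
      have kK: "k \<in> carrier K" and cK: "c \<in> carrier K" using k FA.V_sub ik(2)[OF c] by auto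
      \<comment> \<open>Here \<open>k\<close> clears \<open>b\<close> and \<open>c\<close> clears
        \<open>x\<close>, so the product carries \<open>b x\<close> into \<open>L\<close>.\<close>
      let ?m = "k \<otimes>\<^bsub>K\<^esub> c"
      have bm: "sc ?m (b \<odot>\<^bsub>W\<^esub> z) = lact b' (sc c z)" if z: "z \<in> carrier W" for z
        using sc_smult(1)[OF kK b, of "sc c z"] sc_smult(2)[OF cK b z] sc_simps(3)[OF kK cK, of "b \<odot>\<^bsub>W\<^esub> z"] k(4) z cK b
        by (simp add: lact_def W.smult_closed)
      have bx: "b \<odot>\<^bsub>W\<^esub> x \<in> carrier W" using W.smult_closed b x by simp
      have mbx: "den (b \<odot>\<^bsub>W\<^esub> x) ?m"
        using bm[OF x] L_lact[OF k(3)] c FA.V_closed(6) k FA.K.integral[OF _ kK cK] by (auto simp: den_def)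
      show "F (b \<odot>\<^bsub>W\<^esub> x) = b \<odot>\<^bsub>W\<^esub> F x"
      proof (rule sc_inj[of ?m])
        show "sc ?m (F (b \<odot>\<^bsub>W\<^esub> x)) = sc ?m (b \<odot>\<^bsub>W\<^esub> F x)"
          using F[OF bx mbx] bm[OF x] bm[OF FW[OF x c]] F[OF x c] f_lact[OF k(3)] c by (simp add: den_def)
      qed (use mbx bx FW[OF bx mbx] FW[OF x c] kK cK b W.smult_closed in \<open>simp_all add: den_def\<close>)
    }
  qed (simp_all add: W_group W.smult_closed)
  then obtain x0 where x0: "x0 \<in> carrier EA" "act x0 = (\<lambda>x\<in>carrier W. F x)" using act_full by blast
  have one: "den x \<one>\<^bsub>K\<^esub>" if "x \<in> L" for x
    using that FA.V_closed(3) sc_simps(4)[OF L_sub[OF that]] by (simp add: den_def)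
  \<comment> \<open>On \<open>L\<close> itself \<open>1\<close> is a denominator, so
    \<open>F\<close> extends \<open>f\<close>.\<close>
  have fx: "f x = act x0 x" if x: "x \<in> L" for x
    using F[OF L_sub[OF x] one[OF x]] FW[OF L_sub[OF x] one[OF x]] sc_simps(4) L_sub[OF x] x0(2) by simp
  have "\<exists>a\<in>carrier A. x0 = \<iota>A a"
  proof (cases "x0 = \<zero>\<^bsub>EA\<^esub>")
    case True
    then show ?thesis using FA.\<iota>_zero by (intro bexI[of _ "\<zero>\<^bsub>A\<^esub>"]) simp_all
  next
    case False
    obtain k a where k: "k \<in> carrier K" "k \<noteq> \<zero>\<^bsub>K\<^esub>" "a \<in> carrier A" "x0 = k \<odot>\<^bsub>EA\<^esub> \<iota>A a" using FA.fraction[OF x0(1)] .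
    have "a \<noteq> \<zero>\<^bsub>A\<^esub>" using k False by (auto simp: FA.\<iota>_zero)
    then obtain c b g where c: "c \<in> V" "c \<noteq> \<zero>\<^bsub>K\<^esub>" "b \<in> carrier A" "a = c \<odot>\<^bsub>A\<^esub> b" "sandwich A g" "g b = \<one>\<^bsub>A\<^esub>"
      using FA.primitive_part[OF k(3)] by metis
    have cK: "c \<in> carrier K" using FA.V_sub[OF c(1)] .
    define t where "t = k \<otimes>\<^bsub>K\<^esub> c"
    have t: "t \<in> carrier K" "t \<noteq> \<zero>\<^bsub>K\<^esub>" using k cK c(2) FA.K.integral[of k c] by (auto simp: t_def)
    have bE: "\<iota>A b \<in> carrier EA" using FA.\<iota>_simps(1)[OF c(3)] .
    have x0t: "x0 = t \<odot>\<^bsub>EA\<^esub> \<iota>A b"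
      using k(4) c(4) FA.\<iota>_smult[OF c(1,3)] FA.E.smult_assoc1[OF k(1) cK bE] by (simp add: t_def)
    have "t \<in> V"
    proof (rule ccontr)
      assume tV: "t \<notin> V"
      define v where "v = inv\<^bsub>K\<^esub> t"
      have tu: "t \<in> Units K" using t FA.K.field_Units by simp
      have v: "v \<in> V" using FA.valuation t tV by (auto simp: valuation_ring_def v_def)
      have vK: "v \<in> carrier K" using FA.V_sub[OF v] .
      have bL: "\<exists>y\<in>L. ract b x = sc v y" if x: "x \<in> L" for x
      proof (intro bexI[of _ "f x"])
        have "f x = sc t (ract b x)" using fx[OF x] x0t sc_act(1)[OF t(1) bE L_sub[OF x]] by (simp add: ract_def)
        then show "ract b x = sc v (f x)" using sc_cancel(1)[OF t] c(3) L_sub[OF x] by (simp add: v_def)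
        show "f x \<in> L" by (rule fL[OF x])
      qed
      \<comment> \<open>The elements of \<open>A\<close> that carry \<open>L\<close> into
        \<open>v L\<close> are closed under two-sided multiples and sums. They include
        \<open>b\<close>, hence also \<open>g b = 1\<close>.\<close>
      have "\<forall>x\<in>L. \<exists>y\<in>L. ract (g b) x = sc v y" using c(5)
      proof induction
        case (single a a')
        show ?case
        proof
          fix x assume x: "x \<in> L"
          obtain y where y: "y \<in> L" "ract b (ract a x) = sc v y" using bL[OF L_ract[OF single(1) x]] by blast
          have "ract (a \<otimes>\<^bsub>A\<^esub> b \<otimes>\<^bsub>A\<^esub> a') x = ract a' (sc v y)"
            using single c(3) L_sub[OF x] y(2) by (simp add: ract_simps(3))
          then have "ract (a \<otimes>\<^bsub>A\<^esub> b \<otimes>\<^bsub>A\<^esub> a') x = sc v (ract a' y)"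
            using sc_lact_ract(4)[OF vK single(2) L_sub[OF y(1)]] by simp
          then show "\<exists>y\<in>L. ract (a \<otimes>\<^bsub>A\<^esub> b \<otimes>\<^bsub>A\<^esub> a') x = sc v y" using L_ract[OF single(2) y(1)] by (rule bexI)
        qed
      next
        case (add g g')
        have gg: "g b \<in> carrier A" "g' b \<in> carrier A"
          using sandwich_closed[OF add.hyps(1) FA.A.ring_axioms c(3)] sandwich_closed[OF add.hyps(2) FA.A.ring_axioms c(3)] by auto
        show ?case
        proof
          fix x assume x: "x \<in> L"
          from bspec[OF add.IH(1) x] bspec[OF add.IH(2) x] obtain y z where
            y: "y \<in> L" "ract (g b) x = sc v y" and z: "z \<in> L" "ract (g' b) x = sc v z" by (elim bexE)
          have "ract (g b \<oplus>\<^bsub>A\<^esub> g' b) x = sc v (y \<oplus>\<^bsub>W\<^esub> z)"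
            using ract_simps(2)[OF gg L_sub[OF x]] y z sc_simps(1)[OF vK] L_sub by simp
          then show "\<exists>y\<in>L. ract (g b \<oplus>\<^bsub>A\<^esub> g' b) x = sc v y" using L_add[OF y(1) z(1)] by (rule bexI)
        qed
      qed
      moreover have l0: "l 0 \<in> L" using L.e_closed[OF n] by (simp add: L_module_simps)
      ultimately obtain y where y: "y \<in> L" "l 0 = sc v y" using c(6) ract_simps(4)[OF L_sub[OF l0]] by auto
      \<comment> \<open>Now \<open>L\<close> lies in \<open>v L\<close>, so the basis vector
        \<open>l 0\<close> is \<open>v y\<close>. Comparing its own coordinates makes
        \<open>v\<close> invertible in \<open>V\<close>, and its inverse \<open>t\<close> lies in
        \<open>V\<close> after all.\<close>
      have eq1: "\<one>\<^bsub>K\<^esub> = v \<otimes>\<^bsub>K\<^esub> d 0 y"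
        using L.d_e[OF n n] L.d_smult[OF n, of v y] v y by (simp add: L_module_simps)
      have dV: "d 0 y \<in> V" using L.d_closed[OF n, of y] y(1) by (simp add: L_module_simps)
      have "t = t \<otimes>\<^bsub>K\<^esub> (v \<otimes>\<^bsub>K\<^esub> d 0 y)" unfolding eq1[symmetric] using t(1) by simp
      also have "\<dots> = d 0 y" using FA.K.m_assoc[of t v "d 0 y"] t vK FA.V_sub[OF dV] tu by (simp add: v_def)
      finally show False using tV dV by simp
    qed
    then have "x0 = \<iota>A (t \<odot>\<^bsub>A\<^esub> b)" using x0t FA.\<iota>_smult c(3) by simp
    then show ?thesis using FA.smult_closed[of t b] \<open>t \<in> V\<close> c(3) by (intro bexI[of _ "t \<odot>\<^bsub>A\<^esub> b"]) simp_all
  qed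
  then obtain a where a: "a \<in> carrier A" "x0 = \<iota>A a" by blast
  show thesis by (rule that[OF a(1)]) (simp add: fx a(2) ract_def)
qed

end

section \<open>Comparison of the matrix algebras\<close>

locale based_lattice = bimodule_lattice +
  fixes r l dl
  assumes based: "based_module R L_module r l dl"
begin

sublocale Lm: based_module R L_module r l dl by (rule based)

lemma l_L: "p < r \<Longrightarrow> l p \<in> L" and l_W: "p < r \<Longrightarrow> l p \<in> carrier W"
  using Lm.e_closed[of p] L_sub by (simp_all add: L_module_simps)

lemma dl_V: "\<lbrakk>p < r; x \<in> L\<rbrakk> \<Longrightarrow> dl p x \<in> V"
  using Lm.d_closed[of p x] by (simp add: L_module_simps)

lemma L_finsum:
  assumes "finite I" "g \<in> I \<rightarrow> L" shows "(\<Oplus>\<^bsub>W\<^esub>i\<in>I. g i) \<in> L"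
  using Lm.M.finsum_closed[of g I] assms by (simp add: finsum_L L_module_simps)

lemma expand_L: "x \<in> L \<Longrightarrow> (\<Oplus>\<^bsub>W\<^esub>p\<in>{..<r}. sc (dl p x) (l p)) = x"
  using Lm.expand[of x] finsum_L[of "{..<r}" "\<lambda>p. sc (dl p x) (l p)"] dl_V l_L L_sc
  by (simp add: L_module_simps Pi_iff)

text \<open>An element of \<open>A\<close> that annihilates \<open>L\<close> annihilates
  \<open>W\<close>, since every vector has a nonzero multiple in \<open>L\<close>; then faithfulness
  over \<open>K\<close> and injectivity of \<open>\<iota>A\<close> apply.\<close>

lemma ract_faithful:
  assumes "\<And>x. x \<in> L \<Longrightarrow> ract a x = \<zero>\<^bsub>W\<^esub>" and a: "a \<in> carrier A"
  shows "a = \<zero>\<^bsub>A\<^esub>"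
proof -
  have "act (\<iota>A a) w = \<zero>\<^bsub>W\<^esub>" if w: "w \<in> carrier W" for w
  proof -
    obtain c where c: "c \<in> V" "c \<noteq> \<zero>\<^bsub>K\<^esub>" "sc c w \<in> L" using L_denominator[OF w] by (elim bexE conjE)
    have cK: "c \<in> carrier K" using FA.V_sub[OF c(1)] .
    have "sc c (ract a w) = \<zero>\<^bsub>W\<^esub>" using assms(1)[OF c(3)] sc_lact_ract(4)[OF cK a w] by simp
    then have "ract a w = sc (inv\<^bsub>K\<^esub> c) \<zero>\<^bsub>W\<^esub>" using sc_cancel(1)[OF cK c(2), of "ract a w"] a w by simp
    also have "\<dots> = \<zero>\<^bsub>W\<^esub>" using actions_zero(5)[of "inv\<^bsub>K\<^esub> c"] cK c(2) FA.K.field_Units by simp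
    finally show ?thesis by (simp add: ract_def)
  qed
  then have "\<iota>A a = \<zero>\<^bsub>EA\<^esub>" by (rule act_faithful[OF FA.\<iota>_simps(1)[OF a]])
  then show ?thesis using inj_onD[OF FA.\<iota>_inj, of a "\<zero>\<^bsub>A\<^esub>"] FA.\<iota>_zero a by simp
qed

lemma ract_inject:
  assumes a: "a \<in> carrier A" "a' \<in> carrier A" and eq: "\<And>x. x \<in> L \<Longrightarrow> ract a x = ract a' x"
  shows "a = a'"
proof -
  have "ract (a \<ominus>\<^bsub>A\<^esub> a') x = \<zero>\<^bsub>W\<^esub>" if x: "x \<in> L" for x
  proof -
    have xW: "x \<in> carrier W" by (rule L_sub[OF x])
    have "ract (a \<ominus>\<^bsub>A\<^esub> a') x \<oplus>\<^bsub>W\<^esub> ract a' x = ract ((a \<ominus>\<^bsub>A\<^esub> a') \<oplus>\<^bsub>A\<^esub> a') x"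
      using ract_simps(2)[of "a \<ominus>\<^bsub>A\<^esub> a'" a' x] a xW by simp
    also have "(a \<ominus>\<^bsub>A\<^esub> a') \<oplus>\<^bsub>A\<^esub> a' = a" using a by (simp add: FA.M.minus_eq FA.M.a_assoc FA.M.l_neg)
    also have "ract a x = ract a' x" by (rule eq[OF x])
    finally show ?thesis using a xW W.M.add.r_cancel_one[of "ract a' x" "ract (a \<ominus>\<^bsub>A\<^esub> a') x"] by simp
  qed
  then have "a \<ominus>\<^bsub>A\<^esub> a' = \<zero>\<^bsub>A\<^esub>" by (rule ract_faithful[OF _ FA.M.minus_closed[OF a]])
  then show ?thesis using a FA.A.r_right_minus_eq[of a a'] by simp
qed

text \<open>A lattice of rank \<open>0\<close> would be zero and \<open>1\<close> of
  \<open>A\<close> would act as \<open>0\<close>. Positivity provides the basis vector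
  \<open>l 0\<close> and a nonempty matrix size.\<close>

lemma r_pos: "0 < r"
proof (rule ccontr)
  assume "\<not> 0 < r"
  then have "ract \<one>\<^bsub>A\<^esub> x = \<zero>\<^bsub>W\<^esub>" if "x \<in> L" for x
    using expand_L[OF that] actions_zero(3)[of "\<one>\<^bsub>A\<^esub>"] by simp
  then have "\<one>\<^bsub>A\<^esub> = \<zero>\<^bsub>A\<^esub>" by (rule ract_faithful[OF _ FA.A.one_closed])
  then show False using FA.nontrivial by simp
qed

section \<open>Products of rows over \<open>B\<close> with columns in \<open>W\<close>\<close>

definition comb :: "(nat \<Rightarrow> _) \<Rightarrow> (nat \<Rightarrow> _) \<Rightarrow> _" where
  "comb a z = (\<Oplus>\<^bsub>W\<^esub>p\<in>{..<r}. lact (a p) (z p))"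

definition row :: "(nat \<Rightarrow> _) \<Rightarrow> bool" where "row a \<longleftrightarrow> (\<forall>p<r. a p \<in> carrier B)"

definition column :: "(nat \<Rightarrow> _) \<Rightarrow> bool" where "column z \<longleftrightarrow> (\<forall>p<r. z p \<in> carrier W)"

lemma rowD: "\<lbrakk>row a; p < r\<rbrakk> \<Longrightarrow> a p \<in> carrier B" and columnD: "\<lbrakk>column z; p < r\<rbrakk> \<Longrightarrow> z p \<in> carrier W"
  by (simp_all add: row_def column_def)

lemma comb_closed: "\<lbrakk>row a; column z\<rbrakk> \<Longrightarrow> comb a z \<in> carrier W"
  unfolding comb_def by (rule W.M.finsum_closed) (simp add: Pi_iff rowD columnD)

lemma comb_L: "\<lbrakk>row a; \<And>p. p < r \<Longrightarrow> z p \<in> L\<rbrakk> \<Longrightarrow> comb a z \<in> L"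
  unfolding comb_def by (rule L_finsum) (simp_all add: Pi_iff rowD L_lact)

text \<open>Rows and columns are functions on all natural numbers of which only the entries below
  \<open>r\<close> count, so equality is used in this pointwise form.\<close>

lemma comb_cong:
  assumes "row a" "column z" "\<And>p. p < r \<Longrightarrow> a' p = a p" "\<And>p. p < r \<Longrightarrow> z' p = z p"
  shows "comb a' z' = comb a z"
  unfolding comb_def by (rule W.M.finsum_cong') (simp_all add: assms Pi_iff rowD[OF assms(1)] columnD[OF assms(2)])

lemma comb_add:
  assumes a: "row a" "row a'" and z: "column z"
  shows "comb (\<lambda>p. a p \<oplus>\<^bsub>B\<^esub> a' p) z = comb a z \<oplus>\<^bsub>W\<^esub> comb a' z"
proof -
  have "comb (\<lambda>p. a p \<oplus>\<^bsub>B\<^esub> a' p) z = (\<Oplus>\<^bsub>W\<^esub>p\<in>{..<r}. lact (a p) (z p) \<oplus>\<^bsub>W\<^esub> lact (a' p) (z p))"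
    unfolding comb_def by (rule W.M.finsum_cong') (simp_all add: Pi_iff rowD a columnD[OF z] lact_simps(2))
  also have "\<dots> = comb a z \<oplus>\<^bsub>W\<^esub> comb a' z"
    unfolding comb_def by (rule W.M.finsum_addf) (simp_all add: Pi_iff rowD a columnD[OF z])
  finally show ?thesis .
qed

lemma comb_finsum:
  assumes I: "finite I" and g: "\<And>j. j \<in> I \<Longrightarrow> row (g j)" and z: "column z"
  shows "comb (\<lambda>p. \<Oplus>\<^bsub>B\<^esub>j\<in>I. g j p) z = (\<Oplus>\<^bsub>W\<^esub>j\<in>I. comb (g j) z)"
proof -
  have "comb (\<lambda>p. \<Oplus>\<^bsub>B\<^esub>j\<in>I. g j p) z = (\<Oplus>\<^bsub>W\<^esub>p\<in>{..<r}. \<Oplus>\<^bsub>W\<^esub>j\<in>I. lact (g j p) (z p))"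
    unfolding comb_def
    by (rule W.M.finsum_cong') (simp_all add: Pi_iff W.M.finsum_closed finsum_actions(2) I rowD[OF g] columnD[OF z])
  also have "\<dots> = (\<Oplus>\<^bsub>W\<^esub>j\<in>I. \<Oplus>\<^bsub>W\<^esub>p\<in>{..<r}. lact (g j p) (z p))"
    by (rule W.M.finsum_swap) (simp_all add: I rowD[OF g] columnD[OF z])
  finally show ?thesis by (simp add: comb_def)
qed

lemma comb_lact:
  assumes b: "b \<in> carrier B" and a: "row a" and z: "column z"
  shows "comb (\<lambda>p. b \<otimes>\<^bsub>B\<^esub> a p) z = lact b (comb a z)"
proof -
  have "comb (\<lambda>p. b \<otimes>\<^bsub>B\<^esub> a p) z = (\<Oplus>\<^bsub>W\<^esub>p\<in>{..<r}. lact b (lact (a p) (z p)))"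
    unfolding comb_def by (rule W.M.finsum_cong') (simp_all add: Pi_iff b rowD[OF a] columnD[OF z] lact_simps(3))
  then show ?thesis
    unfolding comb_def using finsum_actions(1)[of "{..<r}" "\<lambda>p. lact (a p) (z p)" b] b rowD[OF a] columnD[OF z] by (simp add: Pi_iff)
qed

text \<open>The right action of \<open>A\<close> commutes with the left action of \<open>B\<close>
  and can be pulled out of a product of row and column.\<close>

lemma comb_ract:
  assumes a: "row a" and I: "finite I" and y: "\<And>j. j \<in> I \<Longrightarrow> y j \<in> carrier A" and z: "\<And>j. j \<in> I \<Longrightarrow> column (z j)"
  shows "comb a (\<lambda>p. \<Oplus>\<^bsub>W\<^esub>j\<in>I. ract (y j) (z j p)) = (\<Oplus>\<^bsub>W\<^esub>j\<in>I. ract (y j) (comb a (z j)))"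
proof -
  have zc: "z j p \<in> carrier W" if "j \<in> I" "p < r" for j p by (rule columnD[OF z[OF that(1)] that(2)])
  have "comb a (\<lambda>p. \<Oplus>\<^bsub>W\<^esub>j\<in>I. ract (y j) (z j p)) = (\<Oplus>\<^bsub>W\<^esub>p\<in>{..<r}. \<Oplus>\<^bsub>W\<^esub>j\<in>I. ract (y j) (lact (a p) (z j p)))"
    unfolding comb_def
  proof (rule W.M.finsum_cong')
    fix p assume p: "p \<in> {..<r}"
    have "lact (a p) (\<Oplus>\<^bsub>W\<^esub>j\<in>I. ract (y j) (z j p)) = (\<Oplus>\<^bsub>W\<^esub>j\<in>I. lact (a p) (ract (y j) (z j p)))"
      by (rule finsum_actions(1)[OF I]) (use p rowD[OF a] y zc in \<open>simp_all add: Pi_iff\<close>)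
    also have "\<dots> = (\<Oplus>\<^bsub>W\<^esub>j\<in>I. ract (y j) (lact (a p) (z j p)))"
      by (rule W.M.finsum_cong') (use p rowD[OF a] y zc in \<open>simp_all add: Pi_iff ract_lact\<close>)
    finally show "lact (a p) (\<Oplus>\<^bsub>W\<^esub>j\<in>I. ract (y j) (z j p)) = \<dots>" .
  qed (use rowD[OF a] y zc in \<open>simp_all add: Pi_iff W.M.finsum_closed\<close>)
  also have "\<dots> = (\<Oplus>\<^bsub>W\<^esub>j\<in>I. \<Oplus>\<^bsub>W\<^esub>p\<in>{..<r}. ract (y j) (lact (a p) (z j p)))"
    by (rule W.M.finsum_swap) (use I rowD[OF a] y zc in simp_all)
  also have "\<dots> = (\<Oplus>\<^bsub>W\<^esub>j\<in>I. ract (y j) (comb a (z j)))"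
    by (rule W.M.finsum_cong')
      (use rowD[OF a] y zc z a comb_closed in \<open>simp_all add: Pi_iff comb_def finsum_actions(3)\<close>)
  finally show ?thesis .
qed

lemma comb_unit:
  assumes q: "q < r" and z: "column z"
  shows "comb (\<lambda>p. if p = q then \<one>\<^bsub>B\<^esub> else \<zero>\<^bsub>B\<^esub>) z = z q"
proof -
  have "comb (\<lambda>p. if p = q then \<one>\<^bsub>B\<^esub> else \<zero>\<^bsub>B\<^esub>) z = (\<Oplus>\<^bsub>W\<^esub>p\<in>{..<r}. if p = q then z p else \<zero>\<^bsub>W\<^esub>)"
    unfolding comb_def by (rule W.M.finsum_cong') (simp_all add: Pi_iff columnD[OF z] lact_simps(4) actions_zero(2))
  then show ?thesis using W.M.finsum_delta[of "{..<r}" q z] q columnD[OF z q] by simp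
qed

text \<open>The column with entries \<open>b l\<^sub>p\<close>. Thus \<open>comb a (vec b)\<close>,
  as a function of \<open>b\<close>, is the \<open>V\<close>-linear map from \<open>B\<close> to
  \<open>L\<close> given by the tensor with components
  \<open>a\<^sub>p \<otimes> l\<^sub>p\<close>.\<close>

definition vec :: "_ \<Rightarrow> nat \<Rightarrow> _" where "vec b p = lact b (l p)"

lemma vec_L: "\<lbrakk>b \<in> carrier B; p < r\<rbrakk> \<Longrightarrow> vec b p \<in> L"
  by (simp add: vec_def L_lact l_L)

lemma vec_column: "b \<in> carrier B \<Longrightarrow> column (vec b)"
  by (simp add: column_def vec_L L_sub)

lemma comb_vec_add:
  assumes a: "row a" and b: "b \<in> carrier B" "b' \<in> carrier B"
  shows "comb a (vec (b \<oplus>\<^bsub>B\<^esub> b')) = comb a (vec b) \<oplus>\<^bsub>W\<^esub> comb a (vec b')"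
proof -
  have "comb a (vec (b \<oplus>\<^bsub>B\<^esub> b')) = (\<Oplus>\<^bsub>W\<^esub>p\<in>{..<r}. lact (a p) (vec b p) \<oplus>\<^bsub>W\<^esub> lact (a p) (vec b' p))"
    unfolding comb_def by (rule W.M.finsum_cong') (simp_all add: vec_def Pi_iff b rowD[OF a] l_W lact_simps(1,2))
  also have "\<dots> = comb a (vec b) \<oplus>\<^bsub>W\<^esub> comb a (vec b')"
    unfolding comb_def by (rule W.M.finsum_addf) (simp_all add: vec_def Pi_iff b rowD[OF a] l_W)
  finally show ?thesis .
qed

lemma comb_vec_sc:
  assumes a: "row a" and b: "b \<in> carrier B" and c: "c \<in> V"
  shows "comb a (vec (c \<odot>\<^bsub>B\<^esub> b)) = sc c (comb a (vec b))"
proof -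
  let ?c = "c \<odot>\<^bsub>A\<^esub> \<one>\<^bsub>A\<^esub>"
  have cA: "?c \<in> carrier A" using FA.smult_closed[of c "\<one>\<^bsub>A\<^esub>"] c by simp
  have rc: "ract ?c x = sc c x" if "x \<in> carrier W" for x
    using sc_lact_ract(3)[OF c FA.A.one_closed that] ract_simps(4)[OF that] by simp
  \<comment> \<open>The scalar is written as an element of \<open>A\<close> acting from the right,
    in a sum with one term, so that \<open>comb_ract\<close> moves it past the row.\<close>
  have "vec (c \<odot>\<^bsub>B\<^esub> b) p = (\<Oplus>\<^bsub>W\<^esub>j\<in>{0::nat}. ract ?c (vec b p))" if "p < r" for p
  proof -
    have "vec b p \<in> carrier W" by (rule L_sub[OF vec_L[OF b that]])
    then have "(\<Oplus>\<^bsub>W\<^esub>j\<in>{0::nat}. ract ?c (vec b p)) = sc c (vec b p)" using rc[of "vec b p"] cA closed(2)[of ?c "vec b p"] by simp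
    then show ?thesis using sc_lact_ract(1)[OF c b l_W[OF that]] by (simp add: vec_def)
  qed
  moreover have "column (\<lambda>p. \<Oplus>\<^bsub>W\<^esub>j\<in>{0::nat}. ract ?c (vec b p))"
    using columnD[OF vec_column[OF b]] cA by (simp add: column_def)
  ultimately have "comb a (vec (c \<odot>\<^bsub>B\<^esub> b)) = comb a (\<lambda>p. \<Oplus>\<^bsub>W\<^esub>j\<in>{0::nat}. ract ?c (vec b p))"
    by (intro comb_cong[OF a]) simp_all
  also have "\<dots> = (\<Oplus>\<^bsub>W\<^esub>j\<in>{0::nat}. ract ?c (comb a (vec b)))"
    by (rule comb_ract[OF a, of "{0}" "\<lambda>_. ?c" "\<lambda>_. vec b"]) (simp_all add: cA vec_column[OF b])
  also have "\<dots> = sc c (comb a (vec b))" using rc comb_closed[OF a vec_column[OF b]] FA.V_sub[OF c] by simp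
  finally show ?thesis .
qed

text \<open>
  The map \<open>a \<mapsto> (Psi a k)\<^sub>k\<close> is an isomorphism from \<open>B\<^sup>r\<close> to \<open>L\<^sup>n\<close> of left \<open>B\<close>-modules, where \<open>n\<close> is the
  rank of \<open>B\<close>. Comparing endomorphism rings relates matrices over \<open>B\<close> and over \<open>A\<close>, the latter acting
  on \<open>L\<close> from the right.
\<close>

abbreviation Psi where "Psi a k \<equiv> comb a (vec (eB k))"

lemma vec_e: "k < nB \<Longrightarrow> column (vec (eB k))" by (rule vec_column[OF FB.e_closed])

lemma Psi_L: "\<lbrakk>row a; k < nB\<rbrakk> \<Longrightarrow> Psi a k \<in> L"
  by (rule comb_L) (simp_all add: vec_L FB.e_closed)

lemma comb_vec_zero:
  assumes a: "row a" and z: "\<And>k. k < nB \<Longrightarrow> Psi a k = \<zero>\<^bsub>W\<^esub>" and b: "b \<in> carrier B"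
  shows "comb a (vec b) = \<zero>\<^bsub>W\<^esub>"
proof -
  have d: "dB k b \<in> V" if "k < nB" for k using FB.d_closed[OF that b] by simp
  have s: "dB k b \<odot>\<^bsub>B\<^esub> eB k \<in> carrier B" if "k < nB" for k
    using FB.smult_closed[of "dB k b" "eB k"] d[OF that] FB.e_closed[OF that] by simp
  have "comb a (vec (\<Oplus>\<^bsub>B\<^esub>k\<in>{..<nB}. dB k b \<odot>\<^bsub>B\<^esub> eB k)) = (\<Oplus>\<^bsub>W\<^esub>k\<in>{..<nB}. comb a (vec (dB k b \<odot>\<^bsub>B\<^esub> eB k)))"
    by (rule additive_finsum[where f = "\<lambda>b. comb a (vec b)", OF FB.A.is_abelian_group W_group])
      (simp_all add: comb_vec_add[OF a] s Pi_iff comb_closed[OF a] vec_column)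
  also have "\<dots> = (\<Oplus>\<^bsub>W\<^esub>k\<in>{..<nB}. \<zero>\<^bsub>W\<^esub>)"
    by (rule W.M.finsum_cong') (simp_all add: comb_vec_sc[OF a] FB.e_closed d z actions_zero(5) FA.V_sub)
  finally show ?thesis using FB.expand[OF b] by simp
qed

text \<open>The right factor \<open>y\<close> of an operator passes to the argument, turning
  \<open>b\<close> into \<open>y b\<close>, and the left factor \<open>x\<close> is pulled out;
  since the hypothesis holds for all arguments, both are harmless.\<close>

lemma sandwich_comb_zero:
  assumes a: "row a" and z: "\<And>b. b \<in> carrier B \<Longrightarrow> comb a (vec b) = \<zero>\<^bsub>W\<^esub>"
    and g: "sandwich B g" and b: "b \<in> carrier B"
  shows "comb (\<lambda>p. g (a p)) (vec b) = \<zero>\<^bsub>W\<^esub>"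
  using g
proof induction
  case (single x y)
  have xa: "row (\<lambda>p. x \<otimes>\<^bsub>B\<^esub> a p)" using single rowD[OF a] by (simp add: row_def)
  have yb: "y \<otimes>\<^bsub>B\<^esub> b \<in> carrier B" using single b by simp
  have "comb (\<lambda>p. x \<otimes>\<^bsub>B\<^esub> a p \<otimes>\<^bsub>B\<^esub> y) (vec b) = comb (\<lambda>p. x \<otimes>\<^bsub>B\<^esub> a p) (vec (y \<otimes>\<^bsub>B\<^esub> b))"
    unfolding comb_def
    by (rule W.M.finsum_cong') (use single b rowD[OF a] in \<open>simp_all add: Pi_iff vec_def l_W lact_simps(3)\<close>)
  also have "\<dots> = lact x (comb a (vec (y \<otimes>\<^bsub>B\<^esub> b)))" by (rule comb_lact[OF single(1) a vec_column[OF yb]])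
  finally show ?case using z[OF yb] actions_zero(1)[OF single(1)] by simp
next
  case (add f g)
  have "row (\<lambda>p. f (a p))" "row (\<lambda>p. g (a p))"
    using sandwich_closed[OF add(1) FB.A.ring_axioms] sandwich_closed[OF add(2) FB.A.ring_axioms] rowD[OF a]
    by (simp_all add: row_def)
  then show ?case using comb_add[OF _ _ vec_column[OF b]] add.IH by simp
qed

lemma coordinate_sandwich:
  assumes k: "k < nB"
  shows "\<exists>g. sandwich B g \<and> (\<forall>x\<in>carrier B. g x = dB k x \<odot>\<^bsub>B\<^esub> \<one>\<^bsub>B\<^esub>)"
  by (rule FB.coord_sandwich[OF k]) (intro exI conjI ballI, assumption, simp)

text \<open>Replacing each entry by its coordinate \<open>k\<close> keeps the combination zero, as
  reading a coordinate is a sandwich operator. At \<open>b = 1\<close> this is a relation over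
  \<open>V\<close> between the basis vectors \<open>l p\<close>, so all coordinates vanish.\<close>

lemma Psi_zero:
  assumes a: "row a" and z: "\<And>k. k < nB \<Longrightarrow> Psi a k = \<zero>\<^bsub>W\<^esub>" and p: "p < r"
  shows "a p = \<zero>\<^bsub>B\<^esub>"
proof (rule FB.coord_eqI)
  fix k assume k: "k < nB"
  obtain g where g: "sandwich B g" "\<And>x. x \<in> carrier B \<Longrightarrow> g x = dB k x \<odot>\<^bsub>B\<^esub> \<one>\<^bsub>B\<^esub>" using coordinate_sandwich[OF k] by (elim exE conjE) (simp add: Ball_def)
  have d: "dB k (a q) \<in> V" if "q < r" for q using FB.d_closed[OF k rowD[OF a that]] by simp
  have "\<zero>\<^bsub>W\<^esub> = comb (\<lambda>p. g (a p)) (vec \<one>\<^bsub>B\<^esub>)"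
    using sandwich_comb_zero[OF a comb_vec_zero[OF a z] g(1) FB.A.one_closed] by simp
  also have "\<dots> = (\<Oplus>\<^bsub>W\<^esub>q\<in>{..<r}. sc (dB k (a q)) (l q))"
    unfolding comb_def
    by (rule W.M.finsum_cong')
      (simp_all add: Pi_iff g(2) rowD[OF a] vec_def l_W lact_simps(4) sc_lact_ract(1) d FA.V_sub)
  also have "\<dots> = (\<Oplus>\<^bsub>L_module\<^esub>q\<in>{..<r}. dB k (a q) \<odot>\<^bsub>L_module\<^esub> l q)"
    using finsum_L[of "{..<r}" "\<lambda>q. sc (dB k (a q)) (l q)"] d l_L L_sc by (simp add: Pi_iff L_module_simps)
  finally have "dB k (a p) = dl p \<zero>\<^bsub>L_module\<^esub>"
    using Lm.d_combination[OF p, of "\<lambda>q. dB k (a q)"] d by (simp add: L_module_simps)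
  then show "dB k (a p) = dB k \<zero>\<^bsub>B\<^esub>" using Lm.d_zero[OF p] FB.d_zero[OF k] by simp
qed (use rowD[OF a p] in simp_all)

lemma Psi_inject:
  assumes a: "row a" "row a'" and eq: "\<And>k. k < nB \<Longrightarrow> Psi a k = Psi a' k" and p: "p < r"
  shows "a p = a' p"
proof -
  let ?d = "\<lambda>p. a p \<ominus>\<^bsub>B\<^esub> a' p"
  have d: "row ?d" using rowD[OF a(1)] rowD[OF a(2)] by (simp add: row_def)
  have "Psi ?d k = \<zero>\<^bsub>W\<^esub>" if k: "k < nB" for k
  proof -
    have c: "Psi ?d k \<in> carrier W" "Psi a' k \<in> carrier W" using comb_closed vec_e[OF k] d a by simp_all
    have "Psi ?d k \<oplus>\<^bsub>W\<^esub> Psi a' k = Psi (\<lambda>p. ?d p \<oplus>\<^bsub>B\<^esub> a' p) k" using comb_add[OF d a(2) vec_e[OF k]] by simp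
    also have "\<dots> = Psi a k"
      by (rule comb_cong[OF a(1) vec_e[OF k]])
        (use rowD[OF a(1)] rowD[OF a(2)] in \<open>simp_all add: FB.M.minus_eq FB.M.a_assoc FB.M.l_neg\<close>)
    finally show ?thesis using eq[OF k] c W.M.add.r_cancel_one[of "Psi a' k" "Psi ?d k"] by simp
  qed
  from Psi_zero[OF d this p] show ?thesis
    using FB.A.r_right_minus_eq[of "a p" "a' p"] rowD[OF a(1) p] rowD[OF a(2) p] by simp
qed

text \<open>For the operator \<open>b \<mapsto> x' b y\<close> the vector \<open>y x\<close> is
  expanded in the basis of \<open>L\<close>, and its coordinates times \<open>x'\<close> form the
  row. Sums of operators correspond to sums of rows.\<close>

lemma sandwich_preimage:
  assumes g: "sandwich B g" and x: "x \<in> L"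
  shows "\<exists>a. row a \<and> (\<forall>b\<in>carrier B. comb a (vec b) = lact (g b) x)"
  using g
proof induction
  case (single x' y)
  have yx: "lact y x \<in> L" by (rule L_lact[OF single(2) x])
  let ?d = "\<lambda>p. dl p (lact y x)"
  let ?a = "\<lambda>p. ?d p \<odot>\<^bsub>B\<^esub> x'"
  have d: "?d p \<in> V" if "p < r" for p by (rule dl_V[OF that yx])
  have a: "row ?a" using FB.smult_closed[of _ x'] d single(1) by (simp add: row_def)
  have "comb ?a (vec b) = lact (x' \<otimes>\<^bsub>B\<^esub> b \<otimes>\<^bsub>B\<^esub> y) x" if b: "b \<in> carrier B" for b
  proof -
    have xb: "x' \<otimes>\<^bsub>B\<^esub> b \<in> carrier B" using single b by simp
    have "comb ?a (vec b) = (\<Oplus>\<^bsub>W\<^esub>p\<in>{..<r}. lact (x' \<otimes>\<^bsub>B\<^esub> b) (sc (?d p) (l p)))"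
      unfolding comb_def
      by (rule W.M.finsum_cong')
        (use d single b in \<open>simp_all add: Pi_iff vec_def l_W sc_lact_ract(1,2) FA.V_sub lact_simps(3)\<close>)
    also have "\<dots> = lact (x' \<otimes>\<^bsub>B\<^esub> b) (\<Oplus>\<^bsub>W\<^esub>p\<in>{..<r}. sc (?d p) (l p))"
      by (rule finsum_actions(1)[symmetric]) (use xb d in \<open>simp_all add: Pi_iff l_W FA.V_sub\<close>)
    also have "\<dots> = lact (x' \<otimes>\<^bsub>B\<^esub> b) (lact y x)" by (simp only: expand_L[OF yx])
    finally show ?thesis using lact_simps(3)[OF xb single(2) L_sub[OF x]] by simp
  qed
  then show ?case using a by (intro exI[of _ ?a] conjI ballI)
next
  case (add f g)
  from add.IH(1) obtain a where a: "row a" "\<forall>b\<in>carrier B. comb a (vec b) = lact (f b) x" by (elim exE conjE)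
  from add.IH(2) obtain a' where a': "row a'" "\<forall>b\<in>carrier B. comb a' (vec b) = lact (g b) x" by (elim exE conjE)
  have "comb (\<lambda>p. a p \<oplus>\<^bsub>B\<^esub> a' p) (vec b) = lact (f b \<oplus>\<^bsub>B\<^esub> g b) x" if b: "b \<in> carrier B" for b
    using comb_add[OF a(1) a'(1) vec_column[OF b]] a(2) a'(2) b L_sub[OF x]
      sandwich_closed[OF add(1) FB.A.ring_axioms b] sandwich_closed[OF add(2) FB.A.ring_axioms b]
    by (simp add: lact_simps(2))
  moreover have "row (\<lambda>p. a p \<oplus>\<^bsub>B\<^esub> a' p)" using rowD[OF a(1)] rowD[OF a'(1)] by (simp add: row_def)
  ultimately show ?case by (intro exI[of _ "\<lambda>p. a p \<oplus>\<^bsub>B\<^esub> a' p"] conjI ballI)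
qed

text \<open>The operator reading off coordinate \<open>j\<close> of \<open>B\<close>, followed by
  the action on \<open>x\<close>, takes the value \<open>x\<close> at the \<open>j\<close>-th basis
  element and zero at the others.\<close>

lemma single_preimage:
  assumes j: "j < nB" and x: "x \<in> L"
  shows "\<exists>a. row a \<and> (\<forall>k<nB. Psi a k = (if k = j then x else \<zero>\<^bsub>W\<^esub>))"
proof -
  obtain g where g: "sandwich B g" "\<And>x. x \<in> carrier B \<Longrightarrow> g x = dB j x \<odot>\<^bsub>B\<^esub> \<one>\<^bsub>B\<^esub>" using coordinate_sandwich[OF j] by (elim exE conjE) (simp add: Ball_def)
  obtain a where a: "row a" "\<forall>b\<in>carrier B. comb a (vec b) = lact (g b) x" using sandwich_preimage[OF g(1) x] by (elim exE conjE)
  have xW: "x \<in> carrier W" by (rule L_sub[OF x])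
  have "Psi a k = (if k = j then x else \<zero>\<^bsub>W\<^esub>)" if k: "k < nB" for k
  proof -
    have "Psi a k = lact (dB j (eB k) \<odot>\<^bsub>B\<^esub> \<one>\<^bsub>B\<^esub>) x" using a(2) g(2) FB.e_closed[OF k] by simp
    then show ?thesis using FB.d_e[OF j k] lact_simps(4)[OF xW] actions_zero(2)[OF xW] FB.smult_one[OF FB.A.one_closed] FB.smult_l_null[OF FB.A.one_closed] by (auto split: if_splits)
  qed
  then show ?thesis using a(1) by (intro exI[of _ a] conjI allI impI)
qed

text \<open>A chosen preimage under \<open>Psi\<close> of the tuple with \<open>x\<close> in place
  \<open>j\<close>. It is not additive as a function on all indices; by \<open>Psi_inject\<close>
  its entries below \<open>r\<close> are determined by \<open>x\<close>, which gives linearity where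
  it matters.\<close>

definition lift :: "nat \<Rightarrow> _ \<Rightarrow> nat \<Rightarrow> _" where
  "lift j x = (SOME a. row a \<and> (\<forall>k<nB. Psi a k = (if k = j then x else \<zero>\<^bsub>W\<^esub>)))"

lemma lift:
  assumes "j < nB" "x \<in> L"
  shows lift_row: "row (lift j x)" and Psi_lift: "k < nB \<Longrightarrow> Psi (lift j x) k = (if k = j then x else \<zero>\<^bsub>W\<^esub>)"
  using someI_ex[OF single_preimage[OF assms], folded lift_def] by simp_all

lemma Psi_sum_lift:
  assumes w: "\<And>j. j < nB \<Longrightarrow> w j \<in> L" and k: "k < nB"
  shows "Psi (\<lambda>p. \<Oplus>\<^bsub>B\<^esub>j\<in>{..<nB}. lift j (w j) p) k = w k"
proof -
  have "Psi (\<lambda>p. \<Oplus>\<^bsub>B\<^esub>j\<in>{..<nB}. lift j (w j) p) k = (\<Oplus>\<^bsub>W\<^esub>j\<in>{..<nB}. Psi (lift j (w j)) k)"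
    by (rule comb_finsum) (simp_all add: lift_row w vec_e[OF k])
  also have "\<dots> = (\<Oplus>\<^bsub>W\<^esub>j\<in>{..<nB}. if j = k then w j else \<zero>\<^bsub>W\<^esub>)"
    by (rule W.M.finsum_cong') (auto simp: Psi_lift w k L_sub)
  finally show ?thesis using W.M.finsum_delta[of "{..<nB}" k w] k L_sub[OF w[OF k]] by simp
qed

lemma row_sum_lift:
  assumes w: "\<And>j. j < nB \<Longrightarrow> w j \<in> L" shows "row (\<lambda>p. \<Oplus>\<^bsub>B\<^esub>j\<in>{..<nB}. lift j (w j) p)"
  using rowD[OF lift_row] w by (simp add: row_def Pi_iff FB.M.finsum_closed)

text \<open>Through \<open>lift j\<close> the map \<open>a \<mapsto> comb a z\<close> becomes a
  \<open>B\<close>-linear endomorphism of \<open>L\<close>, which by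
  \<open>lattice_endomorphism\<close> is the right action of some \<open>y j\<close> in
  \<open>A\<close>. A row is the sum of the lifts of its values under \<open>Psi\<close>.\<close>

lemma operator_matrix:
  assumes z: "\<And>p. p < r \<Longrightarrow> z p \<in> L"
  shows "\<exists>y. (\<forall>j<nB. y j \<in> carrier A) \<and> (\<forall>a. row a \<longrightarrow> comb a z = (\<Oplus>\<^bsub>W\<^esub>j\<in>{..<nB}. ract (y j) (Psi a j)))"
proof -
  have zc: "column z" using z L_sub by (simp add: column_def)
  have "\<exists>y. y \<in> carrier A \<and> (\<forall>x\<in>L. comb (lift j x) z = ract y x)" if j: "j < nB" for j
  proof (rule lattice_endomorphism[OF based r_pos, of "\<lambda>x. comb (lift j x) z"])
    show "comb (lift j x) z \<in> L" if "x \<in> L" for x by (rule comb_L[OF lift_row[OF j that] z])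
  next
    fix x y assume x: "x \<in> L" and y: "y \<in> L"
    have xy: "x \<oplus>\<^bsub>W\<^esub> y \<in> L" by (rule L_add[OF x y])
    let ?s = "\<lambda>p. lift j x p \<oplus>\<^bsub>B\<^esub> lift j y p"
    have s: "row ?s" using rowD[OF lift_row[OF j x]] rowD[OF lift_row[OF j y]] by (simp add: row_def)
    have "lift j (x \<oplus>\<^bsub>W\<^esub> y) p = ?s p" if p: "p < r" for p
      by (rule Psi_inject[OF lift_row[OF j xy] s _ p])
        (simp add: comb_add[OF lift_row[OF j x] lift_row[OF j y] vec_e] Psi_lift j x y xy)
    then have "comb (lift j (x \<oplus>\<^bsub>W\<^esub> y)) z = comb ?s z" by (intro comb_cong[OF s zc]) simp_all
    then show "comb (lift j (x \<oplus>\<^bsub>W\<^esub> y)) z = comb (lift j x) z \<oplus>\<^bsub>W\<^esub> comb (lift j y) z"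
      using comb_add[OF lift_row[OF j x] lift_row[OF j y] zc] by simp
  next
    fix b x assume b: "b \<in> carrier B" and x: "x \<in> L"
    have bx: "lact b x \<in> L" by (rule L_lact[OF b x])
    let ?s = "\<lambda>p. b \<otimes>\<^bsub>B\<^esub> lift j x p"
    have s: "row ?s" using rowD[OF lift_row[OF j x]] b by (simp add: row_def)
    have "lift j (lact b x) p = ?s p" if p: "p < r" for p
      by (rule Psi_inject[OF lift_row[OF j bx] s _ p])
        (simp add: comb_lact[OF b lift_row[OF j x] vec_e] Psi_lift j x bx actions_zero(1)[OF b])
    then have "comb (lift j (lact b x)) z = comb ?s z" by (intro comb_cong[OF s zc]) simp_all
    then show "comb (lift j (lact b x)) z = lact b (comb (lift j x) z)"
      using comb_lact[OF b lift_row[OF j x] zc] by simp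
  next
    fix y assume "y \<in> carrier A" "\<And>x. x \<in> L \<Longrightarrow> comb (lift j x) z = ract y x"
    then show ?thesis by (intro exI[of _ y] conjI ballI)
  qed
  then have "\<forall>j. \<exists>y. j < nB \<longrightarrow> y \<in> carrier A \<and> (\<forall>x\<in>L. comb (lift j x) z = ract y x)" by simp
  from choice[OF this] obtain y
    where "\<forall>j. j < nB \<longrightarrow> y j \<in> carrier A \<and> (\<forall>x\<in>L. comb (lift j x) z = ract (y j) x)" by (elim exE)
  then have y: "\<And>j. j < nB \<Longrightarrow> y j \<in> carrier A" "\<And>j x. \<lbrakk>j < nB; x \<in> L\<rbrakk> \<Longrightarrow> comb (lift j x) z = ract (y j) x"
    by simp_all
  have "comb a z = (\<Oplus>\<^bsub>W\<^esub>j\<in>{..<nB}. ract (y j) (Psi a j))" if a: "row a" for a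
  proof -
    have w: "Psi a j \<in> L" if "j < nB" for j by (rule Psi_L[OF a that])
    \<comment> \<open>The row rebuilt from its values under \<open>Psi\<close>; it has the same
      values, hence the same entries below \<open>r\<close>.\<close>
    let ?s = "\<lambda>p. \<Oplus>\<^bsub>B\<^esub>j\<in>{..<nB}. lift j (Psi a j) p"
    have s: "row ?s" by (rule row_sum_lift[OF w])
    have "a p = ?s p" if p: "p < r" for p
      by (rule Psi_inject[OF a s _ p]) (simp add: Psi_sum_lift[OF w])
    then have "comb a z = comb ?s z" by (intro comb_cong[OF s zc]) simp_all
    also have "\<dots> = (\<Oplus>\<^bsub>W\<^esub>j\<in>{..<nB}. comb (lift j (Psi a j)) z)"
      by (rule comb_finsum) (simp_all add: lift_row w zc)
    also have "\<dots> = (\<Oplus>\<^bsub>W\<^esub>j\<in>{..<nB}. ract (y j) (Psi a j))"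
      by (rule W.M.finsum_cong') (simp_all add: y w L_sub Pi_iff)
    finally show ?thesis .
  qed
  then show ?thesis using y(1) by (intro exI[of _ y]) simp
qed

text \<open>\<open>X\<close> acts on rows by \<open>a \<mapsto> a X\<close>, and \<open>Y\<close>
  acts from the right on \<open>n\<close>-tuples in \<open>L\<close>. The condition says that
  \<open>Psi\<close> intertwines the two on the unit rows: row \<open>p\<close> of \<open>X\<close>
  is the image of the \<open>p\<close>-th unit row, whose value under \<open>Psi\<close> at
  \<open>j\<close> is \<open>vec (eB j) p\<close>.\<close>

definition corresponds :: "(nat \<Rightarrow> nat \<Rightarrow> _) \<Rightarrow> (nat \<Rightarrow> nat \<Rightarrow> _) \<Rightarrow> bool" where
  "corresponds X Y \<longleftrightarrow>
     (\<forall>p<r. \<forall>k<nB. Psi (X p) k = (\<Oplus>\<^bsub>W\<^esub>j\<in>{..<nB}. ract (Y j k) (vec (eB j) p)))"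

abbreviation "MB \<equiv> matrix_algebra r B"
abbreviation "MA \<equiv> matrix_algebra nB A"

lemma MB_row: "X \<in> carrier MB \<Longrightarrow> row (X p)" and MB_closed: "X \<in> carrier MB \<Longrightarrow> X p q \<in> carrier B"
  and MA_closed: "Y \<in> carrier MA \<Longrightarrow> Y j k \<in> carrier A"
  by (simp_all add: matrix_algebra_simps row_def)

text \<open>The intertwining relation extends from unit rows to all rows by
  \<open>B\<close>-linearity of \<open>Psi\<close>.\<close>

lemma corresponds_comb:
  assumes c: "corresponds X Y" and X: "X \<in> carrier MB" and Y: "Y \<in> carrier MA" and a: "row a" and k: "k < nB"
  shows "Psi (\<lambda>q. \<Oplus>\<^bsub>B\<^esub>p\<in>{..<r}. a p \<otimes>\<^bsub>B\<^esub> X p q) k = (\<Oplus>\<^bsub>W\<^esub>j\<in>{..<nB}. ract (Y j k) (Psi a j))"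
proof -
  have rX: "row (\<lambda>q. a p \<otimes>\<^bsub>B\<^esub> X p q)" if "p < r" for p using rowD[OF a that] MB_closed[OF X] by (simp add: row_def)
  have "Psi (\<lambda>q. \<Oplus>\<^bsub>B\<^esub>p\<in>{..<r}. a p \<otimes>\<^bsub>B\<^esub> X p q) k = (\<Oplus>\<^bsub>W\<^esub>p\<in>{..<r}. Psi (\<lambda>q. a p \<otimes>\<^bsub>B\<^esub> X p q) k)"
    by (rule comb_finsum) (simp_all add: rX vec_e[OF k])
  also have "\<dots> = comb a (\<lambda>p. Psi (X p) k)"
    unfolding comb_def[of a]
    by (rule W.M.finsum_cong') (simp_all add: Pi_iff rowD[OF a] comb_lact MB_row[OF X] vec_e[OF k] comb_closed)
  also have "\<dots> = comb a (\<lambda>p. \<Oplus>\<^bsub>W\<^esub>j\<in>{..<nB}. ract (Y j k) (vec (eB j) p))"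
    using c k columnD[OF vec_e] by (intro comb_cong[OF a]) (simp_all add: column_def corresponds_def Pi_iff W.M.finsum_closed MA_closed[OF Y])
  also have "\<dots> = (\<Oplus>\<^bsub>W\<^esub>j\<in>{..<nB}. ract (Y j k) (Psi a j))"
    by (rule comb_ract[OF a]) (simp_all add: MA_closed[OF Y] vec_e)
  finally show ?thesis .
qed

text \<open>Column \<open>k\<close> of \<open>Y\<close> describes the map
  \<open>a \<mapsto> Psi (a X) k\<close>, which is \<open>comb\<close> with the column of all
  \<open>Psi (X p) k\<close>.\<close>

lemma corresponds_left_ex:
  assumes X: "X \<in> carrier MB" shows "\<exists>Y\<in>carrier MA. corresponds X Y"
proof -
  have "\<exists>y. (\<forall>j<nB. y j \<in> carrier A) \<and> (\<forall>a. row a \<longrightarrow> comb a (\<lambda>p. Psi (X p) k) = (\<Oplus>\<^bsub>W\<^esub>j\<in>{..<nB}. ract (y j) (Psi a j)))"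
    if k: "k < nB" for k
    by (rule operator_matrix) (rule Psi_L[OF MB_row[OF X] k])
  then have "\<forall>k. \<exists>y. k < nB \<longrightarrow> (\<forall>j<nB. y j \<in> carrier A) \<and> (\<forall>a. row a \<longrightarrow> comb a (\<lambda>p. Psi (X p) k) = (\<Oplus>\<^bsub>W\<^esub>j\<in>{..<nB}. ract (y j) (Psi a j)))"
    by simp
  from choice[OF this] obtain y where "\<forall>k. k < nB \<longrightarrow> (\<forall>j<nB. y k j \<in> carrier A) \<and>
      (\<forall>a. row a \<longrightarrow> comb a (\<lambda>p. Psi (X p) k) = (\<Oplus>\<^bsub>W\<^esub>j\<in>{..<nB}. ract (y k j) (Psi a j)))" by (elim exE)
  then have y: "\<And>k j. \<lbrakk>k < nB; j < nB\<rbrakk> \<Longrightarrow> y k j \<in> carrier A"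
    "\<And>k a. \<lbrakk>k < nB; row a\<rbrakk> \<Longrightarrow> comb a (\<lambda>p. Psi (X p) k) = (\<Oplus>\<^bsub>W\<^esub>j\<in>{..<nB}. ract (y k j) (Psi a j))"
    by simp_all
  define Y where "Y j k = (if j < nB \<and> k < nB then y k j else \<zero>\<^bsub>A\<^esub>)" for j k
  have "Y \<in> carrier MA" using y(1) by (auto simp: matrix_algebra_simps Y_def)
  moreover have "corresponds X Y"
    unfolding corresponds_def
  proof (intro allI impI)
    fix p k assume p: "p < r" and k: "k < nB"
    let ?u = "\<lambda>q. if q = p then \<one>\<^bsub>B\<^esub> else \<zero>\<^bsub>B\<^esub>"
    have u: "row ?u" by (simp add: row_def)
    have "Psi (X p) k = comb ?u (\<lambda>p. Psi (X p) k)"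
      by (rule comb_unit[symmetric, OF p]) (simp add: column_def comb_closed[OF MB_row[OF X] vec_e[OF k]])
    also have "\<dots> = (\<Oplus>\<^bsub>W\<^esub>j\<in>{..<nB}. ract (y k j) (Psi ?u j))" by (rule y(2)[OF k u])
    also have "\<dots> = (\<Oplus>\<^bsub>W\<^esub>j\<in>{..<nB}. ract (Y j k) (vec (eB j) p))"
      by (rule W.M.finsum_cong') (simp_all add: Y_def k y(1) comb_unit[OF p vec_e] Pi_iff columnD[OF vec_e p])
    finally show "Psi (X p) k = \<dots>" .
  qed
  ultimately show ?thesis by (intro bexI[of _ Y])
qed

text \<open>Row \<open>p\<close> of \<open>X\<close> has to be a preimage under \<open>Psi\<close>
  of the tuple \<open>w p\<close>; a sum of lifts supplies it.\<close>

lemma corresponds_right_ex: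
  assumes Y: "Y \<in> carrier MA" shows "\<exists>X\<in>carrier MB. corresponds X Y"
proof -
  define w where "w p k = (\<Oplus>\<^bsub>W\<^esub>j\<in>{..<nB}. ract (Y j k) (vec (eB j) p))" for p k
  have w: "w p k \<in> L" if "p < r" for p k
    unfolding w_def by (rule L_finsum) (simp_all add: Pi_iff L_ract MA_closed[OF Y] vec_L FB.e_closed that)
  define X where "X p q = (if p < r \<and> q < r then \<Oplus>\<^bsub>B\<^esub>j\<in>{..<nB}. lift j (w p j) q else \<zero>\<^bsub>B\<^esub>)" for p q
  have s: "row (\<lambda>q. \<Oplus>\<^bsub>B\<^esub>j\<in>{..<nB}. lift j (w p j) q)" if "p < r" for p
    by (rule row_sum_lift) (rule w[OF that])
  have "X \<in> carrier MB" using rowD[OF s] by (auto simp: matrix_algebra_simps X_def)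
  moreover have "corresponds X Y"
    unfolding corresponds_def
  proof (intro allI impI)
    fix p k assume p: "p < r" and k: "k < nB"
    have "Psi (X p) k = Psi (\<lambda>q. \<Oplus>\<^bsub>B\<^esub>j\<in>{..<nB}. lift j (w p j) q) k"
      by (rule comb_cong[OF s[OF p] vec_e[OF k]]) (simp_all add: X_def p)
    also have "\<dots> = w p k" by (rule Psi_sum_lift[OF w[OF p] k])
    finally show "Psi (X p) k = (\<Oplus>\<^bsub>W\<^esub>j\<in>{..<nB}. ract (Y j k) (vec (eB j) p))" by (simp add: w_def)
  qed
  ultimately show ?thesis by (intro bexI[of _ X])
qed

lemma corresponds_left_unique:
  assumes X: "X \<in> carrier MB" "X' \<in> carrier MB" and c: "corresponds X Y" "corresponds X' Y"
  shows "X = X'"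
proof (intro ext)
  fix p q show "X p q = X' p q"
  proof (cases "p < r \<and> q < r")
    case True
    show ?thesis
      by (rule Psi_inject[OF MB_row[OF X(1)] MB_row[OF X(2)]]) (use c True in \<open>simp_all add: corresponds_def\<close>)
  qed (use X in \<open>auto simp: matrix_algebra_simps not_less\<close>)
qed

text \<open>On the row \<open>lift j x\<close> the intertwining relation isolates a single entry:
  its value at \<open>k\<close> is \<open>x\<close> acted on by \<open>Y j k\<close>. Faithfulness
  of \<open>A\<close> on \<open>L\<close> then determines the entry.\<close>

lemma corresponds_right_unique:
  assumes X: "X \<in> carrier MB" and Y: "Y \<in> carrier MA" "Y' \<in> carrier MA" and c: "corresponds X Y" "corresponds X Y'"
  shows "Y = Y'"
proof (intro ext)
  fix j k show "Y j k = Y' j k"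
  proof (cases "j < nB \<and> k < nB")
    case True
    have *: "Psi (\<lambda>q. \<Oplus>\<^bsub>B\<^esub>p\<in>{..<r}. lift j x p \<otimes>\<^bsub>B\<^esub> X p q) k = ract (Z j k) x"
      if x: "x \<in> L" and Z: "Z \<in> carrier MA" "corresponds X Z" for x Z
    proof -
      have "Psi (\<lambda>q. \<Oplus>\<^bsub>B\<^esub>p\<in>{..<r}. lift j x p \<otimes>\<^bsub>B\<^esub> X p q) k = (\<Oplus>\<^bsub>W\<^esub>i\<in>{..<nB}. ract (Z i k) (Psi (lift j x) i))"
        by (rule corresponds_comb[OF Z(2) X Z(1) lift_row]) (use True x in simp_all)
      also have "\<dots> = (\<Oplus>\<^bsub>W\<^esub>i\<in>{..<nB}. if i = j then ract (Z i k) x else \<zero>\<^bsub>W\<^esub>)"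
        by (rule W.M.finsum_cong') (use True x MA_closed[OF Z(1)] L_sub[OF x] in \<open>simp_all add: Psi_lift Pi_iff actions_zero(3)\<close>)
      finally show ?thesis
        using W.M.finsum_delta[of "{..<nB}" j "\<lambda>i. ract (Z i k) x"] True MA_closed[OF Z(1)] L_sub[OF x] by simp
    qed
    show ?thesis
      by (rule ract_inject) (simp_all add: MA_closed Y *[OF _ Y(1) c(1), symmetric] *[OF _ Y(2) c(2)])
  qed (use Y in \<open>auto simp: matrix_algebra_simps not_less\<close>)
qed

text \<open>Matrices over \<open>B\<close> act on rows from the right and \<open>A\<close> acts on
  \<open>L\<close> from the right, so both products compose in the same order and no opposite
  algebra appears.\<close>

lemma corresponds_mult:
  assumes X: "X \<in> carrier MB" "X' \<in> carrier MB" and Y: "Y \<in> carrier MA" "Y' \<in> carrier MA"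
    and c: "corresponds X Y" "corresponds X' Y'"
  shows "corresponds (X \<otimes>\<^bsub>MB\<^esub> X') (Y \<otimes>\<^bsub>MA\<^esub> Y')"
  unfolding corresponds_def
proof (intro allI impI)
  fix p k assume p: "p < r" and k: "k < nB"
  have vW: "vec (eB i) p \<in> carrier W" if "i < nB" for i by (rule columnD[OF vec_e[OF that] p])
  have XX: "(X \<otimes>\<^bsub>MB\<^esub> X') p = (\<lambda>q. \<Oplus>\<^bsub>B\<^esub>s\<in>{..<r}. X p s \<otimes>\<^bsub>B\<^esub> X' s q)" by (rule ext) (simp add: matrix_algebra_simps)
  have "Psi ((X \<otimes>\<^bsub>MB\<^esub> X') p) k = (\<Oplus>\<^bsub>W\<^esub>j\<in>{..<nB}. ract (Y' j k) (Psi (X p) j))"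
    unfolding XX by (rule corresponds_comb[OF c(2) X(2) Y(2) MB_row[OF X(1)] k])
  also have "\<dots> = (\<Oplus>\<^bsub>W\<^esub>j\<in>{..<nB}. \<Oplus>\<^bsub>W\<^esub>i\<in>{..<nB}. ract (Y i j \<otimes>\<^bsub>A\<^esub> Y' j k) (vec (eB i) p))"
  proof (rule W.M.finsum_cong')
    fix j assume j: "j \<in> {..<nB}"
    have "ract (Y' j k) (Psi (X p) j) = ract (Y' j k) (\<Oplus>\<^bsub>W\<^esub>i\<in>{..<nB}. ract (Y i j) (vec (eB i) p))"
      using c(1) p j by (simp add: corresponds_def)
    also have "\<dots> = (\<Oplus>\<^bsub>W\<^esub>i\<in>{..<nB}. ract (Y' j k) (ract (Y i j) (vec (eB i) p)))"
      by (rule finsum_actions(3)) (simp_all add: Pi_iff MA_closed Y vW)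
    also have "\<dots> = (\<Oplus>\<^bsub>W\<^esub>i\<in>{..<nB}. ract (Y i j \<otimes>\<^bsub>A\<^esub> Y' j k) (vec (eB i) p))"
      by (rule W.M.finsum_cong') (simp_all add: Pi_iff MA_closed Y vW ract_simps(3))
    finally show "ract (Y' j k) (Psi (X p) j) = \<dots>" .
  qed (simp_all add: Pi_iff MA_closed Y vW W.M.finsum_closed)
  also have "\<dots> = (\<Oplus>\<^bsub>W\<^esub>i\<in>{..<nB}. \<Oplus>\<^bsub>W\<^esub>j\<in>{..<nB}. ract (Y i j \<otimes>\<^bsub>A\<^esub> Y' j k) (vec (eB i) p))"
    by (rule W.M.finsum_swap) (simp_all add: MA_closed Y vW)
  also have "\<dots> = (\<Oplus>\<^bsub>W\<^esub>i\<in>{..<nB}. ract ((Y \<otimes>\<^bsub>MA\<^esub> Y') i k) (vec (eB i) p))"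
    by (rule W.M.finsum_cong')
      (simp_all add: matrix_algebra_simps(2) finsum_actions(4) FA.M.finsum_closed Pi_iff MA_closed Y vW)
  finally show "Psi ((X \<otimes>\<^bsub>MB\<^esub> X') p) k = \<dots>" .
qed

lemma corresponds_add:
  assumes X: "X \<in> carrier MB" "X' \<in> carrier MB" and Y: "Y \<in> carrier MA" "Y' \<in> carrier MA"
    and c: "corresponds X Y" "corresponds X' Y'"
  shows "corresponds (X \<oplus>\<^bsub>MB\<^esub> X') (Y \<oplus>\<^bsub>MA\<^esub> Y')"
  unfolding corresponds_def
proof (intro allI impI)
  fix p k assume p: "p < r" and k: "k < nB"
  have vW: "vec (eB i) p \<in> carrier W" if "i < nB" for i by (rule columnD[OF vec_e[OF that] p])
  have XX: "(X \<oplus>\<^bsub>MB\<^esub> X') p = (\<lambda>q. X p q \<oplus>\<^bsub>B\<^esub> X' p q)" by (rule ext) (simp add: matrix_algebra_simps)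
  have "Psi ((X \<oplus>\<^bsub>MB\<^esub> X') p) k = Psi (X p) k \<oplus>\<^bsub>W\<^esub> Psi (X' p) k"
    unfolding XX by (rule comb_add[OF MB_row[OF X(1)] MB_row[OF X(2)] vec_e[OF k]])
  also have "\<dots> = (\<Oplus>\<^bsub>W\<^esub>j\<in>{..<nB}. ract (Y j k) (vec (eB j) p)) \<oplus>\<^bsub>W\<^esub> (\<Oplus>\<^bsub>W\<^esub>j\<in>{..<nB}. ract (Y' j k) (vec (eB j) p))"
    using c p k by (simp add: corresponds_def)
  also have "\<dots> = (\<Oplus>\<^bsub>W\<^esub>j\<in>{..<nB}. ract (Y j k) (vec (eB j) p) \<oplus>\<^bsub>W\<^esub> ract (Y' j k) (vec (eB j) p))"
    by (rule W.M.finsum_addf[symmetric]) (simp_all add: Pi_iff MA_closed Y vW)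
  also have "\<dots> = (\<Oplus>\<^bsub>W\<^esub>j\<in>{..<nB}. ract ((Y \<oplus>\<^bsub>MA\<^esub> Y') j k) (vec (eB j) p))"
    by (rule W.M.finsum_cong') (simp_all add: matrix_algebra_simps(5) ract_simps(2) Pi_iff MA_closed Y vW)
  finally show "Psi ((X \<oplus>\<^bsub>MB\<^esub> X') p) k = \<dots>" .
qed

text \<open>A scalar of \<open>V\<close> acts on \<open>L\<close> in the same way through
  \<open>B\<close> and through \<open>A\<close>.\<close>

lemma corresponds_scalar:
  assumes c: "c \<in> V"
  shows "corresponds (c \<odot>\<^bsub>MB\<^esub> \<one>\<^bsub>MB\<^esub>) (c \<odot>\<^bsub>MA\<^esub> \<one>\<^bsub>MA\<^esub>)"
  unfolding corresponds_def
proof (intro allI impI)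
  fix p k assume p: "p < r" and k: "k < nB"
  have cB: "c \<odot>\<^bsub>B\<^esub> \<one>\<^bsub>B\<^esub> \<in> carrier B" using FB.smult_closed[of c "\<one>\<^bsub>B\<^esub>"] c by simp
  have cA: "c \<odot>\<^bsub>A\<^esub> \<one>\<^bsub>A\<^esub> \<in> carrier A" using FA.smult_closed[of c "\<one>\<^bsub>A\<^esub>"] c by simp
  have zB: "c \<odot>\<^bsub>B\<^esub> \<zero>\<^bsub>B\<^esub> = \<zero>\<^bsub>B\<^esub>" and zA: "c \<odot>\<^bsub>A\<^esub> \<zero>\<^bsub>A\<^esub> = \<zero>\<^bsub>A\<^esub>"
    using FB.smult_r_null[of c] FA.smult_r_null[of c] c by simp_all
  have vW: "vec (eB i) p \<in> carrier W" if "i < nB" for i by (rule columnD[OF vec_e[OF that] p])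
  let ?u = "\<lambda>q. if q = p then \<one>\<^bsub>B\<^esub> else \<zero>\<^bsub>B\<^esub>"
  have u: "row ?u" by (simp add: row_def)
  have cu: "row (\<lambda>q. (c \<odot>\<^bsub>B\<^esub> \<one>\<^bsub>B\<^esub>) \<otimes>\<^bsub>B\<^esub> ?u q)" using cB by (simp add: row_def)
  have "Psi ((c \<odot>\<^bsub>MB\<^esub> \<one>\<^bsub>MB\<^esub>) p) k = Psi (\<lambda>q. (c \<odot>\<^bsub>B\<^esub> \<one>\<^bsub>B\<^esub>) \<otimes>\<^bsub>B\<^esub> ?u q) k"
    by (rule comb_cong[OF cu vec_e[OF k]]) (use cB p zB in \<open>simp_all add: matrix_algebra_simps(3,6)\<close>)
  also have "\<dots> = lact (c \<odot>\<^bsub>B\<^esub> \<one>\<^bsub>B\<^esub>) (vec (eB k) p)"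
    using comb_lact[OF cB u vec_e[OF k]] comb_unit[OF p vec_e[OF k]] by simp
  also have "\<dots> = ract (c \<odot>\<^bsub>A\<^esub> \<one>\<^bsub>A\<^esub>) (vec (eB k) p)"
    using sc_lact_ract(1)[OF c FB.A.one_closed vW[OF k]] sc_lact_ract(3)[OF c FA.A.one_closed vW[OF k]]
      lact_simps(4)[OF vW[OF k]] ract_simps(4)[OF vW[OF k]] by simp
  also have "\<dots> = (\<Oplus>\<^bsub>W\<^esub>j\<in>{..<nB}. if j = k then ract (c \<odot>\<^bsub>A\<^esub> \<one>\<^bsub>A\<^esub>) (vec (eB j) p) else \<zero>\<^bsub>W\<^esub>)"
    using W.M.finsum_delta[of "{..<nB}" k "\<lambda>j. ract (c \<odot>\<^bsub>A\<^esub> \<one>\<^bsub>A\<^esub>) (vec (eB j) p)"] k cA vW[OF k] by simp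
  also have "\<dots> = (\<Oplus>\<^bsub>W\<^esub>j\<in>{..<nB}. ract ((c \<odot>\<^bsub>MA\<^esub> \<one>\<^bsub>MA\<^esub>) j k) (vec (eB j) p))"
    by (rule W.M.finsum_cong') (use cA zA vW in \<open>auto simp: matrix_algebra_simps(3,6) actions_zero(4)\<close>)
  finally show "Psi ((c \<odot>\<^bsub>MB\<^esub> \<one>\<^bsub>MB\<^esub>) p) k = \<dots>" .
qed

lemma matrix_scalar_closed:
  assumes "c \<in> V"
  shows "c \<odot>\<^bsub>MB\<^esub> \<one>\<^bsub>MB\<^esub> \<in> carrier MB" and "c \<odot>\<^bsub>MA\<^esub> \<one>\<^bsub>MA\<^esub> \<in> carrier MA"
    and "\<one>\<^bsub>K\<^esub> \<odot>\<^bsub>MB\<^esub> \<one>\<^bsub>MB\<^esub> = \<one>\<^bsub>MB\<^esub>" and "\<one>\<^bsub>K\<^esub> \<odot>\<^bsub>MA\<^esub> \<one>\<^bsub>MA\<^esub> = \<one>\<^bsub>MA\<^esub>"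
proof -
  show "c \<odot>\<^bsub>MB\<^esub> \<one>\<^bsub>MB\<^esub> \<in> carrier MB"
    using FB.smult_closed[of c] FB.smult_r_null[of c] assms by (auto simp: matrix_algebra_simps)
  show "c \<odot>\<^bsub>MA\<^esub> \<one>\<^bsub>MA\<^esub> \<in> carrier MA"
    using FA.smult_closed[of c] FA.smult_r_null[of c] assms by (auto simp: matrix_algebra_simps)
  show "\<one>\<^bsub>K\<^esub> \<odot>\<^bsub>MB\<^esub> \<one>\<^bsub>MB\<^esub> = \<one>\<^bsub>MB\<^esub>"
    by (intro ext) (use FB.smult_one in \<open>simp add: matrix_algebra_simps(3,6)\<close>)
  show "\<one>\<^bsub>K\<^esub> \<odot>\<^bsub>MA\<^esub> \<one>\<^bsub>MA\<^esub> = \<one>\<^bsub>MA\<^esub>"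
    by (intro ext) (use FA.smult_one in \<open>simp add: matrix_algebra_simps(3,6)\<close>)
qed

text \<open>The relation \<open>corresponds\<close> is the graph of the isomorphism: existence and
  uniqueness on both sides give a bijection, and its compatibility with the operations gives a
  homomorphism.\<close>

lemma matrix_algebras_iso: "\<exists>\<theta>. algebra_iso R MB MA \<theta>"
proof -
  interpret MB: ring MB by (rule ring_matrix_algebra[OF FB.A.ring_axioms])
  interpret MA: ring MA by (rule ring_matrix_algebra[OF FA.A.ring_axioms])
  have "\<forall>X. \<exists>Y. X \<in> carrier MB \<longrightarrow> Y \<in> carrier MA \<and> corresponds X Y" using corresponds_left_ex by (simp add: Bex_def)
  from choice[OF this] obtain \<theta> where "\<forall>X. X \<in> carrier MB \<longrightarrow> \<theta> X \<in> carrier MA \<and> corresponds X (\<theta> X)" by (elim exE)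
  then have \<theta>: "\<And>X. X \<in> carrier MB \<Longrightarrow> \<theta> X \<in> carrier MA" "\<And>X. X \<in> carrier MB \<Longrightarrow> corresponds X (\<theta> X)" by simp_all
  have eq: "\<theta> X = Y" if "X \<in> carrier MB" "Y \<in> carrier MA" "corresponds X Y" for X Y
    by (rule corresponds_right_unique[OF that(1) \<theta>(1)[OF that(1)] that(2) \<theta>(2)[OF that(1)] that(3)])
  have scal: "\<theta> (c \<odot>\<^bsub>MB\<^esub> \<one>\<^bsub>MB\<^esub>) = c \<odot>\<^bsub>MA\<^esub> \<one>\<^bsub>MA\<^esub>" if "c \<in> V" for c
    by (rule eq[OF matrix_scalar_closed(1,2)[OF that] corresponds_scalar[OF that]])
  have hom: "\<theta> \<in> ring_hom MB MA"
  proof (rule ring_hom_memI)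
    fix X X' assume X: "X \<in> carrier MB" "X' \<in> carrier MB"
    show "\<theta> (X \<otimes>\<^bsub>MB\<^esub> X') = \<theta> X \<otimes>\<^bsub>MA\<^esub> \<theta> X'"
      by (rule eq[OF MB.m_closed[OF X] MA.m_closed corresponds_mult]) (use X \<theta> in simp_all)
    show "\<theta> (X \<oplus>\<^bsub>MB\<^esub> X') = \<theta> X \<oplus>\<^bsub>MA\<^esub> \<theta> X'"
      by (rule eq[OF MB.a_closed[OF X] MA.a_closed corresponds_add]) (use X \<theta> in simp_all)
  next
    have o: "\<one>\<^bsub>K\<^esub> \<in> V" by (rule FA.V_closed(3))
    show "\<theta> \<one>\<^bsub>MB\<^esub> = \<one>\<^bsub>MA\<^esub>" using scal[OF o] matrix_scalar_closed(3,4)[OF o] by simp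
  qed (rule \<theta>(1))
  moreover have "bij_betw \<theta> (carrier MB) (carrier MA)"
    unfolding bij_betw_def
  proof (intro conjI inj_onI equalityI subsetI)
    fix X X' assume X: "X \<in> carrier MB" "X' \<in> carrier MB" "\<theta> X = \<theta> X'"
    show "X = X'" by (rule corresponds_left_unique[OF X(1,2) \<theta>(2)[OF X(1)]]) (use \<theta>(2)[OF X(2)] X(3) in simp)
  next
    fix Y assume Y: "Y \<in> carrier MA"
    obtain X where X: "X \<in> carrier MB" "corresponds X Y" using corresponds_right_ex[OF Y] by (elim bexE)
    show "Y \<in> \<theta> ` carrier MB" using imageI[OF X(1), of \<theta>] eq[OF X(1) Y X(2)] by simp
  qed (elim imageE, simp add: \<theta>(1))
  ultimately show ?thesis using scal by (intro exI[of _ \<theta>]) (simp add: algebra_iso_def ring_iso_def)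
qed

text \<open>\<open>A\<close> and \<open>B\<close> are linked through their matrix algebras of sizes
  \<open>nB\<close> and \<open>r\<close>, both positive.\<close>

lemma morita_equivalent_orders:
  assumes inf: "infinite (UNIV :: 'v set)"
  shows "morita_equivalent TYPE('v) R A B"
proof -
  obtain \<theta> where \<theta>: "algebra_iso R MB MA \<theta>" using matrix_algebras_iso by (elim exE)
  have "morita_equivalent TYPE('v) R MB MA"
    by (rule morita_algebra_iso[OF ring_matrix_algebra[OF FB.A.ring_axioms] ring_matrix_algebra[OF FA.A.ring_axioms] \<theta>])
      (rule matrix_scalar_closed(1), simp)
  moreover have "morita_equivalent TYPE('v) R B MB"
    by (rule morita_equivalent_matrix_algebra[OF FB.assoc_algebra_axioms r_pos inf])
  moreover have "morita_equivalent TYPE('v) R A MA"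
    by (rule morita_equivalent_matrix_algebra[OF FA.assoc_algebra_axioms FB.n_pos inf])
  ultimately show ?thesis using morita_trans morita_sym by metis
qed

end

section \<open>Injectivity\<close>

text \<open>The unit sequences are pairwise distinct, so the type of sequences is infinite even when
  \<open>K\<close> is a finite field.\<close>

lemma infinite_universe:
  fixes K :: "('k, 'm) ring_scheme"
  assumes "field K"
  shows "infinite (UNIV :: ((nat \<Rightarrow> 'k) + 'u) set)"
proof -
  interpret K: field K by fact
  have "inj (\<lambda>n :: nat. Inl (\<lambda>i. if i = n then \<one>\<^bsub>K\<^esub> else \<zero>\<^bsub>K\<^esub>) :: (nat \<Rightarrow> 'k) + 'u)"
  proof (rule injI)
    fix m n :: nat
    assume "(Inl (\<lambda>i. if i = m then \<one>\<^bsub>K\<^esub> else \<zero>\<^bsub>K\<^esub>) :: (nat \<Rightarrow> 'k) + 'u) = Inl (\<lambda>i. if i = n then \<one>\<^bsub>K\<^esub> else \<zero>\<^bsub>K\<^esub>)"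
    then have "(\<lambda>i. if i = m then \<one>\<^bsub>K\<^esub> else \<zero>\<^bsub>K\<^esub>) = (\<lambda>i. if i = n then \<one>\<^bsub>K\<^esub> else \<zero>\<^bsub>K\<^esub>)" by (rule sum.inject(1)[THEN iffD1])
    from fun_cong[OF this, of m] show "m = n" by (simp split: if_splits)
  qed
  from range_inj_infinite[OF this] show ?thesis by (rule infinite_super[OF subset_UNIV])
qed

lemma morita_descends:
  fixes K :: "('k, 'm) ring_scheme" and A B :: "('k, nat \<Rightarrow> 'k) module"
  assumes K: "valued_field K V" and A: "azumaya (K\<lparr>carrier := V\<rparr>) A" and B: "azumaya (K\<lparr>carrier := V\<rparr>) B"
    and eq: "morita_equivalent TYPE((nat \<Rightarrow> 'k) + 'u) K (base_change (K\<lparr>carrier := V\<rparr>) K A) (base_change (K\<lparr>carrier := V\<rparr>) K B)"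
  shows "morita_equivalent TYPE((nat \<Rightarrow> 'k) + 'u) (K\<lparr>carrier := V\<rparr>) A B"
proof -
  interpret valued_field K V by (rule K)
  obtain nA eA dA where bA: "based_algebra R A nA eA dA" by (rule azumaya_based[OF A])
  obtain nB eB dB where bB: "based_algebra R B nB eB dB" by (rule azumaya_based[OF B])
  let ?EA = "base_change R K A" and ?EB = "base_change R K B"
  let ?iA = "\<lambda>a. pure_tensor R A (self_algebra K) a \<one>\<^bsub>K\<^esub>" and ?iB = "\<lambda>a. pure_tensor R B (self_algebra K) a \<one>\<^bsub>K\<^esub>"
  have gA: "generic_fibre K V A nA eA dA ?EA ?iA" by (rule generic_fibre_base_change[OF bA])
  have gB: "generic_fibre K V B nB eB dB ?EB ?iB" by (rule generic_fibre_base_change[OF bB])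
  interpret FA: generic_fibre K V A nA eA dA ?EA ?iA by (rule gA)
  interpret FB: generic_fibre K V B nB eB dB ?EB ?iB by (rule gB)
  obtain jA :: "_ \<Rightarrow> nat \<Rightarrow> 'k" where jA: "inj_on jA (carrier ?EA)" by (rule FA.injection_into_sequences[OF inj_on_id])
  obtain jB :: "_ \<Rightarrow> nat \<Rightarrow> 'k" where jB: "inj_on jB (carrier ?EB)" by (rule FB.injection_into_sequences[OF inj_on_id])
  \<comment> \<open>The sequence summand of the universe receives the regular modules of both base
    changes, for whatever type \<open>'u\<close>.\<close>
  let ?jA = "\<lambda>x. Inl (jA x) :: (nat \<Rightarrow> 'k) + 'u" and ?jB = "\<lambda>x. Inl (jB x) :: (nat \<Rightarrow> 'k) + 'u"
  have jA': "inj_on ?jA (carrier ?EA)" and jB': "inj_on ?jB (carrier ?EB)"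
    using jA jB by (simp_all add: inj_on_def)
  have simple: "\<exists>g. sandwich ?EB g \<and> g z = \<one>\<^bsub>?EB\<^esub>" if "z \<in> carrier ?EB" "z \<noteq> \<zero>\<^bsub>?EB\<^esub>" for z
    by (rule FB.E_simple[OF that]) (intro exI conjI)
  show ?thesis
  proof (rule morita_bimodule[OF FA.E.assoc_algebra_axioms FB.E.assoc_algebra_axioms eq FA.E_nontrivial jA' jB' simple FB.E_nontrivial])
    fix W :: "(_, (nat \<Rightarrow> 'k) + 'u) module" and act S
    assume W: "left_module ?EB W"
      "\<And>a. a \<in> carrier ?EA \<Longrightarrow> act a \<in> module_hom ?EB W W"
      "\<And>x. x \<in> carrier W \<Longrightarrow> act \<one>\<^bsub>?EA\<^esub> x = x"
      "\<And>a b x. \<lbrakk>a \<in> carrier ?EA; b \<in> carrier ?EA; x \<in> carrier W\<rbrakk> \<Longrightarrow> act (a \<otimes>\<^bsub>?EA\<^esub> b) x = act b (act a x)"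
      "\<And>a b x. \<lbrakk>a \<in> carrier ?EA; b \<in> carrier ?EA; x \<in> carrier W\<rbrakk> \<Longrightarrow> act (a \<oplus>\<^bsub>?EA\<^esub> b) x = act a x \<oplus>\<^bsub>W\<^esub> act b x"
      "\<And>r x. \<lbrakk>r \<in> carrier K; x \<in> carrier W\<rbrakk> \<Longrightarrow> act (r \<odot>\<^bsub>?EA\<^esub> \<one>\<^bsub>?EA\<^esub>) x = (r \<odot>\<^bsub>?EB\<^esub> \<one>\<^bsub>?EB\<^esub>) \<odot>\<^bsub>W\<^esub> x"
      "\<And>h. h \<in> module_hom ?EB W W \<Longrightarrow> \<exists>a\<in>carrier ?EA. act a = h"
      "\<And>a. \<lbrakk>a \<in> carrier ?EA; \<And>x. x \<in> carrier W \<Longrightarrow> act a x = \<zero>\<^bsub>W\<^esub>\<rbrakk> \<Longrightarrow> a = \<zero>\<^bsub>?EA\<^esub>"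
      "finite S" "S \<subseteq> carrier W"
      "\<And>w. w \<in> carrier W \<Longrightarrow> w \<in> additive_span W {act a s | a s. a \<in> carrier ?EA \<and> s \<in> S}"
    have lat: "bimodule_lattice K V A nA eA dA ?EA ?iA B nB eB dB ?EB ?iB W act S"
      by (intro bimodule_lattice.intro bimodule_lattice_axioms.intro gA gB W)
    interpret BL: bimodule_lattice K V A nA eA dA ?EA ?iA B nB eB dB ?EB ?iB W act S by (rule lat)
    obtain r l dl where "based_module R BL.L_module r l dl"
      by (rule basis_exists[OF BL.module_L BL.torsion_free_L BL.finitely_generated_L])
    then have "based_lattice K V A nA eA dA ?EA ?iA B nB eB dB ?EB ?iB W act S r l dl"
      by (intro based_lattice.intro based_lattice_axioms.intro lat)
    then show ?thesis by (rule based_lattice.morita_equivalent_orders[OF _ infinite_universe[OF K.field_axioms]])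
  qed
qed

lemma brauer_class_eqI:
  assumes "morita_equivalent TYPE((nat \<Rightarrow> 'r) + 'u) R A B"
  shows "brauer_class TYPE('u) R A = brauer_class TYPE('u) (R :: ('r, 'm) ring_scheme) B"
  unfolding brauer_class_def using morita_trans[OF assms] morita_trans[OF morita_sym[OF assms]] by auto

text \<open>The image of a class is a union of classes, so equality of two images is exploited
  through one common element. It leads to a representative of \<open>Y\<close> whose base change is
  Morita equivalent to that of \<open>A\<close>, and \<open>morita_descends\<close> applies to this
  pair.\<close>

theorem theorem1p1:
  fixes K :: "('k, 'm) ring_scheme" and V :: "'k set"
  assumes "field K"
    and "valuation_ring V K"
  shows "inj_on (brauer_base_change TYPE('u) (K\<lparr>carrier := V\<rparr>) K)
           (carrier (brauer_group TYPE('u) (K\<lparr>carrier := V\<rparr>)))"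
proof (rule inj_onI)
  interpret valued_field K V by (intro valued_field.intro valued_field_axioms.intro assms)
  fix X Y
  assume X: "X \<in> carrier (brauer_group TYPE('u) R)" and Y: "Y \<in> carrier (brauer_group TYPE('u) R)"
    and eq: "brauer_base_change TYPE('u) R K X = brauer_base_change TYPE('u) R K Y"
  obtain A :: "('k, nat \<Rightarrow> 'k) module" where A: "X = brauer_class TYPE('u) R A" "azumaya R A"
    using X by (auto simp: brauer_group_def)
  obtain B :: "('k, nat \<Rightarrow> 'k) module" where B: "Y = brauer_class TYPE('u) R B" "azumaya R B"
    using Y by (auto simp: brauer_group_def)
  let ?EA = "base_change R K A" and ?u = "TYPE((nat \<Rightarrow> 'k) + 'u)"
  obtain n e d where bA: "based_algebra R A n e d" by (rule azumaya_based[OF A(2)])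
  interpret FA: generic_fibre K V A n e d ?EA "\<lambda>a. pure_tensor R A (self_algebra K) a \<one>\<^bsub>K\<^esub>"
    by (rule generic_fibre_base_change[OF bA])
  obtain g :: "_ \<Rightarrow> nat \<Rightarrow> 'k" where g: "inj_on g (carrier ?EA)" by (rule FA.injection_into_sequences[OF inj_on_id])
  \<comment> \<open>The base change of \<open>A\<close> lives on cosets; its copy on sequences is an
    actual member of the image of \<open>X\<close>.\<close>
  define C where "C = algebra_copy g ?EA"
  have "azumaya K C" unfolding C_def by (rule generic_fibre.E_azumaya[OF FA.generic_fibre_copy[OF g]])
  moreover have AC: "morita_equivalent ?u K ?EA C"
    unfolding C_def
    by (rule morita_algebra_iso[OF FA.E.A.ring_axioms _ algebra_iso_copy[OF FA.E.assoc_algebra_axioms g]])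
      (rule assoc_algebra.axioms(2)[OF assoc_algebra_copy[OF FA.E.assoc_algebra_axioms g]],
        rule assoc_algebra_unit_closed[OF FA.E.assoc_algebra_axioms])
  moreover have "A \<in> X" using A morita_refl[OF FA.assoc_algebra_axioms] by (simp add: brauer_class_def)
  ultimately have "C \<in> brauer_base_change TYPE('u) R K X"
    unfolding brauer_base_change_def by (intro UN_I[of A]) (simp_all add: brauer_class_def)
  then have "C \<in> brauer_base_change TYPE('u) R K Y" by (simp only: eq)
  \<comment> \<open>The representative \<open>B'\<close> of \<open>Y\<close> may differ from
    \<open>B\<close>; the two are Morita equivalent over \<open>V\<close>, which is used at the
    end.\<close>
  then obtain B' where B': "B' \<in> Y" "C \<in> brauer_class TYPE('u) K (base_change R K B')"
    unfolding brauer_base_change_def by (elim UN_E)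
  have B'az: "azumaya R B'" and BB': "morita_equivalent ?u R B B'" using B'(1) B(1) by (simp_all add: brauer_class_def)
  have "morita_equivalent ?u K (base_change R K B') C" using B'(2) by (simp add: brauer_class_def)
  then have "morita_equivalent ?u K ?EA (base_change R K B')" by (rule morita_trans[OF AC morita_sym])
  then have "morita_equivalent ?u R A B'" by (rule morita_descends[OF valued_field_axioms A(2) B'az])
  then have "morita_equivalent ?u R A B" by (rule morita_trans[OF _ morita_sym[OF BB']])
  then show "X = Y" unfolding A(1) B(1) by (rule brauer_class_eqI)
qed

end
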